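(* Let $I=[0,\gamma)$ with $0<\gamma\le\infty$, let $\varphi$ be an Orlicz function and let $w$ be a weight function on $I$ with $W(t)=\int_0^t w$. Then the Orlicz-Lorentz space $\Lambda_{\varphi,w}$ on $I$, equipped with the Luxemburg norm, has the Radon-Nikodým property if and only if the following two conditions are satisfied: (i) either $\varphi$ is an N-function at infinity or $\lim_{t\to 0+}\frac{t}{W(t)}=0$; (ii) $\varphi$ satisfies the appropriate $\Delta_2$-condition, that is, the $\Delta_2^\infty$-condition if $\gamma<\infty$ and the $\Delta_2$-condition if $\gamma=\infty$.
   Context: All Banach spaces are real. An Orlicz function is a convex function $\varphi:[0,\infty)\to[0,\infty)$ with $\varphi(0)=0$, not identically zero. It is an N-function at infinity if $\lim_{u\to\infty}\varphi(u)/u=\infty$. $\varphi$ satisfies the $\Delta_2^0$-condition if there are $K>2$ and $u_0>0$ such that $\varphi(2u)\le K\varphi(u)$ for all $u\le u_0$; the $\Delta_2^\infty$-condition if there are $K>2$ and $u_0\ge 0$ such that $\varphi(2u)\le K\varphi(u)$ for all $u\ge u_0$; the $\Delta_2$-condition if it satisfies both. A weight function is a decreasing (i.e. non-increasing), positive, locally integrable function $w$ on $I=[0,\gamma)$ with $W(t)=\int_0^t w<\infty$ for $t\in[0,\gamma)$; if $\gamma=\infty$ it is assumed that $\int_0^\infty w=\infty$. For measurable $f$ on $I$ (Lebesgue measure $m$), $d_f(\lambda)=m\{t:|f(t)|>\lambda\}$ and $f^*(t)=\inf\{\lambda>0:d_f(\lambda)\le t\}$. Put $\rho_{\varphi,w}(f)=\int_I\varphi(f^*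 )w$. Then $\Lambda_{\varphi,w}=\{f:\rho_{\varphi,w}(kf)<\infty\text{ for some }k>0\}$ with the Luxemburg norm $\|f\|_{\varphi,w}=\inf\{\epsilon>0:\rho_{\varphi,w}(f/\epsilon)\le 1\}$.
   Formalization: The Δ₂^0-condition is read with the extra requirement φ(u₀)>0 (automatic if φ>0 on (0,∞)); without it the claim fails, e.g. for γ=∞, w=1, φ(u)=max(0,u−1)², where the space contains ℓ^∞. *)

theory Defs
  imports "HOL-Analysis.Analysis" "HOL-Library.Function_Algebras"
begin

text \<open>Real-valued functions form a real vector space under pointwise operations.\<close>

instantiation "fun" :: (type, real_vector) real_vector
begin

definition scaleR_fun :: "real \<Rightarrow> ('a \<Rightarrow> 'b) \<Rightarrow> 'a \<Rightarrow> 'b" where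
  "scaleR_fun c f = (\<lambda>x. c *\<^sub>R f x)"

instance
  by standard (simp_all add: scaleR_fun_def fun_eq_iff scaleR_add_right scaleR_add_left)

end


section \<open>The Radon--Nikodym property\<close>

text \<open>
  A Banach space is given by a linear subspace \<open>X\<close> of a real vector space and a seminorm \<open>N\<close> on
  \<open>X\<close>; the Banach space meant is the quotient of \<open>X\<close> by the vectors of seminorm 0. For function
  spaces this is the identification of functions that agree almost everywhere. All notions below
  depend only on the classes of the vectors involved. The library's vector-valued integral needs
  a Banach space that is a type and is second countable, so simple functions, the Bochner integral
  and vector measures are taken relative to \<open>(X, N)\<close>.
\<close>

definition simple_into :: "'v set \<Rightarrow> 'a measure \<Rightarrow> ('a \<Rightarrow> 'v) \<Rightarrow> bool" where
  "simple_into X M s \<longleftrightarrow> simple_function M s \<and> s ` space M \<subseteq> X"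

definition simple_integral_over :: "'a measure \<Rightarrow> 'a set \<Rightarrow> ('a \<Rightarrow> 'v::real_vector) \<Rightarrow> 'v" where
  "simple_integral_over M E s =
     (\<Sum>y\<in>s ` space M. measure M (s -` {y} \<inter> E \<inter> space M) *\<^sub>R y)"

definition strongly_measurable_into ::
    "'v::real_vector set \<Rightarrow> ('v \<Rightarrow> real) \<Rightarrow> 'a measure \<Rightarrow> ('a \<Rightarrow> 'v) \<Rightarrow> bool" where
  "strongly_measurable_into X N M g \<longleftrightarrow>
     g ` space M \<subseteq> X \<and>
     (\<exists>s. (\<forall>n. simple_into X M (s n)) \<and>
          (AE x in M. (\<lambda>n. N (s n x - g x)) \<longlonglongrightarrow> 0))"

text \<open>\<open>has_bochner_integral_over X N M g E v\<close>: the function \<open>g\<close> is Bochner integrable on \<open>M\<close>, and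
  its integral over \<open>E\<close> is \<open>v\<close>.\<close>

definition has_bochner_integral_over ::
    "'v::real_vector set \<Rightarrow> ('v \<Rightarrow> real) \<Rightarrow> 'a measure \<Rightarrow> ('a \<Rightarrow> 'v) \<Rightarrow> 'a set \<Rightarrow> 'v \<Rightarrow> bool" where
  "has_bochner_integral_over X N M g E v \<longleftrightarrow>
     strongly_measurable_into X N M g \<and> v \<in> X \<and>
     (\<exists>s. (\<forall>n. simple_into X M (s n)) \<and>
          (\<lambda>n. \<integral>\<^sup>+x. ennreal (N (s n x - g x)) \<partial>M) \<longlonglongrightarrow> 0 \<and>
          (\<lambda>n. N (simple_integral_over M E (s n) - v)) \<longlonglongrightarrow> 0)"

definition vector_measure ::
    "'v::real_vector set \<Rightarrow> ('v \<Rightarrow> real) \<Rightarrow> 'a measure \<Rightarrow> ('a set \<Rightarrow> 'v) \<Rightarrow> bool" where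
  "vector_measure X N M G \<longleftrightarrow>
     (\<forall>E\<in>sets M. G E \<in> X) \<and>
     (\<forall>A::nat \<Rightarrow> 'a set. range A \<subseteq> sets M \<longrightarrow> disjoint_family A \<longrightarrow>
        (\<lambda>n. N ((\<Sum>i<n. G (A i)) - G (\<Union>i. A i))) \<longlonglongrightarrow> 0)"

definition continuous_wrt_measure ::
    "('v \<Rightarrow> real) \<Rightarrow> 'a measure \<Rightarrow> ('a set \<Rightarrow> 'v) \<Rightarrow> bool" where
  "continuous_wrt_measure N M G \<longleftrightarrow>
     (\<forall>e>0. \<exists>d>0. \<forall>E\<in>sets M. measure M E < d \<longrightarrow> N (G E) < e)"

definition bounded_variation ::
    "('v \<Rightarrow> real) \<Rightarrow> 'a measure \<Rightarrow> ('a set \<Rightarrow> 'v) \<Rightarrow> bool" where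
  "bounded_variation N M G \<longleftrightarrow>
     (\<exists>C. \<forall>P. finite P \<longrightarrow> P \<subseteq> sets M \<longrightarrow> partition_on (space M) P \<longrightarrow> (\<Sum>A\<in>P. N (G A)) \<le> C)"

definition radon_nikodym_property_wrt ::
    "'a measure \<Rightarrow> 'v::real_vector set \<Rightarrow> ('v \<Rightarrow> real) \<Rightarrow> bool" where
  "radon_nikodym_property_wrt M X N \<longleftrightarrow>
     (\<forall>G. vector_measure X N M G \<and> continuous_wrt_measure N M G \<and> bounded_variation N M G \<longrightarrow>
        (\<exists>g. \<forall>E\<in>sets M. has_bochner_integral_over X N M g E (G E)))"

text \<open>
  The property is required for all finite measure spaces. A formula of HOL cannot quantify over the
  types of their points, so the type \<open>'m\<close> is a parameter: the definition ranges over all finite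
  measure spaces with points in \<open>'m\<close> and all those with points in \<^typ>\<open>real\<close>. The property for
  all measure spaces is the conjunction over all types \<open>'m\<close>. The second clause keeps
  instances with a small type \<open>'m\<close> (e.g. a finite one) from being degenerate.
\<close>

definition radon_nikodym_property ::
    "'m itself \<Rightarrow> 'v::real_vector set \<Rightarrow> ('v \<Rightarrow> real) \<Rightarrow> bool" where
  "radon_nikodym_property (_ :: 'm itself) X N \<longleftrightarrow>
     (\<forall>M :: 'm measure. finite_measure M \<longrightarrow> radon_nikodym_property_wrt M X N) \<and>
     (\<forall>M :: real measure. finite_measure M \<longrightarrow> radon_nikodym_property_wrt M X N)"


section \<open>Orlicz functions\<close>

definition orlicz_function :: "(real \<Rightarrow> real) \<Rightarrow> bool" where
  "orlicz_function \<phi> \<longleftrightarrow>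
     convex_on {0..} \<phi> \<and> (\<forall>u\<ge>0. 0 \<le> \<phi> u) \<and> \<phi> 0 = 0 \<and> (\<exists>u\<ge>0. \<phi> u \<noteq> 0)"

definition N_function_at_infinity :: "(real \<Rightarrow> real) \<Rightarrow> bool" where
  "N_function_at_infinity \<phi> \<longleftrightarrow> filterlim (\<lambda>u. \<phi> u / u) at_top at_top"

text \<open>
  The clause \<open>0 < \<phi> u0\<close> is the usual proviso in the condition at zero. Without it, a \<open>\<phi>\<close> that
  vanishes on an interval \<open>[0, a]\<close> would satisfy the condition trivially. For \<open>\<phi>\<close> positive on
  \<open>(0, \<infinity>)\<close> the clause is void.
\<close>

definition delta2_zero :: "(real \<Rightarrow> real) \<Rightarrow> bool" where
  "delta2_zero \<phi> \<longleftrightarrow>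
     (\<exists>K>2. \<exists>u0>0. 0 < \<phi> u0 \<and> (\<forall>u. 0 \<le> u \<and> u \<le> u0 \<longrightarrow> \<phi> (2 * u) \<le> K * \<phi> u))"

definition delta2_infinity :: "(real \<Rightarrow> real) \<Rightarrow> bool" where
  "delta2_infinity \<phi> \<longleftrightarrow> (\<exists>K>2. \<exists>u0\<ge>0. \<forall>u\<ge>u0. \<phi> (2 * u) \<le> K * \<phi> u)"

definition delta2 :: "(real \<Rightarrow> real) \<Rightarrow> bool" where
  "delta2 \<phi> \<longleftrightarrow> delta2_zero \<phi> \<and> delta2_infinity \<phi>"


section \<open>Orlicz--Lorentz spaces\<close>

definition half_open_interval :: "ereal \<Rightarrow> real set" where
  "half_open_interval \<gamma> = {t. 0 \<le> t \<and> ereal t < \<gamma>}"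

text \<open>
  The value of \<open>w\<close> at 0 is not used: the standard weights may be unbounded at 0, whereas a
  real-valued function that decreases on all of \<open>[0, \<gamma>)\<close> is bounded by its value at 0.
\<close>

definition weight_function :: "ereal \<Rightarrow> (real \<Rightarrow> real) \<Rightarrow> bool" where
  "weight_function \<gamma> w \<longleftrightarrow>
     antimono_on (half_open_interval \<gamma> - {0}) w \<and>
     (\<forall>t\<in>half_open_interval \<gamma> - {0}. 0 < w t) \<and>
     (\<forall>t\<in>half_open_interval \<gamma>. set_integrable lebesgue {0..t} w) \<and>
     (\<gamma> = \<infinity> \<longrightarrow> (\<integral>\<^sup>+t. ennreal (w t) \<partial>lebesgue_on {0..}) = \<infinity>)"

definition weight_primitive :: "(real \<Rightarrow> real) \<Rightarrow> real \<Rightarrow> real" where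
  "weight_primitive w t = set_lebesgue_integral lebesgue {0..t} w"

definition distribution_fun :: "ereal \<Rightarrow> (real \<Rightarrow> real) \<Rightarrow> real \<Rightarrow> ennreal" where
  "distribution_fun \<gamma> f r = emeasure lebesgue {t \<in> half_open_interval \<gamma>. r < \<bar>f t\<bar>}"

text \<open>The rearrangement may take the value \<open>\<infinity>\<close> (infimum of the empty set), and \<open>\<phi>(\<infinity>) = \<infinity>\<close>.\<close>

definition decreasing_rearrangement :: "ereal \<Rightarrow> (real \<Rightarrow> real) \<Rightarrow> real \<Rightarrow> ennreal" where
  "decreasing_rearrangement \<gamma> f t =
     Inf {ennreal r |r. 0 < r \<and> distribution_fun \<gamma> f r \<le> ennreal t}"

definition extend_to_infinity :: "(real \<Rightarrow> real) \<Rightarrow> ennreal \<Rightarrow> ennreal" where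
  "extend_to_infinity \<phi> x = (if x = \<infinity> then \<infinity> else ennreal (\<phi> (enn2real x)))"

definition orlicz_lorentz_modular ::
    "ereal \<Rightarrow> (real \<Rightarrow> real) \<Rightarrow> (real \<Rightarrow> real) \<Rightarrow> (real \<Rightarrow> real) \<Rightarrow> ennreal" where
  "orlicz_lorentz_modular \<gamma> \<phi> w f =
     (\<integral>\<^sup>+t. extend_to_infinity \<phi> (decreasing_rearrangement \<gamma> f t) * ennreal (w t)
        \<partial>lebesgue_on (half_open_interval \<gamma>))"

text \<open>Elements are functions on \<^typ>\<open>real\<close> whose values off \<open>[0, \<gamma>)\<close> are irrelevant.\<close>

definition orlicz_lorentz_space ::
    "ereal \<Rightarrow> (real \<Rightarrow> real) \<Rightarrow> (real \<Rightarrow> real) \<Rightarrow> (real \<Rightarrow> real) set" where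
  "orlicz_lorentz_space \<gamma> \<phi> w =
     {f. f \<in> borel_measurable (lebesgue_on (half_open_interval \<gamma>)) \<and>
         (\<exists>k>0. orlicz_lorentz_modular \<gamma> \<phi> w (\<lambda>t. k * f t) < \<infinity>)}"

definition luxemburg_norm ::
    "ereal \<Rightarrow> (real \<Rightarrow> real) \<Rightarrow> (real \<Rightarrow> real) \<Rightarrow> (real \<Rightarrow> real) \<Rightarrow> real" where
  "luxemburg_norm \<gamma> \<phi> w f =
     Inf {\<epsilon>. 0 < \<epsilon> \<and> orlicz_lorentz_modular \<gamma> \<phi> w (\<lambda>t. f t / \<epsilon>) \<le> 1}"

end

theory Submission
  imports Defs
begin

text \<open>
  Writing the weight as a superposition of indicators of initial intervals turns the modular into
  \<open>\<rho>(f) = \<integral> S(\<tau>(r), \<phi>\<bar>f\<bar>) dr\<close> with \<open>S(\<tau>, g) = \<integral> min(\<tau>, d\<^sub>g(s)) ds\<close>, and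
  \<open>S(\<tau>, g)\<close> is the minimum over \<open>z \<ge> 0\<close> of \<open>\<tau>z + \<integral>(g - z)\<^sup>+\<close>. The second form shows that
  \<open>\<rho>\<close> is convex and does not increase under averaging, the first gives monotone and dominated
  convergence.

  Sufficiency: let \<open>P\<^sub>n\<close> average over the dyadic cells of generation \<open>n\<close>. These are contractions,
  and under the \<open>\<Delta>\<^sub>2\<close>-condition \<open>P\<^sub>n f \<rightarrow> f\<close> in norm. Condition (i) makes bounded sets
  uniformly integrable on bounded intervals; hence a bounded dyadic martingale has a limit measure
  with a density, and the space is boundedly complete with respect to \<open>(P\<^sub>n)\<close>. A vector measure of
  bounded variation has scalar densities along the finite-dimensional ranges of the \<open>P\<^sub>n\<close>; pointwise
  they form a bounded martingale, whose limit is the Bochner density.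

  Necessity: if (i) fails, the norm is equivalent to the \<open>L\<^sup>1\<close>-norm near 0, and \<open>E \<mapsto> 1\<^sub>E\<close> has no density.
  If (ii) fails, there are disjoint blocks \<open>e\<^sub>n\<close> spanning a copy of \<open>\<ell>\<^sup>\<infinity>\<close>, and
  \<open>E \<mapsto> \<Sum>\<^sub>n (\<integral>\<^sub>E r\<^sub>n) e\<^sub>n\<close> with Rademacher functions \<open>r\<^sub>n\<close> has no density. In both cases a
  simple function approximating a density is tested on a suitable finite partition.
\<close>

section \<open>Vector measures and Bochner integrals over a seminormed subspace\<close>

text \<open>Averaging over cells is a contraction for every \<open>\<phi>\<close> and
  \<open>w\<close>, so each condition has a single point of entry in the sufficiency part: (ii) when
  the averages have to converge in norm (\<open>average_tendsto\<close>), (i) when a bounded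
  martingale has to have a limit (\<open>boundedly_complete\<close>). The form of (i) comes from
  \<open>L1_bound\<close>: over a set of measure at most b, the integral of |f| is at most
  \<open>e / l * (1 / w b + c * b)\<close>, where \<open>l * u - c\<close> is an affine minorant of
  \<phi>. This can be made small either because l may be taken large or because w is unbounded near
  0. The obstacle in the martingale step is that the positive and negative parts, which one needs in
  order to get nonnegative measures, do not have constant integrals over the cells. Their values on
  bounded measurable sets form a point in a product of compact intervals, and a cluster point is
  taken there. Uniform integrability makes it countably additive, and a Fatou property of
  \<open>J\<close> puts the resulting density into the space.\<close>

lemma radon_nikodym_set_function:
  fixes \<nu> :: "'a set \<Rightarrow> ennreal"
  assumes "sigma_finite_measure M" and empty: "\<nu> {} = 0"
    and ca: "\<And>A::nat \<Rightarrow> 'a set. range A \<subseteq> sets M \<Longrightarrow> disjoint_family A \<Longrightarrow> (\<Sum>n. \<nu> (A n)) = \<nu> (\<Union>n. A n)"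
    and null: "\<And>E. E \<in> null_sets M \<Longrightarrow> \<nu> E = 0"
  shows "\<exists>h\<in>borel_measurable M. \<forall>E\<in>sets M. \<nu> E = (\<integral>\<^sup>+x. h x * indicator E x \<partial>M)"
proof -
  interpret sigma_finite_measure M by fact
  define D where "D = measure_of (space M) (sets M) \<nu>"
  have sets_D: "sets D = sets M" unfolding D_def by (simp add: sets.space_closed)
  have em: "emeasure D E = \<nu> E" if "E \<in> sets M" for E
    unfolding D_def
  proof (rule emeasure_measure_of_sigma[OF sets.sigma_algebra_axioms _ _ that])
    show "positive (sets M) \<nu>" using empty by (simp add: positive_def)
    show "countably_additive (sets M) \<nu>" by (rule countably_additiveI) (use ca in auto)
  qed
  have "absolutely_continuous M D"
    unfolding absolutely_continuous_def using null em by (auto simp: null_sets_def sets_D)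
  from Radon_Nikodym[OF this sets_D] obtain h where h: "h \<in> borel_measurable M" "density M h = D" by blast
  have "\<nu> E = (\<integral>\<^sup>+x. h x * indicator E x \<partial>M)" if "E \<in> sets M" for E
    using em[OF that] emeasure_density[OF h(1) that] h(2) by simp
  then show ?thesis using h(1) by blast
qed

text \<open>A finite integral over \<open>B\<close> forces \<open>h\<close> to be finite almost
  everywhere on \<open>B\<close>, so sending the value \<infinity> to 0 by \<open>enn2real\<close>
  changes nothing there.\<close>

lemma enn2real_set_integral:
  assumes h [measurable]: "h \<in> borel_measurable M" and B [measurable]: "B \<in> sets M"
    and eq: "(\<integral>\<^sup>+x. h x * indicator B x \<partial>M) = ennreal r" and r: "0 \<le> r"
  shows "set_integrable M B (\<lambda>x. enn2real (h x))" "set_lebesgue_integral M B (\<lambda>x. enn2real (h x)) = r"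
proof -
  have "AE x in M. h x * indicator B x \<noteq> \<infinity>" using eq by (intro nn_integral_PInf_AE) auto
  then have AE: "AE x in M. ennreal (indicator B x *\<^sub>R enn2real (h x)) = h x * indicator B x"
    by eventually_elim (auto simp: indicator_def less_top split: if_splits)
  then have *: "(\<integral>\<^sup>+x. ennreal (indicator B x *\<^sub>R enn2real (h x)) \<partial>M) = ennreal r"
    using eq by (subst nn_integral_cong_AE[OF AE]) simp
  show int: "set_integrable M B (\<lambda>x. enn2real (h x))"
    unfolding set_integrable_def
  proof (rule integrableI_nonneg)
    show "(\<integral>\<^sup>+x. ennreal (indicator B x *\<^sub>R enn2real (h x)) \<partial>M) < \<infinity>" unfolding * by simp
  qed auto
  have "ennreal (set_lebesgue_integral M B (\<lambda>x. enn2real (h x))) = ennreal r"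
    unfolding set_lebesgue_integral_def *[symmetric]
    by (rule nn_integral_eq_integral[symmetric]) (use int in \<open>auto simp: set_integrable_def\<close>)
  then show "set_lebesgue_integral M B (\<lambda>x. enn2real (h x)) = r"
    using r by (subst (asm) ennreal_inj) (auto simp: set_lebesgue_integral_def intro!: integral_nonneg_AE)
qed

lemma radon_nikodym_real_set_function:
  fixes \<nu> :: "'a set \<Rightarrow> real"
  assumes "finite_measure M" and nn: "\<And>E. E \<in> sets M \<Longrightarrow> 0 \<le> \<nu> E"
    and ca: "\<And>A::nat \<Rightarrow> 'a set. range A \<subseteq> sets M \<Longrightarrow> disjoint_family A \<Longrightarrow> (\<lambda>n. \<nu> (A n)) sums \<nu> (\<Union>n. A n)"
    and null: "\<And>E. E \<in> null_sets M \<Longrightarrow> \<nu> E = 0"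
  shows "\<exists>h. integrable M h \<and> (\<forall>x. 0 \<le> h x) \<and> (\<forall>E\<in>sets M. \<nu> E = set_lebesgue_integral M E h)"
proof -
  interpret finite_measure M by fact
  have "\<exists>h\<in>borel_measurable M. \<forall>E\<in>sets M. ennreal (\<nu> E) = (\<integral>\<^sup>+x. h x * indicator E x \<partial>M)"
  proof (rule radon_nikodym_set_function)
    show "sigma_finite_measure M" by unfold_locales
    show "ennreal (\<nu> {}) = 0" using null[of "{}"] by simp
    fix A :: "nat \<Rightarrow> 'a set" assume A: "range A \<subseteq> sets M" "disjoint_family A"
    have "(\<lambda>n. ennreal (\<nu> (A n))) sums ennreal (\<nu> (\<Union>n. A n))"
      using ca[OF A] nn A(1) by (subst sums_ennreal) (auto intro: sets.countable_UN)
    then show "(\<Sum>n. ennreal (\<nu> (A n))) = ennreal (\<nu> (\<Union>n. A n))" by (simp add: sums_iff)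
  qed (use null in auto)
  then obtain h where h [measurable]: "h \<in> borel_measurable M"
    and eq: "\<And>E. E \<in> sets M \<Longrightarrow> ennreal (\<nu> E) = (\<integral>\<^sup>+x. h x * indicator E x \<partial>M)" by blast
  have eq': "(\<integral>\<^sup>+x. h x * indicator E x \<partial>M) = ennreal (\<nu> E)" if "E \<in> sets M" for E
    using eq[OF that] by simp
  note * = enn2real_set_integral[OF h _ eq' nn]
  have "integrable M (\<lambda>x. enn2real (h x))"
    using *(1)[OF sets.top sets.top sets.top] unfolding set_integrable_def
    by (rule Bochner_Integration.integrable_cong[THEN iffD1, rotated 2]) auto
  then show ?thesis using *(2) by (intro exI[of _ "\<lambda>x. enn2real (h x)"]) auto
qed

section \<open>Simple functions and their integrals\<close>

lemma set_integrable_of_integrable: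
  fixes h :: "'a \<Rightarrow> real"
  shows "integrable M h \<Longrightarrow> E \<in> sets M \<Longrightarrow> set_integrable M E h"
  unfolding set_integrable_def by (rule integrable_mult_indicator)

lemma integrable_simple_approx:
  fixes h :: "'a \<Rightarrow> real"
  assumes "finite_measure M" "integrable M h" "0 < e"
  shows "\<exists>a. simple_function M a \<and> integrable M a \<and> (\<integral>x. \<bar>a x - h x\<bar> \<partial>M) < e"
proof -
  interpret finite_measure M by fact
  from integrable_implies_simple_function_sequence[OF assms(2)] obtain s where
    s: "\<And>i. simple_function M (s i)" "\<And>i. emeasure M {y \<in> space M. s i y \<noteq> 0} \<noteq> \<infinity>"
      "\<And>x. x \<in> space M \<Longrightarrow> (\<lambda>i. s i x) \<longlonglongrightarrow> h x" "\<And>x i. x \<in> space M \<Longrightarrow> norm (s i x) \<le> 2 * norm (h x)" by blast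
  have [measurable]: "s i \<in> borel_measurable M" for i by (rule borel_measurable_simple_function[OF s(1)])
  have int: "integrable M (s i)" for i using s(1,2) by (intro integrable_simple_function) (auto intro: simple_bochner_integrable.intros)
  note [measurable] = borel_measurable_integrable[OF assms(2)]
  have "(\<lambda>i. \<integral>x. \<bar>s i x - h x\<bar> \<partial>M) \<longlonglongrightarrow> (\<integral>x. 0 \<partial>M)"
  \<comment> \<open>The factor 3 is 2 for the bound on \<open>s i\<close> plus 1 for
    \<open>h\<close> itself.\<close>
  proof (rule integral_dominated_convergence[where w="\<lambda>x. 3 * \<bar>h x\<bar>"])
    show "AE x in M. (\<lambda>i. \<bar>s i x - h x\<bar>) \<longlonglongrightarrow> 0"
    proof (rule AE_I2)
      fix x assume "x \<in> space M"
      from s(3)[OF this] have "(\<lambda>i. s i x - h x) \<longlonglongrightarrow> 0" by (rule LIM_zero)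
      then show "(\<lambda>i. \<bar>s i x - h x\<bar>) \<longlonglongrightarrow> 0" by (rule tendsto_rabs_zero)
    qed
    show "AE x in M. norm \<bar>s i x - h x\<bar> \<le> 3 * \<bar>h x\<bar>" for i
    proof (rule AE_I2)
      fix x assume "x \<in> space M"
      from s(4)[OF this, of i] show "norm \<bar>s i x - h x\<bar> \<le> 3 * \<bar>h x\<bar>" by simp
    qed
    show "integrable M (\<lambda>x. 3 * \<bar>h x\<bar>)" using assms(2) by simp
  qed measurable
  then have "eventually (\<lambda>i. (\<integral>x. \<bar>s i x - h x\<bar> \<partial>M) < e) sequentially"
    using assms(3) by (intro order_tendstoD(2)[of _ 0]) auto
  then obtain i where "(\<integral>x. \<bar>s i x - h x\<bar> \<partial>M) < e" by (auto simp: eventually_sequentially)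
  then show ?thesis using s(1) int by blast
qed

text \<open>\<open>simple_integral_over\<close> sums over the values of the function itself, so two
  functions with different level sets cannot be combined termwise. Summing over the values of a
  common refinement \<open>z\<close> removes this difficulty; values \<open>u\<close> with the same
  image under \<open>F\<close> are regrouped.\<close>

lemma simple_integral_over_compose:
  fixes F :: "'z \<Rightarrow> 'v::real_vector"
  assumes "finite_measure M" and z: "simple_function M z" and E: "E \<in> sets M"
  shows "simple_integral_over M E (\<lambda>x. F (z x)) = (\<Sum>u\<in>z ` space M. measure M (z -` {u} \<inter> E \<inter> space M) *\<^sub>R F u)"
proof -
  interpret finite_measure M by fact
  let ?S = "z ` space M"
  have fin: "finite ?S" using z by (simp add: simple_function_def)
  have sets: "z -` {u} \<inter> E \<inter> space M \<in> sets M" if "u \<in> ?S" for u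
  proof -
    have "z -` {u} \<inter> space M \<in> sets M" using z that unfolding simple_function_def by blast
    then have "(z -` {u} \<inter> space M) \<inter> E \<in> sets M" using E by (rule sets.Int)
    then show ?thesis by (simp add: Int_ac)
  qed
  have "simple_integral_over M E (\<lambda>x. F (z x))
     = (\<Sum>y\<in>F ` ?S. \<Sum>u | u \<in> ?S \<and> F u = y. measure M (z -` {u} \<inter> E \<inter> space M) *\<^sub>R F u)"
    unfolding simple_integral_over_def image_image
  proof (rule sum.cong[OF refl])
    fix y assume "y \<in> (\<lambda>x. F (z x)) ` space M"
    have "(\<lambda>x. F (z x)) -` {y} \<inter> E \<inter> space M = (\<Union>u\<in>{u \<in> ?S. F u = y}. z -` {u} \<inter> E \<inter> space M)" by auto
    then have "measure M ((\<lambda>x. F (z x)) -` {y} \<inter> E \<inter> space M) = (\<Sum>u | u \<in> ?S \<and> F u = y. measure M (z -` {u} \<inter> E \<inter> space M))"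
      by (simp only:, intro finite_measure_finite_Union) (use fin sets in \<open>auto simp: disjoint_family_on_def\<close>)
    then show "measure M ((\<lambda>x. F (z x)) -` {y} \<inter> E \<inter> space M) *\<^sub>R y = (\<Sum>u | u \<in> ?S \<and> F u = y. measure M (z -` {u} \<inter> E \<inter> space M) *\<^sub>R F u)"
      by (simp add: scaleR_sum_left)
  qed
  also have "\<dots> = (\<Sum>u\<in>?S. measure M (z -` {u} \<inter> E \<inter> space M) *\<^sub>R F u)"
    by (rule sum.image_gen[OF fin, symmetric])
  finally show ?thesis .
qed

lemma simple_integral_over_real:
  fixes a :: "'a \<Rightarrow> real"
  assumes "finite_measure M" and a: "simple_function M a" and E: "E \<in> sets M"
  shows "simple_integral_over M E a = set_lebesgue_integral M E a"
proof -
  interpret finite_measure M by fact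
  have fin: "finite (a ` space M)" using a by (simp add: simple_function_def)
  have sets: "a -` {u} \<inter> E \<inter> space M \<in> sets M" if "u \<in> a ` space M" for u
  proof -
    have "a -` {u} \<inter> space M \<in> sets M" using a that unfolding simple_function_def by blast
    then have "(a -` {u} \<inter> space M) \<inter> E \<in> sets M" using E by (rule sets.Int)
    then show ?thesis by (simp add: Int_ac)
  qed
  have "set_lebesgue_integral M E a = (\<integral>x. (\<Sum>u\<in>a ` space M. u * indicator (a -` {u} \<inter> E \<inter> space M) x) \<partial>M)"
    unfolding set_lebesgue_integral_def
  proof (rule Bochner_Integration.integral_cong[OF refl])
    fix x assume x: "x \<in> space M"
    have "(\<Sum>u\<in>a ` space M. u * indicator (a -` {u} \<inter> E \<inter> space M) x) = (\<Sum>u\<in>a ` space M. if u = a x then a x * indicator E x else 0)"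
      by (rule sum.cong[OF refl]) (use x in \<open>auto simp: indicator_def\<close>)
    then show "indicator E x *\<^sub>R a x = (\<Sum>u\<in>a ` space M. u * indicator (a -` {u} \<inter> E \<inter> space M) x)"
      using fin x by (simp add: mult.commute)
  qed
  also have "\<dots> = (\<Sum>u\<in>a ` space M. u * measure M (a -` {u} \<inter> E \<inter> space M))"
    using sets by (subst Bochner_Integration.integral_sum) (auto simp: emeasure_eq_measure)
  finally show ?thesis by (simp add: simple_integral_over_def mult.commute)
qed

lemma simple_integral_over_add:
  fixes s t :: "'a \<Rightarrow> 'v::real_vector"
  assumes M: "finite_measure M" and s: "simple_function M s" and t: "simple_function M t" and E: "E \<in> sets M"
  shows "simple_integral_over M E (\<lambda>x. s x + t x) = simple_integral_over M E s + simple_integral_over M E t"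
    and "simple_integral_over M E (\<lambda>x. s x - t x) = simple_integral_over M E s - simple_integral_over M E t"
proof -
  \<comment> \<open>The pair takes finitely many values and refines the level sets of both
    functions.\<close>
  have z: "simple_function M (\<lambda>x. (s x, t x))" by (rule simple_function_Pair[OF s t])
  note * = simple_integral_over_compose[OF M z E]
  show "simple_integral_over M E (\<lambda>x. s x + t x) = simple_integral_over M E s + simple_integral_over M E t"
    using *[of "\<lambda>p. fst p + snd p"] *[of fst] *[of snd]
    by (simp add: scaleR_add_right sum.distrib)
  show "simple_integral_over M E (\<lambda>x. s x - t x) = simple_integral_over M E s - simple_integral_over M E t"
    using *[of "\<lambda>p. fst p - snd p"] *[of fst] *[of snd]
    by (simp add: scaleR_diff_right sum_subtractf)
qed

lemma simple_integral_over_scaleR: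
  fixes a :: "'a \<Rightarrow> real" and e :: "'v::real_vector"
  assumes M: "finite_measure M" and a: "simple_function M a" and E: "E \<in> sets M"
  shows "simple_integral_over M E (\<lambda>x. a x *\<^sub>R e) = set_lebesgue_integral M E a *\<^sub>R e"
  using simple_integral_over_compose[OF M a E, of "\<lambda>r. r *\<^sub>R e"]
  unfolding simple_integral_over_real[OF M a E, symmetric] simple_integral_over_def[of M E a]
  by (simp add: scaleR_sum_left)

lemma simple_function_comb:
  fixes e :: "'i \<Rightarrow> 'v::real_vector"
  assumes "finite A" "\<And>j. j \<in> A \<Longrightarrow> simple_function M (a j)"
  shows "simple_function M (\<lambda>x. \<Sum>j\<in>A. a j x *\<^sub>R e j)"
  using assms
proof (induction A rule: finite_induct)
  case empty then show ?case by (simp add: simple_function_def)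
next
  case (insert i A)
  have "simple_function M (\<lambda>x. a i x *\<^sub>R e i)"
    using simple_function_compose1[of M "a i" "\<lambda>r. r *\<^sub>R e i"] insert by simp
  then have "simple_function M (\<lambda>x. a i x *\<^sub>R e i + (\<Sum>j\<in>A. a j x *\<^sub>R e j))"
    using insert by (intro simple_function_compose2[of M _ _ "(+)"]) auto
  then show ?case using insert by simp
qed

lemma simple_integral_over_comb:
  fixes e :: "'i \<Rightarrow> 'v::real_vector"
  assumes M: "finite_measure M" and "finite A" "\<And>j. j \<in> A \<Longrightarrow> simple_function M (a j)" and E: "E \<in> sets M"
  shows "simple_integral_over M E (\<lambda>x. \<Sum>j\<in>A. a j x *\<^sub>R e j) = (\<Sum>j\<in>A. set_lebesgue_integral M E (a j) *\<^sub>R e j)"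
  using assms(2,3)
proof (induction A rule: finite_induct)
  case empty then show ?case by (auto simp: simple_integral_over_def intro!: sum.neutral)
next
  case (insert i A)
  have 1: "simple_function M (\<lambda>x. a i x *\<^sub>R e i)"
    using simple_function_compose1[of M "a i" "\<lambda>r. r *\<^sub>R e i"] insert by simp
  have 2: "simple_function M (\<lambda>x. \<Sum>j\<in>A. a j x *\<^sub>R e j)" using insert by (intro simple_function_comb) auto
  show ?case using insert simple_integral_over_add(1)[OF M 1 2 E] simple_integral_over_scaleR[OF M _ E, of "a i" "e i"] by simp
qed

text \<open>For scalars an inequality suffices as an assumption: applied to the inverse scalar it
  gives equality (\<open>N_scale\<close>). \<open>N\<close> may vanish at nonzero vectors, as the
  Luxemburg norm does at functions that are zero almost everywhere.\<close>

locale seminormed_subspace =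
  fixes X :: "'v::real_vector set" and N :: "'v \<Rightarrow> real"
  assumes zero: "0 \<in> X"
    and add: "x \<in> X \<Longrightarrow> y \<in> X \<Longrightarrow> x + y \<in> X"
    and scale: "x \<in> X \<Longrightarrow> c *\<^sub>R x \<in> X"
    and N_nonneg: "x \<in> X \<Longrightarrow> 0 \<le> N x"
    and N_triangle: "x \<in> X \<Longrightarrow> y \<in> X \<Longrightarrow> N (x + y) \<le> N x + N y"
    and N_scale_le: "x \<in> X \<Longrightarrow> N (c *\<^sub>R x) \<le> \<bar>c\<bar> * N x"
begin

lemma N_zero [simp]: "N 0 = 0"
  using N_scale_le[OF zero, of 0] N_nonneg[OF zero] by simp

lemma N_scale: assumes "x \<in> X" shows "N (c *\<^sub>R x) = \<bar>c\<bar> * N x"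
proof (cases "c = 0")
  case False
  have "N (inverse c *\<^sub>R (c *\<^sub>R x)) \<le> \<bar>inverse c\<bar> * N (c *\<^sub>R x)"
    by (rule N_scale_le[OF scale[OF assms]])
  then have "\<bar>c\<bar> * N x \<le> N (c *\<^sub>R x)" using False by (simp add: field_simps)
  then show ?thesis using N_scale_le[OF assms, of c] by simp
qed simp

lemma minus: "x \<in> X \<Longrightarrow> - x \<in> X"
  using scale[of x "-1"] by simp

lemma diff: "x \<in> X \<Longrightarrow> y \<in> X \<Longrightarrow> x - y \<in> X"
  using add[of x "- y"] minus[of y] by simp

lemma N_minus: "x \<in> X \<Longrightarrow> N (- x) = N x"
  using N_scale[of x "-1"] by simp

lemma N_minus_commute: "x \<in> X \<Longrightarrow> y \<in> X \<Longrightarrow> N (x - y) = N (y - x)"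
  using N_minus[OF diff[of x y]] by simp

lemma N_diff_triangle: "x \<in> X \<Longrightarrow> y \<in> X \<Longrightarrow> N (x - y) \<le> N x + N y"
  using N_triangle[of x "- y"] minus[of y] N_minus[of y] by simp

lemma N_triangle3: "x \<in> X \<Longrightarrow> y \<in> X \<Longrightarrow> z \<in> X \<Longrightarrow> N (x - z) \<le> N (x - y) + N (y - z)"
  using N_triangle[of "x - y" "y - z"] diff by simp

lemma N_le_add_diff: "x \<in> X \<Longrightarrow> y \<in> X \<Longrightarrow> N x \<le> N y + N (x - y)"
  using N_triangle[of y "x - y"] diff by simp

lemma N_abs_diff: "x \<in> X \<Longrightarrow> y \<in> X \<Longrightarrow> \<bar>N x - N y\<bar> \<le> N (x - y)"
  using N_le_add_diff[of x y] N_le_add_diff[of y x] N_minus_commute[of x y] by (auto simp: abs_le_iff)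

lemma sum_mem: "(\<And>i. i \<in> A \<Longrightarrow> f i \<in> X) \<Longrightarrow> sum f A \<in> X"
  by (induction A rule: infinite_finite_induct) (auto intro: zero add)

lemma N_sum: "finite A \<Longrightarrow> (\<And>i. i \<in> A \<Longrightarrow> f i \<in> X) \<Longrightarrow> N (sum f A) \<le> (\<Sum>i\<in>A. N (f i))"
proof (induction A rule: finite_induct)
  case (insert i A)
  have "N (f i + sum f A) \<le> N (f i) + N (sum f A)" using insert by (intro N_triangle sum_mem) auto
  then show ?case using insert by force
qed simp

lemma N_comb_diff_le:
  assumes "finite A" "\<And>j. j \<in> A \<Longrightarrow> e j \<in> X"
  shows "N ((\<Sum>j\<in>A. a j *\<^sub>R e j) - (\<Sum>j\<in>A. b j *\<^sub>R e j)) \<le> (\<Sum>j\<in>A. \<bar>a j - b j\<bar> * N (e j))"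
proof -
  have "(\<Sum>j\<in>A. a j *\<^sub>R e j) - (\<Sum>j\<in>A. b j *\<^sub>R e j) = (\<Sum>j\<in>A. (a j - b j) *\<^sub>R e j)"
    by (simp add: sum_subtractf scaleR_diff_left)
  also have "N \<dots> \<le> (\<Sum>j\<in>A. N ((a j - b j) *\<^sub>R e j))" using assms by (intro N_sum scale) auto
  also have "\<dots> = (\<Sum>j\<in>A. \<bar>a j - b j\<bar> * N (e j))" using assms by (intro sum.cong refl N_scale) auto
  finally show ?thesis .
qed

lemma N_limit:
  assumes "\<And>n. x n \<in> X" "y \<in> X" "(\<lambda>n. N (x n - y)) \<longlonglongrightarrow> 0"
  shows "(\<lambda>n. N (x n)) \<longlonglongrightarrow> N y"
proof (rule LIM_zero_cancel, rule tendsto_rabs_zero_cancel)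
  show "(\<lambda>n. \<bar>N (x n) - N y\<bar>) \<longlonglongrightarrow> 0"
    by (rule tendsto_sandwich[OF _ _ tendsto_const assms(3)]) (auto intro!: always_eventually N_abs_diff assms)
qed

section \<open>Bochner integrals compared with simple functions\<close>

lemma N_simple_integral_le:
  assumes M: "finite_measure M" and s: "simple_into X M s" and E: "E \<in> sets M"
  shows "N (simple_integral_over M E s) \<le> set_lebesgue_integral M E (\<lambda>x. N (s x))"
proof -
  have sf: "simple_function M s" and sX: "s ` space M \<subseteq> X" using s by (auto simp: simple_into_def)
  have Ns: "simple_function M (\<lambda>x. N (s x))" by (rule simple_function_compose1[OF sf])
  have "N (simple_integral_over M E s) \<le> (\<Sum>y\<in>s ` space M. N (measure M (s -` {y} \<inter> E \<inter> space M) *\<^sub>R y))"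
    unfolding simple_integral_over_def
    by (rule N_sum) (use sf sX scale in \<open>auto simp: simple_function_def\<close>)
  also have "\<dots> = (\<Sum>y\<in>s ` space M. measure M (s -` {y} \<inter> E \<inter> space M) *\<^sub>R N y)"
    by (rule sum.cong[OF refl]) (use sX in \<open>auto simp: N_scale\<close>)
  also have "\<dots> = simple_integral_over M E (\<lambda>x. N (s x))"
    by (rule simple_integral_over_compose[OF M sf E, symmetric])
  also have "\<dots> = set_lebesgue_integral M E (\<lambda>x. N (s x))" by (rule simple_integral_over_real[OF M Ns E])
  finally show ?thesis .
qed

lemma simple_integral_mem:
  assumes "simple_into X M s" shows "simple_integral_over M E s \<in> X"
  unfolding simple_integral_over_def by (rule sum_mem) (use assms scale in \<open>auto simp: simple_into_def\<close>)

lemma simple_into_diff: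
  assumes "simple_into X M s" "simple_into X M t" shows "simple_into X M (\<lambda>x. s x - t x)"
  using assms unfolding simple_into_def
  by (auto intro!: simple_function_compose2[of M s t "(-)"] diff)

text \<open>\<open>X\<close> carries no sigma-algebra, so \<open>N (s x - g x)\<close> is not a
  composition of measurable maps. Almost everywhere it is the limit of the simple functions
  \<open>N (s x - r n x)\<close>, where \<open>r\<close> approximates \<open>g\<close>; this gives a
  measurable version.\<close>

lemma measurable_N_diff:
  assumes s: "simple_into X M s" and g: "strongly_measurable_into X N M g"
  shows "\<exists>u\<in>borel_measurable M. AE x in M. u x = N (s x - g x)"
proof -
  obtain r where r: "\<And>n. simple_into X M (r n)" "AE x in M. (\<lambda>n. N (r n x - g x)) \<longlonglongrightarrow> 0"
    and gX: "g ` space M \<subseteq> X" using g unfolding strongly_measurable_into_def by blast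
  have sf: "simple_function M (\<lambda>x. s x - r n x)" for n
    using simple_into_diff[OF s r(1)] by (simp add: simple_into_def)
  have [measurable]: "(\<lambda>x. N (s x - r n x)) \<in> borel_measurable M" for n
    using simple_function_compose1[OF sf[of n], of N] by (intro borel_measurable_simple_function) simp
  let ?u = "\<lambda>x. lim (\<lambda>n. N (s x - r n x))"
  have "AE x in M. ?u x = N (s x - g x)"
    using r(2) AE_space
  proof eventually_elim
    case (elim x)
    have X: "s x \<in> X" "g x \<in> X" "r n x \<in> X" for n using elim gX s r(1) by (auto simp: simple_into_def)
    have "(\<lambda>n. N (s x - r n x)) \<longlonglongrightarrow> N (s x - g x)"
    proof (rule N_limit)
      have "N ((s x - r n x) - (s x - g x)) = N (r n x - g x)" for n
        using N_minus_commute[OF X(3) X(2), of n] by simp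
      then show "(\<lambda>n. N ((s x - r n x) - (s x - g x))) \<longlonglongrightarrow> 0" using elim by simp
    qed (auto intro: diff X)
    then show ?case by (rule limI)
  qed
  then show ?thesis by (intro bexI[of _ ?u]) measurable
qed

text \<open>The bound involves the integral over \<open>E\<close> only, so errors on disjoint sets
  can be added. The proof compares \<open>t\<close> with the simple functions that define the
  integral of \<open>g\<close> over \<open>E\<close> and lets n tend to infinity.\<close>

lemma bochner_simple_error:
  assumes M: "finite_measure M" and g: "has_bochner_integral_over X N M g E v" and t: "simple_into X M t" and E: "E \<in> sets M"
  shows "ennreal (N (simple_integral_over M E t - v)) \<le> (\<integral>\<^sup>+x. ennreal (N (t x - g x)) * indicator E x \<partial>M)"
proof -
  interpret finite_measure M by fact
  obtain s where s: "\<And>n. simple_into X M (s n)" "(\<lambda>n. \<integral>\<^sup>+x. ennreal (N (s n x - g x)) \<partial>M) \<longlonglongrightarrow> 0"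
      "(\<lambda>n. N (simple_integral_over M E (s n) - v)) \<longlonglongrightarrow> 0"
    and gm: "strongly_measurable_into X N M g" and vX: "v \<in> X"
    using g unfolding has_bochner_integral_over_def by blast
  have gX: "g ` space M \<subseteq> X" using gm by (simp add: strongly_measurable_into_def)
  obtain u where u [measurable]: "u \<in> borel_measurable M" and ueq: "AE x in M. u x = N (t x - g x)"
    using measurable_N_diff[OF t gm] by blast
  let ?c = "\<integral>\<^sup>+x. ennreal (N (t x - g x)) * indicator E x \<partial>M"
  have bound: "ennreal (N (simple_integral_over M E t - v))
      \<le> ?c + (\<integral>\<^sup>+x. ennreal (N (s n x - g x)) \<partial>M) + ennreal (N (simple_integral_over M E (s n) - v))" for n
  proof -
    let ?d = "\<lambda>x. t x - s n x"
    obtain u' where u' [measurable]: "u' \<in> borel_measurable M" and u'eq: "AE x in M. u' x = N (s n x - g x)"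
      using measurable_N_diff[OF s(1) gm] by blast
    have d: "simple_into X M ?d" by (rule simple_into_diff[OF t s(1)])
    have dX: "N (?d x) \<ge> 0" if "x \<in> space M" for x using d that by (auto simp: simple_into_def intro!: N_nonneg)
    have dsf: "simple_function M (\<lambda>x. N (?d x))" using simple_function_compose1[of M ?d N] d by (simp add: simple_into_def)
    have "ennreal (N (simple_integral_over M E ?d)) \<le> ennreal (set_lebesgue_integral M E (\<lambda>x. N (?d x)))"
      by (intro ennreal_leI N_simple_integral_le M d E)
    also have "\<dots> = (\<integral>\<^sup>+x. ennreal (indicator E x *\<^sub>R N (?d x)) \<partial>M)"
      unfolding set_lebesgue_integral_def
    proof (rule nn_integral_eq_integral[symmetric])
      have "integrable M (\<lambda>x. N (?d x))"
        by (rule integrable_simple_function[OF dsf]) (simp add: emeasure_eq_measure)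
      then show "integrable M (\<lambda>x. indicator E x *\<^sub>R N (?d x))" by (rule integrable_mult_indicator[OF E])
      show "AE x in M. 0 \<le> indicator E x *\<^sub>R N (?d x)" by (rule AE_I2) (use dX in simp)
    qed
    \<comment> \<open>The measurable versions \<open>u\<close> and \<open>u'\<close> replace the
      norms because the integral of a sum splits only for measurable summands.\<close>
    also have "\<dots> \<le> (\<integral>\<^sup>+x. ennreal (u x) * indicator E x + ennreal (u' x) \<partial>M)"
    proof (rule nn_integral_mono_AE)
      show "AE x in M. ennreal (indicator E x *\<^sub>R N (?d x)) \<le> ennreal (u x) * indicator E x + ennreal (u' x)"
        using ueq u'eq AE_space
      proof eventually_elim
        case (elim x)
        have X: "t x \<in> X" "s n x \<in> X" "g x \<in> X" using elim gX t s(1) by (auto simp: simple_into_def)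
        have "N (?d x) \<le> u x + u' x" using N_triangle3[OF X(1,3,2)] N_minus_commute[OF X(2,3)] elim by simp
        moreover have "0 \<le> u x" "0 \<le> u' x" using elim X by (auto intro!: N_nonneg diff)
        ultimately show ?case by (auto simp: indicator_def ennreal_plus[symmetric] simp del: ennreal_plus intro!: ennreal_leI)
      qed
    qed
    also have "\<dots> = (\<integral>\<^sup>+x. ennreal (u x) * indicator E x \<partial>M) + (\<integral>\<^sup>+x. ennreal (u' x) \<partial>M)"
      by (intro nn_integral_add) (use E in measurable)
    also have "(\<integral>\<^sup>+x. ennreal (u x) * indicator E x \<partial>M) = ?c"
      by (intro nn_integral_cong_AE) (use ueq in eventually_elim, simp)
    also have "(\<integral>\<^sup>+x. ennreal (u' x) \<partial>M) = (\<integral>\<^sup>+x. ennreal (N (s n x - g x)) \<partial>M)"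
      by (intro nn_integral_cong_AE) (use u'eq in eventually_elim, simp)
    finally have 1: "ennreal (N (simple_integral_over M E ?d)) \<le> ?c + (\<integral>\<^sup>+x. ennreal (N (s n x - g x)) \<partial>M)" .
    have mem: "simple_integral_over M E t \<in> X" "simple_integral_over M E (s n) \<in> X"
      by (intro simple_integral_mem t s(1))+
    have "simple_integral_over M E ?d = simple_integral_over M E t - simple_integral_over M E (s n)"
      by (rule simple_integral_over_add(2)[OF M _ _ E]) (use t s(1) in \<open>auto simp: simple_into_def\<close>)
    then have "N (simple_integral_over M E t - v) \<le> N (simple_integral_over M E ?d) + N (simple_integral_over M E (s n) - v)"
      using N_triangle3[OF mem vX] by simp
    then have "ennreal (N (simple_integral_over M E t - v)) \<le> ennreal (N (simple_integral_over M E ?d)) + ennreal (N (simple_integral_over M E (s n) - v))"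
      using N_nonneg[OF simple_integral_mem[OF d, of E]] N_nonneg[OF diff[OF mem(2) vX]]
      by (simp add: ennreal_plus[symmetric] ennreal_leI del: ennreal_plus)
    also have "\<dots> \<le> ?c + (\<integral>\<^sup>+x. ennreal (N (s n x - g x)) \<partial>M) + ennreal (N (simple_integral_over M E (s n) - v))"
      by (rule add_right_mono[OF 1])
    finally show ?thesis .
  qed
  have "(\<lambda>n. ?c + (\<integral>\<^sup>+x. ennreal (N (s n x - g x)) \<partial>M) + ennreal (N (simple_integral_over M E (s n) - v))) \<longlonglongrightarrow> ?c + 0 + ennreal 0"
    by (intro tendsto_add tendsto_const s(2) tendsto_ennrealI s(3))
  then show ?thesis using bound by (intro LIMSEQ_le_const[of _ "?c"]) auto
qed

text \<open>\<open>t\<close> is fixed before the family \<open>F\<close>, and the errors are bounded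
  in sum, not merely one by one: they are dominated by integrals of the single function
  \<open>N (t x - g x)\<close> over disjoint sets. Both necessity proofs refute this bound.\<close>

lemma bochner_simple_approx:
  assumes M: "finite_measure M" and g: "\<And>E. E \<in> sets M \<Longrightarrow> has_bochner_integral_over X N M g E (G E)" and e: "0 < e"
  shows "\<exists>t. simple_into X M t \<and> (\<forall>K F. finite K \<longrightarrow> F ` K \<subseteq> sets M \<longrightarrow> disjoint_family_on F K \<longrightarrow>
    (\<Sum>k\<in>K. N (simple_integral_over M (F k) t - G (F k))) \<le> e)"
proof -
  obtain s where s: "\<And>n. simple_into X M (s n)" "(\<lambda>n. \<integral>\<^sup>+x. ennreal (N (s n x - g x)) \<partial>M) \<longlonglongrightarrow> 0"
    and gm: "strongly_measurable_into X N M g"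
    \<comment> \<open>The approximating sequence may depend on the set. Only the convergence of the
      integrals of \<open>N (s n x - g x)\<close> over the whole space is needed, so the sequence
      belonging to the empty set will do.\<close>
    using g[OF sets.empty_sets] unfolding has_bochner_integral_over_def by blast
  have GX: "E \<in> sets M \<Longrightarrow> G E \<in> X" for E using g by (auto simp: has_bochner_integral_over_def)
  have "eventually (\<lambda>n. (\<integral>\<^sup>+x. ennreal (N (s n x - g x)) \<partial>M) < ennreal e) sequentially"
    using s(2) e by (intro order_tendstoD(2)[of _ 0]) auto
  then obtain n where n: "(\<integral>\<^sup>+x. ennreal (N (s n x - g x)) \<partial>M) < ennreal e" by (auto simp: eventually_sequentially)
  obtain u where u [measurable]: "u \<in> borel_measurable M" and ueq: "AE x in M. u x = N (s n x - g x)"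
    using measurable_N_diff[OF s(1) gm] by blast
  have "(\<Sum>k\<in>K. N (simple_integral_over M (F k) (s n) - G (F k))) \<le> e"
    if K: "finite K" "F ` K \<subseteq> sets M" "disjoint_family_on F K" for K :: "'c set" and F
  proof -
    have mem: "N (simple_integral_over M (F k) (s n) - G (F k)) \<ge> 0" if "k \<in> K" for k
      using that K(2) GX by (intro N_nonneg diff simple_integral_mem s(1)) auto
    have "ennreal (\<Sum>k\<in>K. N (simple_integral_over M (F k) (s n) - G (F k)))
       = (\<Sum>k\<in>K. ennreal (N (simple_integral_over M (F k) (s n) - G (F k))))"
      using mem by (intro sum_ennreal[symmetric]) auto
    also have "\<dots> \<le> (\<Sum>k\<in>K. \<integral>\<^sup>+x. ennreal (N (s n x - g x)) * indicator (F k) x \<partial>M)"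
      using K(2) by (intro sum_mono bochner_simple_error[OF M g s(1)]) auto
    also have "\<dots> = (\<Sum>k\<in>K. \<integral>\<^sup>+x. ennreal (u x) * indicator (F k) x \<partial>M)"
      by (intro sum.cong refl nn_integral_cong_AE) (use ueq in eventually_elim, simp)
    also have "\<dots> = (\<integral>\<^sup>+x. (\<Sum>k\<in>K. ennreal (u x) * indicator (F k) x) \<partial>M)"
      by (rule nn_integral_sum[symmetric]) (use K(2) in auto)
    also have "\<dots> \<le> (\<integral>\<^sup>+x. ennreal (u x) \<partial>M)"
    proof (rule nn_integral_mono)
      fix x
      have "(\<Sum>k\<in>K. indicator (F k) x :: ennreal) = indicator (\<Union>k\<in>K. F k) x"
        by (rule indicator_UN_disjoint[OF K(1,3), symmetric])
      then show "(\<Sum>k\<in>K. ennreal (u x) * indicator (F k) x) \<le> ennreal (u x)"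
        by (simp add: sum_distrib_left[symmetric] indicator_def)
    qed
    also have "\<dots> = (\<integral>\<^sup>+x. ennreal (N (s n x - g x)) \<partial>M)"
      by (intro nn_integral_cong_AE) (use ueq in eventually_elim, simp)
    also have "\<dots> \<le> ennreal e" using n by simp
    finally show ?thesis using e by simp
  qed
  then show ?thesis using s(1) by blast
qed

text \<open>The form in which both counterexamples are checked. Countable additivity comes from
  finite additivity, because the value on the tail \<open>?U - ?P n\<close> is bounded by a multiple
  of its measure, which tends to 0.\<close>

lemma vector_measure_of_lipschitz:
  assumes M: "finite_measure M" and GX: "\<And>E. E \<in> sets M \<Longrightarrow> G E \<in> X"
    and G_add: "\<And>A B. A \<in> sets M \<Longrightarrow> B \<in> sets M \<Longrightarrow> A \<inter> B = {} \<Longrightarrow> G (A \<union> B) = G A + G B"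
    and K: "0 \<le> K" and bound: "\<And>E. E \<in> sets M \<Longrightarrow> N (G E) \<le> K * measure M E"
  shows "vector_measure X N M G" "continuous_wrt_measure N M G" "bounded_variation N M G"
proof -
  interpret finite_measure M by fact
  have G_empty: "G {} = 0" using G_add[of "{}" "{}"] by simp
  show "vector_measure X N M G"
    unfolding vector_measure_def
  proof (intro conjI ballI allI impI GX)
    fix A :: "nat \<Rightarrow> 'a set" assume A: "range A \<subseteq> sets M" "disjoint_family A"
    let ?U = "\<Union>i. A i"
    let ?P = "\<lambda>n. \<Union>i<n. A i"
    have U: "?U \<in> sets M" and P: "?P n \<in> sets M" for n using A(1) by auto
    have sum: "(\<Sum>i<n. G (A i)) = G (?P n)" for n
    proof (induction n)
      case (Suc n)
      have "A i \<inter> A n = {}" if "i < n" for i using disjoint_family_onD[OF A(2), of i n] that by simp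
      then have "?P n \<inter> A n = {}" by blast
      moreover have "A n \<in> sets M" using A(1) by auto
      ultimately have "G (?P n \<union> A n) = G (?P n) + G (A n)" using P by (intro G_add) auto
      moreover have "?P (Suc n) = ?P n \<union> A n" by (auto simp: less_Suc_eq)
      ultimately show ?case using Suc by simp
    qed (simp add: G_empty)
    have "(\<lambda>n. K * (measure M ?U - (\<Sum>i<n. measure M (A i)))) \<longlonglongrightarrow> K * (measure M ?U - measure M ?U)"
      using finite_measure_UNION[OF A] unfolding sums_def by (intro tendsto_intros)
    then have lim: "(\<lambda>n. K * (measure M ?U - (\<Sum>i<n. measure M (A i)))) \<longlonglongrightarrow> 0" by simp
    show "(\<lambda>n. N ((\<Sum>i<n. G (A i)) - G ?U)) \<longlonglongrightarrow> 0"
    proof (rule tendsto_sandwich[OF _ _ tendsto_const lim])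
      show "eventually (\<lambda>n. 0 \<le> N ((\<Sum>i<n. G (A i)) - G ?U)) sequentially"
        unfolding sum using GX U P by (auto intro!: always_eventually N_nonneg diff)
      show "eventually (\<lambda>n. N ((\<Sum>i<n. G (A i)) - G ?U) \<le> K * (measure M ?U - (\<Sum>i<n. measure M (A i)))) sequentially"
      proof (rule always_eventually, rule allI)
        fix n
        have D: "?U - ?P n \<in> sets M" using U P by auto
        have "?P n \<union> (?U - ?P n) = ?U" by blast
        then have "G ?U = G (?P n) + G (?U - ?P n)" using G_add[OF P D, of n] by simp
        then have "(\<Sum>i<n. G (A i)) - G ?U = - G (?U - ?P n)" unfolding sum by simp
        then have "N ((\<Sum>i<n. G (A i)) - G ?U) = N (G (?U - ?P n))" using N_minus[OF GX[OF D]] by simp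
        also have "\<dots> \<le> K * measure M (?U - ?P n)" by (rule bound[OF D])
        also have "measure M (?U - ?P n) = measure M ?U - measure M (?P n)"
          using U P by (intro finite_measure_Diff) auto
        also have "measure M (?P n) = (\<Sum>i<n. measure M (A i))"
          using A by (intro finite_measure_finite_Union) (auto simp: disjoint_family_on_def)
        finally show "N ((\<Sum>i<n. G (A i)) - G ?U) \<le> K * (measure M ?U - (\<Sum>i<n. measure M (A i)))" .
      qed
    qed
  qed
  show "continuous_wrt_measure N M G"
    unfolding continuous_wrt_measure_def
  proof (intro allI impI)
    fix e :: real assume e: "0 < e"
    show "\<exists>d>0. \<forall>E\<in>sets M. measure M E < d \<longrightarrow> N (G E) < e"
    \<comment> \<open>Dividing by \<open>K + 1\<close> covers the case \<open>K = 0\<close>.\<close>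
    proof (intro exI[of _ "e / (K + 1)"] conjI ballI impI)
      show "0 < e / (K + 1)" using e K by simp
      fix E assume E: "E \<in> sets M" "measure M E < e / (K + 1)"
      have "N (G E) \<le> K * measure M E" by (rule bound[OF E(1)])
      also have "\<dots> \<le> (K + 1) * measure M E" by (intro mult_right_mono) auto
      also have "\<dots> < (K + 1) * (e / (K + 1))" using E(2) K by (intro mult_strict_left_mono) auto
      finally show "N (G E) < e" using K by simp
    qed
  qed
  show "bounded_variation N M G"
    unfolding bounded_variation_def
  proof (intro exI[of _ "K * measure M (space M)"] allI impI)
    fix P assume P: "finite P" "P \<subseteq> sets M" "partition_on (space M) P"
    have "(\<Sum>A\<in>P. N (G A)) \<le> (\<Sum>A\<in>P. K * measure M A)" using P(2) by (intro sum_mono bound) auto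
    also have "\<dots> = K * (\<Sum>A\<in>P. measure M A)" by (simp add: sum_distrib_left)
    also have "(\<Sum>A\<in>P. measure M A) = measure M (\<Union>A\<in>P. A)"
      using P by (intro finite_measure_finite_Union[symmetric]) (auto simp: disjoint_family_on_def partition_on_def pairwise_def disjnt_def)
    also have "(\<Union>A\<in>P. A) = space M" using P(3) by (simp add: partition_on_def)
    finally show "(\<Sum>A\<in>P. N (G A)) \<le> K * measure M (space M)" .
  qed
qed

subsection \<open>Variation and densities\<close>

text \<open>The supremum runs over finite disjoint families inside \<open>E\<close> that need not
  cover \<open>E\<close>. Monotonicity is then immediate, and families can be joined without first
  being completed to partitions.\<close>

definition variation :: "'a measure \<Rightarrow> ('a set \<Rightarrow> 'v) \<Rightarrow> 'a set \<Rightarrow> ennreal" where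
  "variation M G E = (SUP P\<in>{P. finite P \<and> P \<subseteq> sets M \<and> disjoint P \<and> \<Union>P \<subseteq> E}. \<Sum>A\<in>P. ennreal (N (G A)))"

lemma vector_measure_mem: "vector_measure X N M G \<Longrightarrow> E \<in> sets M \<Longrightarrow> G E \<in> X"
  by (simp add: vector_measure_def)

lemma vector_measure_sums:
  "vector_measure X N M G \<Longrightarrow> range A \<subseteq> sets M \<Longrightarrow> disjoint_family A \<Longrightarrow>
    (\<lambda>n. N ((\<Sum>i<n. G (A i)) - G (\<Union>i::nat. A i))) \<longlonglongrightarrow> 0"
  by (simp add: vector_measure_def)

text \<open>Countable additivity for the constant sequence \<open>{}\<close> says that
  \<open>(n - 1) * N (G {})\<close> tends to 0. As \<open>N\<close> is a seminorm, this yields norm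
  0 and not \<open>G {} = 0\<close>.\<close>

lemma vector_measure_empty: assumes vm: "vector_measure X N M G" shows "N (G {}) = 0"
proof -
  have X: "G {} \<in> X" using vm by (rule vector_measure_mem) simp
  have lim: "(\<lambda>n. N ((\<Sum>i<(n::nat). G {}) - G {})) \<longlonglongrightarrow> 0"
    using vector_measure_sums[OF vm, of "\<lambda>_. {}"] by (simp add: disjoint_family_on_def)
  have "N (G {}) \<le> N ((\<Sum>i<n. G {}) - G {})" if "2 \<le> n" for n :: nat
  proof -
    have "(\<Sum>i<n. G {}) - G {} = (real n - 1) *\<^sub>R G {}"
      by (simp add: sum_constant_scaleR scaleR_diff_left)
    then have "N ((\<Sum>i<n. G {}) - G {}) = (real n - 1) * N (G {})" using N_scale[OF X] that by simp
    moreover have "1 * N (G {}) \<le> (real n - 1) * N (G {})" using that N_nonneg[OF X] by (intro mult_right_mono) auto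
    ultimately show ?thesis by simp
  qed
  then have "N (G {}) \<le> 0" by (intro LIMSEQ_le_const[OF lim]) blast
  then show ?thesis using N_nonneg[OF X] by simp
qed

lemma vector_measure_countably_subadditive:
  assumes vm: "vector_measure X N M G" and A: "range A \<subseteq> sets M" "disjoint_family A"
  shows "ennreal (N (G (\<Union>i::nat. A i))) \<le> (\<Sum>i. ennreal (N (G (A i))))"
proof -
  have X: "G (A i) \<in> X" "G (\<Union>i. A i) \<in> X" for i
    using A by (auto intro!: vector_measure_mem[OF vm] sets.countable_UN)
  have "ennreal (N (G (\<Union>i. A i))) \<le> (\<Sum>i. ennreal (N (G (A i)))) + ennreal (N ((\<Sum>i<n. G (A i)) - G (\<Union>i. A i)))" for n
  proof -
    have s: "(\<Sum>i<n. G (A i)) \<in> X" using X by (intro sum_mem)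
    have "N (G (\<Union>i. A i)) \<le> N (\<Sum>i<n. G (A i)) + N ((\<Sum>i<n. G (A i)) - G (\<Union>i. A i))"
      using N_le_add_diff[OF X(2) s] N_minus_commute[OF X(2) s] by simp
    also have "\<dots> \<le> (\<Sum>i<n. N (G (A i))) + N ((\<Sum>i<n. G (A i)) - G (\<Union>i. A i))"
      using N_sum[of "{..<n}" "\<lambda>i. G (A i)"] X by simp
    finally have "ennreal (N (G (\<Union>i. A i))) \<le> ennreal ((\<Sum>i<n. N (G (A i))) + N ((\<Sum>i<n. G (A i)) - G (\<Union>i. A i)))"
      by (rule ennreal_leI)
    also have "\<dots> = (\<Sum>i<n. ennreal (N (G (A i)))) + ennreal (N ((\<Sum>i<n. G (A i)) - G (\<Union>i. A i)))"
    proof -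
      have "ennreal (\<Sum>i<n. N (G (A i))) = (\<Sum>i<n. ennreal (N (G (A i))))"
        by (rule sum_ennreal[symmetric]) (rule N_nonneg[OF X(1)])
      then show ?thesis using X s by (subst ennreal_plus) (auto intro!: sum_nonneg N_nonneg diff)
    qed
    also have "\<dots> \<le> (\<Sum>i. ennreal (N (G (A i)))) + ennreal (N ((\<Sum>i<n. G (A i)) - G (\<Union>i. A i)))"
      by (intro add_right_mono sum_le_suminf) auto
    finally show ?thesis .
  qed
  moreover have "(\<lambda>n. (\<Sum>i. ennreal (N (G (A i)))) + ennreal (N ((\<Sum>i<n. G (A i)) - G (\<Union>i. A i))))
      \<longlonglongrightarrow> (\<Sum>i. ennreal (N (G (A i)))) + ennreal 0"
    by (intro tendsto_add tendsto_const tendsto_ennrealI vector_measure_sums[OF vm A])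
  ultimately show ?thesis by (intro LIMSEQ_le_const[of _ "\<Sum>i. ennreal (N (G (A i)))"]) auto
qed

lemma variation_upper:
  "finite P \<Longrightarrow> P \<subseteq> sets M \<Longrightarrow> disjoint P \<Longrightarrow> \<Union>P \<subseteq> E \<Longrightarrow> (\<Sum>A\<in>P. ennreal (N (G A))) \<le> variation M G E"
  unfolding variation_def by (rule SUP_upper) auto

lemma variation_least:
  assumes "\<And>P. finite P \<Longrightarrow> P \<subseteq> sets M \<Longrightarrow> disjoint P \<Longrightarrow> \<Union>P \<subseteq> E \<Longrightarrow> (\<Sum>A\<in>P. ennreal (N (G A))) \<le> c"
  shows "variation M G E \<le> c"
  unfolding variation_def by (rule SUP_least) (use assms in auto)

lemma variation_ge: "E \<in> sets M \<Longrightarrow> ennreal (N (G E)) \<le> variation M G E"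
  using variation_upper[of "{E}" M E G] by simp

lemma variation_mono: "E \<subseteq> F \<Longrightarrow> variation M G E \<le> variation M G F"
  by (rule variation_least, rule variation_upper) auto

lemma variation_superadditive:
  assumes vm: "vector_measure X N M G" and disj: "E \<inter> F = {}"
  shows "variation M G E + variation M G F \<le> variation M G (E \<union> F)"
proof -
  let ?S = "\<lambda>E. {P. finite P \<and> P \<subseteq> sets M \<and> disjoint P \<and> \<Union>P \<subseteq> E}"
  let ?a = "\<lambda>P. \<Sum>A\<in>P. ennreal (N (G A))"
  have ne: "?S E \<noteq> {}" for E by (auto intro!: exI[of _ "{}"])
  have key: "?a P + ?a Q \<le> variation M G (E \<union> F)" if P: "P \<in> ?S E" and Q: "Q \<in> ?S F" for P Q
  proof -
    \<comment> \<open>Families inside disjoint sets can share only the empty set, whose image has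
      norm 0.\<close>
    have sub: "P \<inter> Q \<subseteq> {{}}" using P Q disj by blast
    have 0: "?a (P \<inter> Q) = 0"
      by (rule sum.neutral) (use sub vector_measure_empty[OF vm] in auto)
    have "?a P + ?a Q = ?a (P \<union> Q) + ?a (P \<inter> Q)" using P Q by (intro sum.union_inter[symmetric]) auto
    also have "\<dots> = ?a (P \<union> Q)" using 0 by simp
    also have "\<dots> \<le> variation M G (E \<union> F)"
    proof (rule variation_upper)
      show "disjoint (P \<union> Q)"
      proof (rule pairwiseI)
        fix A B assume AB: "A \<in> P \<union> Q" "B \<in> P \<union> Q" "A \<noteq> B"
        have cross: "disjnt A B" if "A \<in> P" "B \<in> Q" for A B
          using that P Q disj unfolding disjnt_def by blast
        show "disjnt A B" using AB P Q cross[of A B] cross[of B A]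
          by (auto simp: pairwise_def disjnt_sym)
      qed
    qed (use P Q in auto)
    finally show ?thesis .
  qed
  have "variation M G E + variation M G F = (SUP P\<in>?S E. ?a P + variation M G F)"
    unfolding variation_def[of M G E] by (rule ennreal_SUP_add_left[OF ne, symmetric])
  also have "\<dots> \<le> variation M G (E \<union> F)"
  proof (rule SUP_least)
    fix P assume P: "P \<in> ?S E"
    have "?a P + variation M G F = (SUP Q\<in>?S F. ?a P + ?a Q)"
      unfolding variation_def[of M G F] by (rule ennreal_SUP_add_right[OF ne])
    also have "\<dots> \<le> variation M G (E \<union> F)" by (rule SUP_least) (rule key[OF P])
    finally show "?a P + variation M G F \<le> variation M G (E \<union> F)" .
  qed
  finally show ?thesis .
qed

lemma variation_countably_additive:
  assumes vm: "vector_measure X N M G" and E: "range E \<subseteq> sets M" "disjoint_family E"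
  shows "(\<Sum>i. variation M G (E i)) = variation M G (\<Union>i::nat. E i)"
proof (rule antisym)
  show "variation M G (\<Union>i. E i) \<le> (\<Sum>i. variation M G (E i))"
  proof (rule variation_least)
    fix P assume P: "finite P" "P \<subseteq> sets M" "disjoint P" "\<Union>P \<subseteq> (\<Union>i. E i)"
    \<comment> \<open>Each member of \<open>P\<close> is cut along the sets \<open>E i\<close>;
      countable subadditivity bounds its norm by the norms of the pieces.\<close>
    have "(\<Sum>A\<in>P. ennreal (N (G A))) \<le> (\<Sum>A\<in>P. \<Sum>i. ennreal (N (G (A \<inter> E i))))"
    proof (rule sum_mono)
      fix A assume A: "A \<in> P"
      have "A = (\<Union>i. A \<inter> E i)" using P(4) A by blast
      moreover have "ennreal (N (G (\<Union>i. A \<inter> E i))) \<le> (\<Sum>i. ennreal (N (G (A \<inter> E i))))"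
      proof (rule vector_measure_countably_subadditive[OF vm])
        show "range (\<lambda>i. A \<inter> E i) \<subseteq> sets M" using A P(2) E(1) by auto
        show "disjoint_family (\<lambda>i. A \<inter> E i)" using E(2) unfolding disjoint_family_on_def by blast
      qed
      ultimately show "ennreal (N (G A)) \<le> (\<Sum>i. ennreal (N (G (A \<inter> E i))))" by simp
    qed
    also have "\<dots> = (\<Sum>i. \<Sum>A\<in>P. ennreal (N (G (A \<inter> E i))))"
      by (rule suminf_sum[symmetric]) auto
    also have "\<dots> \<le> (\<Sum>i. variation M G (E i))"
    proof (rule suminf_le)
      fix i
      \<comment> \<open>Two different members of \<open>P\<close> with the same trace on
        \<open>E i\<close> have the empty trace, by disjointness, so passing to the set of traces
        drops only terms of norm 0.\<close>
      have "(\<Sum>A\<in>P. ennreal (N (G (A \<inter> E i)))) = (\<Sum>B\<in>(\<lambda>A. A \<inter> E i) ` P. ennreal (N (G B)))"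
      proof (subst sum.reindex_nontrivial[OF P(1)])
        fix A B assume "A \<in> P" "B \<in> P" "A \<noteq> B" "A \<inter> E i = B \<inter> E i"
        then have "A \<inter> E i = {}" using P(3) unfolding pairwise_def disjnt_def by blast
        then show "ennreal (N (G (A \<inter> E i))) = 0" using vector_measure_empty[OF vm] by simp
      qed simp
      also have "\<dots> \<le> variation M G (E i)"
      proof (rule variation_upper)
        show "disjoint ((\<lambda>A. A \<inter> E i) ` P)"
          using P(3) unfolding pairwise_def disjnt_def by blast
      qed (use P E in auto)
      finally show "(\<Sum>A\<in>P. ennreal (N (G (A \<inter> E i)))) \<le> variation M G (E i)" .
    qed auto
    finally show "(\<Sum>A\<in>P. ennreal (N (G A))) \<le> (\<Sum>i. variation M G (E i))" .
  qed
  have fin: "(\<Sum>i<n. variation M G (E i)) \<le> variation M G (\<Union>i<n. E i)" for n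
  proof (induction n)
    case (Suc n)
    have "E i \<inter> E n = {}" if "i < n" for i using E(2) that unfolding disjoint_family_on_def by simp
    then have "(\<Union>i<n. E i) \<inter> E n = {}" by blast
    note le = variation_superadditive[OF vm this]
    have "(\<Sum>i<Suc n. variation M G (E i)) \<le> variation M G (\<Union>i<n. E i) + variation M G (E n)"
      using add_right_mono[OF Suc] by simp
    also note le
    finally show ?case by (simp add: lessThan_Suc Un_commute)
  qed simp
  have "(\<Sum>i<n. variation M G (E i)) \<le> variation M G (\<Union>i. E i)" for n
    using fin[of n] variation_mono[of "\<Union>i<n. E i" "\<Union>i. E i" M G] by (auto intro: order_trans)
  then show "(\<Sum>i. variation M G (E i)) \<le> variation M G (\<Union>i. E i)"
    by (simp add: suminf_eq_SUP SUP_le_iff)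
qed

lemma variation_finite:
  assumes vm: "vector_measure X N M G" and bv: "bounded_variation N M G"
  shows "variation M G E < \<infinity>"
proof -
  obtain C where C: "\<And>P. finite P \<Longrightarrow> P \<subseteq> sets M \<Longrightarrow> partition_on (space M) P \<Longrightarrow> (\<Sum>A\<in>P. N (G A)) \<le> C"
    using bv unfolding bounded_variation_def by blast
  have "variation M G E \<le> ennreal C"
  proof (rule variation_least)
    fix P assume P: "finite P" "P \<subseteq> sets M" "disjoint P"
    \<comment> \<open>\<open>bounded_variation\<close> speaks of partitions of the whole space,
      whose blocks are nonempty; hence the complement is added and \<open>{}\<close> is
      removed.\<close>
    define R where "R = (insert (space M - \<Union>P) P) - {{}}"
    have UP: "\<Union>P \<in> sets M" using P by auto
    have R: "finite R" "R \<subseteq> sets M" using P UP by (auto simp: R_def)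
    have "partition_on (space M) R"
    proof (rule partition_onI)
      have "\<Union>P \<subseteq> space M" using P(2) sets.sets_into_space by blast
      then show "\<Union>R = space M" unfolding R_def by blast
      show "disjnt A B" if "A \<in> R" "B \<in> R" "A \<noteq> B" for A B
        using that P(3) unfolding R_def pairwise_def disjnt_def by blast
    qed (auto simp: R_def)
    then have le: "(\<Sum>A\<in>R. N (G A)) \<le> C" by (intro C R)
    have Gn: "0 \<le> N (G A)" if "A \<in> sets M" for A using vector_measure_mem[OF vm that] by (rule N_nonneg)
    have "(\<Sum>A\<in>P. N (G A)) = (\<Sum>A\<in>P - {{}}. N (G A))"
      by (rule sum.mono_neutral_right) (use P vector_measure_empty[OF vm] in auto)
    also have "\<dots> \<le> (\<Sum>A\<in>R. N (G A))"
      by (rule sum_mono2) (use R Gn in \<open>auto simp: R_def\<close>)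
    finally have "(\<Sum>A\<in>P. N (G A)) \<le> C" using le by simp
    moreover have "(\<Sum>A\<in>P. ennreal (N (G A))) = ennreal (\<Sum>A\<in>P. N (G A))"
      using P Gn by (intro sum_ennreal) auto
    ultimately show "(\<Sum>A\<in>P. ennreal (N (G A))) \<le> ennreal C" by (simp add: ennreal_leI)
  qed
  then show ?thesis by (simp add: order_le_less_trans)
qed

lemma variation_null:
  assumes vm: "vector_measure X N M G" and ac: "continuous_wrt_measure N M G"
    and E: "E \<in> null_sets M"
  shows "variation M G E = 0"
proof -
  have 0: "N (G A) = 0" if "A \<in> sets M" "A \<subseteq> E" for A
  proof -
    have "A \<in> null_sets M" using that E by (meson null_sets_subset)
    then have m: "measure M A = 0" by (simp add: null_sets_def measure_def)
    have "N (G A) \<le> e" if "0 < e" for e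
      using ac m \<open>A \<in> sets M\<close> that unfolding continuous_wrt_measure_def by (metis less_imp_le)
    then have "N (G A) \<le> 0" by (rule dense_ge)
    then show ?thesis using N_nonneg[OF vector_measure_mem[OF vm that(1)]] by simp
  qed
  have "variation M G E \<le> 0"
  proof (rule variation_least)
    fix P assume P: "finite P" "P \<subseteq> sets M" "disjoint P" "\<Union>P \<subseteq> E"
    have "ennreal (N (G A)) = 0" if A: "A \<in> P" for A
    proof -
      have "A \<in> sets M" "A \<subseteq> E" using P A by blast+
      from 0[OF this] show ?thesis by simp
    qed
    then have "(\<Sum>A\<in>P. ennreal (N (G A))) = 0" by (simp add: sum.neutral)
    then show "(\<Sum>A\<in>P. ennreal (N (G A))) \<le> 0" by simp
  qed
  then show ?thesis by simp
qed

text \<open>\<open>v\<close> is the density of the total variation. It later bounds the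
  approximating densities pointwise and provides the dominating function for the convergence of the
  integrals.\<close>

lemma variation_density:
  assumes M: "finite_measure M" and vm: "vector_measure X N M G" and ac: "continuous_wrt_measure N M G"
    and bv: "bounded_variation N M G"
  shows "\<exists>\<mu> v. integrable M v \<and> (\<forall>E\<in>sets M. N (G E) \<le> \<mu> E \<and> \<mu> E = set_lebesgue_integral M E v) \<and>
    (\<forall>A::nat \<Rightarrow> _. range A \<subseteq> sets M \<longrightarrow> disjoint_family A \<longrightarrow> (\<lambda>n. \<mu> (A n)) sums \<mu> (\<Union>n. A n)) \<and>
    (\<forall>E\<in>null_sets M. \<mu> E = 0)"
proof -
  define \<mu> where "\<mu> E = enn2real (variation M G E)" for E
  have em: "ennreal (\<mu> E) = variation M G E" for E
    using variation_finite[OF vm bv, of E] by (simp add: \<mu>_def less_top)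
  have sums: "(\<lambda>n. \<mu> (A n)) sums \<mu> (\<Union>n. A n)" if A: "range A \<subseteq> sets M" "disjoint_family A" for A :: "nat \<Rightarrow> _"
  proof -
    have "(\<lambda>n. ennreal (\<mu> (A n))) sums ennreal (\<mu> (\<Union>n. A n))"
      unfolding em variation_countably_additive[OF vm A, symmetric] by (intro summable_sums) simp
    then show ?thesis by (subst (asm) sums_ennreal) (auto simp: \<mu>_def)
  qed
  have null: "\<mu> E = 0" if "E \<in> null_sets M" for E using variation_null[OF vm ac that] by (simp add: \<mu>_def)
  have le: "N (G E) \<le> \<mu> E" if "E \<in> sets M" for E
    using variation_ge[OF that, of G] unfolding em[symmetric]
    by (subst (asm) ennreal_le_iff) (auto simp: \<mu>_def)
  have nn: "0 \<le> \<mu> E" for E by (simp add: \<mu>_def)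
  obtain v where v: "integrable M v" "\<forall>E\<in>sets M. \<mu> E = set_lebesgue_integral M E v"
    using radon_nikodym_real_set_function[OF M nn sums null] by blast
  show ?thesis
    by (rule exI[of _ \<mu>], rule exI[of _ v]) (use v sums null le in blast)
qed

text \<open>The set function \<open>c (G E)\<close> is signed, but
  \<open>\<bar>c (G E)\<bar> \<le> K * N (G E) \<le> K * \<mu> E\<close>. Adding
  \<open>K * \<mu> E\<close> makes it nonnegative, and \<open>K * v\<close> is subtracted from the
  density afterwards.\<close>

lemma scalar_density:
  assumes M: "finite_measure M" and vm: "vector_measure X N M G"
    and le: "\<And>E. E \<in> sets M \<Longrightarrow> N (G E) \<le> \<mu> E" and v: "integrable M v" "\<And>E. E \<in> sets M \<Longrightarrow> \<mu> E = set_lebesgue_integral M E v"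
    and sums: "\<And>A::nat \<Rightarrow> _. range A \<subseteq> sets M \<Longrightarrow> disjoint_family A \<Longrightarrow> (\<lambda>n. \<mu> (A n)) sums \<mu> (\<Union>n. A n)"
    and null: "\<And>E. E \<in> null_sets M \<Longrightarrow> \<mu> E = 0"
    and c: "\<And>x y. x \<in> X \<Longrightarrow> y \<in> X \<Longrightarrow> c (x + y) = c x + c y" "\<And>r x. x \<in> X \<Longrightarrow> c (r *\<^sub>R x) = r * c x"
    and K: "0 \<le> K" "\<And>x. x \<in> X \<Longrightarrow> \<bar>c x\<bar> \<le> K * N x"
  shows "\<exists>h. integrable M h \<and> (\<forall>E\<in>sets M. c (G E) = set_lebesgue_integral M E h)"
proof -
  have c_sum: "c (sum f B) = (\<Sum>i\<in>B. c (f i))" if "\<And>i. i \<in> B \<Longrightarrow> f i \<in> X" "finite B" for f and B :: "nat set"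
    using that(2,1)
  proof (induction B rule: finite_induct)
    case empty then show ?case using c(2)[OF zero, of 0] by simp
  next
    case (insert i B) then show ?case by (simp add: c(1) sum_mem)
  qed
  have c_diff: "c (x - y) = c x - c y" if "x \<in> X" "y \<in> X" for x y
    using c(1)[OF that(1) minus[OF that(2)]] c(2)[OF that(2), of "-1"] by simp
  have cb: "\<bar>c (G E)\<bar> \<le> K * \<mu> E" if E: "E \<in> sets M" for E
    using K(2)[OF vector_measure_mem[OF vm E]] mult_left_mono[OF le[OF E] K(1)] by simp
  have "\<exists>h. integrable M h \<and> (\<forall>x. 0 \<le> h x) \<and> (\<forall>E\<in>sets M. c (G E) + K * \<mu> E = set_lebesgue_integral M E h)"
  proof (rule radon_nikodym_real_set_function[OF M])
    show "0 \<le> c (G E) + K * \<mu> E" if "E \<in> sets M" for E using cb[OF that] by simp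
    show "c (G E) + K * \<mu> E = 0" if "E \<in> null_sets M" for E using cb[of E] null[OF that] that by auto
    fix A :: "nat \<Rightarrow> 'a set" assume A: "range A \<subseteq> sets M" "disjoint_family A"
    have GX: "G (A i) \<in> X" "G (\<Union>i. A i) \<in> X" for i
      using A by (auto intro!: vector_measure_mem[OF vm] sets.countable_UN)
    have "(\<lambda>n. c (G (A n))) sums c (G (\<Union>n. A n))"
      unfolding sums_def
    proof (rule LIM_zero_cancel, rule tendsto_rabs_zero_cancel)
      have "(\<lambda>n. K * N ((\<Sum>i<n. G (A i)) - G (\<Union>i. A i))) \<longlonglongrightarrow> K * 0"
        by (intro tendsto_mult tendsto_const vector_measure_sums[OF vm A])
      then have lim: "(\<lambda>n. K * N ((\<Sum>i<n. G (A i)) - G (\<Union>i. A i))) \<longlonglongrightarrow> 0" by simp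
      show "(\<lambda>n. \<bar>(\<Sum>i<n. c (G (A i))) - c (G (\<Union>i. A i))\<bar>) \<longlonglongrightarrow> 0"
      proof (rule tendsto_sandwich[OF _ _ tendsto_const lim])
        show "eventually (\<lambda>n. \<bar>(\<Sum>i<n. c (G (A i))) - c (G (\<Union>i. A i))\<bar> \<le> K * N ((\<Sum>i<n. G (A i)) - G (\<Union>i. A i))) sequentially"
        proof (rule always_eventually, rule allI)
          fix n
          have s: "(\<Sum>i<n. G (A i)) \<in> X" using GX by (intro sum_mem)
          have "(\<Sum>i<n. c (G (A i))) - c (G (\<Union>i. A i)) = c ((\<Sum>i<n. G (A i)) - G (\<Union>i. A i))"
            using GX s by (simp add: c_diff c_sum)
          then show "\<bar>(\<Sum>i<n. c (G (A i))) - c (G (\<Union>i. A i))\<bar> \<le> K * N ((\<Sum>i<n. G (A i)) - G (\<Union>i. A i))"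
            using K(2)[OF diff[OF s GX(2)]] by simp
        qed
      qed auto
    qed
    then show "(\<lambda>n. c (G (A n)) + K * \<mu> (A n)) sums (c (G (\<Union>n. A n)) + K * \<mu> (\<Union>n. A n))"
      using A by (intro sums_add sums_mult sums)
  qed
  then obtain h where h: "integrable M h" "\<And>E. E \<in> sets M \<Longrightarrow> c (G E) + K * \<mu> E = set_lebesgue_integral M E h" by blast
  have int: "integrable M (\<lambda>x. h x - K * v x)" using h v by simp
  have "c (G E) = set_lebesgue_integral M E (\<lambda>x. h x - K * v x)" if E: "E \<in> sets M" for E
  proof -
    have "set_lebesgue_integral M E (\<lambda>x. h x - K * v x) = set_lebesgue_integral M E h - set_lebesgue_integral M E (\<lambda>x. K * v x)"
      using h(1) v(1) E by (intro set_integral_diff set_integrable_of_integrable) auto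
    also have "set_lebesgue_integral M E (\<lambda>x. K * v x) = K * set_lebesgue_integral M E v" by simp
    finally show ?thesis using h(2)[OF E] v(2)[OF E] by simp
  qed
  then show ?thesis using int by blast
qed

text \<open>
  For fixed coefficients \<open>q\<close> the bound \<open>N(\<Sum> q\<^sub>j e\<^sub>j) \<le> v + \<Sum> \<bar>h\<^sub>j - q\<^sub>j\<bar> N(e\<^sub>j)\<close> is an
  inequality between scalar densities; rational \<open>q\<close> close to \<open>h(x)\<close> then give the claim.
\<close>

lemma AE_norm_comb_le:
  assumes M: "finite_measure M" and A: "finite A" and e: "\<And>j. j \<in> A \<Longrightarrow> e j \<in> X"
    and h: "\<And>j. j \<in> A \<Longrightarrow> integrable M (h j)" and v: "integrable M v"
    and le: "\<And>E. E \<in> sets M \<Longrightarrow> N (\<Sum>j\<in>A. set_lebesgue_integral M E (h j) *\<^sub>R e j) \<le> set_lebesgue_integral M E v"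
  shows "AE x in M. N (\<Sum>j\<in>A. h j x *\<^sub>R e j) \<le> v x"
proof -
  interpret finite_measure M by fact
  define Q :: "('b \<Rightarrow> real) set" where "Q = (\<Pi>\<^sub>E j\<in>A. \<rat>)"
  have Q: "countable Q" unfolding Q_def by (intro countable_PiE A countable_rat)
  have each: "AE x in M. N (\<Sum>j\<in>A. q j *\<^sub>R e j) \<le> v x + (\<Sum>j\<in>A. \<bar>h j x - q j\<bar> * N (e j))" for q
  proof -
    define u where "u x = v x + (\<Sum>j\<in>A. \<bar>h j x - q j\<bar> * N (e j)) - N (\<Sum>j\<in>A. q j *\<^sub>R e j)" for x
    have intj: "integrable M (\<lambda>x. \<bar>h j x - q j\<bar> * N (e j))" if "j \<in> A" for j using h[OF that] by simp
    have u: "integrable M u" unfolding u_def using v intj by (intro Bochner_Integration.integrable_diff Bochner_Integration.integrable_add Bochner_Integration.integrable_sum) auto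
    have nn: "0 \<le> set_lebesgue_integral M E u" if E: "E \<in> sets M" for E
    proof -
      have const: "set_lebesgue_integral M E (\<lambda>x. r) = measure M E * r" for r :: real
        using E by (simp add: set_lebesgue_integral_def emeasure_eq_measure)
      have "set_lebesgue_integral M E u = set_lebesgue_integral M E v + (\<Sum>j\<in>A. set_lebesgue_integral M E (\<lambda>x. \<bar>h j x - q j\<bar> * N (e j))) - measure M E * N (\<Sum>j\<in>A. q j *\<^sub>R e j)"
      proof -
        have "set_lebesgue_integral M E u = set_lebesgue_integral M E (\<lambda>x. v x + (\<Sum>j\<in>A. \<bar>h j x - q j\<bar> * N (e j))) - set_lebesgue_integral M E (\<lambda>x. N (\<Sum>j\<in>A. q j *\<^sub>R e j))"
          unfolding u_def using v intj E
          by (intro set_integral_diff set_integrable_of_integrable Bochner_Integration.integrable_add Bochner_Integration.integrable_sum) auto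
        also have "set_lebesgue_integral M E (\<lambda>x. v x + (\<Sum>j\<in>A. \<bar>h j x - q j\<bar> * N (e j)))
           = set_lebesgue_integral M E v + set_lebesgue_integral M E (\<lambda>x. \<Sum>j\<in>A. \<bar>h j x - q j\<bar> * N (e j))"
          using v intj E by (intro set_integral_add set_integrable_of_integrable Bochner_Integration.integrable_sum) auto
        also have "set_lebesgue_integral M E (\<lambda>x. \<Sum>j\<in>A. \<bar>h j x - q j\<bar> * N (e j)) = (\<Sum>j\<in>A. set_lebesgue_integral M E (\<lambda>x. \<bar>h j x - q j\<bar> * N (e j)))"
          unfolding set_lebesgue_integral_def scaleR_sum_right
          using intj E by (intro Bochner_Integration.integral_sum) (auto intro!: integrable_mult_indicator simp del: real_scaleR_def)
        finally show ?thesis by (simp only: const)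
      qed
      moreover have "N (measure M E *\<^sub>R (\<Sum>j\<in>A. q j *\<^sub>R e j)) \<le> N (\<Sum>j\<in>A. set_lebesgue_integral M E (h j) *\<^sub>R e j)
         + (\<Sum>j\<in>A. \<bar>measure M E * q j - set_lebesgue_integral M E (h j)\<bar> * N (e j))"
      proof -
        have eq: "measure M E *\<^sub>R (\<Sum>j\<in>A. q j *\<^sub>R e j) = (\<Sum>j\<in>A. (measure M E * q j) *\<^sub>R e j)"
          by (simp add: scaleR_sum_right)
        have "(\<Sum>j\<in>A. (measure M E * q j) *\<^sub>R e j) \<in> X" "(\<Sum>j\<in>A. set_lebesgue_integral M E (h j) *\<^sub>R e j) \<in> X"
          using e by (auto intro!: sum_mem scale)
        from N_le_add_diff[OF this] N_comb_diff_le[OF A, of e, OF e, where a="\<lambda>j. measure M E * q j" and b="\<lambda>j. set_lebesgue_integral M E (h j)"]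
        show ?thesis unfolding eq by simp
      qed
      moreover have "N (measure M E *\<^sub>R (\<Sum>j\<in>A. q j *\<^sub>R e j)) = measure M E * N (\<Sum>j\<in>A. q j *\<^sub>R e j)"
        using e by (subst N_scale) (auto intro!: sum_mem scale)
      moreover have "(\<Sum>j\<in>A. \<bar>measure M E * q j - set_lebesgue_integral M E (h j)\<bar> * N (e j)) \<le> (\<Sum>j\<in>A. set_lebesgue_integral M E (\<lambda>x. \<bar>h j x - q j\<bar> * N (e j)))"
      proof (rule sum_mono)
        fix j assume j: "j \<in> A"
        have "measure M E * q j - set_lebesgue_integral M E (h j) = - set_lebesgue_integral M E (\<lambda>x. h j x - q j)"
          using h[OF j] E by (subst set_integral_diff) (auto intro!: set_integrable_of_integrable simp: const)
        then have "\<bar>measure M E * q j - set_lebesgue_integral M E (h j)\<bar> = \<bar>set_lebesgue_integral M E (\<lambda>x. h j x - q j)\<bar>" by simp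
        also have "\<dots> \<le> set_lebesgue_integral M E (\<lambda>x. \<bar>h j x - q j\<bar>)"
        proof -
          have "set_integrable M E (\<lambda>x. h j x - q j)" using h[OF j] E by (intro set_integrable_of_integrable) auto
          from set_integral_norm_bound[OF this] show ?thesis by simp
        qed
        finally have "\<bar>measure M E * q j - set_lebesgue_integral M E (h j)\<bar> * N (e j) \<le> set_lebesgue_integral M E (\<lambda>x. \<bar>h j x - q j\<bar>) * N (e j)"
          using N_nonneg[OF e[OF j]] by (rule mult_right_mono)
        then show "\<bar>measure M E * q j - set_lebesgue_integral M E (h j)\<bar> * N (e j) \<le> set_lebesgue_integral M E (\<lambda>x. \<bar>h j x - q j\<bar> * N (e j))"
          by simp
      qed
      ultimately show ?thesis using le[OF E] by linarith
    qed
    have "AE x in M. 0 \<le> u x" by (rule density_nonneg[OF u]) (rule nn)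
    then show ?thesis by eventually_elim (simp add: u_def)
  qed
  have "AE x in M. \<forall>q\<in>Q. N (\<Sum>j\<in>A. q j *\<^sub>R e j) \<le> v x + (\<Sum>j\<in>A. \<bar>h j x - q j\<bar> * N (e j))"
    using each by (intro AE_ball_countable'[OF _ Q])
  then show ?thesis
  proof eventually_elim
    case (elim x)
    define K where "K = (\<Sum>j\<in>A. N (e j))"
    have K: "0 \<le> K" unfolding K_def by (intro sum_nonneg N_nonneg e)
    show ?case
    proof (rule field_le_epsilon)
      fix d :: real assume d: "0 < d"
      \<comment> \<open>The error \<open>\<epsilon> * K\<close> is paid twice: once for replacing
        \<open>h j x\<close> by \<open>q j\<close> inside the norm, once for the error sum in the
        bound. The summand 1 avoids division by 0.\<close>
      define \<epsilon> where "\<epsilon> = d / (2 * (K + 1))"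
      have eps: "0 < \<epsilon>" "2 * (\<epsilon> * K) \<le> d" using d K by (auto simp: \<epsilon>_def field_simps)
      have "\<exists>r\<in>\<rat>. h j x < r \<and> r < h j x + \<epsilon>" for j using Rats_dense_in_real[of "h j x" "h j x + \<epsilon>"] eps by auto
      then obtain r where r: "\<And>j. r j \<in> \<rat>" "\<And>j. h j x < r j" "\<And>j. r j < h j x + \<epsilon>" by metis
      define q where "q = restrict r A"
      have qQ: "q \<in> Q" using r(1) by (auto simp: Q_def q_def)
      have qd: "\<bar>h j x - q j\<bar> \<le> \<epsilon>" if "j \<in> A" for j using r(2,3)[of j] that by (simp add: q_def)
      have s: "(\<Sum>j\<in>A. \<bar>h j x - q j\<bar> * N (e j)) \<le> \<epsilon> * K"
        unfolding K_def sum_distrib_left using qd e by (intro sum_mono mult_right_mono N_nonneg) auto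
      have X: "(\<Sum>j\<in>A. h j x *\<^sub>R e j) \<in> X" "(\<Sum>j\<in>A. q j *\<^sub>R e j) \<in> X" using e by (auto intro!: sum_mem scale)
      have "N (\<Sum>j\<in>A. h j x *\<^sub>R e j) \<le> N (\<Sum>j\<in>A. q j *\<^sub>R e j) + (\<Sum>j\<in>A. \<bar>h j x - q j\<bar> * N (e j))"
        using N_le_add_diff[OF X] N_comb_diff_le[OF A, of e, OF e, where a="\<lambda>j. h j x" and b=q] by simp
      also have "\<dots> \<le> v x + 2 * (\<epsilon> * K)" using elim qQ s by fastforce
      finally show "N (\<Sum>j\<in>A. h j x *\<^sub>R e j) \<le> v x + d" using eps by simp
    qed
  qed
qed

text \<open>The sums \<open>\<Sum>j\<in>A n. c n j x *\<^sub>R e n j\<close> are finite-rank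
  operators on \<open>X\<close>; \<open>compat\<close> is the martingale relation between two
  consecutive ones, and \<open>complete\<close> is bounded completeness. The density is built point
  by point: the coordinate densities at a point form a martingale of vectors with a bound
  \<open>v x\<close> that depends on the point.\<close>

theorem radon_nikodym_from_decomposition:
  fixes A :: "nat \<Rightarrow> 'i set" and e :: "nat \<Rightarrow> 'i \<Rightarrow> 'v" and c :: "nat \<Rightarrow> 'i \<Rightarrow> 'v \<Rightarrow> real"
  assumes A: "\<And>n. finite (A n)" and e: "\<And>n j. j \<in> A n \<Longrightarrow> e n j \<in> X"
    and c_add: "\<And>n j x y. j \<in> A n \<Longrightarrow> x \<in> X \<Longrightarrow> y \<in> X \<Longrightarrow> c n j (x + y) = c n j x + c n j y"
    and c_scale: "\<And>n j r x. j \<in> A n \<Longrightarrow> x \<in> X \<Longrightarrow> c n j (r *\<^sub>R x) = r * c n j x"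
    and c_bound: "\<And>n j. j \<in> A n \<Longrightarrow> \<exists>K\<ge>0. \<forall>x\<in>X. \<bar>c n j x\<bar> \<le> K * N x"
    and contraction: "\<And>n x. x \<in> X \<Longrightarrow> N (\<Sum>j\<in>A n. c n j x *\<^sub>R e n j) \<le> N x"
    and converges: "\<And>x. x \<in> X \<Longrightarrow> (\<lambda>n. N ((\<Sum>j\<in>A n. c n j x *\<^sub>R e n j) - x)) \<longlonglongrightarrow> 0"
    and compat: "\<And>n j x. j \<in> A n \<Longrightarrow> x \<in> X \<Longrightarrow> c n j (\<Sum>i\<in>A (Suc n). c (Suc n) i x *\<^sub>R e (Suc n) i) = c n j x"
    and complete: "\<And>a C. (\<And>n j. j \<in> A n \<Longrightarrow> c n j (\<Sum>i\<in>A (Suc n). a (Suc n) i *\<^sub>R e (Suc n) i) = a n j) \<Longrightarrow>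
      (\<And>n. N (\<Sum>j\<in>A n. a n j *\<^sub>R e n j) \<le> C) \<Longrightarrow> \<exists>x\<in>X. \<forall>n. \<forall>j\<in>A n. c n j x = a n j"
    and M: "finite_measure M"
  shows "radon_nikodym_property_wrt M X N"
  unfolding radon_nikodym_property_wrt_def
proof (intro allI impI, elim conjE)
  fix G assume vm: "vector_measure X N M G" and ac: "continuous_wrt_measure N M G" and bv: "bounded_variation N M G"
  interpret finite_measure M by (rule M)
  obtain \<mu> v where v: "integrable M v" and \<mu>: "\<And>E. E \<in> sets M \<Longrightarrow> N (G E) \<le> \<mu> E" "\<And>E. E \<in> sets M \<Longrightarrow> \<mu> E = set_lebesgue_integral M E v"
    and sums: "\<And>A::nat \<Rightarrow> _. range A \<subseteq> sets M \<Longrightarrow> disjoint_family A \<Longrightarrow> (\<lambda>n. \<mu> (A n)) sums \<mu> (\<Union>n. A n)"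
    and null: "\<And>E. E \<in> null_sets M \<Longrightarrow> \<mu> E = 0"
    using variation_density[OF M vm ac bv] by blast
  have GX: "G E \<in> X" if "E \<in> sets M" for E using vector_measure_mem[OF vm that] .
  have ex_h: "\<exists>h. integrable M h \<and> (\<forall>E\<in>sets M. c n j (G E) = set_lebesgue_integral M E h)" if j: "j \<in> A n" for n j
  proof -
    obtain K where "0 \<le> K" "\<And>x. x \<in> X \<Longrightarrow> \<bar>c n j x\<bar> \<le> K * N x" using c_bound[OF j] by blast
    then show ?thesis
      by (intro scalar_density[OF M vm \<mu>(1) v \<mu>(2) sums null c_add[OF j] c_scale[OF j]])
  qed
  define h where "h n j = (SOME h. integrable M h \<and> (\<forall>E\<in>sets M. c n j (G E) = set_lebesgue_integral M E h))" for n j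
  have h: "integrable M (h n j)" and hG: "E \<in> sets M \<Longrightarrow> c n j (G E) = set_lebesgue_integral M E (h n j)"
    if "j \<in> A n" for n j E
    using someI_ex[OF ex_h[OF that]] unfolding h_def by auto
  have hm: "h n j \<in> borel_measurable M" if "j \<in> A n" for n j using h[OF that] by (rule borel_measurable_integrable)
  define g where "g n x = (\<Sum>j\<in>A n. h n j x *\<^sub>R e n j)" for n x
  have gX: "g n x \<in> X" for n x unfolding g_def using e by (intro sum_mem scale)
  have g_le: "AE x in M. \<forall>n. N (g n x) \<le> v x"
    unfolding AE_all_countable g_def
  proof
    fix n
    show "AE x in M. N (\<Sum>j\<in>A n. h n j x *\<^sub>R e n j) \<le> v x"
    proof (rule AE_norm_comb_le[OF M A e h v])
      fix E assume E: "E \<in> sets M"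
      have "N (\<Sum>j\<in>A n. set_lebesgue_integral M E (h n j) *\<^sub>R e n j) = N (\<Sum>j\<in>A n. c n j (G E) *\<^sub>R e n j)"
        using hG E by (intro arg_cong[of _ _ N] sum.cong) auto
      also have "\<dots> \<le> N (G E)" by (rule contraction[OF GX[OF E]])
      also have "\<dots> \<le> set_lebesgue_integral M E v" using \<mu>[OF E] by simp
      finally show "N (\<Sum>j\<in>A n. set_lebesgue_integral M E (h n j) *\<^sub>R e n j) \<le> set_lebesgue_integral M E v" .
    qed
  qed
  have c_comb: "c n j (\<Sum>i\<in>B. r i *\<^sub>R f i) = (\<Sum>i\<in>B. r i * c n j (f i))" if j: "j \<in> A n" and "finite B" "\<And>i. i \<in> B \<Longrightarrow> f i \<in> X"
    for n j r f and B :: "'i set"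
    using that(2,3)
  proof (induction B rule: finite_induct)
    case empty then show ?case using c_scale[OF j zero, of 0] by simp
  next
    case (insert i B) then show ?case using c_add[OF j] c_scale[OF j] by (simp add: sum_mem scale)
  qed
  \<comment> \<open>By \<open>compat\<close> for the vectors \<open>G E\<close>, both sides have the
    same integral over every measurable set and so agree almost everywhere.\<close>
  have cons: "AE x in M. \<forall>n. \<forall>j\<in>A n. c n j (g (Suc n) x) = h n j x"
    unfolding AE_all_countable
  proof
    fix n
    show "AE x in M. \<forall>j\<in>A n. c n j (g (Suc n) x) = h n j x"
    proof (rule AE_finite_allI[OF A])
      fix j assume j: "j \<in> A n"
      have eq: "c n j (g (Suc n) x) = (\<Sum>i\<in>A (Suc n). h (Suc n) i x * c n j (e (Suc n) i))" for x
        unfolding g_def using e by (intro c_comb[OF j] A) auto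
      show "AE x in M. c n j (g (Suc n) x) = h n j x"
        unfolding eq
      proof (rule density_unique_banach)
        show "integrable M (\<lambda>x. \<Sum>i\<in>A (Suc n). h (Suc n) i x * c n j (e (Suc n) i))" using h by (intro Bochner_Integration.integrable_sum) auto
        fix E assume E: "E \<in> sets M"
        have "set_lebesgue_integral M E (\<lambda>x. \<Sum>i\<in>A (Suc n). h (Suc n) i x * c n j (e (Suc n) i))
          = (\<Sum>i\<in>A (Suc n). set_lebesgue_integral M E (h (Suc n) i) * c n j (e (Suc n) i))"
        proof -
          have "set_lebesgue_integral M E (\<lambda>x. \<Sum>i\<in>A (Suc n). h (Suc n) i x * c n j (e (Suc n) i))
            = (\<Sum>i\<in>A (Suc n). set_lebesgue_integral M E (\<lambda>x. h (Suc n) i x * c n j (e (Suc n) i)))"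
            unfolding set_lebesgue_integral_def scaleR_sum_right
            using h E by (intro Bochner_Integration.integral_sum) (auto intro!: integrable_mult_indicator simp del: real_scaleR_def)
          then show ?thesis by simp
        qed
        also have "\<dots> = (\<Sum>i\<in>A (Suc n). c (Suc n) i (G E) * c n j (e (Suc n) i))" using hG E by simp
        also have "\<dots> = c n j (\<Sum>i\<in>A (Suc n). c (Suc n) i (G E) *\<^sub>R e (Suc n) i)"
          using e by (intro c_comb[OF j, symmetric] A) auto
        also have "\<dots> = c n j (G E)" by (rule compat[OF j GX[OF E]])
        also have "\<dots> = set_lebesgue_integral M E (h n j)" by (rule hG[OF j E])
        finally show "set_lebesgue_integral M E (\<lambda>x. \<Sum>i\<in>A (Suc n). h (Suc n) i x * c n j (e (Suc n) i)) = set_lebesgue_integral M E (h n j)" .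
      qed (rule h[OF j])
    qed
  qed
  define good where "good x \<longleftrightarrow> (\<forall>n. N (g n x) \<le> v x) \<and> (\<forall>n. \<forall>j\<in>A n. c n j (g (Suc n) x) = h n j x)" for x
  \<comment> \<open>The vector with the prescribed coordinates is picked by choice. This does no
    harm: strong measurability of \<open>f\<close> follows afterwards from its approximation by the
    simple functions \<open>s n\<close>.\<close>
  define f where "f x = (if good x then (SOME y. y \<in> X \<and> (\<forall>n. \<forall>j\<in>A n. c n j y = h n j x)) else 0)" for x
  have f_good: "f x \<in> X \<and> (\<forall>n. \<forall>j\<in>A n. c n j (f x) = h n j x)" if "good x" for x
  proof -
    have "\<exists>y\<in>X. \<forall>n. \<forall>j\<in>A n. c n j y = h n j x"
      by (rule complete[of "\<lambda>n j. h n j x" "v x"]) (use that in \<open>auto simp: good_def g_def\<close>)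
    then have "\<exists>y. y \<in> X \<and> (\<forall>n. \<forall>j\<in>A n. c n j y = h n j x)" by blast
    from someI_ex[OF this] show ?thesis using that by (simp add: f_def)
  qed
  have fX: "f x \<in> X" for x using f_good[of x] zero by (cases "good x") (auto simp: f_def)
  have AE_good: "AE x in M. good x" using g_le cons by eventually_elim (simp add: good_def)
  have g_eq: "g n x = (\<Sum>j\<in>A n. c n j (f x) *\<^sub>R e n j)" if "good x" for n x
    unfolding g_def using f_good[OF that] by (intro sum.cong) auto
  have g_lim: "(\<lambda>n. N (g n x - f x)) \<longlonglongrightarrow> 0" if "good x" for x
    unfolding g_eq[OF that] by (rule converges[OF fX])
  have f_le: "N (f x) \<le> v x" if "good x" for x
    by (rule LIMSEQ_le_const2[OF N_limit[OF gX fX g_lim[OF that]]]) (use that in \<open>auto simp: good_def\<close>)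
  define K where "K n = (\<Sum>j\<in>A n. N (e n j))" for n
  have K0: "0 \<le> K n" for n unfolding K_def using e by (intro sum_nonneg N_nonneg)
  \<comment> \<open>Each coordinate is approximated so closely that the whole vector is within
    \<open>(1/2)^n\<close> in mean. The sum over n converges, so the errors also tend to 0 almost
    everywhere.\<close>
  define \<epsilon> where "\<epsilon> n = (1/2)^n / (K n + 1)" for n
  have eps: "0 < \<epsilon> n" "\<epsilon> n * K n \<le> (1/2)^n" for n
  proof -
    show "0 < \<epsilon> n" using K0[of n] by (simp add: \<epsilon>_def)
    have "\<epsilon> n * K n = (1/2)^n * (K n / (K n + 1))" by (simp add: \<epsilon>_def)
    also have "\<dots> \<le> (1/2)^n * 1" using K0[of n] by (intro mult_left_mono) auto
    finally show "\<epsilon> n * K n \<le> (1/2)^n" by simp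
  qed
  have ex_a: "\<exists>a. simple_function M a \<and> integrable M a \<and> (\<integral>x. \<bar>a x - h n j x\<bar> \<partial>M) < \<epsilon> n" if "j \<in> A n" for n j
    by (rule integrable_simple_approx[OF M h[OF that] eps(1)])
  define a where "a n j = (SOME a. simple_function M a \<and> integrable M a \<and> (\<integral>x. \<bar>a x - h n j x\<bar> \<partial>M) < \<epsilon> n)" for n j
  have a: "simple_function M (a n j)" "integrable M (a n j)" "(\<integral>x. \<bar>a n j x - h n j x\<bar> \<partial>M) < \<epsilon> n"
    if "j \<in> A n" for n j
    using someI_ex[OF ex_a[OF that]] unfolding a_def by auto
  define s where "s n x = (\<Sum>j\<in>A n. a n j x *\<^sub>R e n j)" for n x
  have s: "simple_into X M (s n)" for n
    unfolding s_def simple_into_def using e a(1) by (auto intro!: simple_function_comb A sum_mem scale)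
  have sX: "s n x \<in> X" for n x unfolding s_def using e by (intro sum_mem scale)
  define b where "b n x = (\<Sum>j\<in>A n. \<bar>a n j x - h n j x\<bar> * N (e n j))" for n x
  have b0: "0 \<le> b n x" for n x unfolding b_def using e by (intro sum_nonneg mult_nonneg_nonneg N_nonneg) auto
  have b_int: "integrable M (b n)" for n unfolding b_def using a h by (intro Bochner_Integration.integrable_sum) auto
  have b_meas [measurable]: "b n \<in> borel_measurable M" for n by (rule borel_measurable_integrable[OF b_int])
  have b_le: "(\<integral>\<^sup>+x. ennreal (b n x) \<partial>M) \<le> ennreal ((1/2)^n)" for n
  proof -
    have "(\<integral>x. b n x \<partial>M) = (\<Sum>j\<in>A n. (\<integral>x. \<bar>a n j x - h n j x\<bar> \<partial>M) * N (e n j))"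
      unfolding b_def using a h by (subst Bochner_Integration.integral_sum) auto
    also have "\<dots> \<le> (\<Sum>j\<in>A n. \<epsilon> n * N (e n j))"
      using a(3) e by (intro sum_mono mult_right_mono N_nonneg) (auto intro: less_imp_le)
    also have "\<dots> = \<epsilon> n * K n" by (simp add: K_def sum_distrib_left)
    also have "\<dots> \<le> (1/2)^n" by (rule eps)
    finally have "(\<integral>x. b n x \<partial>M) \<le> (1/2)^n" .
    then show ?thesis using b0 b_int by (subst nn_integral_eq_integral) (auto intro: ennreal_leI)
  qed
  have sg: "N (s n x - g n x) \<le> b n x" for n x
    unfolding s_def g_def b_def by (rule N_comb_diff_le[OF A]) (rule e)
  have "(\<integral>\<^sup>+x. (\<Sum>n. ennreal (b n x)) \<partial>M) = (\<Sum>n. \<integral>\<^sup>+x. ennreal (b n x) \<partial>M)"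
    by (rule nn_integral_suminf) measurable
  also have "\<dots> \<le> (\<Sum>n. ennreal ((1/2)^n))" by (intro suminf_le b_le) auto
  also have "\<dots> = ennreal (\<Sum>n. (1/2)^n)" by (rule suminf_ennreal2) (auto intro: summable_geometric)
  also have "\<dots> < \<infinity>" by simp
  finally have "AE x in M. (\<Sum>n. ennreal (b n x)) \<noteq> \<infinity>" by (intro nn_integral_PInf_AE) auto
  then have b_lim: "AE x in M. (\<lambda>n. b n x) \<longlonglongrightarrow> 0"
  proof eventually_elim
    case (elim x)
    then have "summable (\<lambda>n. b n x)" using b0 by (intro summable_suminf_not_top) auto
    then show ?case by (rule summable_LIMSEQ_zero)
  qed
  have lim0: "(\<lambda>n. N (s n x - f x)) \<longlonglongrightarrow> 0" if "good x" "(\<lambda>n. b n x) \<longlonglongrightarrow> 0" for x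
  proof -
    have "(\<lambda>n. b n x + N (g n x - f x)) \<longlonglongrightarrow> 0 + 0" by (intro tendsto_add that g_lim)
    then have lim: "(\<lambda>n. b n x + N (g n x - f x)) \<longlonglongrightarrow> 0" by simp
    show ?thesis
    proof (rule tendsto_sandwich[OF _ _ tendsto_const lim])
      show "eventually (\<lambda>n. N (s n x - f x) \<le> b n x + N (g n x - f x)) sequentially"
        by (rule always_eventually, rule allI, rule order_trans[OF N_triangle3[OF sX gX fX] add_right_mono[OF sg]])
    qed (auto intro!: always_eventually N_nonneg diff sX fX)
  qed
  have sm: "strongly_measurable_into X N M f"
    unfolding strongly_measurable_into_def
  proof (intro conjI exI[of _ s] allI s)
    show "f ` space M \<subseteq> X" using fX by auto
    show "AE x in M. (\<lambda>n. N (s n x - f x)) \<longlonglongrightarrow> 0"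
      using AE_good b_lim by eventually_elim (rule lim0)
  qed
  have int_lim: "(\<lambda>n. \<integral>\<^sup>+x. ennreal (N (s n x - f x)) \<partial>M) \<longlonglongrightarrow> 0"
  proof -
    have "\<exists>u\<in>borel_measurable M. AE x in M. u x = N (s n x - f x)" for n by (rule measurable_N_diff[OF s sm])
    then obtain u where u [measurable]: "\<And>n. u n \<in> borel_measurable M" and ueq: "\<And>n. AE x in M. u n x = N (s n x - f x)" by metis
    have [measurable]: "v \<in> borel_measurable M" using v by (rule borel_measurable_integrable)
    \<comment> \<open>The error is split into \<open>r n\<close>, which stays below twice
      \<open>\<bar>v\<bar>\<close> and allows dominated convergence, and \<open>b n\<close>, whose
      integral is at most \<open>(1/2)^n\<close>.\<close>
    define r where "r n x = max 0 (u n x - b n x)" for n x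
    have [measurable]: "r n \<in> borel_measurable M" for n unfolding r_def by measurable
    have ueq': "AE x in M. \<forall>n. u n x = N (s n x - f x)" unfolding AE_all_countable using ueq by blast
    have "(\<lambda>n. \<integral>\<^sup>+x. ennreal (r n x) \<partial>M) \<longlonglongrightarrow> (\<integral>\<^sup>+x. 0 \<partial>M)"
    proof (rule nn_integral_dominated_convergence[where w="\<lambda>x. ennreal (2 * \<bar>v x\<bar>)"])
      show "(\<integral>\<^sup>+x. ennreal (2 * \<bar>v x\<bar>) \<partial>M) < \<infinity>"
      proof -
        have "integrable M (\<lambda>x. 2 * \<bar>v x\<bar>)" using v by simp
        then show ?thesis unfolding integrable_iff_bounded by simp
      qed
      show "AE x in M. ennreal (r n x) \<le> ennreal (2 * \<bar>v x\<bar>)" for n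
        using AE_good ueq'
      proof eventually_elim
        case (elim x)
        have "N (s n x - f x) \<le> b n x + N (g n x - f x)"
          by (rule order_trans[OF N_triangle3[OF sX gX fX] add_right_mono[OF sg]])
        moreover have "N (g n x - f x) \<le> v x + v x"
        proof (rule order_trans[OF N_diff_triangle[OF gX fX]], rule add_mono)
          show "N (g n x) \<le> v x" using elim(1) by (simp add: good_def)
        qed (rule f_le[OF elim(1)])
        ultimately show ?case using elim(2) by (intro ennreal_leI) (auto simp: r_def)
      qed
      show "AE x in M. (\<lambda>n. ennreal (r n x)) \<longlonglongrightarrow> 0"
        using AE_good ueq' b_lim
      proof eventually_elim
        case (elim x)
        have "(\<lambda>n. max 0 (u n x - b n x)) \<longlonglongrightarrow> max 0 (0 - 0)"
          using lim0[OF elim(1,3)] elim(2,3) by (intro tendsto_max tendsto_const tendsto_diff) simp_all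
        then have "(\<lambda>n. r n x) \<longlonglongrightarrow> 0" by (simp add: r_def)
        then show ?case using tendsto_ennrealI by fastforce
      qed
    qed measurable
    moreover have "(\<lambda>n. ennreal ((1/2)^n)) \<longlonglongrightarrow> ennreal 0"
      by (intro tendsto_ennrealI LIMSEQ_power_zero) simp
    ultimately have lim: "(\<lambda>n. (\<integral>\<^sup>+x. ennreal (r n x) \<partial>M) + ennreal ((1/2)^n)) \<longlonglongrightarrow> 0"
      using tendsto_add[of "\<lambda>n. \<integral>\<^sup>+x. ennreal (r n x) \<partial>M" 0 sequentially "\<lambda>n. ennreal ((1/2)^n)" 0] by simp
    show ?thesis
    proof (rule tendsto_sandwich[OF _ _ tendsto_const lim])
      show "eventually (\<lambda>n. (\<integral>\<^sup>+x. ennreal (N (s n x - f x)) \<partial>M) \<le> (\<integral>\<^sup>+x. ennreal (r n x) \<partial>M) + ennreal ((1/2)^n)) sequentially"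
      proof (rule always_eventually, rule allI)
        fix n
        have "(\<integral>\<^sup>+x. ennreal (N (s n x - f x)) \<partial>M) \<le> (\<integral>\<^sup>+x. ennreal (r n x) + ennreal (b n x) \<partial>M)"
        proof (rule nn_integral_mono_AE)
          show "AE x in M. ennreal (N (s n x - f x)) \<le> ennreal (r n x) + ennreal (b n x)"
            using ueq[of n]
          proof eventually_elim
            case (elim x)
            have "N (s n x - f x) \<le> r n x + b n x" unfolding elim[symmetric] by (simp add: r_def)
            then show ?case using b0 by (simp add: r_def ennreal_plus[symmetric] ennreal_leI del: ennreal_plus)
          qed
        qed
        also have "\<dots> = (\<integral>\<^sup>+x. ennreal (r n x) \<partial>M) + (\<integral>\<^sup>+x. ennreal (b n x) \<partial>M)" by (rule nn_integral_add) measurable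
        also have "\<dots> \<le> (\<integral>\<^sup>+x. ennreal (r n x) \<partial>M) + ennreal ((1/2)^n)" by (rule add_left_mono[OF b_le])
        finally show "(\<integral>\<^sup>+x. ennreal (N (s n x - f x)) \<partial>M) \<le> (\<integral>\<^sup>+x. ennreal (r n x) \<partial>M) + ennreal ((1/2)^n)" .
      qed
    qed auto
  qed
  have "has_bochner_integral_over X N M f E (G E)" if E: "E \<in> sets M" for E
    unfolding has_bochner_integral_over_def
  proof (intro conjI sm GX[OF E] exI[of _ s] allI s int_lim)
    let ?P = "\<lambda>n. \<Sum>j\<in>A n. c n j (G E) *\<^sub>R e n j"
    have PX: "?P n \<in> X" for n using e by (intro sum_mem scale)
    have SX: "simple_integral_over M E (s n) \<in> X" for n by (rule simple_integral_mem[OF s])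
    have le: "N (simple_integral_over M E (s n) - ?P n) \<le> (1/2)^n" for n
    proof -
      have "simple_integral_over M E (s n) = (\<Sum>j\<in>A n. set_lebesgue_integral M E (a n j) *\<^sub>R e n j)"
        unfolding s_def by (rule simple_integral_over_comb[OF M A a(1) E])
      then have "N (simple_integral_over M E (s n) - ?P n) \<le> (\<Sum>j\<in>A n. \<bar>set_lebesgue_integral M E (a n j) - c n j (G E)\<bar> * N (e n j))"
        by (simp only:) (rule N_comb_diff_le[OF A e])
      also have "\<dots> \<le> (\<Sum>j\<in>A n. \<epsilon> n * N (e n j))"
      proof (intro sum_mono mult_right_mono N_nonneg e)
        fix j assume j: "j \<in> A n"
        have "set_lebesgue_integral M E (a n j) - c n j (G E) = set_lebesgue_integral M E (\<lambda>x. a n j x - h n j x)"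
          unfolding hG[OF j E] using a(2)[OF j] h[OF j] E by (intro set_integral_diff(2)[symmetric] set_integrable_of_integrable)
        also have "\<bar>\<dots>\<bar> \<le> set_lebesgue_integral M E (\<lambda>x. \<bar>a n j x - h n j x\<bar>)"
        proof -
          have "set_integrable M E (\<lambda>x. a n j x - h n j x)" using a(2)[OF j] h[OF j] E by (intro set_integrable_of_integrable) auto
          from set_integral_norm_bound[OF this] show ?thesis by simp
        qed
        also have "\<dots> \<le> (\<integral>x. \<bar>a n j x - h n j x\<bar> \<partial>M)"
          unfolding set_lebesgue_integral_def using a(2)[OF j] h[OF j] E
          by (intro integral_mono integrable_mult_indicator) (auto simp: indicator_def)
        finally show "\<bar>set_lebesgue_integral M E (a n j) - c n j (G E)\<bar> \<le> \<epsilon> n" using a(3)[OF j] by linarith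
      qed
      also have "\<dots> = \<epsilon> n * K n" by (simp add: K_def sum_distrib_left)
      also have "\<dots> \<le> (1/2)^n" by (rule eps)
      finally show ?thesis .
    qed
    have "(\<lambda>n. (1/2)^n + N (?P n - G E)) \<longlonglongrightarrow> 0 + 0"
      by (intro tendsto_add LIMSEQ_power_zero converges GX E) simp
    then have lim: "(\<lambda>n. (1/2)^n + N (?P n - G E)) \<longlonglongrightarrow> 0" by simp
    show "(\<lambda>n. N (simple_integral_over M E (s n) - G E)) \<longlonglongrightarrow> 0"
    proof (rule tendsto_sandwich[OF _ _ tendsto_const lim])
      show "eventually (\<lambda>n. N (simple_integral_over M E (s n) - G E) \<le> (1/2)^n + N (?P n - G E)) sequentially"
        by (rule always_eventually, rule allI, rule order_trans[OF N_triangle3[OF SX PX GX[OF E]] add_right_mono[OF le]])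
    qed (auto intro!: always_eventually N_nonneg diff SX GX E)
  qed
  then show "\<exists>g. \<forall>E\<in>sets M. has_bochner_integral_over X N M g E (G E)" by blast
qed

end

section \<open>Differentiation of integrals and cluster points\<close>

lemma AE_lebesgue_of_negligible: "negligible Z \<Longrightarrow> AE x in lebesgue. x \<notin> Z"
  by (rule AE_not_in) (simp add: negligible_iff_null_sets)

text \<open>Lebesgue's differentiation theorem for intervals to the right of the point, multiplied
  by the length so that estimates over adjacent intervals can be added.\<close>

lemma integrable_right_average:
  fixes f :: "real \<Rightarrow> real"
  assumes "integrable lebesgue f"
  shows "AE x in lebesgue. \<forall>e>0. \<exists>d>0. \<forall>h. 0 < h \<and> h < d \<longrightarrow> \<bar>integral {x..x + h} f - h * f x\<bar> \<le> e * h"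
proof -
  have "f integrable_on cbox a b" for a b
    using integrable_on_lebesgue[OF assms] integrable_on_subcbox by blast
  then obtain Z where Z: "negligible Z"
    "\<And>x e. x \<notin> Z \<Longrightarrow> 0 < e \<Longrightarrow> \<exists>d>0. \<forall>h. 0 < h \<and> h < d \<longrightarrow>
      norm (integral (cbox x (x + h *\<^sub>R One)) f /\<^sub>R h ^ DIM(real) - f x) < e"
    using integrable_ccontinuous_explicit[of f] by (metis (no_types, lifting))
  show ?thesis
    using AE_lebesgue_of_negligible[OF Z(1)]
  proof eventually_elim
    case (elim x)
    show ?case
    proof (intro allI impI)
      fix e :: real assume "0 < e"
      from Z(2)[OF elim this] obtain d where d: "d > 0"
        "\<And>h. 0 < h \<Longrightarrow> h < d \<Longrightarrow> norm (integral (cbox x (x + h *\<^sub>R One)) f /\<^sub>R h ^ DIM(real) - f x) < e" by blast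
      have "\<bar>integral {x..x + h} f - h * f x\<bar> \<le> e * h" if h: "0 < h" "h < d" for h
      proof -
        have "\<bar>integral {x..x + h} f / h - f x\<bar> < e"
          using d(2)[OF h] by (simp add: divide_inverse_commute)
        then have "h * \<bar>integral {x..x + h} f / h - f x\<bar> \<le> h * e" using h by (intro mult_left_mono) auto
        moreover have "h * \<bar>integral {x..x + h} f / h - f x\<bar> = \<bar>h * (integral {x..x + h} f / h - f x)\<bar>"
          using h by (simp add: abs_mult)
        moreover have "h * (integral {x..x + h} f / h - f x) = integral {x..x + h} f - h * f x"
          using h by (simp add: right_diff_distrib)
        ultimately show ?thesis by (simp add: mult.commute)
      qed
      then show "\<exists>d>0. \<forall>h. 0 < h \<and> h < d \<longrightarrow> \<bar>integral {x..x + h} f - h * f x\<bar> \<le> e * h" using d(1) by blast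
    qed
  qed
qed

lemma AE_lebesgue_minus:
  assumes "AE x in lebesgue. P (x::real)" shows "AE x in lebesgue. P (- x)"
proof -
  obtain Z where Z: "{x. \<not> P x} \<subseteq> Z" "Z \<in> null_sets lebesgue"
    using assms by (auto elim!: AE_E simp: null_sets_def)
  have "negligible ((\<lambda>x. - x) ` Z)"
    using Z(2) by (intro negligible_differentiable_image_negligible) (auto simp: negligible_iff_null_sets intro!: derivative_intros)
  from AE_lebesgue_of_negligible[OF this] show ?thesis
  proof eventually_elim
    case (elim x)
    then have "- x \<notin> Z" by (metis image_eqI minus_minus)
    then show ?case using Z(1) by blast
  qed
qed

text \<open>A dyadic cell contains its point in an arbitrary position, so the estimates over
  \<open>{a..x}\<close> and \<open>{x..b}\<close> are added. The left one is the right one for the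
  reflected function.\<close>

lemma integrable_average:
  fixes f :: "real \<Rightarrow> real"
  assumes f: "integrable lebesgue f"
  shows "AE x in lebesgue. \<forall>e>0. \<exists>d>0. \<forall>a b. a \<le> x \<and> x < b \<and> b - a < d \<longrightarrow>
    \<bar>integral {a..b} f - (b - a) * f x\<bar> \<le> e * (b - a)"
proof -
  have fm: "integrable lebesgue (\<lambda>x. f (- x))"
    using lebesgue_integrable_real_affine[of f "-1" 0] f by (simp add: integrable_completion)
  have right: "AE x in lebesgue. \<forall>e>0. \<exists>d>0. \<forall>h. 0 < h \<and> h < d \<longrightarrow> \<bar>integral {x..x + h} f - h * f x\<bar> \<le> e * h"
    by (rule integrable_right_average[OF f])
  have left: "AE x in lebesgue. \<forall>e>0. \<exists>d>0. \<forall>h. 0 < h \<and> h < d \<longrightarrow> \<bar>integral {x - h..x} f - h * f x\<bar> \<le> e * h"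
  proof -
    have refl: "integral {- x..- x + h} (\<lambda>x. f (- x)) = integral {x - h..x} f" for x h
      using Henstock_Kurzweil_Integration.integral_reflect_real[of x "x - h" f] by simp
    show ?thesis using AE_lebesgue_minus[OF integrable_right_average[OF fm]] unfolding refl by simp
  qed
  show ?thesis
    using right left
  proof eventually_elim
    case (elim x)
    show ?case
    proof (intro allI impI)
      fix e :: real assume e: "0 < e"
      from elim(1)[THEN spec, THEN mp, OF e]
      obtain d1 where "d1 > 0" and "\<forall>h. 0 < h \<and> h < d1 \<longrightarrow> \<bar>integral {x..x + h} f - h * f x\<bar> \<le> e * h"
        by (elim exE conjE)
      then have d1: "d1 > 0" "\<And>h. 0 < h \<Longrightarrow> h < d1 \<Longrightarrow> \<bar>integral {x..x + h} f - h * f x\<bar> \<le> e * h" by simp_all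
      from elim(2)[THEN spec, THEN mp, OF e]
      obtain d2 where "d2 > 0" and "\<forall>h. 0 < h \<and> h < d2 \<longrightarrow> \<bar>integral {x - h..x} f - h * f x\<bar> \<le> e * h"
        by (elim exE conjE)
      then have d2: "d2 > 0" "\<And>h. 0 < h \<Longrightarrow> h < d2 \<Longrightarrow> \<bar>integral {x - h..x} f - h * f x\<bar> \<le> e * h" by simp_all
      show "\<exists>d>0. \<forall>a b. a \<le> x \<and> x < b \<and> b - a < d \<longrightarrow> \<bar>integral {a..b} f - (b - a) * f x\<bar> \<le> e * (b - a)"
      proof (intro exI[of _ "min d1 d2"] conjI allI impI)
        show "0 < min d1 d2" using d1(1) d2(1) by simp
        fix a b assume "a \<le> x \<and> x < b \<and> b - a < min d1 d2"
        then have ab: "a \<le> x" "x < b" "b - a < min d1 d2" by auto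
        have 1: "\<bar>integral {x..b} f - (b - x) * f x\<bar> \<le> e * (b - x)" using d1(2)[of "b - x"] ab by simp
        \<comment> \<open>The left estimate is stated for positive lengths; for \<open>a = x\<close>
          both sides vanish.\<close>
        have 2: "\<bar>integral {a..x} f - (x - a) * f x\<bar> \<le> e * (x - a)"
          using d2(2)[of "x - a"] ab by (cases "a = x") simp_all
        have "integral {a..x} f + integral {x..b} f = integral {a..b} f"
          using ab by (intro Henstock_Kurzweil_Integration.integral_combine) (auto intro: integrable_on_subinterval[OF integrable_on_lebesgue[OF f]])
        then have "integral {a..b} f - (b - a) * f x = (integral {a..x} f - (x - a) * f x) + (integral {x..b} f - (b - x) * f x)"
          by (simp add: algebra_simps)
        then have "\<bar>integral {a..b} f - (b - a) * f x\<bar> \<le> \<bar>integral {a..x} f - (x - a) * f x\<bar> + \<bar>integral {x..b} f - (b - x) * f x\<bar>" by simp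
        also have "\<dots> \<le> e * (x - a) + e * (b - x)" using 1 2 by simp
        finally show "\<bar>integral {a..b} f - (b - a) * f x\<bar> \<le> e * (b - a)" by (simp add: algebra_simps)
      qed
    qed
  qed
qed

text \<open>
  The point \<open>p\<close> replaces a limit along an ultrafilter: closed relations pass to it.
\<close>

lemma bounded_sequence_cluster_point:
  fixes x :: "nat \<Rightarrow> 'i \<Rightarrow> real"
  assumes "\<And>n i. \<bar>x n i\<bar> \<le> c i"
  shows "\<exists>p. \<forall>S. closed S \<longrightarrow> eventually (\<lambda>n. x n \<in> S) sequentially \<longrightarrow> p \<in> S"
proof -
  let ?K = "PiE UNIV (\<lambda>i. {- c i..c i})"
  have "compactin (product_topology (\<lambda>i::'i. euclidean :: real topology) UNIV) ?K"
    by (subst compactin_PiE) auto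
  then have K: "compact ?K" by (simp add: euclidean_product_topology)
  have ev: "eventually (\<lambda>y. y \<in> ?K) (filtermap x sequentially)"
    unfolding eventually_filtermap using assms by (auto intro!: always_eventually simp: abs_le_iff minus_le_iff)
  have "filtermap x sequentially \<noteq> bot" by (simp add: filtermap_bot_iff)
  then obtain p where p: "inf (nhds p) (filtermap x sequentially) \<noteq> bot"
    using compact_filter[THEN iffD1, OF K] ev by blast
  have "p \<in> S" if S: "closed S" "eventually (\<lambda>n. x n \<in> S) sequentially" for S
  proof (rule ccontr)
    assume "p \<notin> S"
    then have "eventually (\<lambda>y. y \<in> - S) (nhds p)" using S(1) by (intro eventually_nhds_in_open) auto
    moreover have "eventually (\<lambda>y. y \<in> S) (filtermap x sequentially)" using S(2) by (simp add: eventually_filtermap)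
    ultimately have "eventually (\<lambda>y. False) (inf (nhds p) (filtermap x sequentially))"
      unfolding eventually_inf by (intro exI[of _ "\<lambda>y. y \<in> - S"] exI[of _ "\<lambda>y. y \<in> S"]) auto
    then show False using p by (simp add: trivial_limit_def)
  qed
  then show ?thesis by blast
qed

section \<open>The functional of a decreasing weight\<close>

lemma emeasure_lborel_atLeast: "emeasure lborel {a::real..} = \<infinity>"
proof -
  have "(SUP n::nat. of_nat n) \<le> emeasure lborel {a..}"
  proof (rule SUP_least)
    fix n :: nat
    have "emeasure lborel {a..a + real n} \<le> emeasure lborel {a..}"
      by (intro emeasure_mono) auto
    then show "of_nat n \<le> emeasure lborel {a..}" by (simp add: ennreal_of_nat_eq_real_of_nat)
  qed
  then show ?thesis
    by (simp add: ennreal_SUP_of_nat_eq_top top_unique)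
qed

lemma sigma_finite_lebesgue: "sigma_finite_measure (lebesgue :: real measure)"
proof
  show "\<exists>A::real set set. countable A \<and> A \<subseteq> sets lebesgue \<and> \<Union> A = space lebesgue
      \<and> (\<forall>a\<in>A. emeasure lebesgue a \<noteq> \<infinity>)"
  proof (intro exI conjI)
    show "countable (range (\<lambda>n::nat. {- real n..real n}))" by simp
    show "\<Union> (range (\<lambda>n::nat. {- real n..real n})) = space lebesgue"
    proof -
      have "\<exists>n::nat. - real n \<le> x \<and> x \<le> real n" for x
        using real_arch_simple[of "\<bar>x\<bar>"] by (metis abs_le_iff minus_le_iff)
      then show ?thesis by auto
    qed
  qed auto
qed

text \<open>The number \<open>g t\<close> is the length of the set of all s \<ge> 0 below it; Fubini
  does the rest. The factor \<open>v\<close> is the weight, a constant or an indicator in the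
  applications, and in \<open>W_eq_min\<close> the weight itself is the function that is
  sliced.\<close>

lemma nn_integral_layer_cake:
  fixes g v :: "'a \<Rightarrow> ennreal"
  assumes "sigma_finite_measure L"
    and [measurable]: "g \<in> borel_measurable L" "v \<in> borel_measurable L"
  shows "(\<integral>\<^sup>+t. g t * v t \<partial>L) =
    (\<integral>\<^sup>+s. (\<integral>\<^sup>+t. v t * indicator {t. ennreal s < g t} t \<partial>L) * indicator {0..} s \<partial>lborel)"
proof -
  interpret L: sigma_finite_measure L by fact
  interpret pair_sigma_finite L "lborel :: real measure" ..
  have len: "emeasure lborel {s::real. 0 \<le> s \<and> ennreal s < x} = x" for x
  proof (cases x)
    case (real r)
    then have "{s. 0 \<le> s \<and> ennreal s < x} = {0..<r}" by (auto simp: ennreal_less_iff)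
    then show ?thesis using real by simp
  next
    case top
    have "emeasure lborel {0::real..} = \<infinity>" by (rule emeasure_lborel_atLeast)
    moreover have "{s. 0 \<le> s \<and> ennreal s < x} = {0..}" using top by auto
    ultimately show ?thesis using top by simp
  qed
  have "(\<integral>\<^sup>+t. g t * v t \<partial>L)
      = (\<integral>\<^sup>+t. (\<integral>\<^sup>+s. v t * indicator {s. 0 \<le> s \<and> ennreal s < g t} s \<partial>lborel) \<partial>L)"
    by (intro nn_integral_cong, subst nn_integral_cmult) (auto simp: len mult.commute)
  also have "\<dots> = (\<integral>\<^sup>+s. (\<integral>\<^sup>+t. v t * indicator {s. 0 \<le> s \<and> ennreal s < g t} s \<partial>L) \<partial>lborel)"
    by (rule Fubini'[symmetric]) (simp add: indicator_def, measurable)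
  also have "\<dots> = (\<integral>\<^sup>+s. (\<integral>\<^sup>+t. v t * indicator {t. ennreal s < g t} t \<partial>L) * indicator {0..} s \<partial>lborel)"
  proof (rule nn_integral_cong)
    fix s :: real
    show "(\<integral>\<^sup>+t. v t * indicator {s. 0 \<le> s \<and> ennreal s < g t} s \<partial>L)
      = (\<integral>\<^sup>+t. v t * indicator {t. ennreal s < g t} t \<partial>L) * indicator {0..} s"
      by (cases "0 \<le> s") (simp_all add: indicator_def)
  qed
  finally show ?thesis .
qed

lemma ennreal_diff_le: "x \<le> y + ennreal z \<Longrightarrow> x - ennreal z \<le> y"
  by (simp add: ennreal_minus_le_iff add.commute)

lemma ennreal_le_diff_add: "x \<le> (x - ennreal z) + ennreal z"
  by (metis add.commute diff_add_cancel_ennreal ennreal_minus_le_iff le_iff_add linear)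

lemma ennreal_less_diff_iff:
  assumes "0 \<le> s" "0 \<le> z" shows "ennreal s < x - ennreal z \<longleftrightarrow> ennreal (z + s) < x"
proof (cases x)
  case (real r)
  show ?thesis
    unfolding real(2) using real(1) assms
    by (subst ennreal_minus) (auto simp: ennreal_less_iff simp del: ennreal_plus)
next
  case top then show ?thesis by simp
qed

section \<open>The interval, its weight and the primitive of the weight\<close>

locale weighted_interval =
  fixes \<gamma> :: ereal and w :: "real \<Rightarrow> real"
  assumes length_pos: "0 < \<gamma>" and weight: "weight_function \<gamma> w"
begin

abbreviation "I \<equiv> half_open_interval \<gamma>"
abbreviation "L \<equiv> lebesgue_on I"

text \<open>The primitive of \<open>w\<close>, with arguments in [0,\<infinity>] so that it can be
  applied to distribution functions. It is constant beyond the right end of the interval.\<close>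

definition W :: "ennreal \<Rightarrow> ennreal" where
  "W x = (\<integral>\<^sup>+t. ennreal (w t) * indicator {t. ennreal t < x} t \<partial>L)"

definition dist_at :: "(real \<Rightarrow> ennreal) \<Rightarrow> real \<Rightarrow> ennreal" where
  "dist_at g s = emeasure L {t \<in> I. ennreal s < g t}"

text \<open>The layer cake form of the integral of the rearrangement of \<open>g\<close> against
  \<open>w\<close>. With \<phi>(|f|) in place of \<open>g\<close> it is the modular, as
  \<open>modular_eq\<close> shows.\<close>

definition J :: "(real \<Rightarrow> ennreal) \<Rightarrow> ennreal" where
  "J g = (\<integral>\<^sup>+s. W (dist_at g s) * indicator {0..} s \<partial>lborel)"

lemma I_borel [measurable]: "I \<in> sets borel"
proof (cases \<gamma>)
  case (real r)
  then have "I = {0..<r}" by (auto simp: half_open_interval_def)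
  then show ?thesis by simp
next
  case PInf
  then have "I = {0..}" by (auto simp: half_open_interval_def)
  then show ?thesis by simp
next
  case MInf then show ?thesis using length_pos by simp
qed

lemma I_lebesgue [measurable]: "I \<in> sets lebesgue"
  using I_borel by auto

lemma space_L [simp]: "space L = I" by simp

lemma sets_L_iff: "A \<in> sets L \<longleftrightarrow> A \<in> sets lebesgue \<and> A \<subseteq> I"
  by (auto simp: sets_restrict_space_iff)

lemma borel_Int_I: "A \<in> sets borel \<Longrightarrow> A \<subseteq> I \<Longrightarrow> A \<in> sets L"
  by (simp add: sets_L_iff)

lemma L_le_lebesgue: "A \<in> sets L \<Longrightarrow> emeasure L A = emeasure lebesgue A"
  by (simp add: emeasure_restrict_space sets_L_iff)

lemma emeasure_L_le:
  assumes "A \<in> sets L" "A \<subseteq> {0..y}" "0 \<le> y" shows "emeasure L A \<le> ennreal y"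
proof -
  have "emeasure L A = emeasure lebesgue A" using assms(1) by (rule L_le_lebesgue)
  also have "\<dots> \<le> emeasure lebesgue {0..y}" using assms(2) by (rule emeasure_mono) simp
  finally show ?thesis using assms(3) by simp
qed

lemma id_measurable_L [measurable]: "(\<lambda>t. t) \<in> borel_measurable L"
  by (intro measurable_restrict_space1 measurable_completion) simp

lemma mem_sets_L_borel: "B \<in> sets borel \<Longrightarrow> {t \<in> I. t \<in> B} \<in> sets L"
  by (rule borel_Int_I) (auto simp: Collect_conj_eq)

sublocale L: sigma_finite_measure L
  by (rule sigma_finite_measure_restrict_space) (auto intro: sigma_finite_lebesgue)

lemma AE_L_pos: "AE t in L. 0 < t"
proof -
  have "AE t in lebesgue. t \<noteq> (0::real)"
    by (metis AE_completion AE_lborel_singleton)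
  then show ?thesis
    by (subst AE_restrict_space_iff) (auto simp: half_open_interval_def elim!: eventually_mono)
qed

lemma w_pos: "t \<in> I \<Longrightarrow> 0 < t \<Longrightarrow> 0 < w t"
  using weight by (auto simp: weight_function_def)

lemma w_anti: "s \<le> t \<Longrightarrow> 0 < s \<Longrightarrow> t \<in> I \<Longrightarrow> w t \<le> w s"
  using weight unfolding weight_function_def
  by (auto dest!: monotone_onD[where x=s and y=t] simp: half_open_interval_def less_ereal.simps(1)
      intro: le_less_trans[of "ereal s" "ereal t"])

lemma I_down: "t \<in> I \<Longrightarrow> 0 \<le> s \<Longrightarrow> s \<le> t \<Longrightarrow> s \<in> I"
  by (auto simp: half_open_interval_def) (meson ereal_less_eq(3) le_less_trans)

text \<open>Monotonicity is available only away from 0, where the value of \<open>w\<close> is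
  arbitrary. So \<open>w\<close> is treated on \<open>I - {0}\<close> and patched at the single
  point 0.\<close>

lemma w_measurable [measurable]: "w \<in> borel_measurable L"
proof -
  have anti: "monotone_on (I - {0}) (\<le>) (\<le>) (\<lambda>t. - w t)"
    by (rule monotone_onI) (use w_anti in \<open>auto simp: half_open_interval_def\<close>)
  have "(\<lambda>t. - w t) \<in> borel_measurable (restrict_space borel (I - {0}))"
    by (rule borel_measurable_mono_on_fnc[OF anti])
  then have "(\<lambda>t. - (- w t)) \<in> borel_measurable (restrict_space borel (I - {0}))"
    by (rule borel_measurable_uminus)
  then have "(\<lambda>t. if t \<in> I - {0} then w t else 0) \<in> borel_measurable borel"
    by (subst (asm) borel_measurable_restrict_space_iff) (simp_all add: indicator_def of_bool_def if_distrib[where f="\<lambda>x. x * w _"] if_distrib[where f="\<lambda>x. x *\<^sub>R w _"] cong: if_cong)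
  then have "(\<lambda>t. if t = 0 then w 0 else (if t \<in> I - {0} then w t else 0)) \<in> borel_measurable borel"
    by measurable
  then have "(\<lambda>t. if t = 0 then w 0 else (if t \<in> I - {0} then w t else 0)) \<in> borel_measurable L"
    by (intro measurable_restrict_space1 measurable_completion) simp
  then show ?thesis
    by (rule subst[OF measurable_cong, THEN iffD1, rotated -1]) auto
qed

lemma dist_at_nn_integral:
  assumes [measurable]: "g \<in> borel_measurable L"
  shows "dist_at g s = (\<integral>\<^sup>+t. indicator {t. ennreal s < g t} t \<partial>L)"
proof -
  have "dist_at g s = (\<integral>\<^sup>+t. indicator {t \<in> I. ennreal s < g t} t \<partial>L)"
    unfolding dist_at_def by (subst nn_integral_indicator) (use assms in measurable, auto)
  also have "\<dots> = (\<integral>\<^sup>+t. indicator {t. ennreal s < g t} t \<partial>L)"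
    by (intro nn_integral_cong) (auto simp: indicator_def)
  finally show ?thesis .
qed

lemma dist_at_measurable [measurable]:
  assumes [measurable]: "g \<in> borel_measurable L"
  shows "dist_at g \<in> borel_measurable borel"
proof -
  have "(\<lambda>s. \<integral>\<^sup>+t. (if ennreal s < g t then 1 else 0) \<partial>L) \<in> borel_measurable borel"
    by measurable
  then show ?thesis
    by (subst (asm) measurable_cong[where g="dist_at g"])
       (auto simp: dist_at_nn_integral indicator_def of_bool_def)
qed

lemma dist_at_mono_AE:
  assumes "AE t in L. g t \<le> h t" and [measurable]: "h \<in> borel_measurable L"
  shows "dist_at g s \<le> dist_at h s"
  unfolding dist_at_def
proof (rule emeasure_mono_AE)
  show "AE t in L. t \<in> {t \<in> I. ennreal s < g t} \<longrightarrow> t \<in> {t \<in> I. ennreal s < h t}"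
    using assms(1) by eventually_elim auto
  have "{t \<in> space L. ennreal s < h t} \<in> sets L" by measurable
  then show "{t \<in> I. ennreal s < h t} \<in> sets L" by simp
qed

lemma dist_at_antimono:
  assumes [measurable]: "g \<in> borel_measurable L" and "s \<le> r"
  shows "dist_at g r \<le> dist_at g s"
  unfolding dist_at_def
proof (rule emeasure_mono)
  show "{t \<in> I. ennreal r < g t} \<subseteq> {t \<in> I. ennreal s < g t}"
    using assms(2) by (auto intro: le_less_trans[OF ennreal_leI])
  have "{t \<in> space L. ennreal s < g t} \<in> sets L" by measurable
  then show "{t \<in> I. ennreal s < g t} \<in> sets L" by simp
qed

lemma W_mono: "x \<le> y \<Longrightarrow> W x \<le> W y"
  unfolding W_def by (intro nn_integral_mono) (auto simp: indicator_def)

lemma W_0 [simp]: "W 0 = 0"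
  unfolding W_def by simp

lemma W_measurable [measurable]: "W \<in> borel_measurable borel"
proof -
  have "(\<lambda>x. \<integral>\<^sup>+t. ennreal (w t) * (if ennreal t < x then 1 else 0) \<partial>L) \<in> borel_measurable borel"
    by measurable
  then show ?thesis
    unfolding W_def[abs_def] by (simp add: indicator_def of_bool_def)
qed

text \<open>The strict inequality in the definition of \<open>W\<close> makes the indicators
  increase to the indicator that belongs to the supremum, so monotone convergence applies.\<close>

lemma W_SUP:
  fixes x :: "nat \<Rightarrow> ennreal"
  assumes "incseq x" shows "W (SUP n. x n) = (SUP n. W (x n))"
proof -
  have "W (SUP n. x n) = (\<integral>\<^sup>+t. (SUP n. ennreal (w t) * indicator {t. ennreal t < x n} t) \<partial>L)"
    unfolding W_def
  proof (intro nn_integral_cong)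
    fix t
    have "indicator {t. ennreal t < (SUP n. x n)} t = (SUP n. indicator {t. ennreal t < x n} t :: ennreal)"
    proof (cases "\<exists>n. ennreal t < x n")
      case True
      then obtain n where n: "ennreal t < x n" by blast
      have "(SUP n. indicator {t. ennreal t < x n} t :: ennreal) = 1"
      proof (rule antisym)
        show "(SUP n. indicator {t. ennreal t < x n} t :: ennreal) \<le> 1"
          by (rule SUP_least) (auto simp: indicator_def)
        show "1 \<le> (SUP n. indicator {t. ennreal t < x n} t :: ennreal)"
          by (rule SUP_upper2[of n]) (use n in \<open>auto simp: indicator_def\<close>)
      qed
      then show ?thesis using n by (auto simp: less_SUP_iff indicator_def)
    next
      case False then show ?thesis by (auto simp: less_SUP_iff indicator_def)
    qed
    then show "ennreal (w t) * indicator {t. ennreal t < (SUP n. x n)} t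
        = (SUP n. ennreal (w t) * indicator {t. ennreal t < x n} t)"
      by (simp add: SUP_mult_left_ennreal)
  qed
  also have "\<dots> = (SUP n. W (x n))"
    unfolding W_def
    by (rule nn_integral_monotone_convergence_SUP)
       (auto simp: incseq_def le_fun_def indicator_def dest: incseqD[OF assms] intro: less_le_trans)
  finally show ?thesis .
qed

lemma W_eq_primitive:
  assumes "t \<in> I" shows "W (ennreal t) = ennreal (weight_primitive w t)"
proof -
  have t0: "0 \<le> t" using assms by (auto simp: half_open_interval_def)
  have sub: "{0..t} \<subseteq> I" using assms I_down by auto
  have int: "set_integrable lebesgue {0..t} w"
    using weight assms by (auto simp: weight_function_def)
  have [measurable]: "(\<lambda>s. indicator {0..t} s * w s) \<in> borel_measurable lebesgue"
    using int by (auto simp: set_integrable_def)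
  have pos: "AE s in lebesgue. 0 \<le> indicator {0..t} s * w s"
  proof -
    have "AE s in lebesgue. s \<noteq> (0::real)" by (metis AE_completion AE_lborel_singleton)
    then show ?thesis
      by eventually_elim (use w_pos sub in \<open>force simp: indicator_def less_imp_le\<close>)
  qed
  have "W (ennreal t) = (\<integral>\<^sup>+s. ennreal (w s) * indicator {s. ennreal s < ennreal t} s * indicator I s \<partial>lebesgue)"
    unfolding W_def by (subst nn_integral_restrict_space) auto
  also have "\<dots> = (\<integral>\<^sup>+s. ennreal (indicator {0..t} s * w s) \<partial>lebesgue)"
  proof (rule nn_integral_cong_AE)
    have "AE s in lebesgue. s \<noteq> (0::real)" "AE s in lebesgue. s \<noteq> t"
      by (metis AE_completion AE_lborel_singleton)+
    then show "AE s in lebesgue. ennreal (w s) * indicator {s. ennreal s < ennreal t} s * indicator I s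
        = ennreal (indicator {0..t} s * w s)"
      by eventually_elim
         (use sub in \<open>auto simp: indicator_def ennreal_less_iff subset_eq half_open_interval_def\<close>)
  qed
  also have "\<dots> = ennreal (weight_primitive w t)"
    unfolding weight_primitive_def set_lebesgue_integral_def
    by (subst nn_integral_eq_integral) (use int pos in \<open>auto simp: set_integrable_def\<close>)
  finally show ?thesis .
qed

lemma exists_pos: "\<exists>c>0. c \<in> I"
proof -
  obtain c where "0 < ereal c" "ereal c < \<gamma>"
    using length_pos ereal_dense2[of 0 \<gamma>] by auto
  then show ?thesis by (auto simp: half_open_interval_def)
qed

lemma W_finite: "W (ennreal x) < \<infinity>"
proof (cases "ennreal x \<in> ennreal ` I")
  case True
  then obtain t where "t \<in> I" "ennreal x = ennreal t" by auto
  then show ?thesis using W_eq_primitive by simp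
next
  case False
  show ?thesis
  proof (cases "x \<le> 0")
    case True then show ?thesis by (simp add: ennreal_neg)
  next
    case pos: False
    then have "x \<notin> I" using False by auto
    then have le: "\<gamma> \<le> ereal x" using pos by (auto simp: half_open_interval_def)
    obtain c where c: "0 < c" "c \<in> I" using exists_pos by blast
    \<comment> \<open>Here \<open>x\<close> lies at or beyond the finite right end of the interval.
      On the part after \<open>c\<close> the weight is at most \<open>w c\<close> and the length is
      finite.\<close>
    have "W (ennreal x) \<le> (\<integral>\<^sup>+t. ennreal (w t) * indicator {t. ennreal t < ennreal c} t
        + ennreal (w c) * indicator {t \<in> I. t \<in> {c..x}} t \<partial>L)"
      unfolding W_def
    proof (rule nn_integral_mono)
      fix t assume t: "t \<in> space L"
      then have "t \<le> x" using le by (auto simp: half_open_interval_def) (meson ereal_less_eq(3) less_imp_le less_le_trans)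
      show "ennreal (w t) * indicator {t. ennreal t < ennreal x} t \<le> ennreal (w t) * indicator {t. ennreal t < ennreal c} t
        + ennreal (w c) * indicator {t \<in> I. t \<in> {c..x}} t"
        using t c \<open>t \<le> x\<close> w_anti[of c t]
        by (auto simp: indicator_def ennreal_less_iff half_open_interval_def not_less intro!: ennreal_leI)
    qed
    also have "\<dots> = W (ennreal c) + ennreal (w c) * emeasure L {t \<in> I. t \<in> {c..x}}"
      unfolding W_def
      by (subst nn_integral_add) (auto intro!: mem_sets_L_borel simp: nn_integral_cmult_indicator[OF mem_sets_L_borel[of "{c..x}", simplified], simplified])
    also have "\<dots> < \<infinity>"
    proof -
      have "emeasure L {t \<in> I. t \<in> {c..x}} \<le> emeasure lebesgue {c..x}"
        by (subst L_le_lebesgue, rule mem_sets_L_borel, simp, rule emeasure_mono) auto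
      also have "\<dots> < \<infinity>" using emeasure_lborel_cbox_finite[of c x] by simp
      finally show ?thesis using W_eq_primitive[OF c(2)]
        by (auto simp: ennreal_mult_less_top)
    qed
    finally show ?thesis .
  qed
qed

lemma W_top: "\<gamma> = \<infinity> \<Longrightarrow> W \<infinity> = \<infinity>"
proof -
  assume g: "\<gamma> = \<infinity>"
  then have "I = {0..}" by (auto simp: half_open_interval_def)
  moreover have "(\<integral>\<^sup>+t. ennreal (w t) \<partial>lebesgue_on {0..}) = \<infinity>"
    using weight g by (auto simp: weight_function_def)
  ultimately show ?thesis unfolding W_def by simp
qed

lemma W_small: assumes "0 < e" shows "\<exists>d>0. W (ennreal d) < e"
proof -
  obtain c where c: "0 < c" "c \<in> I" using exists_pos by blast
  have "(\<lambda>n. W (ennreal (c / real (Suc n)))) \<longlonglongrightarrow> (\<integral>\<^sup>+t. 0 \<partial>L)"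
    unfolding W_def
  proof (rule nn_integral_dominated_convergence[where w="\<lambda>t. ennreal (w t) * indicator {t. ennreal t < ennreal c} t"])
    show "(\<integral>\<^sup>+t. ennreal (w t) * indicator {t. ennreal t < ennreal c} t \<partial>L) < \<infinity>"
      using W_finite[of c] by (simp add: W_def)
    show "AE t in L. ennreal (w t) * indicator {t. ennreal t < ennreal (c / real (Suc j))} t
         \<le> ennreal (w t) * indicator {t. ennreal t < ennreal c} t" for j
    proof (rule AE_I2)
      fix t
      have "c / real (Suc j) \<le> c" using c by (simp add: field_simps)
      then show "ennreal (w t) * indicator {t. ennreal t < ennreal (c / real (Suc j))} t
         \<le> ennreal (w t) * indicator {t. ennreal t < ennreal c} t"
        by (auto simp: indicator_def dest: less_le_trans[OF _ ennreal_leI])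
    qed
    show "AE t in L. (\<lambda>j. ennreal (w t) * indicator {t. ennreal t < ennreal (c / real (Suc j))} t) \<longlonglongrightarrow> 0"
      using AE_L_pos
    proof eventually_elim
      case (elim t)
      have "(\<lambda>j. c / real (Suc j)) \<longlonglongrightarrow> 0" by (intro LIMSEQ_Suc lim_const_over_n)
      then have "eventually (\<lambda>j. c / real (Suc j) < t) sequentially"
        using elim by (rule order_tendstoD)
      then have "eventually (\<lambda>j. ennreal (w t) * indicator {t. ennreal t < ennreal (c / real (Suc j))} t = 0) sequentially"
        by eventually_elim (use c elim in \<open>auto simp: indicator_def ennreal_less_iff\<close>)
      then show ?case by (rule tendsto_eventually)
    qed
  qed auto
  then have "eventually (\<lambda>n. W (ennreal (c / real (Suc n))) < e) sequentially"
    using assms by (intro order_tendstoD(2)[of _ 0]) auto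
  then obtain n where "W (ennreal (c / real (Suc n))) < e"
    by (auto simp: eventually_sequentially)
  then show ?thesis using c by (intro exI[of _ "c / real (Suc n)"]) auto
qed

lemma W_tendsto_0:
  fixes x :: "nat \<Rightarrow> ennreal"
  assumes "x \<longlonglongrightarrow> 0" shows "(\<lambda>n. W (x n)) \<longlonglongrightarrow> 0"
proof (rule order_tendstoI)
  fix e :: ennreal assume "0 < e"
  then obtain d where d: "d > 0" "W (ennreal d) < e" using W_small by blast
  then have "eventually (\<lambda>n. x n < ennreal d) sequentially"
    using assms by (intro order_tendstoD(2)[of _ 0]) auto
  then show "eventually (\<lambda>n. W (x n) < e) sequentially"
    by eventually_elim (use d W_mono in \<open>meson less_imp_le le_less_trans\<close>)
qed auto

text \<open>The \<tau>(r) of the overview. Since \<open>w\<close> decreases, the level set is an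
  initial interval up to its end points and is determined by this length.\<close>

definition level_length :: "real \<Rightarrow> ennreal" where
  "level_length r = emeasure L {t \<in> I. ennreal r < ennreal (w t)}"

text \<open>Both the set where t < x and the level set of \<open>w\<close> are initial intervals, so
  their intersection has the smaller of the two lengths. This exhibits \<open>W\<close> as a
  superposition of the concave functions min(\<tau>, x).\<close>

lemma W_eq_min:
  "W x = (\<integral>\<^sup>+r. min (level_length r) x * indicator {0..} r \<partial>lborel)"
proof -
  have "W x = (\<integral>\<^sup>+r. (\<integral>\<^sup>+t. indicator {t. ennreal t < x} t * indicator {t. ennreal r < ennreal (w t)} t \<partial>L) * indicator {0..} r \<partial>lborel)"
    unfolding W_def by (rule nn_integral_layer_cake[OF L.sigma_finite_measure_axioms]) (auto simp: indicator_def)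
  also have "\<dots> = (\<integral>\<^sup>+r. min (level_length r) x * indicator {0..} r \<partial>lborel)"
  proof (intro nn_integral_cong)
    fix r :: real
    let ?U = "{t \<in> I. ennreal r < ennreal (w t)}"
    let ?V = "{t \<in> I. ennreal t < x \<and> ennreal r < ennreal (w t)}"
    have U: "?U \<in> sets L" "?V \<in> sets L"
    proof -
      have "{t \<in> space L. ennreal r < ennreal (w t)} \<in> sets L" by measurable
      moreover have "{t \<in> space L. ennreal t < x \<and> ennreal r < ennreal (w t)} \<in> sets L" by measurable
      ultimately show "?U \<in> sets L" "?V \<in> sets L" unfolding space_L .
    qed
    have "(\<integral>\<^sup>+t. indicator {t. ennreal t < x} t * indicator {t. ennreal r < ennreal (w t)} t \<partial>L)
        = (\<integral>\<^sup>+t. indicator ?V t \<partial>L)"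
      by (intro nn_integral_cong) (auto simp: indicator_def)
    also have "\<dots> = emeasure L ?V" by (rule nn_integral_indicator[OF U(2)])
    also have "\<dots> = min (level_length r) x"
    \<comment> \<open>If some point of the level set lies at or beyond \<open>x\<close>, the level
      set contains the open interval from 0 to \<open>x\<close> and the minimum is \<open>x\<close>.
      Otherwise it lies below \<open>x\<close>, and the minimum is its length.\<close>
    proof (cases "\<exists>t0\<in>?U. x \<le> ennreal t0")
      case True
      then obtain t0 where t0: "t0 \<in> I" "ennreal r < ennreal (w t0)" "x \<le> ennreal t0" by auto
      then obtain y where y: "x = ennreal y" "0 \<le> y" "y \<le> t0"
        by (cases x) (auto simp: half_open_interval_def top_unique)
      \<comment> \<open>The interval is open at 0, where nothing is known about the value of
        \<open>w\<close>.\<close>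
      have sub: "{0<..<y} \<subseteq> ?V"
      proof
        fix s assume s: "s \<in> {0<..<y}"
        then have "w t0 \<le> w s" using y t0 by (intro w_anti) auto
        then show "s \<in> ?V" using s y t0 I_down[OF t0(1), of s]
          by (auto simp: ennreal_less_iff intro: less_le_trans[OF _ ennreal_leI])
      qed
      have subI: "{0<..<y} \<subseteq> I" using sub by blast
      have "{0<..<y} \<in> sets L" by (rule borel_Int_I[OF _ subI]) simp
      from L_le_lebesgue[OF this] have "ennreal y = emeasure L {0<..<y}" using y(2) by simp
      also have "\<dots> \<le> emeasure L ?V" by (rule emeasure_mono[OF sub U(2)])
      finally have 1: "x \<le> emeasure L ?V" by (rule order_trans[OF eq_refl[OF y(1)]])
      have sub': "?V \<subseteq> {0..y}"
        unfolding y(1) using y(2) by (auto simp: ennreal_less_iff half_open_interval_def)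
      have 2: "emeasure L ?V \<le> x"
        by (rule order_trans[OF emeasure_L_le[OF U(2) sub' y(2)] eq_refl[OF y(1)[symmetric]]])
      have "emeasure L ?V \<le> level_length r"
        unfolding level_length_def by (rule emeasure_mono[OF _ U(1)]) auto
      then show ?thesis using 1 2 by (simp add: min_def)
    next
      case False
      then have eq: "?U = ?V" by (auto simp: not_le)
      have "emeasure L ?U \<le> x"
      proof (cases x)
        case (real y)
        then have sub': "?V \<subseteq> {0..y}" by (auto simp: ennreal_less_iff half_open_interval_def)
        show ?thesis
          unfolding eq
          by (rule order_trans[OF emeasure_L_le[OF U(2) sub' real(1)] eq_refl[OF real(2)[symmetric]]])
      next
        case top then show ?thesis by simp
      qed
      then show ?thesis unfolding level_length_def eq by (rule min_absorb1[symmetric])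
    qed
    finally show "(\<integral>\<^sup>+t. indicator {t. ennreal t < x} t * indicator {t. ennreal r < ennreal (w t)} t \<partial>L) * indicator {0..} r
       = min (level_length r) x * indicator {0..} r" by simp
  qed
  finally show ?thesis .
qed

section \<open>The functional S and its convexity\<close>

definition S :: "ennreal \<Rightarrow> (real \<Rightarrow> ennreal) \<Rightarrow> ennreal" where
  "S \<tau> g = (\<integral>\<^sup>+s. min \<tau> (dist_at g s) * indicator {0..} s \<partial>lborel)"

lemma level_length_measurable [measurable]: "level_length \<in> borel_measurable borel"
proof -
  have "(\<lambda>t. ennreal (w t)) \<in> borel_measurable L" by measurable
  from dist_at_measurable[OF this] show ?thesis
    by (simp add: level_length_def[abs_def] dist_at_def[abs_def])
qed

lemma J_eq_S:
  assumes [measurable]: "g \<in> borel_measurable L"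
  shows "J g = (\<integral>\<^sup>+r. S (level_length r) g * indicator {0..} r \<partial>lborel)"
proof -
  have "J g = (\<integral>\<^sup>+s. (\<integral>\<^sup>+r. min (level_length r) (dist_at g s) * indicator {0..} r * indicator {0..} s \<partial>lborel) \<partial>lborel)"
    unfolding J_def by (subst W_eq_min, subst nn_integral_multc) auto
  also have "\<dots> = (\<integral>\<^sup>+r. (\<integral>\<^sup>+s. min (level_length r) (dist_at g s) * indicator {0..} r * indicator {0..} s \<partial>lborel) \<partial>lborel)"
    by (rule lborel_pair.Fubini') measurable
  also have "\<dots> = (\<integral>\<^sup>+r. S (level_length r) g * indicator {0..} r \<partial>lborel)"
    unfolding S_def
    by (intro nn_integral_cong, subst nn_integral_multc[symmetric]) (auto intro!: nn_integral_cong simp: mult.commute mult.left_commute)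
  finally show ?thesis .
qed

text \<open>Subtraction in \<open>ennreal\<close> is truncated at 0, so
  \<open>g t - ennreal z\<close> is the excess of \<open>g\<close> over the level \<open>z\<close>.
  Its distribution function is that of \<open>g\<close> shifted by \<open>z\<close>.\<close>

lemma nn_integral_excess:
  assumes [measurable]: "g \<in> borel_measurable L" and "0 \<le> z"
  shows "(\<integral>\<^sup>+t. (g t - ennreal z) \<partial>L) = (\<integral>\<^sup>+s. dist_at g s * indicator {z..} s \<partial>lborel)"
proof -
  have "(\<integral>\<^sup>+t. (g t - ennreal z) \<partial>L) = (\<integral>\<^sup>+t. (g t - ennreal z) * 1 \<partial>L)" by simp
  also have "\<dots> = (\<integral>\<^sup>+s. (\<integral>\<^sup>+t. 1 * indicator {t. ennreal s < g t - ennreal z} t \<partial>L) * indicator {0..} s \<partial>lborel)"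
    by (rule nn_integral_layer_cake[OF L.sigma_finite_measure_axioms]) auto
  also have "\<dots> = (\<integral>\<^sup>+s. dist_at g (z + 1 * s) * indicator {z..} (z + 1 * s) \<partial>lborel)"
    by (intro nn_integral_cong)
       (auto simp: dist_at_nn_integral indicator_def ennreal_less_diff_iff assms intro!: nn_integral_cong)
  also have "\<dots> = (\<integral>\<^sup>+s. dist_at g s * indicator {z..} s \<partial>lborel)"
    by (subst nn_integral_real_affine[of "\<lambda>s. dist_at g s * indicator {z..} s" 1 z]) auto
  finally show ?thesis .
qed

lemma S_le:
  assumes [measurable]: "g \<in> borel_measurable L" and "0 \<le> z"
  shows "S \<tau> g \<le> \<tau> * ennreal z + (\<integral>\<^sup>+t. (g t - ennreal z) \<partial>L)"
proof -
  have "S \<tau> g \<le> (\<integral>\<^sup>+s. \<tau> * indicator {0..<z} s + dist_at g s * indicator {z..} s \<partial>lborel)"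
    unfolding S_def by (intro nn_integral_mono) (auto simp: indicator_def)
  also have "\<dots> = \<tau> * ennreal z + (\<integral>\<^sup>+t. (g t - ennreal z) \<partial>L)"
    unfolding nn_integral_excess[OF assms]
    by (subst nn_integral_add) (auto simp: nn_integral_cmult_indicator assms)
  finally show ?thesis .
qed

text \<open>Take for \<open>z\<close> the first level at which the distribution function falls to
  \<tau>: before \<open>z\<close> the minimum in \<open>S\<close> is \<tau>, after \<open>z\<close>
  it is the distribution function. If that level does not exist, \<open>S\<close> is \<tau> times
  \<infinity>.\<close>

lemma S_attained:
  assumes [measurable]: "g \<in> borel_measurable L"
  shows "\<tau> = 0 \<or> S \<tau> g = \<infinity> \<or>
    (\<exists>z\<ge>0. S \<tau> g = \<tau> * ennreal z + (\<integral>\<^sup>+t. (g t - ennreal z) \<partial>L))"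
proof (cases "\<exists>s\<ge>0. dist_at g s \<le> \<tau>")
  case False
  have "S \<tau> g = (\<integral>\<^sup>+(s::real). \<tau> * indicator {0..} s \<partial>lborel)"
    unfolding S_def
  proof (intro nn_integral_cong)
    fix s :: real
    show "min \<tau> (dist_at g s) * indicator {0..} s = \<tau> * indicator {0..} s"
      using False by (cases "0 \<le> s") (auto simp: min_absorb1 less_imp_le not_le dest!: spec[of _ s])
  qed
  also have "\<dots> = \<tau> * emeasure lborel {0::real..}" by (simp add: nn_integral_cmult_indicator)
  also have "emeasure lborel {0::real..} = \<infinity>" by (rule emeasure_lborel_atLeast)
  finally show ?thesis by (cases "\<tau> = 0") (auto simp: ennreal_mult_top)
next
  case True
  define A where "A = {s. 0 \<le> s \<and> dist_at g s \<le> \<tau>}"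
  define z where "z = Inf A"
  have A: "A \<noteq> {}" "bdd_below A" using True by (auto simp: A_def bdd_below_def)
  have z0: "0 \<le> z" unfolding z_def using A by (intro cInf_greatest) (auto simp: A_def)
  have below: "\<tau> < dist_at g s" if "0 \<le> s" "s < z" for s
    using that cInf_lower[OF _ A(2), of s] by (auto simp: A_def z_def not_le[symmetric])
  have above: "dist_at g s \<le> \<tau>" if "z < s" for s
  proof -
    obtain r where "r \<in> A" "r < s" using \<open>z < s\<close> A by (auto simp: z_def cInf_less_iff)
    then show ?thesis using dist_at_antimono[OF assms, of r s] by (auto simp: A_def)
  qed
  have "S \<tau> g = (\<integral>\<^sup>+(s::real). \<tau> * indicator {0..<z} s + dist_at g s * indicator {z..} s \<partial>lborel)"
    unfolding S_def
  proof (rule nn_integral_cong_AE)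
    have "AE s in lborel. s \<noteq> z" by (rule AE_lborel_singleton)
    then show "AE s in lborel. min \<tau> (dist_at g s) * indicator {0..} s = \<tau> * indicator {0..<z} s + dist_at g s * indicator {z..} s"
    proof eventually_elim
      case (elim s)
      then consider "s < 0" | "0 \<le> s" "s < z" | "z < s" by linarith
      then show ?case
      proof cases
        case 1 then show ?thesis using z0 by simp
      next
        case 2 then show ?thesis using below[of s] by (simp add: min_absorb1 less_imp_le)
      next
        case 3 then show ?thesis using above[of s] z0 by (auto simp: min_def indicator_def)
      qed
    qed
  qed
  also have "\<dots> = \<tau> * ennreal z + (\<integral>\<^sup>+t. (g t - ennreal z) \<partial>L)"
    unfolding nn_integral_excess[OF assms z0]
    by (subst nn_integral_add) (auto simp: nn_integral_cmult_indicator z0)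
  finally show ?thesis using z0 by blast
qed

lemma S_0 [simp]: "S 0 g = 0"
  by (simp add: S_def min_def)

lemma S_measurable [measurable]:
  assumes [measurable]: "g \<in> borel_measurable L"
  shows "(\<lambda>\<tau>. S \<tau> g) \<in> borel_measurable borel"
  unfolding S_def by measurable

text \<open>Distribution functions are not convex in \<open>g\<close>, but \<open>S\<close> is a
  minimum over the level of an expression that is jointly convex in \<open>g\<close> and the level.
  If \<open>y\<close> and \<open>z\<close> are optimal for \<open>g\<close> and \<open>h\<close>,
  the level \<open>a * y + b * z\<close> is admissible for the combination.\<close>

lemma S_comb_le:
  assumes [measurable]: "g \<in> borel_measurable L" "h \<in> borel_measurable L" and ab: "0 < a" "0 < b"
  shows "S \<tau> (\<lambda>t. ennreal a * g t + ennreal b * h t) \<le> ennreal a * S \<tau> g + ennreal b * S \<tau> h"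
proof -
  consider "\<tau> = 0" | "S \<tau> g = \<infinity>" | "S \<tau> h = \<infinity>"
    | y z where "y \<ge> 0" "z \<ge> 0" "S \<tau> g = \<tau> * ennreal y + (\<integral>\<^sup>+t. (g t - ennreal y) \<partial>L)"
      "S \<tau> h = \<tau> * ennreal z + (\<integral>\<^sup>+t. (h t - ennreal z) \<partial>L)"
    using S_attained[OF assms(1), of \<tau>] S_attained[OF assms(2), of \<tau>] by blast
  then show ?thesis
  proof cases
    case 4
    let ?z = "a * y + b * z"
    have "S \<tau> (\<lambda>t. ennreal a * g t + ennreal b * h t)
       \<le> \<tau> * ennreal ?z + (\<integral>\<^sup>+t. (ennreal a * g t + ennreal b * h t - ennreal ?z) \<partial>L)"
      using 4 ab by (intro S_le) auto
    also have "(\<integral>\<^sup>+t. (ennreal a * g t + ennreal b * h t - ennreal ?z) \<partial>L)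
       \<le> (\<integral>\<^sup>+t. ennreal a * (g t - ennreal y) + ennreal b * (h t - ennreal z) \<partial>L)"
    proof (intro nn_integral_mono ennreal_diff_le)
      fix t
      have "ennreal a * g t + ennreal b * h t
         \<le> ennreal a * ((g t - ennreal y) + ennreal y) + ennreal b * ((h t - ennreal z) + ennreal z)"
        by (intro add_mono mult_left_mono ennreal_le_diff_add) auto
      also have "\<dots> = ennreal a * (g t - ennreal y) + ennreal b * (h t - ennreal z) + ennreal ?z"
        using 4 ab by (simp add: distrib_left ennreal_mult ennreal_plus algebra_simps)
      finally show "ennreal a * g t + ennreal b * h t \<le> \<dots>" .
    qed
    also have "\<dots> = ennreal a * (\<integral>\<^sup>+t. (g t - ennreal y) \<partial>L) + ennreal b * (\<integral>\<^sup>+t. (h t - ennreal z) \<partial>L)"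
      by (subst nn_integral_add) (auto simp: nn_integral_cmult)
    also have "\<tau> * ennreal ?z + \<dots> = ennreal a * S \<tau> g + ennreal b * S \<tau> h"
      unfolding 4(3,4) using 4(1,2) ab by (simp add: distrib_left ennreal_mult ennreal_plus algebra_simps)
    finally show ?thesis by (auto simp: add_left_mono)
  next
    case 1 then show ?thesis by simp
  next
    case 2 then show ?thesis using ab(1) by (simp add: ennreal_mult_top)
  next
    case 3 then show ?thesis using ab(2) by (simp add: ennreal_mult_top)
  qed
qed

lemma J_comb_le:
  assumes [measurable]: "g \<in> borel_measurable L" "h \<in> borel_measurable L" and ab: "0 < a" "0 < b"
  shows "J (\<lambda>t. ennreal a * g t + ennreal b * h t) \<le> ennreal a * J g + ennreal b * J h"
proof -
  have "J (\<lambda>t. ennreal a * g t + ennreal b * h t)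
    = (\<integral>\<^sup>+r. S (level_length r) (\<lambda>t. ennreal a * g t + ennreal b * h t) * indicator {0..} r \<partial>lborel)"
    by (rule J_eq_S) measurable
  also have "\<dots> \<le> (\<integral>\<^sup>+r. ennreal a * (S (level_length r) g * indicator {0..} r) + ennreal b * (S (level_length r) h * indicator {0..} r) \<partial>lborel)"
    by (intro nn_integral_mono) (use S_comb_le[OF assms] in \<open>auto simp: indicator_def\<close>)
  also have "\<dots> = ennreal a * J g + ennreal b * J h"
    by (subst nn_integral_add) (auto simp: nn_integral_cmult J_eq_S)
  finally show ?thesis .
qed

section \<open>Monotonicity and limit theorems for J\<close>

lemma J_mono_AE:
  assumes "AE t in L. g t \<le> h t" and "h \<in> borel_measurable L" shows "J g \<le> J h"
  unfolding J_def by (intro nn_integral_mono mult_right_mono W_mono dist_at_mono_AE assms) auto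

lemma J_cong_AE:
  assumes "AE t in L. g t = h t" "g \<in> borel_measurable L" "h \<in> borel_measurable L" shows "J g = J h"
proof (rule antisym)
  show "J g \<le> J h" by (rule J_mono_AE[OF _ assms(3)]) (use assms(1) in eventually_elim, simp)
  show "J h \<le> J g" by (rule J_mono_AE[OF _ assms(2)]) (use assms(1) in eventually_elim, simp)
qed

lemma J_indicator:
  assumes B: "B \<in> sets L" and c: "0 \<le> c"
  shows "J (\<lambda>t. ennreal c * indicator B t) = ennreal c * W (emeasure L B)"
proof -
  have "J (\<lambda>t. ennreal c * indicator B t) = (\<integral>\<^sup>+s. W (emeasure L B) * indicator {0..<c} s \<partial>lborel)"
    unfolding J_def
  proof (intro nn_integral_cong)
    fix s :: real
    have BI: "B \<subseteq> I" using B by (simp add: sets_L_iff)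
    show "W (dist_at (\<lambda>t. ennreal c * indicator B t) s) * indicator {0..} s = W (emeasure L B) * indicator {0..<c} s"
    proof (cases "0 \<le> s")
      case True
      have "{t \<in> I. ennreal s < ennreal c * indicator B t} = (if s < c then B else {})"
        using BI True c by (auto simp: indicator_def ennreal_less_iff split: if_splits)
      then show ?thesis using True by (simp add: dist_at_def indicator_def)
    qed simp
  qed
  also have "\<dots> = ennreal c * W (emeasure L B)"
    using c by (subst nn_integral_cmult_indicator) (auto simp: mult.commute)
  finally show ?thesis .
qed

lemma J_SUP:
  fixes g :: "nat \<Rightarrow> real \<Rightarrow> ennreal"
  assumes inc: "\<And>t. incseq (\<lambda>n. g n t)" and [measurable]: "\<And>n. g n \<in> borel_measurable L"
  shows "J (\<lambda>t. SUP n. g n t) = (SUP n. J (g n))"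
proof -
  have d: "dist_at (\<lambda>t. SUP n. g n t) s = (SUP n. dist_at (g n) s)" for s
  proof -
    have "{t \<in> I. ennreal s < (SUP n. g n t)} = (\<Union>n. {t \<in> I. ennreal s < g n t})"
      by (auto simp: less_SUP_iff)
    moreover have "{t \<in> I. ennreal s < g n t} \<in> sets L" for n
    proof -
      have "{t \<in> space L. ennreal s < g n t} \<in> sets L" by measurable
      then show ?thesis by simp
    qed
    ultimately show ?thesis
      unfolding dist_at_def
      by (subst SUP_emeasure_incseq)
         (auto simp: incseq_def dest: incseqD[OF inc] intro: less_le_trans)
  qed
  have inc': "incseq (\<lambda>n. dist_at (g n) s)" for s
    by (intro incseq_SucI dist_at_mono_AE AE_I2) (auto intro: incseq_SucD[OF inc])
  have "J (\<lambda>t. SUP n. g n t) = (\<integral>\<^sup>+s. (SUP n. W (dist_at (g n) s) * indicator {0..} s) \<partial>lborel)"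
    unfolding J_def d W_SUP[OF inc'] by (simp add: SUP_mult_right_ennreal)
  also have "\<dots> = (SUP n. J (g n))"
    unfolding J_def
    by (rule nn_integral_monotone_convergence_SUP)
       (auto simp: incseq_def le_fun_def intro!: mult_right_mono W_mono incseqD[OF inc'])
  finally show ?thesis .
qed

text \<open>The infima over the tails increase to the limit, and each of them lies below a term with
  index at least \<open>k\<close>, so monotone convergence suffices.\<close>

lemma J_Fatou:
  fixes g :: "nat \<Rightarrow> real \<Rightarrow> ennreal"
  assumes [measurable]: "\<And>n. g n \<in> borel_measurable L" "f \<in> borel_measurable L"
    and lim: "AE t in L. (\<lambda>n. g n t) \<longlonglongrightarrow> f t" and le: "\<And>n. n \<ge> k \<Longrightarrow> J (g n) \<le> c"
  shows "J f \<le> c"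
proof -
  have "J f = J (\<lambda>t. SUP n. INF m\<in>{n..}. g m t)"
  proof (rule J_cong_AE)
    show "AE t in L. f t = (SUP n. INF m\<in>{n..}. g m t)"
      using lim
    proof eventually_elim
      case (elim t)
      then have "liminf (\<lambda>n. g n t) = f t"
        by (intro lim_imp_Liminf) auto
      then show ?case by (simp add: liminf_SUP_INF)
    qed
  qed measurable
  also have "\<dots> = (SUP n. J (\<lambda>t. INF m\<in>{n..}. g m t))"
    by (rule J_SUP) (auto simp: incseq_def intro!: INF_superset_mono)
  also have "\<dots> \<le> c"
  proof (rule SUP_least)
    fix n
    have "J (\<lambda>t. INF m\<in>{n..}. g m t) \<le> J (g (max n k))"
      by (intro J_mono_AE AE_I2 INF_lower) auto
    also have "\<dots> \<le> c" by (rule le) simp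
    finally show "J (\<lambda>t. INF m\<in>{n..}. g m t) \<le> c" .
  qed
  finally show ?thesis .
qed

lemma J_suminf_le:
  fixes g :: "nat \<Rightarrow> real \<Rightarrow> ennreal"
  assumes [measurable]: "\<And>n. g n \<in> borel_measurable L"
  shows "J (\<lambda>t. \<Sum>n. g n t) \<le> (\<Sum>n. J (g n))"
proof -
  have fin: "J (\<lambda>t. \<Sum>i<n. g i t) \<le> (\<Sum>i<n. J (g i))" for n
  proof (induction n)
    case 0 show ?case using J_indicator[of "{}" 0] by simp
  next
    case (Suc n)
    \<comment> \<open>The coefficients 1 bring the sum into the form of \<open>J_comb_le\<close>,
      which does not require the coefficients to add up to 1.\<close>
    have "J (\<lambda>t. \<Sum>i<Suc n. g i t) = J (\<lambda>t. ennreal 1 * (\<Sum>i<n. g i t) + ennreal 1 * g n t)" by simp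
    also have "\<dots> \<le> ennreal 1 * J (\<lambda>t. \<Sum>i<n. g i t) + ennreal 1 * J (g n)"
      by (rule J_comb_le) auto
    also have "\<dots> \<le> (\<Sum>i<Suc n. J (g i))" using Suc by (simp add: add_right_mono)
    finally show ?case .
  qed
  have "J (\<lambda>t. \<Sum>n. g n t) = J (\<lambda>t. SUP n. \<Sum>i<n. g i t)" by (simp add: suminf_eq_SUP)
  also have "\<dots> = (SUP n. J (\<lambda>t. \<Sum>i<n. g i t))"
    by (rule J_SUP) (auto simp: incseq_def intro!: sum_mono2)
  also have "\<dots> \<le> (SUP n. \<Sum>i<n. J (g i))" by (intro SUP_mono) (use fin in blast)
  finally show ?thesis by (simp add: suminf_eq_SUP)
qed

text \<open>On the half-line the total weight is infinite, so an infinite distribution function at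
  level \<open>s\<close> would give the integrand of \<open>J\<close> the value \<infinity> on all
  of \<open>{0..s}\<close>. On a bounded interval there is nothing to show.\<close>

lemma dist_at_finite:
  assumes [measurable]: "h \<in> borel_measurable L" and "J h < \<infinity>" "0 < s"
  shows "dist_at h s < \<infinity>"
proof (cases "\<gamma> = \<infinity>")
  case True
  show ?thesis
  proof (rule ccontr)
    assume "\<not> dist_at h s < \<infinity>"
    then have top: "dist_at h s = \<infinity>" by (simp flip: less_top)
    have "(\<integral>\<^sup>+r. \<infinity> * indicator {0..s} r \<partial>lborel) \<le> J h"
      unfolding J_def
    proof (intro nn_integral_mono)
      fix r :: real
      show "\<infinity> * indicator {0..s} r \<le> W (dist_at h r) * indicator {0..} r"
        using dist_at_antimono[OF assms(1), of r s] top W_top[OF True]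
        by (auto simp: indicator_def top_unique)
    qed
    moreover have "(\<integral>\<^sup>+r. \<infinity> * indicator {0..s} r \<partial>lborel) = \<infinity>"
      using \<open>0 < s\<close> by (subst nn_integral_cmult_indicator) (auto simp: ennreal_top_mult)
    ultimately have "J h = \<infinity>" by (simp add: top_unique)
    then show False using assms by simp
  qed
next
  case False
  then obtain r where r: "\<gamma> = ereal r" using length_pos by (cases \<gamma>) auto
  have "dist_at h s \<le> emeasure L (space L)"
    unfolding dist_at_def by (rule emeasure_space)
  also have "\<dots> \<le> emeasure lebesgue {0..r}"
    using r by (subst L_le_lebesgue) (auto intro!: emeasure_mono simp: half_open_interval_def sets_L_iff)
  also have "\<dots> < \<infinity>" using emeasure_lborel_cbox_finite[of 0 r] by simp
  finally show ?thesis .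
qed

text \<open>Dominated convergence is applied twice: in t for the distribution function at a fixed
  level s > 0, which is finite for \<open>h\<close> by \<open>dist_at_finite\<close>, and then in
  s.\<close>

lemma J_dominated:
  fixes g :: "nat \<Rightarrow> real \<Rightarrow> ennreal"
  assumes [measurable]: "\<And>n. g n \<in> borel_measurable L" "h \<in> borel_measurable L"
    and lim: "AE t in L. (\<lambda>n. g n t) \<longlonglongrightarrow> 0" and le: "\<And>n. AE t in L. g n t \<le> h t"
    and fin: "J h < \<infinity>"
  shows "(\<lambda>n. J (g n)) \<longlonglongrightarrow> 0"
proof -
  have d: "(\<lambda>n. dist_at (g n) s) \<longlonglongrightarrow> 0" if s: "0 < s" for s
  proof -
    have "(\<lambda>n. \<integral>\<^sup>+t. indicator {t. ennreal s < g n t} t \<partial>L) \<longlonglongrightarrow> (\<integral>\<^sup>+t. 0 \<partial>L)"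
    proof (rule nn_integral_dominated_convergence[where w="\<lambda>t. indicator {t. ennreal s < h t} t"])
      show "(\<integral>\<^sup>+t. indicator {t. ennreal s < h t} t \<partial>L) < \<infinity>"
        using dist_at_finite[OF assms(2) fin s] by (simp add: dist_at_nn_integral)
      show "AE t in L. indicator {t. ennreal s < g j t} t \<le> (indicator {t. ennreal s < h t} t :: ennreal)" for j
        using le[of j] by eventually_elim (auto simp: indicator_def)
      show "AE t in L. (\<lambda>j. indicator {t. ennreal s < g j t} t :: ennreal) \<longlonglongrightarrow> 0"
        using lim
      proof eventually_elim
        case (elim t)
        then have "eventually (\<lambda>j. g j t < ennreal s) sequentially"
          using s by (intro order_tendstoD(2)[of _ 0]) auto
        then have "eventually (\<lambda>j. (indicator {t. ennreal s < g j t} t :: ennreal) = 0) sequentially"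
          by eventually_elim (auto simp: indicator_def)
        then show ?case by (rule tendsto_eventually)
      qed
    qed (auto simp: indicator_def)
    then show ?thesis by (simp add: dist_at_nn_integral)
  qed
  have "(\<lambda>n. J (g n)) \<longlonglongrightarrow> (\<integral>\<^sup>+(s::real). 0 \<partial>lborel)"
    unfolding J_def
  proof (rule nn_integral_dominated_convergence[where w="\<lambda>s. W (dist_at h s) * indicator {0..} s"])
    show "(\<integral>\<^sup>+s. W (dist_at h s) * indicator {0..} s \<partial>lborel) < \<infinity>" using fin by (simp add: J_def)
    show "AE s in lborel. W (dist_at (g j) s) * indicator {0..} s \<le> W (dist_at h s) * indicator {0..} s" for j
      by (intro AE_I2 mult_right_mono W_mono dist_at_mono_AE le) auto
    have "AE s in lborel. s \<noteq> (0::real)" by (rule AE_lborel_singleton)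
    then show "AE s in lborel. (\<lambda>j. W (dist_at (g j) s) * indicator {0..} s) \<longlonglongrightarrow> 0"
    proof eventually_elim
      case (elim s)
      show ?case
      proof (cases "0 < s")
        case True
        then show ?thesis using W_tendsto_0[OF d[OF True]] by (simp add: indicator_def)
      next
        case False then show ?thesis using elim by (simp add: indicator_def)
      qed
    qed
  qed auto
  then show ?thesis by simp
qed

lemma W_ge: assumes "x \<le> ennreal b" "0 < b" "b \<in> I" shows "ennreal (w b) * x \<le> W x"
proof -
  obtain y where y: "x = ennreal y" "0 \<le> y" "y \<le> b" using assms(1,2)
    by (cases x) (auto simp: top_unique)
  have "ennreal (w b) * x = (\<integral>\<^sup>+t. ennreal (w b) * indicator {0<..<y} t \<partial>L)"
    using y I_down[OF assms(3)]
    by (subst nn_integral_cmult_indicator) (auto intro!: borel_Int_I simp: L_le_lebesgue borel_Int_I subset_eq)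
  also have "\<dots> \<le> W x"
    unfolding W_def
    by (intro nn_integral_mono) (use y assms w_anti[of _ b] in \<open>auto simp: indicator_def ennreal_less_iff intro!: ennreal_leI\<close>)
  finally show ?thesis .
qed

text \<open>The source of all local integrability: the part of a level set inside \<open>B\<close>
  has measure at most \<open>b\<close>, and on arguments up to \<open>b\<close> the primitive has
  slope at least \<open>w b\<close>.\<close>

lemma J_ge:
  assumes [measurable]: "g \<in> borel_measurable L" and B [measurable]: "B \<in> sets L"
    and b: "emeasure L B \<le> ennreal b" "0 < b" "b \<in> I"
  shows "ennreal (w b) * (\<integral>\<^sup>+t. g t * indicator B t \<partial>L) \<le> J g"
proof -
  have "ennreal (w b) * (\<integral>\<^sup>+t. g t * indicator B t \<partial>L)
    = (\<integral>\<^sup>+s. ennreal (w b) * ((\<integral>\<^sup>+t. indicator B t * indicator {t. ennreal s < g t} t \<partial>L) * indicator {0..} s) \<partial>lborel)"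
    by (subst nn_integral_layer_cake[OF L.sigma_finite_measure_axioms], simp, simp, subst nn_integral_cmult)
       (simp_all add: indicator_def cong: if_cong)
  also have "\<dots> \<le> J g"
    unfolding J_def
  proof (rule nn_integral_mono)
    fix s :: real
    let ?x = "\<integral>\<^sup>+t. indicator B t * indicator {t. ennreal s < g t} t \<partial>L"
    have "?x \<le> (\<integral>\<^sup>+t. indicator B t \<partial>L)" by (intro nn_integral_mono) (auto simp: indicator_def)
    then have "?x \<le> ennreal b" using b by auto
    then have "ennreal (w b) * ?x \<le> W ?x" using b by (intro W_ge)
    also have "\<dots> \<le> W (dist_at g s)"
      unfolding dist_at_nn_integral[OF assms(1)]
      by (intro W_mono nn_integral_mono) (simp add: indicator_def)
    finally show "ennreal (w b) * (?x * indicator {0..} s) \<le> W (dist_at g s) * indicator {0..} s"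
      by (simp add: indicator_def)
  qed
  finally show ?thesis .
qed

subsection \<open>Averages over dyadic cells\<close>

definition cell :: "nat \<Rightarrow> nat \<Rightarrow> real set" where
  "cell n j = {real j / 2 ^ n ..< real (Suc j) / 2 ^ n}"

text \<open>The first condition makes the index set finite, the second keeps the right end of the
  cell inside \<open>I\<close>, where the weight is positive. Every point of \<open>I\<close> lies
  in such a cell for all large n.\<close>

definition cells :: "nat \<Rightarrow> nat set" where
  "cells n = {j. Suc j \<le> n * 2 ^ n \<and> ereal (real (Suc j) / 2 ^ n) < \<gamma>}"

definition coeff :: "nat \<Rightarrow> nat \<Rightarrow> (real \<Rightarrow> real) \<Rightarrow> real" where
  "coeff n j f = set_lebesgue_integral L (cell n j) f"

text \<open>The factor \<open>2 ^ n\<close> makes \<open>a j\<close> the integral over the cell and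
  not the value on it. Hence \<open>coeff\<close> recovers \<open>a\<close>, and the coefficients of
  the two halves of a cell add up to its own.\<close>

definition step :: "nat \<Rightarrow> (nat \<Rightarrow> real) \<Rightarrow> real \<Rightarrow> real" where
  "step n a t = (\<Sum>j\<in>cells n. a j * (2 ^ n * indicator (cell n j) t))"

lemma finite_cells: "finite (cells n)"
  by (rule finite_subset[of _ "{..<n * 2 ^ n}"]) (auto simp: cells_def)

lemma cell_end_mem: "j \<in> cells n \<Longrightarrow> real (Suc j) / 2 ^ n \<in> I"
  by (auto simp: cells_def half_open_interval_def)

lemma cell_sub: "j \<in> cells n \<Longrightarrow> cell n j \<subseteq> {0..real (Suc j) / 2 ^ n}"
proof
  fix t assume "t \<in> cell n j"
  then have "real j / 2 ^ n \<le> t" "t < real (Suc j) / 2 ^ n" unfolding cell_def by auto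
  moreover have "0 \<le> real j / 2 ^ n" by simp
  ultimately show "t \<in> {0..real (Suc j) / 2 ^ n}" unfolding atLeastAtMost_iff by linarith
qed

lemma cell_sub_I: "j \<in> cells n \<Longrightarrow> cell n j \<subseteq> I"
  using I_down[OF cell_end_mem] cell_sub by (auto simp: subset_eq)

lemma cell_sets [measurable]: "j \<in> cells n \<Longrightarrow> cell n j \<in> sets L"
  by (rule borel_Int_I[OF _ cell_sub_I]) (auto simp: cell_def)

lemma cell_length: "real (Suc j) / 2 ^ n - real j / 2 ^ n = 1 / 2 ^ n"
  by (simp add: diff_divide_distrib[symmetric])

lemma emeasure_cell: "j \<in> cells n \<Longrightarrow> emeasure L (cell n j) = ennreal (1 / 2 ^ n)"
  using L_le_lebesgue[OF cell_sets[of j n]] cell_length[of j n] by (simp add: cell_def divide_right_mono)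

text \<open>The explicit index of the cell of a point gives disjointness at once and ties
  \<open>rademacher\<close> to the parity of the index.\<close>

lemma mem_cell_iff: "t \<in> cell n j \<longleftrightarrow> 0 \<le> t \<and> nat \<lfloor>2 ^ n * t\<rfloor> = j"
proof
  assume "t \<in> cell n j"
  then have "real j \<le> 2 ^ n * t" "2 ^ n * t < real (Suc j)" by (auto simp: cell_def field_simps)
  moreover have "0 \<le> t" using \<open>t \<in> cell n j\<close> by (auto simp: cell_def intro: order_trans[of 0 "real j / 2 ^ n"])
  ultimately show "0 \<le> t \<and> nat \<lfloor>2 ^ n * t\<rfloor> = j" by (auto simp: nat_eq_iff floor_eq_iff)
next
  assume *: "0 \<le> t \<and> nat \<lfloor>2 ^ n * t\<rfloor> = j"
  then have "\<lfloor>2 ^ n * t\<rfloor> = int j" by auto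
  then have "real j \<le> 2 ^ n * t" "2 ^ n * t < real j + 1" by (auto simp: floor_eq_iff)
  then show "t \<in> cell n j" by (auto simp: cell_def field_simps)
qed

lemma cell_disjoint: "j \<noteq> k \<Longrightarrow> cell n j \<inter> cell n k = {}"
  by (auto simp: mem_cell_iff)

lemma step_in_cell: assumes "j \<in> cells n" "t \<in> cell n j" shows "step n a t = a j * 2 ^ n"
proof -
  have "step n a t = (\<Sum>k\<in>cells n. if k = j then a j * 2 ^ n else 0)"
    unfolding step_def using assms cell_disjoint by (intro sum.cong) (auto simp: indicator_def)
  then show ?thesis using assms finite_cells by simp
qed

lemma step_outside: "(\<And>j. j \<in> cells n \<Longrightarrow> t \<notin> cell n j) \<Longrightarrow> step n a t = 0"
  unfolding step_def by (intro sum.neutral) auto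

lemma step_measurable [measurable]: "step n a \<in> borel_measurable L"
  unfolding step_def[abs_def] by measurable

lemma cell_halves: "cell n j = cell (Suc n) (2 * j) \<union> cell (Suc n) (2 * j + 1)"
  by (auto simp: cell_def field_simps)

lemma cells_halves: assumes "j \<in> cells n" shows "2 * j \<in> cells (Suc n)" "2 * j + 1 \<in> cells (Suc n)"
proof -
  have j: "Suc j \<le> n * 2 ^ n" "ereal (real (Suc j) / 2 ^ n) < \<gamma>" using assms by (auto simp: cells_def)
  have "Suc (2 * j + 1) = 2 * Suc j" by simp
  also have "\<dots> \<le> 2 * (n * 2 ^ n)" using j(1) by (rule mult_le_mono2)
  also have "\<dots> \<le> Suc n * 2 ^ Suc n" by simp
  finally have 1: "Suc (2 * j + 1) \<le> Suc n * 2 ^ Suc n" .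
  have "real (Suc (2 * j + 1)) / 2 ^ Suc n = real (Suc j) / 2 ^ n" by (simp add: field_simps)
  then have 2: "ereal (real (Suc (2 * j + 1)) / 2 ^ Suc n) < \<gamma>" using j(2) by simp
  then show "2 * j + 1 \<in> cells (Suc n)" using 1 by (simp add: cells_def)
  have "ereal (real (Suc (2 * j)) / 2 ^ Suc n) \<le> ereal (real (Suc (2 * j + 1)) / 2 ^ Suc n)"
    by (simp add: divide_right_mono)
  then have "ereal (real (Suc (2 * j)) / 2 ^ Suc n) < \<gamma>" using 2 by (rule le_less_trans)
  then show "2 * j \<in> cells (Suc n)" using 1 by (simp add: cells_def)
qed

lemma coeff_halves:
  assumes j: "j \<in> cells n" and f: "set_integrable L (cell n j) f"
  shows "coeff n j f = coeff (Suc n) (2 * j) f + coeff (Suc n) (2 * j + 1) f"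
proof -
  have "set_integrable L (cell (Suc n) (2 * j)) f" "set_integrable L (cell (Suc n) (2 * j + 1)) f"
    by (rule set_integrable_subset[OF f]; use cells_halves[OF j] cell_halves[of n j] in auto)+
  then show ?thesis
    unfolding coeff_def cell_halves[of n j]
    by (intro set_integral_Un) (use cell_disjoint[of "2 * j" "2 * j + 1" "Suc n"] in auto)
qed

lemma coeff_step: assumes j: "j \<in> cells n" shows "coeff n j (step n a) = a j"
proof -
  have "coeff n j (step n a) = (\<integral>t. (a j * 2 ^ n) * indicator (cell n j) t \<partial>L)"
    unfolding coeff_def set_lebesgue_integral_def
    by (intro Bochner_Integration.integral_cong) (auto simp: step_in_cell[OF j] indicator_def)
  also have "\<dots> = (a j * 2 ^ n) * measure L (cell n j)"
    using j emeasure_cell[OF j] cell_sub_I[OF j] by (simp add: Int_absorb2)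
  also have "measure L (cell n j) = 1 / 2 ^ n" using emeasure_cell[OF j] by (simp add: measure_def)
  finally show ?thesis by simp
qed

lemma step_set_integrable: assumes "A \<in> sets L" shows "set_integrable L A (step n a)"
proof -
  have "integrable L (step n a)"
    unfolding step_def[abs_def]
  proof (intro Bochner_Integration.integrable_sum integrable_mult_right)
    fix j assume "j \<in> cells n"
    then show "integrable L (indicator (cell n j) :: real \<Rightarrow> real)"
      using emeasure_cell by (intro integrable_real_indicator) auto
  qed
  then show ?thesis using assms by (rule set_integrable_of_integrable)
qed

text \<open>The bounds on integrals over \<open>{0..R}\<close> depend on \<open>w R\<close> and so
  need \<open>R\<close> inside the interval; this sequence exhausts \<open>I\<close> by such
  points.\<close>

lemma exhaustion: "\<exists>R::nat \<Rightarrow> real. incseq R \<and> (\<forall>m. 0 < R m \<and> R m \<in> I) \<and> (\<forall>t\<in>I. \<exists>m. t < R m)"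
proof (cases "\<gamma> = \<infinity>")
  case True
  have "\<exists>m. t < 1 + real m" for t using reals_Archimedean2[of "t - 1"] by (auto simp: algebra_simps)
  then show ?thesis using True
    by (intro exI[of _ "\<lambda>m. 1 + real m"]) (auto simp: incseq_def half_open_interval_def)
next
  case False
  then obtain r where r: "\<gamma> = ereal r" "0 < r" using length_pos by (cases \<gamma>) auto
  \<comment> \<open>The 2 in the denominator keeps the first member of the sequence
    positive.\<close>
  have "\<exists>m. t < r - r / (real m + 2)" if t: "t < r" for t
  proof -
    obtain m :: nat where "r / (r - t) < real m" using reals_Archimedean2 by blast
    then have "r < (r - t) * real m" using t by (simp add: field_simps)
    also have "\<dots> \<le> (r - t) * (real m + 2)" using t by (intro mult_left_mono) auto
    finally have "r / (real m + 2) < r - t" by (simp add: field_simps)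
    then show ?thesis by (intro exI[of _ m]) linarith
  qed
  moreover have "incseq (\<lambda>m. r - r / (real m + 2))"
    using r(2) by (auto simp: incseq_def intro!: divide_left_mono)
  moreover have "0 < r - r / (real m + 2)" "r - r / (real m + 2) < r" for m
  proof -
    have "r / (real m + 2) \<le> r / 2" using r(2) by (intro divide_left_mono) auto
    moreover have "0 < r / (real m + 2)" using r(2) by simp
    ultimately
    show "0 < r - r / (real m + 2)" "r - r / (real m + 2) < r" using r(2) by linarith+
  qed
  ultimately show ?thesis using r(1)
    by (intro exI[of _ "\<lambda>m. r - r / (real m + 2)"]) (auto simp: half_open_interval_def less_imp_le)
qed

text \<open>On the cell of t the step function is the mean of \<open>g\<close>, and the cells shrink
  to t, so \<open>integrable_average\<close> applies. As \<open>g\<close> is only locally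
  integrable, it is first cut off at the points \<open>R m\<close>.\<close>

lemma step_coeff_tendsto_AE:
  assumes g [measurable]: "g \<in> borel_measurable L" and int: "\<And>R. R \<in> I \<Longrightarrow> set_integrable L {0..R} g"
  shows "AE t in L. (\<lambda>n. step n (\<lambda>j. coeff n j g) t) \<longlonglongrightarrow> g t"
proof -
  obtain R where R: "incseq R" "\<And>m. 0 < R m" "\<And>m. R m \<in> I" "\<And>t. t \<in> I \<Longrightarrow> \<exists>m. t < R m"
    using exhaustion by blast
  define f where "f m t = indicator {0..R m} t * g t" for m t
  have sub: "{0..R m} \<subseteq> I" for m using I_down[OF R(3)] by auto
  have f_int: "integrable lebesgue (f m)" for m
  proof -
    have "integrable L (\<lambda>t. indicator {0..R m} t *\<^sub>R g t)" using int[OF R(3)] by (simp add: set_integrable_def)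
    then have "integrable lebesgue (\<lambda>t. indicator I t *\<^sub>R (indicator {0..R m} t *\<^sub>R g t))"
      by (subst (asm) integrable_restrict_space) auto
    moreover have "indicator I t *\<^sub>R (indicator {0..R m} t *\<^sub>R g t) = f m t" for t
      using sub[of m] by (auto simp: f_def indicator_def)
    ultimately show ?thesis by simp
  qed
  define Q where "Q m t \<longleftrightarrow> (\<forall>e>0. \<exists>d>0. \<forall>a b. a \<le> t \<and> t < b \<and> b - a < d \<longrightarrow>
      \<bar>integral {a..b} (f m) - (b - a) * f m t\<bar> \<le> e * (b - a))" for m t
  have "AE t in lebesgue. \<forall>m. Q m t"
    unfolding AE_all_countable Q_def by (intro allI integrable_average f_int)
  then have "AE t in L. \<forall>m. Q m t"
    by (subst AE_restrict_space_iff) (auto elim: eventually_mono)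
  then show ?thesis
    using AE_space
  proof eventually_elim
    case (elim t)
    then have tI: "t \<in> I" by simp
    then have t0: "0 \<le> t" by (simp add: half_open_interval_def)
    obtain m where m: "t < R m" using R(4)[OF tI] by blast
    have ft: "f m t = g t" using t0 m by (simp add: f_def)
    show ?case
    proof (rule LIMSEQ_I)
      fix e :: real assume e: "0 < e"
      have "Q m t" using elim(1) by simp
      from this[unfolded Q_def, THEN spec, THEN mp, OF half_gt_zero[OF e]]
      obtain d where "d > 0" and "\<forall>a b. a \<le> t \<and> t < b \<and> b - a < d \<longrightarrow> \<bar>integral {a..b} (f m) - (b - a) * f m t\<bar> \<le> (e / 2) * (b - a)"
        by (elim exE conjE)
      then have d: "d > 0" "\<And>a b. a \<le> t \<Longrightarrow> t < b \<Longrightarrow> b - a < d \<Longrightarrow> \<bar>integral {a..b} (f m) - (b - a) * f m t\<bar> \<le> (e / 2) * (b - a)" by simp_all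
      \<comment> \<open>This makes the cell of t shorter than \<open>d\<close> and keeps its right
        end below \<open>R m\<close>. The next condition places the cell below n, as membership in
        \<open>cells n\<close> requires.\<close>
      have "eventually (\<lambda>n. (1 / 2 :: real) ^ n < min d (R m - t)) sequentially"
        using d m by (intro order_tendstoD(2)[OF LIMSEQ_power_zero]) auto
      moreover have "eventually (\<lambda>n. t + 1 \<le> real n) sequentially"
        using eventually_ge_at_top[of "nat \<lceil>t + 1\<rceil>"] by eventually_elim linarith
      ultimately have "eventually (\<lambda>n. (1 / 2 :: real) ^ n < min d (R m - t) \<and> t + 1 \<le> real n) sequentially"
        by (rule eventually_conj)
      then have "eventually (\<lambda>n. norm (step n (\<lambda>j. coeff n j g) t - g t) < e) sequentially"
      proof eventually_elim
        case (elim n)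
        define j where "j = nat \<lfloor>2 ^ n * t\<rfloor>"
        define a where "a = real j / 2 ^ n"
        define b where "b = real (Suc j) / 2 ^ n"
        have tc: "t \<in> cell n j" using t0 by (simp add: mem_cell_iff j_def)
        have ba: "b - a = (1 / 2) ^ n" using cell_length[of j n] by (simp add: a_def b_def power_divide)
        have ab: "a \<le> t" "t < b" "0 \<le> a" using tc by (auto simp: cell_def a_def b_def)
        have bR: "b < R m" using ab ba elim by linarith
        have pos: "0 < b - a" using ab by simp
        have j: "j \<in> cells n"
        proof -
          have "b \<le> real n" using ab ba elim power_le_one[of "1/2::real" n] by auto
          then have "real (Suc j) \<le> real (n * 2 ^ n)" by (simp add: b_def field_simps)
          moreover have "ereal b < \<gamma>" using bR R(3)[of m] I_down[OF R(3)[of m], of b] ab by (auto simp: half_open_interval_def)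
          ultimately show ?thesis unfolding cells_def b_def by (simp only: of_nat_le_iff mem_Collect_eq simp_thms)
        qed
        have "coeff n j g = integral {a..b} (f m)"
        proof -
          have "coeff n j g = (\<integral>t. indicator I t *\<^sub>R (indicator (cell n j) t *\<^sub>R g t) \<partial>lebesgue)"
            unfolding coeff_def set_lebesgue_integral_def by (subst integral_restrict_space) auto
          also have "\<dots> = (\<integral>t. indicator {a..b} t *\<^sub>R f m t \<partial>lebesgue)"
          proof (rule integral_cong_AE)
            show "(\<lambda>t. indicator {a..b} t *\<^sub>R f m t) \<in> borel_measurable lebesgue"
              by (rule borel_measurable_integrable[OF integrable_mult_indicator[OF _ f_int]]) simp
            have eq: "indicator I t *\<^sub>R (indicator (cell n j) t *\<^sub>R g t) = indicator (cell n j) t *\<^sub>R f m t" for t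
            proof (cases "t \<in> cell n j")
              case True
              then have "t \<in> I" "0 \<le> t" "t \<le> b" using cell_sub_I[OF j] cell_sub[OF j] by (auto simp: b_def)
              then show ?thesis using bR by (simp add: f_def)
            qed simp
            show "(\<lambda>t. indicator I t *\<^sub>R (indicator (cell n j) t *\<^sub>R g t)) \<in> borel_measurable lebesgue"
              unfolding eq
              by (rule borel_measurable_integrable[OF integrable_mult_indicator[OF _ f_int]]) (simp add: cell_def)
            have "AE t in lebesgue. t \<noteq> b" by (metis AE_completion AE_lborel_singleton)
            then show "AE t in lebesgue. indicator I t *\<^sub>R (indicator (cell n j) t *\<^sub>R g t) = indicator {a..b} t *\<^sub>R f m t"
              unfolding eq by eventually_elim (auto simp: cell_def a_def b_def indicator_def)
          qed
          also have "\<dots> = integral {a..b} (f m)"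
          proof -
            have "set_integrable lebesgue {a..b} (f m)" using f_int by (intro set_integrable_of_integrable) auto
            from set_lebesgue_integral_eq_integral(2)[OF this] show ?thesis by (simp add: set_lebesgue_integral_def)
          qed
          finally show ?thesis .
        qed
        then have "\<bar>coeff n j g - (b - a) * g t\<bar> \<le> (e / 2) * (b - a)"
          using d(2)[OF ab(1,2)] ba elim ft by simp
        then have "\<bar>coeff n j g - (b - a) * g t\<bar> * 2 ^ n \<le> (e / 2) * (b - a) * 2 ^ n" by (intro mult_right_mono) auto
        moreover have "(b - a) * 2 ^ n = 1" by (simp add: ba power_divide)
        moreover have "step n (\<lambda>j. coeff n j g) t - g t = (coeff n j g - (b - a) * g t) * 2 ^ n"
        proof -
          have "(coeff n j g - (b - a) * g t) * 2 ^ n = coeff n j g * 2 ^ n - ((b - a) * 2 ^ n) * g t"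
            by (simp add: algebra_simps)
          then show ?thesis unfolding \<open>(b - a) * 2 ^ n = 1\<close> step_in_cell[OF j tc] by simp
        qed
        ultimately have "\<bar>step n (\<lambda>j. coeff n j g) t - g t\<bar> \<le> e / 2" by (simp add: abs_mult mult.assoc)
        then show ?case using e by simp
      qed
      then show "\<exists>no. \<forall>n\<ge>no. norm (step n (\<lambda>j. coeff n j g) t - g t) < e" by (simp add: eventually_sequentially)
    qed
  qed
qed

definition nn_average :: "nat \<Rightarrow> (real \<Rightarrow> ennreal) \<Rightarrow> real \<Rightarrow> ennreal" where
  "nn_average n g t = (\<Sum>j\<in>cells n. ennreal (2 ^ n) * (\<integral>\<^sup>+s. g s * indicator (cell n j) s \<partial>L) * indicator (cell n j) t)"

lemma nn_average_in_cell:
  assumes "j \<in> cells n" "t \<in> cell n j"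
  shows "nn_average n g t = ennreal (2 ^ n) * (\<integral>\<^sup>+s. g s * indicator (cell n j) s \<partial>L)"
proof -
  have "nn_average n g t = (\<Sum>k\<in>cells n. if k = j then ennreal (2 ^ n) * (\<integral>\<^sup>+s. g s * indicator (cell n j) s \<partial>L) else 0)"
    unfolding nn_average_def using assms cell_disjoint by (intro sum.cong) (auto simp: indicator_def)
  then show ?thesis using assms finite_cells by simp
qed

lemma nn_average_outside: "(\<And>j. j \<in> cells n \<Longrightarrow> t \<notin> cell n j) \<Longrightarrow> nn_average n g t = 0"
  unfolding nn_average_def by (intro sum.neutral) auto

lemma nn_average_measurable [measurable]: "nn_average n g \<in> borel_measurable L"
  unfolding nn_average_def[abs_def] by measurable

lemma two_pow_cell: "ennreal (2 ^ n) * ennreal (1 / 2 ^ n) = 1"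
  by (simp add: ennreal_mult[symmetric])

text \<open>Jensen's inequality for the excess over a level z shows that its integral does not grow
  under averaging. With z optimal for \<open>g\<close> this passes to \<open>S\<close>, and by
  integration over the levels of the weight to \<open>J\<close>.\<close>

lemma J_average_le:
  assumes g [measurable]: "g \<in> borel_measurable L"
  shows "J (nn_average n g) \<le> J g"
proof -
  have excess: "(\<integral>\<^sup>+t. (nn_average n g t - ennreal z) \<partial>L) \<le> (\<integral>\<^sup>+t. (g t - ennreal z) \<partial>L)" if z: "0 \<le> z" for z
  proof -
    let ?c = "\<lambda>j. ennreal (2 ^ n) * (\<integral>\<^sup>+s. (g s - ennreal z) * indicator (cell n j) s \<partial>L)"
    have "(\<integral>\<^sup>+t. (nn_average n g t - ennreal z) \<partial>L) \<le> (\<integral>\<^sup>+t. (\<Sum>j\<in>cells n. ?c j * indicator (cell n j) t) \<partial>L)"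
    proof (rule nn_integral_mono)
      fix t
      show "nn_average n g t - ennreal z \<le> (\<Sum>j\<in>cells n. ?c j * indicator (cell n j) t)"
      proof (cases "\<exists>j\<in>cells n. t \<in> cell n j")
        case False
        then show ?thesis by (subst nn_average_outside) auto
      next
        case True
        then obtain j where j: "j \<in> cells n" "t \<in> cell n j" by blast
        have "nn_average n g t - ennreal z \<le> ?c j"
        proof (rule ennreal_diff_le)
          have "nn_average n g t \<le> ennreal (2 ^ n) * (\<integral>\<^sup>+s. ((g s - ennreal z) + ennreal z) * indicator (cell n j) s \<partial>L)"
            unfolding nn_average_in_cell[OF j] by (intro mult_left_mono nn_integral_mono mult_right_mono ennreal_le_diff_add) auto
          also have "(\<integral>\<^sup>+s. ((g s - ennreal z) + ennreal z) * indicator (cell n j) s \<partial>L)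
            = (\<integral>\<^sup>+s. (g s - ennreal z) * indicator (cell n j) s \<partial>L) + ennreal z * ennreal (1 / 2 ^ n)"
            unfolding distrib_right using j(1)
            by (subst nn_integral_add) (auto simp: nn_integral_cmult_indicator emeasure_cell)
          also have "ennreal (2 ^ n) * \<dots> = ?c j + ennreal z * (ennreal (2 ^ n) * ennreal (1 / 2 ^ n))"
            by (simp only: distrib_left mult.left_commute)
          also have "\<dots> = ?c j + ennreal z" by (simp add: two_pow_cell)
          finally show "nn_average n g t \<le> ?c j + ennreal z" .
        qed
        also have "?c j = ?c j * indicator (cell n j) t" using j by simp
        also have "\<dots> \<le> (\<Sum>j\<in>cells n. ?c j * indicator (cell n j) t)"
          using j finite_cells by (intro member_le_sum) auto
        finally show ?thesis .
      qed
    qed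
    also have "\<dots> = (\<Sum>j\<in>cells n. ?c j * ennreal (1 / 2 ^ n))"
      by (subst nn_integral_sum) (auto simp: nn_integral_cmult_indicator emeasure_cell)
    also have "\<dots> = (\<Sum>j\<in>cells n. (\<integral>\<^sup>+s. (g s - ennreal z) * indicator (cell n j) s \<partial>L))"
    proof (rule sum.cong[OF refl])
      fix j
      have "?c j * ennreal (1 / 2 ^ n) = (ennreal (2 ^ n) * ennreal (1 / 2 ^ n)) * (\<integral>\<^sup>+s. (g s - ennreal z) * indicator (cell n j) s \<partial>L)"
        by (simp only: mult_ac)
      then show "?c j * ennreal (1 / 2 ^ n) = (\<integral>\<^sup>+s. (g s - ennreal z) * indicator (cell n j) s \<partial>L)"
        by (simp only: two_pow_cell mult_1)
    qed
    also have "\<dots> = (\<integral>\<^sup>+s. (\<Sum>j\<in>cells n. (g s - ennreal z) * indicator (cell n j) s) \<partial>L)"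
      by (rule nn_integral_sum[symmetric]) auto
    also have "\<dots> \<le> (\<integral>\<^sup>+t. (g t - ennreal z) \<partial>L)"
    proof (rule nn_integral_mono)
      fix s
      have "disjoint_family_on (cell n) (cells n)" using cell_disjoint by (auto simp: disjoint_family_on_def)
      then have "(\<Sum>j\<in>cells n. indicator (cell n j) s :: ennreal) = indicator (\<Union>j\<in>cells n. cell n j) s"
        by (rule indicator_UN_disjoint[OF finite_cells, symmetric])
      then show "(\<Sum>j\<in>cells n. (g s - ennreal z) * indicator (cell n j) s) \<le> g s - ennreal z"
        by (simp add: sum_distrib_left[symmetric] indicator_def)
    qed
    finally show ?thesis .
  qed
  have S: "S \<tau> (nn_average n g) \<le> S \<tau> g" for \<tau>
  proof -
    consider "\<tau> = 0" | "S \<tau> g = \<infinity>" | z where "0 \<le> z" "S \<tau> g = \<tau> * ennreal z + (\<integral>\<^sup>+t. (g t - ennreal z) \<partial>L)"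
      using S_attained[OF g] by blast
    then show ?thesis
    proof cases
      case 3
      have "S \<tau> (nn_average n g) \<le> \<tau> * ennreal z + (\<integral>\<^sup>+t. (nn_average n g t - ennreal z) \<partial>L)"
        using 3 by (intro S_le) auto
      also have "\<dots> \<le> S \<tau> g" unfolding 3(2) by (intro add_left_mono excess 3(1))
      finally show ?thesis .
    qed auto
  qed
  have "J (nn_average n g) = (\<integral>\<^sup>+r. S (level_length r) (nn_average n g) * indicator {0..} r \<partial>lborel)"
    by (rule J_eq_S) measurable
  also have "\<dots> \<le> (\<integral>\<^sup>+r. S (level_length r) g * indicator {0..} r \<partial>lborel)"
    by (intro nn_integral_mono mult_right_mono S) auto
  also have "\<dots> = J g" by (rule J_eq_S[symmetric]) measurable
  finally show ?thesis .
qed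

section \<open>Rademacher functions\<close>

definition rademacher :: "nat \<Rightarrow> real \<Rightarrow> real" where
  "rademacher n t = (if even (nat \<lfloor>2 ^ n * t\<rfloor>) then 1 else - 1)"

lemma rademacher_measurable [measurable]: "rademacher n \<in> borel_measurable L"
proof -
  have "rademacher n \<in> borel_measurable borel" unfolding rademacher_def[abs_def] by measurable
  then show ?thesis by (intro measurable_restrict_space1 measurable_completion) simp
qed

lemma abs_rademacher [simp]: "\<bar>rademacher n t\<bar> = 1"
  by (simp add: rademacher_def)

lemma rademacher_cell: "t \<in> cell n j \<Longrightarrow> rademacher n t = (if even j then 1 else - 1)"
  by (simp add: rademacher_def mem_cell_iff)

text \<open>The function of generation n + 1 has opposite signs on the two halves of a cell of
  generation n.\<close>

lemma rademacher_cell_integral: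
  assumes j: "j \<in> cells n" shows "set_lebesgue_integral L (cell n j) (rademacher (Suc n)) = 0"
proof -
  have half: "set_integrable L (cell (Suc n) i) (rademacher (Suc n))"
    "set_lebesgue_integral L (cell (Suc n) i) (rademacher (Suc n)) = (if even i then 1 else - 1) / 2 ^ Suc n"
    if i: "i \<in> cells (Suc n)" for i
  proof -
    let ?r = "if even i then 1 else - 1 :: real"
    have eq: "indicator (cell (Suc n) i) t *\<^sub>R rademacher (Suc n) t = ?r * indicator (cell (Suc n) i) t" for t
      by (auto simp: indicator_def rademacher_cell)
    show "set_integrable L (cell (Suc n) i) (rademacher (Suc n))"
      unfolding set_integrable_def eq using i emeasure_cell[OF i] by (intro integrable_mult_right integrable_real_indicator) auto
    show "set_lebesgue_integral L (cell (Suc n) i) (rademacher (Suc n)) = ?r / 2 ^ Suc n"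
      unfolding set_lebesgue_integral_def eq
      using i emeasure_cell[OF i] cell_sub_I[OF i] by (simp add: measure_def Int_absorb2)
  qed
  have "set_lebesgue_integral L (cell n j) (rademacher (Suc n))
     = set_lebesgue_integral L (cell (Suc n) (2 * j)) (rademacher (Suc n)) + set_lebesgue_integral L (cell (Suc n) (2 * j + 1)) (rademacher (Suc n))"
    unfolding cell_halves[of n j]
    by (rule set_integral_Un) (use half(1) cells_halves[OF j] cell_disjoint[of "2 * j" "2 * j + 1" "Suc n"] in auto)
  then show ?thesis using half(2) cells_halves[OF j] by simp
qed

text \<open>The average \<open>P n\<close> of the indicator of \<open>H\<close> is constant on cells
  of generation n and hence orthogonal to the Rademacher function of generation n + 1. As
  \<open>P n\<close> converges to the indicator in mean, the integral over \<open>H\<close> is at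
  most an error that tends to 0.\<close>

lemma rademacher_tendsto_0:
  assumes fin: "emeasure L I < \<infinity>" and H [measurable]: "H \<in> sets L"
  shows "(\<lambda>n. set_lebesgue_integral L H (rademacher n)) \<longlonglongrightarrow> 0"
proof -
  have I [measurable]: "I \<in> sets L" by (rule borel_Int_I) auto
  have fm: "finite_measure L" by (rule finite_measureI) (use fin in simp)
  interpret F: finite_measure L by (rule fm)
  define f where "f = (indicator H :: real \<Rightarrow> real)"
  have [measurable]: "f \<in> borel_measurable L" unfolding f_def by measurable
  have f_int: "integrable L f" unfolding f_def by (intro integrable_real_indicator) (simp_all add: F.emeasure_eq_measure)
  define P where "P n = step n (\<lambda>j. coeff n j f)" for n
  have P_lim: "AE t in L. (\<lambda>n. P n t) \<longlonglongrightarrow> f t"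
    unfolding P_def
  proof (rule step_coeff_tendsto_AE)
    fix R assume R: "R \<in> I"
    have "{0..R} \<in> sets L" using I_down[OF R] by (intro borel_Int_I) auto
    then show "set_integrable L {0..R} f" by (rule set_integrable_of_integrable[OF f_int])
  qed measurable
  have P_bound: "\<bar>P n t\<bar> \<le> 1" for n t
  proof (cases "\<exists>j\<in>cells n. t \<in> cell n j")
    case True
    then obtain j where j: "j \<in> cells n" "t \<in> cell n j" by blast
    have "coeff n j f = measure L (H \<inter> cell n j)"
    proof -
      have "coeff n j f = (\<integral>t. indicator (H \<inter> cell n j) t \<partial>L)"
        unfolding coeff_def set_lebesgue_integral_def f_def
        by (intro Bochner_Integration.integral_cong) (auto simp: indicator_def)
      then show ?thesis using cell_sub_I[OF j(1)] by (simp add: Int_absorb2 le_infI2)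
    qed
    moreover have "measure L (H \<inter> cell n j) \<le> measure L (cell n j)"
      using cell_sets[OF j(1)] by (intro F.finite_measure_mono) auto
    moreover have "measure L (cell n j) = 1 / 2 ^ n" using emeasure_cell[OF j(1)] by (simp add: measure_def)
    ultimately show ?thesis unfolding P_def step_in_cell[OF j] by (simp add: abs_mult field_simps)
  qed (auto simp: P_def step_outside)
  have Pm [measurable]: "P n \<in> borel_measurable L" for n unfolding P_def by measurable
  have "(\<lambda>n. \<integral>t. \<bar>f t - P n t\<bar> \<partial>L) \<longlonglongrightarrow> (\<integral>t. 0 \<partial>L)"
  proof (rule integral_dominated_convergence[where w="\<lambda>t. 2"])
    show "AE t in L. (\<lambda>n. \<bar>f t - P n t\<bar>) \<longlonglongrightarrow> 0"
      using P_lim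
    proof eventually_elim
      case (elim t)
      then have "(\<lambda>n. f t - P n t) \<longlonglongrightarrow> f t - f t" by (intro tendsto_intros)
      then show ?case by (intro tendsto_rabs_zero) simp
    qed
    show "AE t in L. norm \<bar>f t - P n t\<bar> \<le> 2" for n
    proof (rule AE_I2)
      fix t
      show "norm \<bar>f t - P n t\<bar> \<le> 2" using P_bound[of n t] by (auto simp: f_def indicator_def abs_le_iff)
    qed
  qed auto
  then have lim: "(\<lambda>n. \<integral>t. \<bar>f t - P n t\<bar> \<partial>L) \<longlonglongrightarrow> 0" by simp
  have P_int: "integrable L (P n)" for n
    using step_set_integrable[OF I, of n] unfolding P_def set_integrable_def
    by (rule Bochner_Integration.integrable_cong[THEN iffD1, rotated 2]) auto
  have P_rad: "(\<integral>t. P n t * rademacher (Suc n) t \<partial>L) = 0" for n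
  proof -
    have "(\<integral>t. P n t * rademacher (Suc n) t \<partial>L) = (\<integral>t. (\<Sum>j\<in>cells n. (coeff n j f * 2 ^ n) * (indicator (cell n j) t *\<^sub>R rademacher (Suc n) t)) \<partial>L)"
      by (simp add: P_def step_def sum_distrib_left sum_distrib_right mult_ac)
    also have "\<dots> = (\<Sum>j\<in>cells n. (coeff n j f * 2 ^ n) * set_lebesgue_integral L (cell n j) (rademacher (Suc n)))"
    proof (subst Bochner_Integration.integral_sum)
      fix j assume j: "j \<in> cells n"
      have "integrable L (\<lambda>t. indicator (cell n j) t *\<^sub>R rademacher (Suc n) t)"
        using j emeasure_cell[OF j] by (intro F.integrable_const_bound[where B=1]) (auto simp: indicator_def)
      then show "integrable L (\<lambda>t. coeff n j f * 2 ^ n * (indicator (cell n j) t *\<^sub>R rademacher (Suc n) t))"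
        by (rule integrable_mult_right)
    qed (simp add: set_lebesgue_integral_def)
    also have "\<dots> = 0" by (simp add: rademacher_cell_integral)
    finally show ?thesis .
  qed
  have le: "norm (set_lebesgue_integral L H (rademacher (Suc n))) \<le> (\<integral>t. \<bar>f t - P n t\<bar> \<partial>L)" for n
  proof -
    have int: "integrable L (\<lambda>t. f t * rademacher (Suc n) t)" "integrable L (\<lambda>t. P n t * rademacher (Suc n) t)"
      using P_bound by (auto intro!: F.integrable_const_bound[where B=1] simp: f_def indicator_def abs_mult)
    have "set_lebesgue_integral L H (rademacher (Suc n)) = (\<integral>t. f t * rademacher (Suc n) t \<partial>L) - (\<integral>t. P n t * rademacher (Suc n) t \<partial>L)"
      unfolding P_rad by (simp add: set_lebesgue_integral_def f_def)
    also have "\<dots> = (\<integral>t. (f t - P n t) * rademacher (Suc n) t \<partial>L)"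
      using int by (subst Bochner_Integration.integral_diff[symmetric]) (auto simp: left_diff_distrib)
    also have "norm \<dots> \<le> (\<integral>t. norm ((f t - P n t) * rademacher (Suc n) t) \<partial>L)" by (rule integral_norm_bound)
    finally show ?thesis by (simp add: abs_mult)
  qed
  have "(\<lambda>n. set_lebesgue_integral L H (rademacher (Suc n))) \<longlonglongrightarrow> 0"
    by (rule Lim_null_comparison[OF _ lim]) (use le in simp)
  then show ?thesis by (rule LIMSEQ_imp_Suc)
qed

end

section \<open>Orlicz--Lorentz spaces\<close>

lemma sum_fun_apply: "(sum f A) x = (\<Sum>i\<in>A. f i x)"
  for f :: "'i \<Rightarrow> 'a \<Rightarrow> 'b::comm_monoid_add"
  by (induction A rule: infinite_finite_induct) auto

locale orlicz_lorentz = weighted_interval +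
  fixes \<phi> :: "real \<Rightarrow> real"
  assumes orlicz: "orlicz_function \<phi>"
begin

abbreviation "X \<equiv> orlicz_lorentz_space \<gamma> \<phi> w"
abbreviation "N \<equiv> luxemburg_norm \<gamma> \<phi> w"

section \<open>Elementary properties of the Orlicz function\<close>

lemma phi_0 [simp]: "\<phi> 0 = 0"
  using orlicz by (simp add: orlicz_function_def)

lemma phi_nonneg: "0 \<le> u \<Longrightarrow> 0 \<le> \<phi> u"
  using orlicz by (simp add: orlicz_function_def)

lemma phi_convex: "0 \<le> u \<Longrightarrow> 0 \<le> v \<Longrightarrow> 0 \<le> a \<Longrightarrow> 0 \<le> b \<Longrightarrow> a + b = 1 \<Longrightarrow>
    \<phi> (a * u + b * v) \<le> a * \<phi> u + b * \<phi> v"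
  using orlicz unfolding orlicz_function_def convex_on_def by auto

lemma phi_scale: "0 \<le> v \<Longrightarrow> 0 \<le> a \<Longrightarrow> a \<le> 1 \<Longrightarrow> \<phi> (a * v) \<le> a * \<phi> v"
  using phi_convex[of v 0 a "1 - a"] by simp

lemma phi_mono: assumes "0 \<le> u" "u \<le> v" shows "\<phi> u \<le> \<phi> v"
proof (cases "v = 0")
  case True then show ?thesis using assms by simp
next
  case False
  then have "\<phi> ((u / v) * v) \<le> (u / v) * \<phi> v" using assms by (intro phi_scale) auto
  also have "\<dots> \<le> 1 * \<phi> v" using assms False by (intro mult_right_mono phi_nonneg) auto
  finally show ?thesis using False by simp
qed

lemma phi_ratio_mono: assumes "0 < u" "u \<le> v" shows "\<phi> u / u \<le> \<phi> v / v"
proof -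
  have "\<phi> ((u / v) * v) \<le> (u / v) * \<phi> v" using assms by (intro phi_scale) auto
  then show ?thesis using assms by (simp add: field_simps)
qed

lemma phi_pos_at: "\<exists>u>0. 0 < \<phi> u"
proof -
  obtain u where "0 \<le> u" "\<phi> u \<noteq> 0" using orlicz by (auto simp: orlicz_function_def)
  then show ?thesis using phi_nonneg[of u] by (intro exI[of _ u]) (cases "u = 0"; auto simp: less_le)
qed

text \<open>Since \<phi>(u)/u increases, beyond a point \<open>u0\<close> with positive value \<phi>
  lies above the line through the origin and the graph at \<open>u0\<close>; the constant takes care
  of smaller u. The minorant turns bounds on the modular into bounds on integrals.\<close>

lemma phi_affine_lower: "\<exists>l>0. \<exists>c\<ge>0. \<forall>u\<ge>0. l * u - c \<le> \<phi> u"
proof -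
  obtain u0 where u0: "0 < u0" "0 < \<phi> u0" using phi_pos_at by blast
  have "\<phi> u0 / u0 * u - \<phi> u0 \<le> \<phi> u" if "0 \<le> u" for u
  proof (cases "u0 \<le> u")
    case True
    then have "\<phi> u0 / u0 * u \<le> \<phi> u / u * u" using phi_ratio_mono[of u0 u] u0 by (intro mult_right_mono) auto
    then show ?thesis using True u0 by simp
  next
    case False
    then have "\<phi> u0 / u0 * u \<le> \<phi> u0 / u0 * u0" using u0 by (intro mult_left_mono) auto
    then show ?thesis using u0 phi_nonneg[OF that] by simp
  qed
  then show ?thesis using u0 by (intro exI[of _ "\<phi> u0 / u0"]) (auto intro!: exI[of _ "\<phi> u0"])
qed

text \<open>The even extension is convex on the whole line, which is open; this gives continuity
  also at 0, and supporting lines at every point.\<close>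

lemma phi_abs_convex: "convex_on UNIV (\<lambda>u. \<phi> \<bar>u\<bar>)"
proof (rule convex_onI)
  fix t x y :: real assume t: "0 < t" "t < 1"
  have "\<phi> \<bar>(1 - t) *\<^sub>R x + t *\<^sub>R y\<bar> \<le> \<phi> ((1 - t) * \<bar>x\<bar> + t * \<bar>y\<bar>)"
    using t by (intro phi_mono order_trans[OF abs_triangle_ineq]) (auto simp: abs_mult)
  also have "\<dots> \<le> (1 - t) * \<phi> \<bar>x\<bar> + t * \<phi> \<bar>y\<bar>" using t by (intro phi_convex) auto
  finally show "\<phi> \<bar>(1 - t) *\<^sub>R x + t *\<^sub>R y\<bar> \<le> (1 - t) * \<phi> \<bar>x\<bar> + t * \<phi> \<bar>y\<bar>" .
qed auto

lemma phi_abs_continuous: "continuous_on UNIV (\<lambda>u. \<phi> \<bar>u\<bar>)"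
  by (rule convex_on_continuous[OF open_UNIV phi_abs_convex])

lemma phi_abs_measurable [measurable]: "(\<lambda>u. \<phi> \<bar>u\<bar>) \<in> borel_measurable borel"
  by (rule borel_measurable_continuous_onI[OF phi_abs_continuous])

lemma phi_tendsto: "((\<lambda>n. f n) \<longlongrightarrow> a) F \<Longrightarrow> ((\<lambda>n. \<phi> \<bar>f n\<bar>) \<longlongrightarrow> \<phi> \<bar>a\<bar>) F"
  using continuous_on_tendsto_compose[OF phi_abs_continuous] by simp

text \<open>The threshold is the largest point at which \<phi> is at most \<open>s\<close>; it
  exists because \<phi> is continuous and unbounded. It turns level sets of \<phi>(|f|) into level
  sets of |f|.\<close>

lemma phi_threshold:
  assumes "0 \<le> s" shows "\<exists>r\<ge>0. \<forall>u\<ge>0. s < \<phi> u \<longleftrightarrow> r < u"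
proof -
  define A where "A = {u. 0 \<le> u \<and> \<phi> \<bar>u\<bar> \<le> s}"
  obtain l c where lc: "0 < l" "\<forall>u\<ge>0. l * u - c \<le> \<phi> u" using phi_affine_lower by blast
  have bdd: "bdd_above A"
  proof (rule bdd_aboveI)
    fix u assume "u \<in> A"
    then have "l * u - c \<le> s" using lc(2) by (force simp: A_def)
    then show "u \<le> (s + c) / l" using lc(1) by (simp add: field_simps)
  qed
  have ne: "A \<noteq> {}" using assms by (auto simp: A_def intro!: exI[of _ 0])
  have "closed A" unfolding A_def
    by (intro closed_Collect_conj closed_Collect_le continuous_intros phi_abs_continuous)
  then have r: "Sup A \<in> A" using closed_contains_Sup[OF ne bdd] by simp
  have "s < \<phi> u \<longleftrightarrow> Sup A < u" if "0 \<le> u" for u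
  proof
    assume "s < \<phi> u"
    then show "Sup A < u" using r phi_mono[of u "Sup A"] that by (force simp: A_def)
  next
    assume "Sup A < u"
    then show "s < \<phi> u" using cSup_upper[OF _ bdd, of u] that by (force simp: A_def)
  qed
  then show ?thesis using r by (auto simp: A_def)
qed

text \<open>The rearrangement is a generalized inverse of the distribution function. One direction
  uses right continuity of the latter: the level set at \<open>r\<close> is the increasing union of
  the level sets at \<open>r + 1 / (n + 1)\<close>.\<close>

lemma rearrangement_greater_iff:
  assumes [measurable]: "f \<in> borel_measurable L" and "0 \<le> r"
  shows "ennreal r < decreasing_rearrangement \<gamma> f t \<longleftrightarrow> ennreal t < distribution_fun \<gamma> f r"
proof
  have anti: "distribution_fun \<gamma> f b \<le> distribution_fun \<gamma> f a" if "a \<le> b" for a b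
  proof -
    have "{t \<in> space L. a < \<bar>f t\<bar>} \<in> sets L" by measurable
    then show ?thesis unfolding distribution_fun_def using that
      by (intro emeasure_mono) (auto simp: sets_L_iff)
  qed
  {
    assume less: "ennreal t < distribution_fun \<gamma> f r"
    have meas: "{t \<in> I. r + 1 / real (Suc n) < \<bar>f t\<bar>} \<in> sets lebesgue" for n
    proof -
      have "{t \<in> space L. r + 1 / real (Suc n) < \<bar>f t\<bar>} \<in> sets L" by measurable
      then show ?thesis by (simp add: sets_L_iff)
    qed
    have "{t \<in> I. r < \<bar>f t\<bar>} = (\<Union>n. {t \<in> I. r + 1 / real (Suc n) < \<bar>f t\<bar>})"
    proof (intro equalityI subsetI)
      fix t assume t: "t \<in> {t \<in> I. r < \<bar>f t\<bar>}"
      then obtain n where "inverse (real (Suc n)) < \<bar>f t\<bar> - r" using reals_Archimedean[of "\<bar>f t\<bar> - r"] by auto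
      then show "t \<in> (\<Union>n. {t \<in> I. r + 1 / real (Suc n) < \<bar>f t\<bar>})"
        using t by (auto simp: inverse_eq_divide intro!: exI[of _ n])
    next
      fix t assume "t \<in> (\<Union>n. {t \<in> I. r + 1 / real (Suc n) < \<bar>f t\<bar>})"
      then obtain n where n: "t \<in> I" "r + 1 / real (Suc n) < \<bar>f t\<bar>" by auto
      have "0 < 1 / real (Suc n)" by simp
      then have "r < \<bar>f t\<bar>" using n(2) by linarith
      then show "t \<in> {t \<in> I. r < \<bar>f t\<bar>}" using n by simp
    qed
    then have "distribution_fun \<gamma> f r = emeasure lebesgue (\<Union>n. {t \<in> I. r + 1 / real (Suc n) < \<bar>f t\<bar>})"
      by (simp add: distribution_fun_def)
    also have "\<dots> = (SUP n. emeasure lebesgue {t \<in> I. r + 1 / real (Suc n) < \<bar>f t\<bar>})"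
    proof (rule SUP_emeasure_incseq[symmetric])
      show "range (\<lambda>n. {t \<in> I. r + 1 / real (Suc n) < \<bar>f t\<bar>}) \<subseteq> sets lebesgue" using meas by blast
      show "incseq (\<lambda>n. {t \<in> I. r + 1 / real (Suc n) < \<bar>f t\<bar>})"
      proof (rule incseq_SucI, rule subsetI)
        fix n t assume t: "t \<in> {t \<in> I. r + 1 / real (Suc n) < \<bar>f t\<bar>}"
        have "1 / real (Suc (Suc n)) \<le> 1 / real (Suc n)" by (simp add: frac_le)
        then show "t \<in> {t \<in> I. r + 1 / real (Suc (Suc n)) < \<bar>f t\<bar>}" using t by auto
      qed
    qed
    finally have "\<exists>n. ennreal t < emeasure lebesgue {t \<in> I. r + 1 / real (Suc n) < \<bar>f t\<bar>}"
      using less by (simp only: less_SUP_iff) blast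
    then obtain n where n: "ennreal t < distribution_fun \<gamma> f (r + 1 / real (Suc n))"
      unfolding distribution_fun_def by blast
    have "ennreal r < ennreal (r + 1 / real (Suc n))"
      using assms(2) by (intro ennreal_lessI) (auto simp: add_pos_nonneg intro: add_nonneg_pos)
    also have "\<dots> \<le> decreasing_rearrangement \<gamma> f t"
      unfolding decreasing_rearrangement_def
    proof (rule Inf_greatest)
      fix x assume "x \<in> {ennreal r |r. 0 < r \<and> distribution_fun \<gamma> f r \<le> ennreal t}"
      then obtain q where q: "x = ennreal q" "0 < q" "distribution_fun \<gamma> f q \<le> ennreal t" by auto
      have "r + 1 / real (Suc n) < q"
      proof (rule ccontr)
        assume "\<not> ?thesis"
        then have "distribution_fun \<gamma> f (r + 1 / real (Suc n)) \<le> distribution_fun \<gamma> f q" by (intro anti) simp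
        then show False using q(3) n by (meson leD order_trans)
      qed
      then show "ennreal (r + 1 / real (Suc n)) \<le> x" using q by (simp add: ennreal_leI)
    qed
    finally show "ennreal r < decreasing_rearrangement \<gamma> f t" .
  }
  {
    assume less: "ennreal r < decreasing_rearrangement \<gamma> f t"
    show "ennreal t < distribution_fun \<gamma> f r"
    proof (rule ccontr)
      assume "\<not> ?thesis"
      then have le: "distribution_fun \<gamma> f r \<le> ennreal t" by simp
      have "decreasing_rearrangement \<gamma> f t \<le> ennreal q" if "r < q" for q
        unfolding decreasing_rearrangement_def
        using that assms(2) order_trans[OF anti le, of q] by (intro Inf_lower) auto
      moreover obtain q where "r < q" "ennreal q < decreasing_rearrangement \<gamma> f t"
      proof -
        obtain y where y: "ennreal r < y" "y < decreasing_rearrangement \<gamma> f t" using less dense by blast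
        then obtain q where q: "y = ennreal q" "0 \<le> q" by (cases y) auto
        then show ?thesis using that[of q] y assms(2) by (simp add: ennreal_less_iff)
      qed
      ultimately show False by (meson leD)
    qed
  }
qed

section \<open>The modular in terms of distribution functions\<close>

definition Mod :: "(real \<Rightarrow> real) \<Rightarrow> ennreal" where
  "Mod f = J (\<lambda>t. ennreal (\<phi> \<bar>f t\<bar>))"

lemma phi_comp_measurable [measurable]:
  "f \<in> borel_measurable L \<Longrightarrow> (\<lambda>t. ennreal (\<phi> \<bar>f t\<bar>)) \<in> borel_measurable L"
  by (intro measurable_compose[OF _ measurable_ennreal] measurable_compose[OF _ phi_abs_measurable])

text \<open>Both sides are sliced into levels. The superlevel set at s of \<phi> applied to the
  rearrangement is an initial interval whose length is the distribution function of \<phi>(|f|) at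
  s. After this lemma the rearrangement does not occur again.\<close>

lemma modular_eq:
  assumes f [measurable]: "f \<in> borel_measurable L"
  shows "orlicz_lorentz_modular \<gamma> \<phi> w f = Mod f"
proof -
  define g where "g t = extend_to_infinity \<phi> (decreasing_rearrangement \<gamma> f t)" for t
  obtain r where r: "\<And>s. 0 \<le> s \<Longrightarrow> 0 \<le> r s" "\<And>s u. 0 \<le> s \<Longrightarrow> 0 \<le> u \<Longrightarrow> s < \<phi> u \<longleftrightarrow> r s < u"
    using phi_threshold by metis
  have g_iff: "ennreal s < g t \<longleftrightarrow> ennreal t < distribution_fun \<gamma> f (r s)" if s: "0 \<le> s" for s t
  proof -
    have "ennreal s < extend_to_infinity \<phi> x \<longleftrightarrow> ennreal (r s) < x" for x
    proof (cases x)
      case (real u)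
      then show ?thesis using r(2)[OF s, of u] r(1)[OF s] s
        by (simp add: extend_to_infinity_def ennreal_less_iff)
    next
      case top then show ?thesis by (simp add: extend_to_infinity_def)
    qed
    then show ?thesis unfolding g_def using rearrangement_greater_iff[OF f r(1)[OF s]] by simp
  qed
  have [measurable]: "g \<in> borel_measurable L"
  proof (rule borel_measurableI_greater)
    fix y :: ennreal
    show "{t \<in> space L. y < g t} \<in> sets L"
    proof (cases y)
      case (real s)
      have "{t \<in> space L. ennreal t < distribution_fun \<gamma> f (r s)} \<in> sets L" by measurable
      then show ?thesis using real g_iff by simp
    next
      case top then show ?thesis by simp
    qed
  qed
  have "orlicz_lorentz_modular \<gamma> \<phi> w f
     = (\<integral>\<^sup>+s. (\<integral>\<^sup>+t. ennreal (w t) * indicator {t. ennreal s < g t} t \<partial>L) * indicator {0..} s \<partial>lborel)"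
    unfolding orlicz_lorentz_modular_def g_def[symmetric]
    by (rule nn_integral_layer_cake[OF L.sigma_finite_measure_axioms]) measurable
  also have "\<dots> = Mod f"
    unfolding Mod_def J_def
  proof (rule nn_integral_cong)
    fix s :: real
    show "(\<integral>\<^sup>+t. ennreal (w t) * indicator {t. ennreal s < g t} t \<partial>L) * indicator {0..} s
      = W (dist_at (\<lambda>t. ennreal (\<phi> \<bar>f t\<bar>)) s) * indicator {0..} s"
    proof (cases "0 \<le> s")
      case True
      have eq: "{t \<in> I. ennreal s < ennreal (\<phi> \<bar>f t\<bar>)} = {t \<in> I. r s < \<bar>f t\<bar>}"
        using True r(2)[OF True] by (auto simp: ennreal_less_iff)
      have "{t \<in> space L. r s < \<bar>f t\<bar>} \<in> sets L" by measurable
      then have "dist_at (\<lambda>t. ennreal (\<phi> \<bar>f t\<bar>)) s = distribution_fun \<gamma> f (r s)"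
        unfolding dist_at_def distribution_fun_def eq by (intro L_le_lebesgue) simp
      then show ?thesis using g_iff[OF True] by (simp add: W_def)
    qed simp
  qed
  finally show ?thesis .
qed

section \<open>The space and its Luxemburg norm\<close>

lemma X_iff: "f \<in> X \<longleftrightarrow> f \<in> borel_measurable L \<and> (\<exists>k>0. Mod (\<lambda>t. k * f t) < \<infinity>)"
proof -
  have "(\<lambda>t. k * f t) \<in> borel_measurable L" if "f \<in> borel_measurable L" for k
    using that by measurable
  then show ?thesis unfolding orlicz_lorentz_space_def using modular_eq by auto
qed

lemma X_measurable [measurable_dest]: "f \<in> X \<Longrightarrow> f \<in> borel_measurable L"
  by (simp add: X_iff)

lemma N_eq: "f \<in> borel_measurable L \<Longrightarrow> N f = Inf {e. 0 < e \<and> Mod (\<lambda>t. f t / e) \<le> 1}"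
proof -
  assume f [measurable]: "f \<in> borel_measurable L"
  have "orlicz_lorentz_modular \<gamma> \<phi> w (\<lambda>t. f t / e) = Mod (\<lambda>t. f t / e)" for e
    by (rule modular_eq) measurable
  then show ?thesis unfolding luxemburg_norm_def by simp
qed

lemma Mod_mono_AE:
  assumes "AE t in L. \<bar>f t\<bar> \<le> \<bar>g t\<bar>" and [measurable]: "g \<in> borel_measurable L"
  shows "Mod f \<le> Mod g"
  unfolding Mod_def
proof (rule J_mono_AE)
  show "AE t in L. ennreal (\<phi> \<bar>f t\<bar>) \<le> ennreal (\<phi> \<bar>g t\<bar>)"
    using assms(1) by eventually_elim (intro ennreal_leI phi_mono, auto)
qed measurable

lemma Mod_mono:
  assumes "\<And>t. t \<in> I \<Longrightarrow> \<bar>f t\<bar> \<le> \<bar>g t\<bar>" and "g \<in> borel_measurable L"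
  shows "Mod f \<le> Mod g"
  by (rule Mod_mono_AE[OF AE_I2 assms(2)]) (use assms(1) in simp)

lemma Mod_convex:
  assumes [measurable]: "f \<in> borel_measurable L" "g \<in> borel_measurable L" and ab: "0 < a" "0 < b" "a + b = 1"
  shows "Mod (\<lambda>t. a * f t + b * g t) \<le> ennreal a * Mod f + ennreal b * Mod g"
proof -
  have "Mod (\<lambda>t. a * f t + b * g t) \<le> J (\<lambda>t. ennreal a * ennreal (\<phi> \<bar>f t\<bar>) + ennreal b * ennreal (\<phi> \<bar>g t\<bar>))"
    unfolding Mod_def
  proof (rule J_mono_AE[OF AE_I2])
    fix t
    have "\<phi> \<bar>a * f t + b * g t\<bar> \<le> \<phi> (a * \<bar>f t\<bar> + b * \<bar>g t\<bar>)"
      using ab by (intro phi_mono order_trans[OF abs_triangle_ineq]) (auto simp: abs_mult)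
    also have "\<dots> \<le> a * \<phi> \<bar>f t\<bar> + b * \<phi> \<bar>g t\<bar>" using ab by (intro phi_convex) auto
    finally have "ennreal (\<phi> \<bar>a * f t + b * g t\<bar>) \<le> ennreal (a * \<phi> \<bar>f t\<bar> + b * \<phi> \<bar>g t\<bar>)"
      by (rule ennreal_leI)
    then show "ennreal (\<phi> \<bar>a * f t + b * g t\<bar>) \<le> ennreal a * ennreal (\<phi> \<bar>f t\<bar>) + ennreal b * ennreal (\<phi> \<bar>g t\<bar>)"
      using ab by (simp add: ennreal_plus ennreal_mult phi_nonneg)
  qed measurable
  also have "\<dots> \<le> ennreal a * Mod f + ennreal b * Mod g"
    unfolding Mod_def using ab by (intro J_comb_le) measurable
  finally show ?thesis .
qed

lemma Mod_0 [simp]: "Mod (\<lambda>t. 0) = 0"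
  using J_indicator[of "{}" 0] by (simp add: Mod_def)

lemma Mod_scale:
  assumes [measurable]: "f \<in> borel_measurable L" and a: "0 < a" "a \<le> 1"
  shows "Mod (\<lambda>t. a * f t) \<le> ennreal a * Mod f"
proof (cases "a = 1")
  case False
  have "Mod (\<lambda>t. a * f t + (1 - a) * 0) \<le> ennreal a * Mod f + ennreal (1 - a) * Mod (\<lambda>t. 0)"
    using a False by (intro Mod_convex) auto
  then show ?thesis by simp
qed simp

lemma X_witness:
  assumes f: "f \<in> X" shows "\<exists>e>0. Mod (\<lambda>t. f t / e) \<le> 1"
proof -
  note [measurable] = X_measurable[OF f]
  obtain k where k: "0 < k" "Mod (\<lambda>t. k * f t) < \<infinity>" using f X_iff by blast
  obtain m where m: "0 \<le> m" "Mod (\<lambda>t. k * f t) = ennreal m" using k(2)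
    by (cases "Mod (\<lambda>t. k * f t)") auto
  \<comment> \<open>By convexity a factor \<open>a\<close> of at most 1 multiplies the modular by at
    most \<open>a\<close>, which brings the finite value \<open>m\<close> below 1.\<close>
  define a where "a = 1 / (m + 1)"
  have a: "0 < a" "a \<le> 1" "a * m \<le> 1" using m by (auto simp: a_def field_simps)
  have "Mod (\<lambda>t. a * (k * f t)) \<le> ennreal a * Mod (\<lambda>t. k * f t)" using a by (intro Mod_scale) auto
  also have "\<dots> \<le> 1" using m a by (simp flip: ennreal_mult ennreal_1)
  finally have "Mod (\<lambda>t. f t / (1 / (a * k))) \<le> 1" by (simp add: mult_ac)
  then show ?thesis using a k by (intro exI[of _ "1 / (a * k)"]) auto
qed

lemma N_bdd: "bdd_below {e. 0 < e \<and> P e}" for P :: "real \<Rightarrow> bool"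
  by (rule bdd_belowI[of _ 0]) auto

lemma N_le:
  assumes "f \<in> borel_measurable L" "0 < e" "Mod (\<lambda>t. f t / e) \<le> 1" shows "N f \<le> e"
  unfolding N_eq[OF assms(1)] by (rule cInf_lower[OF _ N_bdd]) (use assms in simp)

lemma N_nonneg: assumes "f \<in> X" shows "0 \<le> N f"
  unfolding N_eq[OF X_measurable[OF assms]]
  by (rule cInf_greatest) (use X_witness[OF assms] in auto)

lemma N_less:
  assumes f: "f \<in> X" and "N f < e" shows "Mod (\<lambda>t. f t / e) \<le> 1"
proof -
  note [measurable] = X_measurable[OF f]
  obtain d where d: "0 < d" "Mod (\<lambda>t. f t / d) \<le> 1" "d < e"
    using assms(2) X_witness[OF f] unfolding N_eq[OF X_measurable[OF f]]
    by (subst (asm) cInf_less_iff[OF _ N_bdd]) auto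
  have "Mod (\<lambda>t. f t / e) \<le> Mod (\<lambda>t. f t / d)"
    using d by (intro Mod_mono) (auto simp: abs_divide intro!: divide_left_mono)
  then show ?thesis using d(2) by simp
qed

lemma X_I: "f \<in> borel_measurable L \<Longrightarrow> 0 < e \<Longrightarrow> Mod (\<lambda>t. f t / e) < \<infinity> \<Longrightarrow> f \<in> X"
  unfolding X_iff by (auto intro!: exI[of _ "1 / e"])

lemma X_mono_AE:
  assumes g: "g \<in> X" and f [measurable]: "f \<in> borel_measurable L" and le: "AE t in L. \<bar>f t\<bar> \<le> \<bar>g t\<bar>"
  shows "f \<in> X" "N f \<le> N g"
proof -
  note [measurable] = X_measurable[OF g]
  have mono: "Mod (\<lambda>t. f t / e) \<le> Mod (\<lambda>t. g t / e)" if "0 < e" for e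
  proof (rule Mod_mono_AE)
    show "AE t in L. \<bar>f t / e\<bar> \<le> \<bar>g t / e\<bar>"
      using le by eventually_elim (use that in \<open>simp add: abs_divide divide_right_mono\<close>)
  qed measurable
  obtain e where e: "0 < e" "Mod (\<lambda>t. g t / e) \<le> 1" using X_witness[OF g] by blast
  show "f \<in> X" by (rule X_I[OF f e(1)]) (use mono[OF e(1)] e(2) in \<open>simp add: order_le_less_trans\<close>)
  show "N f \<le> N g"
  proof (rule dense_ge)
    fix e assume e: "N g < e"
    then have "0 < e" using N_nonneg[OF g] by linarith
    then show "N f \<le> e" using N_less[OF g e] mono[of e] f by (intro N_le) (auto intro: order_trans)
  qed
qed

lemma X_0: "(\<lambda>t. 0) \<in> X" and N_0: "N (\<lambda>t. 0) = 0"
proof -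
  show 0: "(\<lambda>t. 0) \<in> X" unfolding X_iff by (auto intro!: exI[of _ 1])
  have "N (\<lambda>t. 0) \<le> e" if "0 < e" for e using that by (intro N_le) auto
  then have "N (\<lambda>t. 0) \<le> 0" by (rule dense_ge)
  then show "N (\<lambda>t. 0) = 0" using N_nonneg[OF 0] by simp
qed

lemma X_scale: assumes f: "f \<in> X" shows "(\<lambda>t. c * f t) \<in> X" and "N (\<lambda>t. c * f t) \<le> \<bar>c\<bar> * N f"
proof -
  note [measurable] = X_measurable[OF f]
  have *: "(\<lambda>t. c * f t) \<in> X \<and> N (\<lambda>t. c * f t) \<le> \<bar>c\<bar> * N f"
  proof (cases "c = 0")
    case True then show ?thesis using X_0 N_0 by simp
  next
    case False
    have eq: "Mod (\<lambda>t. c * f t / (\<bar>c\<bar> * e)) \<le> Mod (\<lambda>t. f t / e)" for e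
      using False by (intro Mod_mono) (auto simp: abs_mult abs_divide)
    obtain e where e: "0 < e" "Mod (\<lambda>t. f t / e) \<le> 1" using X_witness[OF f] by blast
    have "(\<lambda>t. c * f t) \<in> X"
      by (rule X_I[of _ "\<bar>c\<bar> * e"]) (use False e eq[of e] in \<open>auto simp: order_le_less_trans\<close>)
    moreover have "N (\<lambda>t. c * f t) / \<bar>c\<bar> \<le> N f"
    proof (rule dense_ge)
      fix e assume e: "N f < e"
      then have "0 < e" using N_nonneg[OF f] by linarith
      then have "N (\<lambda>t. c * f t) \<le> \<bar>c\<bar> * e"
        using False eq[of e] N_less[OF f e] by (intro N_le) (auto intro: order_trans)
      then show "N (\<lambda>t. c * f t) / \<bar>c\<bar> \<le> e" using False by (simp add: field_simps)
    qed
    ultimately show ?thesis using False by (simp add: field_simps)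
  qed
  show "(\<lambda>t. c * f t) \<in> X" "N (\<lambda>t. c * f t) \<le> \<bar>c\<bar> * N f" using * by auto
qed

lemma X_add: assumes f: "f \<in> X" and g: "g \<in> X"
  shows "(\<lambda>t. f t + g t) \<in> X" and "N (\<lambda>t. f t + g t) \<le> N f + N g"
proof -
  note [measurable] = X_measurable[OF f] X_measurable[OF g]
  have key: "Mod (\<lambda>t. (f t + g t) / (a + b)) \<le> 1"
    if ab: "N f < a" "N g < b" for a b
  proof -
    have pos: "0 < a" "0 < b" using ab N_nonneg[OF f] N_nonneg[OF g] by linarith+
    have eq: "(f t + g t) / (a + b) = a / (a + b) * (f t / a) + b / (a + b) * (g t / b)" for t
      using pos by (simp add: add_divide_distrib)
    have "Mod (\<lambda>t. (f t + g t) / (a + b)) \<le> ennreal (a / (a + b)) * Mod (\<lambda>t. f t / a) + ennreal (b / (a + b)) * Mod (\<lambda>t. g t / b)"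
      unfolding eq
    proof (rule Mod_convex)
      show "a / (a + b) + b / (a + b) = 1" using pos by (simp add: add_divide_distrib[symmetric])
    qed (use pos in \<open>measurable, auto\<close>)
    also have "\<dots> \<le> ennreal (a / (a + b)) * 1 + ennreal (b / (a + b)) * 1"
      using N_less[OF f ab(1)] N_less[OF g ab(2)] by (intro add_mono mult_left_mono) auto
    also have "\<dots> = 1" using pos by (simp add: ennreal_plus[symmetric] add_divide_distrib[symmetric] del: ennreal_plus)
    finally show ?thesis .
  qed
  show "(\<lambda>t. f t + g t) \<in> X"
    by (rule X_I[of _ "(N f + 1) + (N g + 1)"])
       (use key[of "N f + 1" "N g + 1"] N_nonneg[OF f] N_nonneg[OF g] in \<open>auto simp: order_le_less_trans\<close>)
  show "N (\<lambda>t. f t + g t) \<le> N f + N g"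
  proof (rule field_le_epsilon)
    fix e :: real assume e: "0 < e"
    have "N (\<lambda>t. f t + g t) \<le> (N f + e / 2) + (N g + e / 2)"
      using key[of "N f + e / 2" "N g + e / 2"] e N_nonneg[OF f] N_nonneg[OF g] by (intro N_le) auto
    then show "N (\<lambda>t. f t + g t) \<le> N f + N g + e" by simp
  qed
qed

lemma N_tendsto_0:
  assumes [measurable]: "\<And>n. f n \<in> borel_measurable L"
    and lim: "\<And>k. 0 < k \<Longrightarrow> (\<lambda>n. Mod (\<lambda>t. k * f n t)) \<longlonglongrightarrow> 0"
    and X: "\<And>n. f n \<in> X"
  shows "(\<lambda>n. N (f n)) \<longlonglongrightarrow> 0"
proof (rule order_tendstoI)
  fix a :: real assume "a < 0"
  then show "eventually (\<lambda>n. a < N (f n)) sequentially"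
    using N_nonneg[OF X] by (auto intro!: always_eventually simp: less_le_trans)
next
  fix a :: real assume a: "0 < a"
  \<comment> \<open>A modular of at most 1 after division by \<open>a / 2\<close> gives norm at most
    \<open>a / 2\<close>, which is strictly below \<open>a\<close>.\<close>
  have "eventually (\<lambda>n. Mod (\<lambda>t. (2 / a) * f n t) < 1) sequentially"
    using lim[of "2 / a"] a by (intro order_tendstoD(2)[of _ 0]) auto
  then show "eventually (\<lambda>n. N (f n) < a) sequentially"
  proof eventually_elim
    case (elim n)
    then have "N (f n) \<le> a / 2" using a by (intro N_le) (auto simp: mult.commute)
    then show ?case using a by simp
  qed
qed

text \<open>All multiples of \<open>h\<close> must have finite modular, not just one: norm
  convergence means convergence of the modular for every multiple. For arbitrary elements of the
  space this is supplied by the doubling condition through \<open>Mod_finite\<close>.\<close>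

lemma N_dominated:
  assumes [measurable]: "\<And>n. f n \<in> borel_measurable L" "h \<in> borel_measurable L"
    and lim: "AE t in L. (\<lambda>n. f n t) \<longlonglongrightarrow> 0" and le: "\<And>n. AE t in L. \<bar>f n t\<bar> \<le> \<bar>h t\<bar>"
    and fin: "\<And>k. 0 < k \<Longrightarrow> Mod (\<lambda>t. k * h t) < \<infinity>"
  shows "(\<lambda>n. N (f n)) \<longlonglongrightarrow> 0"
proof (rule N_tendsto_0)
  have "h \<in> X" using fin[of 1] by (auto simp: X_iff intro!: exI[of _ 1])
  then show "f n \<in> X" for n by (rule X_mono_AE(1)[OF _ _ le]) measurable
  fix k :: real assume k: "0 < k"
  show "(\<lambda>n. Mod (\<lambda>t. k * f n t)) \<longlonglongrightarrow> 0"
    unfolding Mod_def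
  proof (rule J_dominated[where h="\<lambda>t. ennreal (\<phi> \<bar>k * h t\<bar>)"])
    show "AE t in L. (\<lambda>n. ennreal (\<phi> \<bar>k * f n t\<bar>)) \<longlonglongrightarrow> 0"
      using lim
    proof eventually_elim
      case (elim t)
      then have "(\<lambda>n. k * f n t) \<longlonglongrightarrow> k * 0" by (intro tendsto_intros)
      from phi_tendsto[OF this] show ?case by (auto intro: tendsto_ennrealI[of _ 0, simplified])
    qed
    show "AE t in L. ennreal (\<phi> \<bar>k * f n t\<bar>) \<le> ennreal (\<phi> \<bar>k * h t\<bar>)" for n
      using le[of n]
      by eventually_elim (use k in \<open>auto intro!: ennreal_leI phi_mono mult_left_mono simp: abs_mult\<close>)
    show "J (\<lambda>t. ennreal (\<phi> \<bar>k * h t\<bar>)) < \<infinity>" using fin[OF k] by (simp add: Mod_def)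
  qed measurable
qed measurable

text \<open>The affine minorant bounds |f|/e by \<phi>(|f|/e) plus a constant, up to the factor 1/l.
  The modular of f/e is at most 1, so \<open>J_ge\<close> bounds the integral of the first summand
  over \<open>B\<close> by \<open>1 / w b\<close>.\<close>

lemma L1_bound:
  assumes f: "f \<in> X" "N f < e" and B [measurable]: "B \<in> sets L"
    and b: "emeasure L B \<le> ennreal b" "0 < b" "b \<in> I"
    and lc: "0 < l" "0 \<le> c" "\<And>u. 0 \<le> u \<Longrightarrow> l * u - c \<le> \<phi> u"
  shows "(\<integral>\<^sup>+t. ennreal \<bar>f t\<bar> * indicator B t \<partial>L) \<le> ennreal (e / l * (1 / w b + c * b))"
proof -
  note [measurable] = X_measurable[OF f(1)]
  have e: "0 < e" using f N_nonneg by force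
  have wb: "0 < w b" using w_pos b by simp
  have "(\<integral>\<^sup>+t. ennreal \<bar>f t\<bar> * indicator B t \<partial>L)
     \<le> (\<integral>\<^sup>+t. ennreal (e / l) * (ennreal (\<phi> \<bar>f t / e\<bar>) * indicator B t + ennreal c * indicator B t) \<partial>L)"
  proof (rule nn_integral_mono)
    fix t
    have "\<bar>f t\<bar> = (e / l) * (l * \<bar>f t / e\<bar>)" using e lc by (simp add: abs_divide)
    also have "\<dots> \<le> (e / l) * (\<phi> \<bar>f t / e\<bar> + c)" using lc(3)[of "\<bar>f t / e\<bar>"] e lc(1) by (intro mult_left_mono) auto
    finally have "ennreal \<bar>f t\<bar> \<le> ennreal ((e / l) * (\<phi> \<bar>f t / e\<bar> + c))" by (rule ennreal_leI)
    also have "\<dots> = ennreal (e / l) * (ennreal (\<phi> \<bar>f t / e\<bar>) + ennreal c)"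
      using e lc by (subst ennreal_mult) (auto simp: ennreal_plus phi_nonneg)
    finally show "ennreal \<bar>f t\<bar> * indicator B t \<le> ennreal (e / l) * (ennreal (\<phi> \<bar>f t / e\<bar>) * indicator B t + ennreal c * indicator B t)"
      by (auto simp: indicator_def)
  qed
  also have "\<dots> = ennreal (e / l) * ((\<integral>\<^sup>+t. ennreal (\<phi> \<bar>f t / e\<bar>) * indicator B t \<partial>L) + ennreal c * emeasure L B)"
  proof -
    have m: "(\<lambda>t. ennreal (\<phi> \<bar>f t / e\<bar>)) \<in> borel_measurable L"
      by (rule phi_comp_measurable) measurable
    note [measurable] = m
    show ?thesis
      by (subst nn_integral_cmult, measurable, subst nn_integral_add, measurable)
        (simp add: nn_integral_cmult_indicator)
  qed
  also have "\<dots> \<le> ennreal (e / l) * (ennreal (1 / w b) + ennreal c * ennreal b)"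
  proof (intro mult_left_mono add_mono)
    have "ennreal (w b) * (\<integral>\<^sup>+t. ennreal (\<phi> \<bar>f t / e\<bar>) * indicator B t \<partial>L) \<le> Mod (\<lambda>t. f t / e)"
      unfolding Mod_def by (rule J_ge[OF _ B b]) measurable
    also have "\<dots> \<le> 1" by (rule N_less[OF f])
    finally have "ennreal (1 / w b) * (ennreal (w b) * (\<integral>\<^sup>+t. ennreal (\<phi> \<bar>f t / e\<bar>) * indicator B t \<partial>L)) \<le> ennreal (1 / w b) * 1"
      by (rule mult_left_mono) simp
    then show "(\<integral>\<^sup>+t. ennreal (\<phi> \<bar>f t / e\<bar>) * indicator B t \<partial>L) \<le> ennreal (1 / w b)"
      using wb by (simp add: mult.assoc[symmetric] ennreal_mult[symmetric])
  qed (use b in auto)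
  also have "\<dots> = ennreal (e / l * (1 / w b + c * b))"
  proof -
    have "ennreal (1 / w b) + ennreal c * ennreal b = ennreal (1 / w b + c * b)"
      using lc b wb by (subst ennreal_mult[symmetric]) (auto simp: ennreal_plus)
    moreover have "0 \<le> 1 / w b + c * b" using lc b wb by simp
    ultimately show ?thesis using e lc by (simp only: ennreal_mult[symmetric] divide_nonneg_pos less_imp_le)
  qed
  finally show ?thesis .
qed

lemma L1_local_bound:
  assumes R: "0 < R" "R \<in> I"
  shows "\<exists>K\<ge>0. \<forall>f\<in>X. (\<integral>\<^sup>+t. ennreal \<bar>f t\<bar> * indicator {0..R} t \<partial>L) \<le> ennreal (K * N f)"
proof -
  obtain l c where lc: "0 < l" "0 \<le> c" "\<And>u. 0 \<le> u \<Longrightarrow> l * u - c \<le> \<phi> u"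
    using phi_affine_lower by blast
  define K where "K = 1 / l * (1 / w R + c * R)"
  have K: "0 \<le> K" using lc w_pos[of R] R by (simp add: K_def)
  have sub: "{0..R} \<subseteq> I" using R I_down by auto
  have B: "{0..R} \<in> sets L" by (rule borel_Int_I[OF _ sub]) simp
  have "(\<integral>\<^sup>+t. ennreal \<bar>f t\<bar> * indicator {0..R} t \<partial>L) \<le> ennreal (K * N f)" if f: "f \<in> X" for f
  proof (rule ennreal_le_epsilon)
    fix e :: real assume e: "0 < e"
    \<comment> \<open>\<open>L1_bound\<close> needs a number strictly above the norm;
      \<open>d\<close> is the excess, and \<open>K * d\<close> is the resulting error.\<close>
    define d where "d = e / (K + 1)"
    have d: "0 < d" "K * d \<le> e" using e K by (auto simp: d_def field_simps)
    have "(\<integral>\<^sup>+t. ennreal \<bar>f t\<bar> * indicator {0..R} t \<partial>L) \<le> ennreal ((N f + d) / l * (1 / w R + c * R))"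
      using R B d by (intro L1_bound[OF f _ B _ R lc]) (auto simp: L_le_lebesgue)
    also have "(N f + d) / l * (1 / w R + c * R) = K * N f + K * d" by (simp add: K_def add_divide_distrib ring_distribs mult_ac)
    also have "ennreal (K * N f + K * d) \<le> ennreal (K * N f + e)" using d by (intro ennreal_leI) auto
    finally show "(\<integral>\<^sup>+t. ennreal \<bar>f t\<bar> * indicator {0..R} t \<partial>L) \<le> ennreal (K * N f) + ennreal e"
      using K N_nonneg[OF f] e by (simp add: ennreal_plus[symmetric] del: ennreal_plus)
  qed
  then show ?thesis using K by blast
qed

section \<open>The two conditions in usable form\<close>

definition growth_cond :: bool where
  "growth_cond \<longleftrightarrow> N_function_at_infinity \<phi> \<or> ((\<lambda>t. t / weight_primitive w t) \<longlongrightarrow> 0) (at_right 0)"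

definition delta2_cond :: bool where
  "delta2_cond \<longleftrightarrow> (if \<gamma> < \<infinity> then delta2_infinity \<phi> else delta2 \<phi>)"

lemma primitive_le:
  assumes "0 < t" "t \<in> I" "\<And>s. 0 < s \<Longrightarrow> s \<in> I \<Longrightarrow> w s \<le> B"
  shows "weight_primitive w t \<le> B * t"
proof -
  have B: "0 \<le> B" using assms(3)[OF assms(1,2)] w_pos[OF assms(2,1)] by linarith
  have sub: "{0<..<t} \<subseteq> I" using I_down[OF assms(2)] by auto
  have "W (ennreal t) \<le> (\<integral>\<^sup>+s. ennreal B * indicator {0<..<t} s \<partial>L)"
    unfolding W_def
  proof (rule nn_integral_mono_AE)
    show "AE s in L. ennreal (w s) * indicator {s. ennreal s < ennreal t} s \<le> ennreal B * indicator {0<..<t} s"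
      using AE_L_pos AE_space
      by eventually_elim (use assms(3) in \<open>auto simp: indicator_def ennreal_less_iff intro!: ennreal_leI\<close>)
  qed
  also have "\<dots> = ennreal (B * t)"
    using borel_Int_I[OF _ sub] B assms(1)
    by (subst nn_integral_cmult_indicator) (auto simp: L_le_lebesgue ennreal_mult)
  finally have "ennreal (weight_primitive w t) \<le> ennreal (B * t)"
    using W_eq_primitive[OF assms(2)] by simp
  then show ?thesis using B assms(1) by (subst (asm) ennreal_le_iff) auto
qed

lemma primitive_ge:
  assumes "0 < t" "t \<in> I" shows "w t * t \<le> weight_primitive w t" "0 < weight_primitive w t"
proof -
  have wt: "0 < w t" using w_pos assms by simp
  have "ennreal (w t * t) \<le> ennreal (weight_primitive w t)"
    using W_ge[of "ennreal t" t] assms W_eq_primitive[OF assms(2)] wt by (simp add: ennreal_mult)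
  moreover have "0 < w t * t" using wt assms by simp
  ultimately show "w t * t \<le> weight_primitive w t" "0 < weight_primitive w t"
    by (metis ennreal_le_iff2 less_le_not_le less_le_trans not_less)+
qed

text \<open>If \<open>w \<le> B\<close> then the primitive is at most \<open>B * t\<close>, and in
  any case it is at least \<open>w t * t\<close>. So the limit condition says that the weight is
  unbounded near 0, and in this form it is used from here on.\<close>

lemma weight_bounded_iff:
  "((\<lambda>t. t / weight_primitive w t) \<longlongrightarrow> 0) (at_right 0) \<longleftrightarrow> \<not> (\<exists>B. \<forall>s. 0 < s \<longrightarrow> s \<in> I \<longrightarrow> w s \<le> B)"
proof
  obtain c where c: "0 < c" "c \<in> I" using exists_pos by blast
  have ev: "eventually (\<lambda>t. 0 < t \<and> t \<in> I) (at_right 0)"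
    unfolding eventually_at_right_field using c I_down[OF c(2)] by (auto intro!: exI[of _ c])
  {
    assume lim: "((\<lambda>t. t / weight_primitive w t) \<longlongrightarrow> 0) (at_right 0)"
    show "\<not> (\<exists>B. \<forall>s. 0 < s \<longrightarrow> s \<in> I \<longrightarrow> w s \<le> B)"
    proof
      assume "\<exists>B. \<forall>s. 0 < s \<longrightarrow> s \<in> I \<longrightarrow> w s \<le> B"
      then obtain B where B: "\<And>s. 0 < s \<Longrightarrow> s \<in> I \<Longrightarrow> w s \<le> B" by blast
      have Bp: "0 < B" using B[OF c] w_pos[of c] c by simp
      have "eventually (\<lambda>t. t / weight_primitive w t < 1 / B) (at_right 0)"
        using lim Bp by (intro order_tendstoD(2)[of _ 0]) auto
      then have "eventually (\<lambda>t::real. False) (at_right 0)"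
        using ev
      proof eventually_elim
        case (elim t)
        have "weight_primitive w t \<le> B * t" using B elim by (intro primitive_le) auto
        then show False using elim primitive_ge(2)[of t] Bp by (simp add: field_simps)
      qed
      then show False by simp
    qed
  }
  {
    assume unb: "\<not> (\<exists>B. \<forall>s. 0 < s \<longrightarrow> s \<in> I \<longrightarrow> w s \<le> B)"
    show "((\<lambda>t. t / weight_primitive w t) \<longlongrightarrow> 0) (at_right 0)"
    proof (rule order_tendstoI)
      fix a :: real assume "a < 0"
      show "eventually (\<lambda>t. a < t / weight_primitive w t) (at_right 0)"
        using ev
      proof eventually_elim
        case (elim t)
        then have "0 < t / weight_primitive w t" using primitive_ge(2) by simp
        then show ?case using \<open>a < 0\<close> by linarith
      qed
    next
      fix a :: real assume a: "0 < a"
      obtain s where s: "0 < s" "s \<in> I" "1 / a < w s" using unb by (meson not_le)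
      have "eventually (\<lambda>t. t \<in> {0<..s}) (at_right 0)"
        unfolding eventually_at_right_field using s by (auto intro!: exI[of _ s])
      then show "eventually (\<lambda>t. t / weight_primitive w t < a) (at_right 0)"
      proof eventually_elim
        case (elim t)
        then have t: "0 < t" "t \<in> I" using I_down[OF s(2)] by auto
        have "1 / a < w t" using s w_anti[of t s] elim by auto
        then have "t < a * (w t * t)" using a t by (simp add: field_simps)
        also have "\<dots> \<le> a * weight_primitive w t" using a primitive_ge(1)[OF t] by (intro mult_left_mono) auto
        finally show ?case using primitive_ge(2)[OF t] by (simp add: field_simps)
      qed
    qed
  }
qed

text \<open>In the bound of \<open>L1_bound\<close> either the slope \<open>l\<close> or the value
  \<open>w b\<close> can be made large, according to which alternative of the growth condition
  holds. The shift \<open>E = C + 1\<close> meets the strict inequality in that lemma.\<close>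

lemma uniform_integrability:
  assumes cond: growth_cond and C: "0 < C" and e: "0 < e"
  shows "\<exists>b>0. \<forall>f\<in>X. N f \<le> C \<longrightarrow> (\<forall>B\<in>sets L. emeasure L B \<le> ennreal b \<longrightarrow>
    (\<integral>\<^sup>+t. ennreal \<bar>f t\<bar> * indicator B t \<partial>L) \<le> ennreal e)"
proof -
  define E where "E = C + 1"
  have E: "0 < E" using C by (simp add: E_def)
  have "\<exists>b l c. 0 < b \<and> b \<in> I \<and> 0 < l \<and> 0 \<le> c \<and> (\<forall>u\<ge>0. l * u - c \<le> \<phi> u) \<and> E / l * (1 / w b + c * b) \<le> e"
  proof (cases "N_function_at_infinity \<phi>")
    case True
    obtain b0 where b0: "0 < b0" "b0 \<in> I" using exists_pos by blast
    have wb0: "0 < w b0" using w_pos b0 by simp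
    \<comment> \<open>The slope is chosen first, so that \<open>E / l * (2 / w b0) = e\<close>. Only
      then is \<open>b\<close> made so small that \<open>c * b\<close> is at most
      \<open>1 / w b0\<close>, because \<open>c\<close> depends on \<open>l\<close>.\<close>
    define l where "l = 2 * E / (e * w b0)"
    have l: "0 < l" using E e wb0 by (simp add: l_def)
    have "eventually (\<lambda>u. l \<le> \<phi> u / u) at_top"
      using True unfolding N_function_at_infinity_def filterlim_at_top by blast
    then obtain u1 where u1: "\<And>u. u \<ge> u1 \<Longrightarrow> l \<le> \<phi> u / u" by (auto simp: eventually_at_top_linorder)
    define c where "c = l * max u1 1"
    have c: "0 < c" using l by (simp add: c_def)
    have lc: "l * u - c \<le> \<phi> u" if "0 \<le> u" for u
    proof (cases "max u1 1 \<le> u")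
      case True
      then have "l \<le> \<phi> u / u" using u1 by auto
      then have "l * u \<le> \<phi> u" using True by (simp add: field_simps)
      then show ?thesis using c by simp
    next
      case False
      then have "l * u \<le> c" using l by (auto simp: c_def)
      then show ?thesis using phi_nonneg[OF that] by simp
    qed
    define b where "b = min b0 (1 / (w b0 * c))"
    have b: "0 < b" "b \<le> b0" using b0 c wb0 by (auto simp: b_def)
    have bI: "b \<in> I" using I_down[OF b0(2)] b by simp
    have "c * b \<le> 1 / w b0"
    proof -
      have "c * b \<le> c * (1 / (w b0 * c))" using c by (intro mult_left_mono) (auto simp: b_def)
      then show ?thesis using c by simp
    qed
    moreover have "1 / w b \<le> 1 / w b0" using w_anti[OF b(2,1) b0(2)] wb0 by (simp add: frac_le)
    ultimately have "E / l * (1 / w b + c * b) \<le> E / l * (2 / w b0)" using E l by (intro mult_left_mono) auto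
    also have "\<dots> = e" using E e wb0 by (simp add: l_def field_simps)
    finally show ?thesis using b bI l c lc by (intro exI[of _ b] exI[of _ l] exI[of _ c]) auto
  next
    case False
    then have unb: "\<not> (\<exists>B. \<forall>s. 0 < s \<longrightarrow> s \<in> I \<longrightarrow> w s \<le> B)"
      using cond weight_bounded_iff by (simp add: growth_cond_def)
    obtain l c where lc: "0 < l" "0 \<le> c" "\<forall>u\<ge>0. l * u - c \<le> \<phi> u" using phi_affine_lower by blast
    \<comment> \<open>Both summands \<open>1 / w b\<close> and \<open>c * b\<close> will be at most
      \<open>y\<close>, and \<open>E / l * (y + y) = e\<close>.\<close>
    define y where "y = e * l / (2 * E)"
    have y: "0 < y" using e lc E by (simp add: y_def)
    obtain s where s: "0 < s" "s \<in> I" "1 / y < w s" using unb by (meson not_le)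
    define b where "b = min s (y / (c + 1))"
    have b: "0 < b" "b \<le> s" using s y lc by (auto simp: b_def)
    have bI: "b \<in> I" using I_down[OF s(2)] b by simp
    have "c * b \<le> (c + 1) * (y / (c + 1))" using lc y b by (intro mult_mono) (auto simp: b_def)
    then have 1: "c * b \<le> y" using lc by simp
    have "1 / y < w b" using w_anti[OF b(2,1) s(2)] s by simp
    then have 2: "1 / w b \<le> y" using y w_pos[OF bI b(1)] by (simp add: field_simps)
    have "E / l * (1 / w b + c * b) \<le> E / l * (y + y)" using 1 2 E lc by (intro mult_left_mono add_mono) auto
    also have "\<dots> = e" using E lc by (simp add: y_def field_simps)
    finally show ?thesis using b bI lc by blast
  qed
  then obtain b l c where *: "0 < b" "b \<in> I" "0 < l" "0 \<le> c" "\<And>u. 0 \<le> u \<Longrightarrow> l * u - c \<le> \<phi> u"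
    "E / l * (1 / w b + c * b) \<le> e" by blast
  show ?thesis
  proof (intro exI[of _ b] conjI ballI impI)
    fix f B assume f: "f \<in> X" "N f \<le> C" and B: "B \<in> sets L" "emeasure L B \<le> ennreal b"
    have "(\<integral>\<^sup>+t. ennreal \<bar>f t\<bar> * indicator B t \<partial>L) \<le> ennreal (E / l * (1 / w b + c * b))"
      using f by (intro L1_bound[OF f(1) _ B *(1-5)]) (auto simp: E_def)
    also have "\<dots> \<le> ennreal e" by (rule ennreal_leI[OF *(6)])
    finally show "(\<integral>\<^sup>+t. ennreal \<bar>f t\<bar> * indicator B t \<partial>L) \<le> ennreal e" .
  qed (rule *)
qed

text \<open>Both variants of the doubling condition take the form of one inequality with an additive
  constant. The constant is harmless on an interval of finite length and must vanish on the
  half-line.\<close>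

lemma doubling:
  assumes delta2_cond
  shows "\<exists>K>0. \<exists>c\<ge>0. (\<forall>u\<ge>0. \<phi> (2 * u) \<le> K * \<phi> u + c) \<and> (\<gamma> = \<infinity> \<longrightarrow> c = 0)"
proof (cases "\<gamma> = \<infinity>")
  case False
  then have "delta2_infinity \<phi>" using assms unfolding delta2_cond_def by simp
  then obtain K u0 where K: "K > 2" "u0 \<ge> 0" "\<And>u. u \<ge> u0 \<Longrightarrow> \<phi> (2 * u) \<le> K * \<phi> u"
    by (auto simp: delta2_infinity_def)
  have "\<phi> (2 * u) \<le> K * \<phi> u + \<phi> (2 * u0)" if "0 \<le> u" for u
  proof (cases "u0 \<le> u")
    case True then show ?thesis using K(3)[OF True] phi_nonneg[of "2 * u0"] K(2) by simp
  next
    case False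
    then have "\<phi> (2 * u) \<le> \<phi> (2 * u0)" using that by (intro phi_mono) auto
    then show ?thesis using phi_nonneg[OF that] K(1) by (smt (verit) mult_nonneg_nonneg)
  qed
  then show ?thesis using K False phi_nonneg[of "2 * u0"] by (intro exI[of _ K]) (auto intro!: exI[of _ "\<phi> (2 * u0)"])
next
  case True
  then have "delta2 \<phi>" using assms unfolding delta2_cond_def by simp
  then obtain K0 u0 K1 u1 where K: "K0 > 2" "u0 > 0" "0 < \<phi> u0" "\<And>u. 0 \<le> u \<Longrightarrow> u \<le> u0 \<Longrightarrow> \<phi> (2 * u) \<le> K0 * \<phi> u"
    "K1 > 2" "u1 \<ge> 0" "\<And>u. u \<ge> u1 \<Longrightarrow> \<phi> (2 * u) \<le> K1 * \<phi> u"
    by (auto simp: delta2_def delta2_zero_def delta2_infinity_def)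
  \<comment> \<open>The last summand serves the range between \<open>u0\<close> and
    \<open>u1\<close>, which neither condition covers; it makes sense because \<phi> is positive at
    \<open>u0\<close>.\<close>
  define K where "K = K0 + K1 + \<phi> (2 * u1) / \<phi> u0"
  have nn: "0 \<le> \<phi> (2 * u1) / \<phi> u0" using K phi_nonneg[of "2 * u1"] by simp
  have "\<phi> (2 * u) \<le> K * \<phi> u" if "0 \<le> u" for u
  proof -
    have p: "0 \<le> \<phi> u" by (rule phi_nonneg[OF that])
    consider "u \<le> u0" | "u1 \<le> u" | "u0 \<le> u" "u \<le> u1" by linarith
    then show ?thesis
    proof cases
      case 1
      have "K0 * \<phi> u \<le> K * \<phi> u" using nn K p by (intro mult_right_mono) (auto simp: K_def)
      then show ?thesis using K(4)[OF that 1] by simp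
    next
      case 2
      have "K1 * \<phi> u \<le> K * \<phi> u" using nn K p by (intro mult_right_mono) (auto simp: K_def)
      then show ?thesis using K(7)[OF 2] by simp
    next
      case 3
      have "\<phi> (2 * u) \<le> \<phi> (2 * u1)" using 3 that by (intro phi_mono) auto
      also have "\<dots> = \<phi> (2 * u1) / \<phi> u0 * \<phi> u0" using K by simp
      also have "\<dots> \<le> \<phi> (2 * u1) / \<phi> u0 * \<phi> u" using 3 K nn phi_mono[of u0 u] by (intro mult_left_mono) auto
      also have "\<dots> \<le> K * \<phi> u" using K p by (intro mult_right_mono) (auto simp: K_def)
      finally show ?thesis .
    qed
  qed
  moreover have "0 < K" using K nn by (simp add: K_def)
  ultimately show ?thesis by (intro exI[of _ K]) auto
qed

lemma Mod_double_finite: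
  assumes d: delta2_cond and [measurable]: "f \<in> borel_measurable L" and fin: "Mod f < \<infinity>"
  shows "Mod (\<lambda>t. 2 * f t) < \<infinity>"
proof -
  obtain K c where K: "0 < K" "0 \<le> c" "\<And>u. 0 \<le> u \<Longrightarrow> \<phi> (2 * u) \<le> K * \<phi> u + c" "\<gamma> = \<infinity> \<longrightarrow> c = 0"
    using doubling[OF d] by blast
  have "Mod (\<lambda>t. 2 * f t) \<le> J (\<lambda>t. ennreal K * ennreal (\<phi> \<bar>f t\<bar>) + ennreal 1 * (ennreal c * indicator I t))"
    unfolding Mod_def
  proof (rule J_mono_AE[OF AE_I2])
    fix t assume "t \<in> space L"
    then have t: "t \<in> I" by simp
    have "ennreal (\<phi> \<bar>2 * f t\<bar>) \<le> ennreal (K * \<phi> \<bar>f t\<bar> + c)"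
      using K(3)[of "\<bar>f t\<bar>"] by (intro ennreal_leI) (simp add: abs_mult)
    then show "ennreal (\<phi> \<bar>2 * f t\<bar>) \<le> ennreal K * ennreal (\<phi> \<bar>f t\<bar>) + ennreal 1 * (ennreal c * indicator I t)"
      using K t by (simp add: ennreal_plus ennreal_mult phi_nonneg)
  next
    have "I \<in> sets L" by (rule borel_Int_I) auto
    then show "(\<lambda>t. ennreal K * ennreal (\<phi> \<bar>f t\<bar>) + ennreal 1 * (ennreal c * indicator I t)) \<in> borel_measurable L"
      by measurable
  qed
  also have "\<dots> \<le> ennreal K * Mod f + ennreal 1 * J (\<lambda>t. ennreal c * indicator I t)"
  proof -
    have "I \<in> sets L" by (rule borel_Int_I) auto
    then show ?thesis unfolding Mod_def using K by (intro J_comb_le) measurable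
  qed
  also have "J (\<lambda>t. ennreal c * indicator I t) = ennreal c * W (emeasure L I)"
    using K by (intro J_indicator borel_Int_I) auto
  also have "ennreal K * Mod f + ennreal 1 * \<dots> < \<infinity>"
  proof (cases "\<gamma> = \<infinity>")
    case True then show ?thesis using K fin by (simp add: ennreal_mult_less_top)
  next
    case False
    then obtain r where r: "\<gamma> = ereal r" "0 < r" using length_pos by (cases \<gamma>) auto
    have "emeasure L I \<le> ennreal r"
      using r by (intro emeasure_L_le borel_Int_I) (auto simp: half_open_interval_def)
    then have "W (emeasure L I) < \<infinity>" using W_mono W_finite by (meson le_less_trans)
    then show ?thesis using fin by (simp add: ennreal_mult_less_top)
  qed
  finally show ?thesis .
qed

lemma Mod_finite:
  assumes d: delta2_cond and f: "f \<in> X" shows "Mod (\<lambda>t. k * f t) < \<infinity>"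
proof -
  note [measurable] = X_measurable[OF f]
  obtain a where a: "0 < a" "Mod (\<lambda>t. a * f t) < \<infinity>" using f X_iff by blast
  have pow: "Mod (\<lambda>t. 2 ^ n * (a * f t)) < \<infinity>" for n
  proof (induction n)
    case (Suc n)
    have "Mod (\<lambda>t. 2 * (2 ^ n * (a * f t))) < \<infinity>" by (rule Mod_double_finite[OF d _ Suc]) measurable
    then show ?case by (simp add: mult.assoc)
  qed (use a in simp)
  obtain n :: nat where "\<bar>k\<bar> / a < 2 ^ n" using real_arch_pow[of 2 "\<bar>k\<bar> / a"] by auto
  then have n: "\<bar>k\<bar> \<le> 2 ^ n * a" using a by (simp add: field_simps)
  have "Mod (\<lambda>t. k * f t) \<le> Mod (\<lambda>t. 2 ^ n * (a * f t))"
  proof (rule Mod_mono)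
    fix t
    have "\<bar>k\<bar> * \<bar>f t\<bar> \<le> 2 ^ n * a * \<bar>f t\<bar>" using n by (intro mult_right_mono) auto
    then show "\<bar>k * f t\<bar> \<le> \<bar>2 ^ n * (a * f t)\<bar>" using a by (simp add: abs_mult mult.assoc)
  qed measurable
  then show ?thesis using pow by (rule order_le_less_trans)
qed

subsection \<open>Sufficiency\<close>

sublocale nrm: seminormed_subspace X N
proof
  show "0 \<in> X" using X_0 by (simp add: zero_fun_def)
  show "x + y \<in> X" if "x \<in> X" "y \<in> X" for x y using X_add(1)[OF that] by (simp add: plus_fun_def)
  show "c *\<^sub>R x \<in> X" if "x \<in> X" for c x using X_scale(1)[OF that, of c] by (simp add: scaleR_fun_def)
  show "N (x + y) \<le> N x + N y" if "x \<in> X" "y \<in> X" for x y using X_add(2)[OF that] by (simp add: plus_fun_def)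
  show "N (c *\<^sub>R x) \<le> \<bar>c\<bar> * N x" if "x \<in> X" for c x using X_scale(2)[OF that, of c] by (simp add: scaleR_fun_def)
qed (rule N_nonneg)

lemma Mod_indicator:
  assumes "B \<in> sets L" shows "Mod (\<lambda>t. c * indicator B t) = ennreal (\<phi> \<bar>c\<bar>) * W (emeasure L B)"
proof -
  have "ennreal (\<phi> \<bar>c * indicator B t\<bar>) = ennreal (\<phi> \<bar>c\<bar>) * indicator B t" for t
    by (simp add: indicator_def)
  then show ?thesis unfolding Mod_def using J_indicator[OF assms, of "\<phi> \<bar>c\<bar>"] by (simp add: phi_nonneg)
qed

lemma W_finite': "x < \<infinity> \<Longrightarrow> W x < \<infinity>"
  using W_finite by (cases x) auto

lemma Mod_indicator_finite:
  assumes "B \<in> sets L" "emeasure L B < \<infinity>" shows "Mod (\<lambda>t. c * indicator B t) < \<infinity>"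
  unfolding Mod_indicator[OF assms(1)] using W_finite'[OF assms(2)] by (simp add: ennreal_mult_less_top)

lemma indicator_mem: 
  assumes "B \<in> sets L" "emeasure L B < \<infinity>" shows "(\<lambda>t. c * indicator B t) \<in> X"
  using assms Mod_indicator_finite[OF assms, of c] by (auto simp: X_iff intro!: exI[of _ 1])

lemma step_eq_sum: "step n a = (\<Sum>j\<in>cells n. a j *\<^sub>R (\<lambda>t. 2 ^ n * indicator (cell n j) t))"
  by (rule ext) (simp add: step_def sum_fun_apply scaleR_fun_def)

lemma cell_vector_mem: "j \<in> cells n \<Longrightarrow> (\<lambda>t. 2 ^ n * indicator (cell n j) t) \<in> X"
  by (rule indicator_mem) (auto simp: emeasure_cell)

lemma step_mem: "step n a \<in> X"
  unfolding step_eq_sum by (intro nrm.sum_mem nrm.scale cell_vector_mem)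

lemma X_set_integrable:
  assumes f: "f \<in> X" and B: "B \<in> sets L" "B \<subseteq> {0..R}" and R: "R \<in> I"
  shows "set_integrable L B f"
proof -
  note [measurable] = X_measurable[OF f]
  obtain c where c: "0 < c" "c \<in> I" using exists_pos by blast
  \<comment> \<open>\<open>L1_local_bound\<close> needs a positive end point, while \<open>R\<close>
    may be 0.\<close>
  define r where "r = max R c"
  have r: "0 < r" "r \<in> I" using c R by (auto simp: r_def max_def)
  have sub: "{0..r} \<subseteq> I" using I_down[OF r(2)] by auto
  have m [measurable]: "{0..r} \<in> sets L" by (rule borel_Int_I[OF _ sub]) simp
  obtain K where K: "(\<integral>\<^sup>+t. ennreal \<bar>f t\<bar> * indicator {0..r} t \<partial>L) \<le> ennreal (K * N f)"
    using L1_local_bound[OF r] f by blast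
  have "set_integrable L {0..r} f"
    unfolding set_integrable_def
  proof (rule integrableI_bounded)
    have "(\<integral>\<^sup>+t. ennreal (norm (indicator {0..r} t *\<^sub>R f t)) \<partial>L) = (\<integral>\<^sup>+t. ennreal \<bar>f t\<bar> * indicator {0..r} t \<partial>L)"
      by (intro nn_integral_cong) (auto simp: indicator_def)
    also have "\<dots> < \<infinity>" using K by (rule order_le_less_trans) simp
    finally show "(\<integral>\<^sup>+t. ennreal (norm (indicator {0..r} t *\<^sub>R f t)) \<partial>L) < \<infinity>" .
  qed measurable
  then show ?thesis 
  proof (rule set_integrable_subset)
    show "B \<subseteq> {0..r}" using B(2) by (rule order_trans) (simp add: r_def)
  qed (use B in simp)
qed

lemma X_set_integrable_cell: "f \<in> X \<Longrightarrow> j \<in> cells n \<Longrightarrow> set_integrable L (cell n j) f"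
  by (rule X_set_integrable[OF _ cell_sets cell_sub cell_end_mem])

section \<open>Coefficients and averages on the space\<close>

lemma coeff_add: "f \<in> X \<Longrightarrow> g \<in> X \<Longrightarrow> j \<in> cells n \<Longrightarrow> coeff n j (f + g) = coeff n j f + coeff n j g"
  unfolding coeff_def plus_fun_def by (intro set_integral_add X_set_integrable_cell)

lemma coeff_scale: "coeff n j (r *\<^sub>R f) = r * coeff n j f"
  unfolding coeff_def scaleR_fun_def by simp

lemma L1_local_bound_real:
  assumes R: "0 < R" "R \<in> I"
  shows "\<exists>K\<ge>0. \<forall>f\<in>X. \<forall>B\<in>sets L. B \<subseteq> {0..R} \<longrightarrow> set_lebesgue_integral L B (\<lambda>t. \<bar>f t\<bar>) \<le> K * N f"
proof -
  from L1_local_bound[OF R] obtain K where K: "0 \<le> K"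
    "\<And>f. f \<in> X \<Longrightarrow> (\<integral>\<^sup>+t. ennreal \<bar>f t\<bar> * indicator {0..R} t \<partial>L) \<le> ennreal (K * N f)" by blast
  have "set_lebesgue_integral L B (\<lambda>t. \<bar>f t\<bar>) \<le> K * N f" if f: "f \<in> X" and B: "B \<in> sets L" "B \<subseteq> {0..R}" for f B
  proof -
    have int: "set_integrable L B f" by (rule X_set_integrable[OF f B R(2)])
    have "ennreal (set_lebesgue_integral L B (\<lambda>t. \<bar>f t\<bar>)) = (\<integral>\<^sup>+t. ennreal (indicator B t *\<^sub>R \<bar>f t\<bar>) \<partial>L)"
      unfolding set_lebesgue_integral_def
      by (rule nn_integral_eq_integral[symmetric]) (use set_integrable_abs[OF int] in \<open>auto simp: set_integrable_def\<close>)
    also have "\<dots> \<le> (\<integral>\<^sup>+t. ennreal \<bar>f t\<bar> * indicator {0..R} t \<partial>L)"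
      using B by (intro nn_integral_mono) (auto simp: indicator_def)
    also have "\<dots> \<le> ennreal (K * N f)" by (rule K(2)[OF f])
    finally show ?thesis using K(1) N_nonneg[OF f] by (subst (asm) ennreal_le_iff) auto
  qed
  then show ?thesis using K(1) by blast
qed

lemma coeff_bounded:
  assumes j: "j \<in> cells n" shows "\<exists>K\<ge>0. \<forall>f\<in>X. \<bar>coeff n j f\<bar> \<le> K * N f"
proof -
  have "0 < real (Suc j) / 2 ^ n" by simp
  from L1_local_bound_real[OF this cell_end_mem[OF j]] obtain K where K: "0 \<le> K"
    "\<And>f. f \<in> X \<Longrightarrow> set_lebesgue_integral L (cell n j) (\<lambda>t. \<bar>f t\<bar>) \<le> K * N f"
    using cell_sets[OF j] cell_sub[OF j] by blast
  have "\<bar>coeff n j f\<bar> \<le> K * N f" if f: "f \<in> X" for f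
    unfolding coeff_def
    using set_integral_norm_bound[OF X_set_integrable_cell[OF f j]] K(2)[OF f] by simp
  then show ?thesis using K(1) by blast
qed

text \<open>Jensen's inequality, proved with the slope \<open>c\<close> of a supporting line of the
  even extension at the mean \<open>m\<close>. Unless the right-hand side is infinite, the line is
  integrated over the cell.\<close>

lemma phi_average_le:
  assumes j: "j \<in> cells n" and f [measurable]: "f \<in> borel_measurable L" and int: "set_integrable L (cell n j) f"
  shows "ennreal (\<phi> \<bar>coeff n j f * 2 ^ n\<bar>) \<le> ennreal (2 ^ n) * (\<integral>\<^sup>+t. ennreal (\<phi> \<bar>f t\<bar>) * indicator (cell n j) t \<partial>L)"
proof (cases "(\<integral>\<^sup>+t. ennreal (\<phi> \<bar>f t\<bar>) * indicator (cell n j) t \<partial>L) = \<infinity>")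
  case True then show ?thesis by (simp add: ennreal_mult_top)
next
  case False
  note [measurable] = j
  define m where "m = coeff n j f * 2 ^ n"
  obtain c where c: "\<And>u. \<phi> \<bar>m\<bar> + c * (u - m) \<le> \<phi> \<bar>u\<bar>"
    using convex_le_Inf_differential[OF phi_abs_convex, of m] by auto
  have phi_int: "set_integrable L (cell n j) (\<lambda>t. \<phi> \<bar>f t\<bar>)"
    unfolding set_integrable_def
  proof (rule integrableI_bounded)
    have "(\<lambda>t. \<phi> \<bar>f t\<bar>) \<in> borel_measurable L" by (rule measurable_compose[OF f phi_abs_measurable])
    then show "(\<lambda>t. indicator (cell n j) t *\<^sub>R \<phi> \<bar>f t\<bar>) \<in> borel_measurable L" by measurable
    have "(\<integral>\<^sup>+t. ennreal (norm (indicator (cell n j) t *\<^sub>R \<phi> \<bar>f t\<bar>)) \<partial>L) = (\<integral>\<^sup>+t. ennreal (\<phi> \<bar>f t\<bar>) * indicator (cell n j) t \<partial>L)"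
      by (intro nn_integral_cong) (auto simp: indicator_def phi_nonneg)
    then show "(\<integral>\<^sup>+t. ennreal (norm (indicator (cell n j) t *\<^sub>R \<phi> \<bar>f t\<bar>)) \<partial>L) < \<infinity>"
      using False by (simp add: less_top)
  qed
  have const: "set_integrable L (cell n j) (\<lambda>t. r)" "set_lebesgue_integral L (cell n j) (\<lambda>t. r) = r / 2 ^ n" for r :: real
    using emeasure_cell[OF j] cell_sub_I[OF j] by (auto simp: set_integrable_def set_lebesgue_integral_def measure_def Int_absorb2)
  have "\<phi> \<bar>m\<bar> / 2 ^ n = set_lebesgue_integral L (cell n j) (\<lambda>t. (\<phi> \<bar>m\<bar> - c * m) + c * f t)"
  proof -
    have "set_lebesgue_integral L (cell n j) (\<lambda>t. (\<phi> \<bar>m\<bar> - c * m) + c * f t) = (\<phi> \<bar>m\<bar> - c * m) / 2 ^ n + c * coeff n j f"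
      unfolding coeff_def using const int by (subst set_integral_add) auto
    also have "\<dots> = \<phi> \<bar>m\<bar> / 2 ^ n" by (simp add: m_def field_simps)
    finally show ?thesis by simp
  qed
  also have "\<dots> \<le> set_lebesgue_integral L (cell n j) (\<lambda>t. \<phi> \<bar>f t\<bar>)"
  proof (rule set_integral_mono)
    show "set_integrable L (cell n j) (\<lambda>t. (\<phi> \<bar>m\<bar> - c * m) + c * f t)"
      using const(1) int by (intro set_integral_add) auto
    show "(\<phi> \<bar>m\<bar> - c * m) + c * f t \<le> \<phi> \<bar>f t\<bar>" for t using c[of "f t"] by (simp add: algebra_simps)
  qed (rule phi_int)
  finally have "ennreal (\<phi> \<bar>m\<bar>) \<le> ennreal (2 ^ n * set_lebesgue_integral L (cell n j) (\<lambda>t. \<phi> \<bar>f t\<bar>))"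
    by (intro ennreal_leI) (simp add: field_simps)
  also have "\<dots> = ennreal (2 ^ n) * ennreal (set_lebesgue_integral L (cell n j) (\<lambda>t. \<phi> \<bar>f t\<bar>))"
    by (rule ennreal_mult') simp
  also have "ennreal (set_lebesgue_integral L (cell n j) (\<lambda>t. \<phi> \<bar>f t\<bar>)) = (\<integral>\<^sup>+t. ennreal (indicator (cell n j) t *\<^sub>R \<phi> \<bar>f t\<bar>) \<partial>L)"
    unfolding set_lebesgue_integral_def
    by (rule nn_integral_eq_integral[symmetric]) (use phi_int in \<open>auto simp: set_integrable_def phi_nonneg\<close>)
  also have "\<dots> = (\<integral>\<^sup>+t. ennreal (\<phi> \<bar>f t\<bar>) * indicator (cell n j) t \<partial>L)"
    by (intro nn_integral_cong) (auto simp: indicator_def)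
  finally show ?thesis by (simp add: m_def)
qed

lemma Mod_average_le:
  assumes f [measurable]: "f \<in> borel_measurable L" and int: "\<And>j. j \<in> cells n \<Longrightarrow> set_integrable L (cell n j) f"
  shows "Mod (step n (\<lambda>j. coeff n j f)) \<le> Mod f"
proof -
  have "Mod (step n (\<lambda>j. coeff n j f)) \<le> J (nn_average n (\<lambda>t. ennreal (\<phi> \<bar>f t\<bar>)))"
    unfolding Mod_def
  proof (rule J_mono_AE[OF AE_I2])
    fix t
    show "ennreal (\<phi> \<bar>step n (\<lambda>j. coeff n j f) t\<bar>) \<le> nn_average n (\<lambda>t. ennreal (\<phi> \<bar>f t\<bar>)) t"
    proof (cases "\<exists>j\<in>cells n. t \<in> cell n j")
      case True
      then obtain j where j: "j \<in> cells n" "t \<in> cell n j" by blast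
      show ?thesis unfolding step_in_cell[OF j] nn_average_in_cell[OF j]
        by (rule phi_average_le[OF j(1) f int[OF j(1)]])
    next
      case False
      then have "step n (\<lambda>j. coeff n j f) t = 0" by (intro step_outside) auto
      then show ?thesis by simp
    qed
  qed measurable
  also have "\<dots> \<le> Mod f" unfolding Mod_def by (rule J_average_le) measurable
  finally show ?thesis .
qed

lemma N_average_le:
  assumes f: "f \<in> X" shows "N (step n (\<lambda>j. coeff n j f)) \<le> N f"
proof (rule dense_ge)
  fix e assume e: "N f < e"
  then have e0: "0 < e" using N_nonneg[OF f] by linarith
  note [measurable] = X_measurable[OF f]
  have eq: "step n (\<lambda>j. coeff n j f) t / e = step n (\<lambda>j. coeff n j (\<lambda>t. f t / e)) t" for t
    by (simp add: step_def coeff_def sum_divide_distrib)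
  have "Mod (\<lambda>t. step n (\<lambda>j. coeff n j f) t / e) \<le> Mod (\<lambda>t. f t / e)"
    unfolding eq by (rule Mod_average_le) (use X_set_integrable_cell[OF f] in auto)
  also have "\<dots> \<le> 1" by (rule N_less[OF f e])
  finally show "N (step n (\<lambda>j. coeff n j f)) \<le> e" using e0 by (intro N_le) auto
qed

lemma average_tendsto_AE:
  assumes f: "f \<in> X" shows "AE t in L. (\<lambda>n. step n (\<lambda>j. coeff n j f) t) \<longlonglongrightarrow> f t"
proof (rule step_coeff_tendsto_AE[OF X_measurable[OF f]])
  fix R assume R: "R \<in> I"
  have "{0..R} \<subseteq> I" using I_down[OF R] by auto
  then show "set_integrable L {0..R} f" by (intro X_set_integrable[OF f borel_Int_I _ R]) auto
qed

lemma coeff_diff: "f \<in> X \<Longrightarrow> g \<in> X \<Longrightarrow> j \<in> cells n \<Longrightarrow> coeff n j (f - g) = coeff n j f - coeff n j g"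
  unfolding coeff_def fun_diff_def by (intro set_integral_diff X_set_integrable_cell)

lemma step_diff: "step n a - step n b = step n (\<lambda>j. a j - b j)"
  by (rule ext) (simp add: step_def sum_subtractf left_diff_distrib)

lemma step_cong: "(\<And>j. j \<in> cells n \<Longrightarrow> a j = b j) \<Longrightarrow> step n a = step n b"
  by (rule ext) (simp add: step_def)

lemma average_bounded_tendsto:
  fixes m :: nat
  assumes y [measurable]: "y \<in> borel_measurable L" and ym: "\<And>t. \<bar>y t\<bar> \<le> real m" "\<And>t. real m < t \<Longrightarrow> y t = 0"
  shows "y \<in> X" "(\<lambda>n. N (step n (\<lambda>j. coeff n j y) - y)) \<longlonglongrightarrow> 0"
proof -
  define B where "B = {t \<in> I. t \<in> {0..real m + 1}}"
  have B: "B \<in> sets L" unfolding B_def by (rule mem_sets_L_borel) simp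
  have Bfin: "emeasure L B < \<infinity>"
    by (rule le_less_trans[OF emeasure_L_le[OF B, of "real m + 1"]]) (auto simp: B_def)
  note [measurable] = B
  define h where "h = (\<lambda>t. 2 * real m * indicator B t)"
  have hX: "h \<in> X" unfolding h_def by (rule indicator_mem[OF B Bfin])
  have yh: "\<bar>y t\<bar> \<le> \<bar>h t\<bar>" if "t \<in> I" for t
    using ym(1)[of t] ym(2)[of t] that by (cases "real m < t") (auto simp: h_def B_def indicator_def half_open_interval_def)
  show yX: "y \<in> X" by (rule X_mono_AE(1)[OF hX y AE_I2]) (use yh in simp)
  show "(\<lambda>n. N (step n (\<lambda>j. coeff n j y) - y)) \<longlonglongrightarrow> 0"
  proof (rule N_dominated[where h=h])
    show "(step n (\<lambda>j. coeff n j y) - y) \<in> borel_measurable L" for n unfolding fun_diff_def by measurable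
    show "h \<in> borel_measurable L" unfolding h_def by measurable
    show "AE t in L. (\<lambda>n. (step n (\<lambda>j. coeff n j y) - y) t) \<longlonglongrightarrow> 0"
      using average_tendsto_AE[OF yX] by eventually_elim (simp add: LIM_zero)
    show "Mod (\<lambda>t. k * h t) < \<infinity>" for k
      using Mod_indicator_finite[OF B Bfin, of "k * (2 * real m)"] by (simp add: h_def mult.assoc)
    show "AE t in L. \<bar>(step n (\<lambda>j. coeff n j y) - y) t\<bar> \<le> \<bar>h t\<bar>" for n
    proof (rule AE_I2)
      fix t assume "t \<in> space L"
      then have t: "t \<in> I" by simp
      have "\<bar>step n (\<lambda>j. coeff n j y) t\<bar> \<le> real m * indicator B t"
      proof (cases "\<exists>j\<in>cells n. t \<in> cell n j")
        case False
        then show ?thesis by (subst step_outside) auto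
      next
        case True
        then obtain j where j: "j \<in> cells n" "t \<in> cell n j" by blast
        note [measurable] = j(1)
        have int: "set_integrable L (cell n j) y" by (rule X_set_integrable_cell[OF yX j(1)])
        show ?thesis
        proof (cases "t \<in> B")
          case True
          have "\<bar>coeff n j y\<bar> \<le> set_lebesgue_integral L (cell n j) (\<lambda>t. \<bar>y t\<bar>)"
            unfolding coeff_def using set_integral_norm_bound[OF int] by simp
          also have "\<dots> \<le> set_lebesgue_integral L (cell n j) (\<lambda>t. real m)"
            by (rule set_integral_mono[OF set_integrable_abs[OF int]])
               (use ym(1) emeasure_cell[OF j(1)] cell_sub_I[OF j(1)] in \<open>auto simp: set_integrable_def\<close>)
          also have "\<dots> = real m / 2 ^ n"
            using emeasure_cell[OF j(1)] cell_sub_I[OF j(1)] by (simp add: set_lebesgue_integral_def measure_def Int_absorb2)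
          finally show ?thesis using True unfolding step_in_cell[OF j] by (simp add: abs_mult field_simps)
        next
          case False
          then have "real m + 1 < t" using t by (auto simp: B_def half_open_interval_def)
          moreover have "t < real j / 2 ^ n + 1 / 2 ^ n" using j(2) cell_length[of j n] by (auto simp: cell_def)
          moreover have "1 / 2 ^ n \<le> (1::real)" by simp
          ultimately have "real m < real j / 2 ^ n" by linarith
          then have "indicator (cell n j) s *\<^sub>R y s = 0" for s
            using ym(2)[of s] by (auto simp: cell_def indicator_def)
          then have "coeff n j y = 0" unfolding coeff_def set_lebesgue_integral_def by (simp only: Bochner_Integration.integral_zero)
          then show ?thesis unfolding step_in_cell[OF j] by simp
        qed
      qed
      moreover have "\<bar>y t\<bar> \<le> real m * indicator B t"
        using ym(1)[of t] ym(2)[of t] t by (cases "real m < t") (auto simp: B_def indicator_def half_open_interval_def)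
      ultimately show "\<bar>(step n (\<lambda>j. coeff n j y) - y) t\<bar> \<le> \<bar>h t\<bar>" unfolding h_def by (auto simp: abs_mult)
    qed
  qed
qed

text \<open>An argument with three error terms: the truncations \<open>y m\<close> converge to
  \<open>f\<close> in norm, their averages converge, and averaging is a contraction. The doubling
  condition enters in the first term, where \<open>f\<close> itself is the dominating
  function.\<close>

lemma average_tendsto:
  assumes d: delta2_cond and f: "f \<in> X"
  shows "(\<lambda>n. N (step n (\<lambda>j. coeff n j f) - f)) \<longlonglongrightarrow> 0"
proof -
  note [measurable] = X_measurable[OF f]
  define y where "y m t = (if \<bar>f t\<bar> \<le> real m \<and> t \<le> real m then f t else 0)" for m :: nat and t
  have [measurable]: "y m \<in> borel_measurable L" for m unfolding y_def[abs_def] by measurable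
  have yX: "y m \<in> X" and y_lim: "(\<lambda>n. N (step n (\<lambda>j. coeff n j (y m)) - y m)) \<longlonglongrightarrow> 0" for m
    by (rule average_bounded_tendsto[of _ m]; auto simp: y_def)+
  have z_lim: "(\<lambda>m. N (f - y m)) \<longlonglongrightarrow> 0"
  proof (rule N_dominated[where h=f])
    show "f - y m \<in> borel_measurable L" for m unfolding fun_diff_def by measurable
    show "AE t in L. \<bar>(f - y m) t\<bar> \<le> \<bar>f t\<bar>" for m by (rule AE_I2) (simp add: y_def)
    show "AE t in L. (\<lambda>m. (f - y m) t) \<longlonglongrightarrow> 0"
    proof (rule AE_I2)
      fix t
      have "eventually (\<lambda>m. max \<bar>f t\<bar> t \<le> real m) sequentially"
        using eventually_ge_at_top[of "nat \<lceil>max \<bar>f t\<bar> t\<rceil>"] by eventually_elim linarith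
      then have "eventually (\<lambda>m. (f - y m) t = 0) sequentially" by eventually_elim (simp add: y_def)
      then show "(\<lambda>m. (f - y m) t) \<longlonglongrightarrow> 0" by (rule tendsto_eventually)
    qed
  qed (use Mod_finite[OF d f] X_measurable[OF f] in auto)
  show ?thesis
  proof (rule order_tendstoI)
    fix e :: real assume "e < 0"
    then show "eventually (\<lambda>n. e < N (step n (\<lambda>j. coeff n j f) - f)) sequentially"
      using N_nonneg[OF nrm.diff[OF step_mem f]] by (auto intro!: always_eventually intro: less_le_trans)
  next
    fix e :: real assume e: "0 < e"
    have "eventually (\<lambda>m. N (f - y m) < e / 3) sequentially" using z_lim e by (intro order_tendstoD(2)[of _ 0]) auto
    then obtain m where m: "N (f - y m) < e / 3" by (auto simp: eventually_sequentially)
    have "eventually (\<lambda>n. N (step n (\<lambda>j. coeff n j (y m)) - y m) < e / 3) sequentially"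
      using y_lim e by (intro order_tendstoD(2)[of _ 0]) auto
    then show "eventually (\<lambda>n. N (step n (\<lambda>j. coeff n j f) - f) < e) sequentially"
    proof eventually_elim
      case (elim n)
      let ?P = "\<lambda>f. step n (\<lambda>j. coeff n j f)"
      have eq: "?P f - ?P (y m) = ?P (f - y m)"
        unfolding step_diff by (rule step_cong) (rule coeff_diff[OF f yX, symmetric])
      have "N (?P f - f) \<le> N (?P f - ?P (y m)) + N (?P (y m) - f)"
        by (rule nrm.N_triangle3[OF step_mem step_mem f])
      also have "N (?P (y m) - f) \<le> N (?P (y m) - y m) + N (y m - f)"
        by (rule nrm.N_triangle3[OF step_mem yX f])
      also have "N (y m - f) = N (f - y m)" by (rule nrm.N_minus_commute[OF yX f])
      also have "N (?P f - ?P (y m)) \<le> N (f - y m)" unfolding eq by (rule N_average_le[OF nrm.diff[OF f yX]])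
      finally show ?case using elim m by linarith
    qed
  qed
qed

lemma coeff_compat:
  assumes "f \<in> X" "j \<in> cells n"
  shows "coeff n j (step (Suc n) (\<lambda>i. coeff (Suc n) i f)) = coeff n j f"
  using coeff_halves[OF assms(2) step_set_integrable[OF cell_sets[OF assms(2)]], of "Suc n"]
    coeff_halves[OF assms(2) X_set_integrable_cell[OF assms]] coeff_step cells_halves[OF assms(2)] by simp

text \<open>The positive and negative parts of the martingale are nonnegative and bounded in mean on
  bounded intervals, but their integrals over a cell need not stabilise; therefore cluster values
  \<open>p\<close> are taken. The difference of the two integrals over a cell is eventually the
  prescribed coefficient, and this relation survives in \<open>p\<close>.\<close>

lemma boundedly_complete:
  assumes gc: growth_cond
    and cons: "\<And>n j. j \<in> cells n \<Longrightarrow> coeff n j (step (Suc n) (a (Suc n))) = a n j"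
    and bd: "\<And>n. N (step n (a n)) \<le> C"
  shows "\<exists>x\<in>X. \<forall>n. \<forall>j\<in>cells n. coeff n j x = a n j"
proof -
  define g where "g n = step n (a n)" for n
  have gX: "g n \<in> X" and gN: "N (g n) \<le> C" for n unfolding g_def by (rule step_mem) (rule bd)
  have gm [measurable]: "g n \<in> borel_measurable L" for n using X_measurable[OF gX] .
  have C0: "0 \<le> C" using N_nonneg[OF gX] gN by (rule order_trans)
  have coh: "j \<in> cells n \<Longrightarrow> coeff n j (g (n + k)) = a n j" for k n j
  proof (induction k arbitrary: n j)
    case 0 then show ?case by (simp add: g_def coeff_step)
  next
    case (Suc k)
    note h = cells_halves[OF Suc.prems]
    have "coeff n j (g (n + Suc k)) = coeff (Suc n) (2 * j) (g (Suc n + k)) + coeff (Suc n) (2 * j + 1) (g (Suc n + k))"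
      using coeff_halves[OF Suc.prems X_set_integrable_cell[OF gX Suc.prems]] by simp
    also have "\<dots> = a (Suc n) (2 * j) + a (Suc n) (2 * j + 1)" using Suc.IH[OF h(1)] Suc.IH[OF h(2)] by simp
    also have "\<dots> = coeff n j (step (Suc n) (a (Suc n)))"
      using coeff_halves[OF Suc.prems step_set_integrable[OF cell_sets[OF Suc.prems]]] coeff_step h by simp
    finally show ?case using cons[OF Suc.prems] by simp
  qed
  obtain R where R: "incseq R" "\<And>m. 0 < R m" "\<And>m. R m \<in> I" "\<And>t. t \<in> I \<Longrightarrow> \<exists>m. t < R m"
    using exhaustion by blast
  have "\<exists>K\<ge>0. \<forall>f\<in>X. (\<integral>\<^sup>+t. ennreal \<bar>f t\<bar> * indicator {0..R m} t \<partial>L) \<le> ennreal (K * N f)" for m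
    by (rule L1_local_bound[OF R(2,3)])
  then obtain K where K: "\<And>m. 0 \<le> K m" "\<And>m f. f \<in> X \<Longrightarrow> (\<integral>\<^sup>+t. ennreal \<bar>f t\<bar> * indicator {0..R m} t \<partial>L) \<le> ennreal (K m * N f)"
    by metis
  \<comment> \<open>The bounded measurable sets: on them the norm controls the integral of the
    absolute value.\<close>
  define bs where "bs m = {B \<in> sets L. B \<subseteq> {0..R m}}" for m
  have Rsub: "{0..R m} \<subseteq> I" for m using I_down[OF R(3)] by auto
  have Rset [measurable]: "{0..R m} \<in> sets L" for m by (rule borel_Int_I[OF _ Rsub]) simp
  define gp where "gp s n t = (if s then max 0 (g n t) else max 0 (- g n t))" for s n t
  have gpm [measurable]: "gp s n \<in> borel_measurable L" for s n unfolding gp_def[abs_def] by measurable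
  have gp0: "0 \<le> gp s n t" "gp s n t \<le> \<bar>g n t\<bar>" for s n t by (auto simp: gp_def)
  have gp_int: "set_integrable L B (gp s n)" if B: "B \<in> bs m" for s n B m
  proof -
    have "set_integrable L B (g n)" using B by (intro X_set_integrable[OF gX _ _ R(3)]) (auto simp: bs_def)
    then have "integrable L (\<lambda>t. indicator B t *\<^sub>R g n t)" by (simp add: set_integrable_def)
    moreover have "(\<lambda>t. indicator B t *\<^sub>R gp s n t) \<in> borel_measurable L"
      using B gpm[of s n] by (auto simp: bs_def intro!: borel_measurable_indicator borel_measurable_times)
    moreover have "AE t in L. norm (indicator B t *\<^sub>R gp s n t) \<le> norm (indicator B t *\<^sub>R g n t)"
      using gp0 by (intro AE_I2) (auto simp: indicator_def)
    ultimately show ?thesis unfolding set_integrable_def by (rule Bochner_Integration.integrable_bound)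
  qed
  have gp_nn: "ennreal (set_lebesgue_integral L B (gp s n)) \<le> (\<integral>\<^sup>+t. ennreal \<bar>g n t\<bar> * indicator B t \<partial>L)" if B: "B \<in> bs m" for s n B m
  proof -
    have "ennreal (set_lebesgue_integral L B (gp s n)) = (\<integral>\<^sup>+t. ennreal (indicator B t *\<^sub>R gp s n t) \<partial>L)"
      unfolding set_lebesgue_integral_def
      by (rule nn_integral_eq_integral[symmetric]) (use gp_int[OF B, of s n] gp0 in \<open>auto simp: set_integrable_def\<close>)
    also have "\<dots> \<le> (\<integral>\<^sup>+t. ennreal \<bar>g n t\<bar> * indicator B t \<partial>L)"
      using gp0 by (intro nn_integral_mono) (auto simp: indicator_def intro: ennreal_leI)
    finally show ?thesis .
  qed
  have gp_int0: "0 \<le> set_lebesgue_integral L B (gp s n)" for s n B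
    unfolding set_lebesgue_integral_def using gp0 by (intro integral_nonneg_AE AE_I2) auto
  \<comment> \<open>Coordinates are indexed by a sign and a set. The value 0 on sets that are in no
    \<open>bs m\<close> keeps every coordinate bounded in n.\<close>
  define y where "y n i = (if \<exists>m. snd i \<in> bs m then set_lebesgue_integral L (snd i) (gp (fst i) n) else 0)" for n :: nat and i :: "bool \<times> real set"
  \<comment> \<open>A set lies in many \<open>bs m\<close>; the least such m selects one bound for
    its coordinate.\<close>
  define c where "c i = (if \<exists>m. snd i \<in> bs m then K (LEAST m. snd i \<in> bs m) * C else 0)" for i :: "bool \<times> real set"
  have y_le: "\<bar>y n i\<bar> \<le> c i" for n i
  proof (cases "\<exists>m. snd i \<in> bs m")
    case True
    then have B: "snd i \<in> bs (LEAST m. snd i \<in> bs m)" by (rule LeastI_ex)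
    let ?m = "LEAST m. snd i \<in> bs m"
    have "ennreal (set_lebesgue_integral L (snd i) (gp (fst i) n)) \<le> (\<integral>\<^sup>+t. ennreal \<bar>g n t\<bar> * indicator (snd i) t \<partial>L)"
      by (rule gp_nn[OF B])
    also have "\<dots> \<le> (\<integral>\<^sup>+t. ennreal \<bar>g n t\<bar> * indicator {0..R ?m} t \<partial>L)"
      using B by (intro nn_integral_mono) (auto simp: bs_def indicator_def)
    also have "\<dots> \<le> ennreal (K ?m * N (g n))" by (rule K(2)[OF gX])
    also have "\<dots> \<le> ennreal (K ?m * C)" by (intro ennreal_leI mult_left_mono gN K)
    finally have "set_lebesgue_integral L (snd i) (gp (fst i) n) \<le> K ?m * C"
      using K(1) C0 by (subst (asm) ennreal_le_iff) auto
    then show ?thesis using True gp_int0 by (simp add: y_def c_def)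
  qed (simp add: y_def c_def)
  obtain p where p: "\<And>S. closed S \<Longrightarrow> eventually (\<lambda>n. y n \<in> S) sequentially \<Longrightarrow> p \<in> S"
    using bounded_sequence_cluster_point[of y c, OF y_le] by blast
  have p_le: "p i \<le> e" if "\<And>n. y n i \<le> e" for i e
  proof -
    have "p \<in> {z. z i \<le> e}"
      by (rule p, intro closed_Collect_le continuous_on_product_coordinates continuous_on_const, use that in simp)
    then show ?thesis by simp
  qed
  have p_ge: "e \<le> p i" if "\<And>n. e \<le> y n i" for i e
  proof -
    have "p \<in> {z. e \<le> z i}"
      by (rule p, intro closed_Collect_le continuous_on_product_coordinates continuous_on_const, use that in simp)
    then show ?thesis by simp
  qed
  have y_eq: "y n (s, B) = set_lebesgue_integral L B (gp s n)" if "B \<in> bs m" for n s B m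
    using that by (auto simp: y_def)
  have p0: "0 \<le> p (s, B)" for s B
    by (rule p_ge) (simp add: y_def gp_int0)
  have p_add: "p (s, A \<union> B) = p (s, A) + p (s, B)" if AB: "A \<in> bs m" "B \<in> bs m" "A \<inter> B = {}" for s A B m
  proof -
    have U: "A \<union> B \<in> bs m" using AB by (auto simp: bs_def)
    have "y n \<in> {z. z (s, A \<union> B) = z (s, A) + z (s, B)}" for n
      unfolding mem_Collect_eq y_eq[OF U] y_eq[OF AB(1)] y_eq[OF AB(2)]
      using AB gp_int by (intro set_integral_Un) auto
    then have "p \<in> {z. z (s, A \<union> B) = z (s, A) + z (s, B)}"
      by (intro p closed_Collect_eq continuous_on_add continuous_on_product_coordinates always_eventually allI)
    then show ?thesis by simp
  qed
  \<comment> \<open>Uniform integrability passes to the cluster point, being a family of closed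
    conditions. It yields both countable additivity and absolute continuity of
    \<open>p\<close>.\<close>
  have p_small: "\<exists>b>0. \<forall>s m. \<forall>B\<in>bs m. emeasure L B \<le> ennreal b \<longrightarrow> p (s, B) \<le> e" if e: "0 < e" for e
  proof -
    have "0 < C + 1" using C0 by simp
    from uniform_integrability[OF gc this e] obtain b where b: "b > 0"
      "\<And>f B. f \<in> X \<Longrightarrow> N f \<le> C + 1 \<Longrightarrow> B \<in> sets L \<Longrightarrow> emeasure L B \<le> ennreal b \<Longrightarrow> (\<integral>\<^sup>+t. ennreal \<bar>f t\<bar> * indicator B t \<partial>L) \<le> ennreal e" by blast
    have "p (s, B) \<le> e" if B: "B \<in> bs m" "emeasure L B \<le> ennreal b" for s m B
    proof (rule p_le)
      fix n
      have "ennreal (y n (s, B)) \<le> ennreal e"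
        unfolding y_eq[OF B(1)]
        by (rule order_trans[OF gp_nn[OF B(1)] b(2)[OF gX _ _ B(2)]]) (use gN[of n] B(1) in \<open>auto simp: bs_def\<close>)
      then show "y n (s, B) \<le> e" using e by (subst (asm) ennreal_le_iff) auto
    qed
    then show ?thesis using b(1) by blast
  qed
  have bs_mono: "B \<in> bs m \<Longrightarrow> m \<le> k \<Longrightarrow> B \<in> bs k" for B m k
    using incseqD[OF R(1), of m k] by (force simp: bs_def)
  have bs_Int: "E \<inter> {0..R m} \<in> bs m" if "E \<in> sets L" for E m
    using that Rset[of m] by (auto simp: bs_def)
  have p_mono: "p (s, A) \<le> p (s, B)" if "A \<in> bs m" "B \<in> bs m" "A \<subseteq> B" for s A B m
  proof -
    have "B - A \<in> bs m" using that by (auto simp: bs_def)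
    then have "p (s, A \<union> (B - A)) = p (s, A) + p (s, B - A)" using that by (intro p_add) auto
    moreover have "A \<union> (B - A) = B" using that(3) by blast
    ultimately show ?thesis using p0[of s "B - A"] by simp
  qed
  have p_empty: "p (s, {}) = 0" for s
    using p_add[of "{}" 0 "{}" s] by (simp add: bs_def)
  \<comment> \<open>So far \<open>p\<close> is meaningful on bounded sets. The supremum extends it
    to all measurable sets, possibly with the value \<infinity>, which is why Radon-Nikodym is used
    for extended set functions.\<close>
  define \<nu> where "\<nu> s E = (SUP m. ennreal (p (s, E \<inter> {0..R m})))" for s E
  have inc: "incseq (\<lambda>m. ennreal (p (s, E \<inter> {0..R m})))" if "E \<in> sets L" for s E
  proof (rule incseq_SucI)
    fix m
    have "R m \<le> R (Suc m)" using R(1) by (rule incseq_SucD)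
    then show "ennreal (p (s, E \<inter> {0..R m})) \<le> ennreal (p (s, E \<inter> {0..R (Suc m)}))"
      by (intro ennreal_leI p_mono[of _ "Suc m"] bs_mono[OF bs_Int[OF that, of m]] bs_Int that) auto
  qed
  have \<nu>_bs: "\<nu> s B = ennreal (p (s, B))" if B: "B \<in> bs m" for s B m
  proof (rule antisym)
    have BL: "B \<in> sets L" using B by (simp add: bs_def)
    show "\<nu> s B \<le> ennreal (p (s, B))"
      unfolding \<nu>_def
    proof (rule SUP_least)
      fix k
      show "ennreal (p (s, B \<inter> {0..R k})) \<le> ennreal (p (s, B))"
        by (intro ennreal_leI p_mono[of _ "max m k"] bs_mono[OF bs_Int[OF BL, of k]] bs_mono[OF B]) auto
    qed
    have "B \<inter> {0..R m} = B" using B by (auto simp: bs_def)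
    then show "ennreal (p (s, B)) \<le> \<nu> s B"
      unfolding \<nu>_def by (intro SUP_upper2[of m]) auto
  qed
  have p_sums: "(\<lambda>i. p (s, A i)) sums p (s, \<Union>i. A i)" if A: "\<And>i. A i \<in> bs m" "disjoint_family A" for s A m
  proof -
    let ?T = "\<lambda>n. \<Union>i\<in>{n..}. A i"
    have Um: "(\<Union>i\<in>F. A i) \<in> bs m" for F
    proof -
      have "(\<Union>i\<in>F. A i) \<in> sets L" using A(1) by (intro sets.countable_UN'[OF countableI_type]) (auto simp: bs_def)
      then show ?thesis using A(1) by (auto simp: bs_def)
    qed
    have split: "p (s, \<Union>i. A i) = (\<Sum>i<n. p (s, A i)) + p (s, ?T n)" for n
    proof (induction n)
      case 0 then show ?case by (simp add: atLeast_0)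
    next
      case (Suc n)
      have "?T n = A n \<union> ?T (Suc n)" by (force simp: le_eq_less_or_eq Suc_le_eq)
      moreover have "A n \<inter> ?T (Suc n) = {}"
      proof -
        have "A n \<inter> A i = {}" if "Suc n \<le> i" for i
          using disjoint_family_onD[OF A(2), of n i] that by simp
        then show ?thesis by blast
      qed
      ultimately have "p (s, ?T n) = p (s, A n) + p (s, ?T (Suc n))"
        using p_add[OF A(1) Um] by simp
      then show ?case using Suc by simp
    qed
    \<comment> \<open>The tails decrease to the empty set inside a set of finite measure, so their
      measures tend to 0 and \<open>p_small\<close> applies.\<close>
    have tail: "(\<lambda>n. p (s, ?T n)) \<longlonglongrightarrow> 0"
    proof (rule order_tendstoI)
      fix e :: real assume "e < 0"
      then show "eventually (\<lambda>n. e < p (s, ?T n)) sequentially" using p0 by (auto intro!: always_eventually intro: less_le_trans)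
    next
      fix e :: real assume e: "0 < e"
      obtain b where b: "b > 0" "\<And>B. B \<in> bs m \<Longrightarrow> emeasure L B \<le> ennreal b \<Longrightarrow> p (s, B) \<le> e / 2"
        using p_small[of "e / 2"] e by auto
      have "(\<lambda>n. emeasure L (?T n)) \<longlonglongrightarrow> emeasure L (\<Inter>n. ?T n)"
      proof (rule Lim_emeasure_decseq)
        show "range ?T \<subseteq> sets L" using Um by (auto simp: bs_def)
        show "decseq ?T" unfolding decseq_def by (intro allI impI UN_mono) auto
        show "emeasure L (?T n) \<noteq> \<infinity>" for n
          using emeasure_L_le[of "?T n" "R m"] Um[of "{n..}"] R(2)[of m] by (auto simp: bs_def top_unique)
      qed
      moreover have "(\<Inter>n. ?T n) = {}"
      proof (rule equals0I)
        fix t assume t: "t \<in> (\<Inter>n. ?T n)"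
        then obtain i where i: "t \<in> A i" by blast
        from t obtain k where "k \<ge> Suc i" "t \<in> A k" by blast
        then show False using i disjoint_family_onD[OF A(2), of i k] by auto
      qed
      ultimately have "(\<lambda>n. emeasure L (?T n)) \<longlonglongrightarrow> 0" by simp
      then have "eventually (\<lambda>n. emeasure L (?T n) < ennreal b) sequentially"
        using b(1) by (intro order_tendstoD(2)[of _ 0]) auto
      then show "eventually (\<lambda>n. p (s, ?T n) < e) sequentially"
      proof eventually_elim
        case (elim n)
        then have "p (s, ?T n) \<le> e / 2" by (intro b(2)[OF Um]) simp
        then show ?case using e by simp
      qed
    qed
    have "(\<lambda>n. p (s, \<Union>i. A i) - p (s, ?T n)) \<longlonglongrightarrow> p (s, \<Union>i. A i) - 0"
      by (intro tendsto_diff tendsto_const tail)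
    moreover have "(\<lambda>n. p (s, \<Union>i. A i) - p (s, ?T n)) = (\<lambda>n. \<Sum>i<n. p (s, A i))"
    proof (rule ext)
      fix n
      show "p (s, \<Union>i. A i) - p (s, ?T n) = (\<Sum>i<n. p (s, A i))" using split[of n] by linarith
    qed
    ultimately show ?thesis by (simp add: sums_def)
  qed
  have "\<exists>h\<in>borel_measurable L. \<forall>E\<in>sets L. \<nu> s E = (\<integral>\<^sup>+t. h t * indicator E t \<partial>L)" for s
  proof (rule radon_nikodym_set_function[OF L.sigma_finite_measure_axioms])
    show "\<nu> s {} = 0" by (simp add: \<nu>_def p_empty)
    show "\<nu> s E = 0" if E: "E \<in> null_sets L" for E
    proof -
      have "p (s, E \<inter> {0..R m}) \<le> e" if "0 < e" for m e
      proof -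
        have "E \<inter> {0..R m} \<in> null_sets L" using E Rset[of m] by (auto intro: null_set_Int2)
        then have "emeasure L (E \<inter> {0..R m}) = 0" by (simp add: null_sets_def)
        then show ?thesis using p_small[OF that] bs_Int[of E m] E by (auto simp: null_sets_def)
      qed
      then have "p (s, E \<inter> {0..R m}) \<le> 0" for m by (rule dense_ge)
      then have "p (s, E \<inter> {0..R m}) = 0" for m using p0 by (rule antisym)
      then show ?thesis by (simp add: \<nu>_def)
    qed
    fix A :: "nat \<Rightarrow> real set" assume A: "range A \<subseteq> sets L" "disjoint_family A"
    have "(\<Sum>i. \<nu> s (A i)) = (SUP m. \<Sum>i. ennreal (p (s, A i \<inter> {0..R m})))"
      unfolding \<nu>_def using A(1) by (intro ennreal_suminf_SUP_eq inc) auto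
    also have "\<dots> = (SUP m. ennreal (p (s, (\<Union>i. A i) \<inter> {0..R m})))"
    proof (intro SUP_cong refl)
      fix m
      have "(\<lambda>i. p (s, A i \<inter> {0..R m})) sums p (s, \<Union>i. A i \<inter> {0..R m})"
      proof (rule p_sums[of _ m])
        show "A i \<inter> {0..R m} \<in> bs m" for i using A(1) by (intro bs_Int) auto
        show "disjoint_family (\<lambda>i. A i \<inter> {0..R m})" using A(2) unfolding disjoint_family_on_def by blast
      qed
      then have "(\<lambda>i. ennreal (p (s, A i \<inter> {0..R m}))) sums ennreal (p (s, \<Union>i. A i \<inter> {0..R m}))"
        using p0 by (subst sums_ennreal) auto
      moreover have "(\<Union>i. A i \<inter> {0..R m}) = (\<Union>i. A i) \<inter> {0..R m}" by blast
      ultimately show "(\<Sum>i. ennreal (p (s, A i \<inter> {0..R m}))) = ennreal (p (s, (\<Union>i. A i) \<inter> {0..R m}))"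
        by (simp add: sums_iff)
    qed
    finally show "(\<Sum>i. \<nu> s (A i)) = \<nu> s (\<Union>i. A i)" by (simp add: \<nu>_def)
  qed
  then obtain h where h [measurable]: "\<And>s. h s \<in> borel_measurable L"
    and h_eq: "\<And>s E. E \<in> sets L \<Longrightarrow> \<nu> s E = (\<integral>\<^sup>+t. h s t * indicator E t \<partial>L)" by metis
  have h_int: "set_integrable L B (\<lambda>t. enn2real (h s t))" "set_lebesgue_integral L B (\<lambda>t. enn2real (h s t)) = p (s, B)"
    if B: "B \<in> bs m" for s B m
  proof -
    have BL: "B \<in> sets L" using B by (simp add: bs_def)
    have "(\<integral>\<^sup>+t. h s t * indicator B t \<partial>L) = ennreal (p (s, B))"
      unfolding h_eq[OF BL, symmetric] by (rule \<nu>_bs[OF B])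
    from enn2real_set_integral[OF h BL this p0]
    show "set_integrable L B (\<lambda>t. enn2real (h s t))" "set_lebesgue_integral L B (\<lambda>t. enn2real (h s t)) = p (s, B)" .
  qed
  define x where "x t = enn2real (h True t) - enn2real (h False t)" for t
  have xm [measurable]: "x \<in> borel_measurable L" unfolding x_def[abs_def] by measurable
  have cell_bs: "\<exists>m. cell n j \<in> bs m" if j: "j \<in> cells n" for n j
  proof -
    obtain m where "real (Suc j) / 2 ^ n < R m" using R(4)[OF cell_end_mem[OF j]] by blast
    then show ?thesis using cell_sub[OF j] cell_sets[OF j] by (intro exI[of _ m]) (force simp: bs_def)
  qed
  have x_coeff: "coeff n j x = a n j" if j: "j \<in> cells n" for n j
  proof -
    obtain m where m: "cell n j \<in> bs m" using cell_bs[OF j] by blast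
    \<comment> \<open>By coherence all members with index at least n have the same integral over the
      cell, so the equation holds eventually and defines a closed set.\<close>
    have "y k \<in> {z. z (True, cell n j) - z (False, cell n j) = a n j}" if "n \<le> k" for k
    proof -
      have "set_lebesgue_integral L (cell n j) (gp True k) - set_lebesgue_integral L (cell n j) (gp False k)
        = set_lebesgue_integral L (cell n j) (\<lambda>t. gp True k t - gp False k t)"
        by (intro set_integral_diff(2)[symmetric] gp_int[OF m])
      also have "(\<lambda>t. gp True k t - gp False k t) = g k" by (auto simp: gp_def fun_eq_iff)
      also have "set_lebesgue_integral L (cell n j) (g k) = a n j"
        using coh[OF j, of "k - n"] that by (simp add: coeff_def)
      finally show ?thesis by (simp add: y_eq[OF m])
    qed
    then have ev: "eventually (\<lambda>k. y k \<in> {z. z (True, cell n j) - z (False, cell n j) = a n j}) sequentially"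
      by (auto simp: eventually_sequentially)
    have "p \<in> {z. z (True, cell n j) - z (False, cell n j) = a n j}"
      by (rule p[OF _ ev]) (intro closed_Collect_eq continuous_on_diff continuous_on_product_coordinates continuous_on_const)
    moreover have "coeff n j x = p (True, cell n j) - p (False, cell n j)"
      unfolding coeff_def x_def using h_int[OF m] by (subst set_integral_diff(2)) auto
    ultimately show ?thesis by simp
  qed
  have lim: "AE t in L. (\<lambda>n. g n t) \<longlonglongrightarrow> x t"
  proof -
    have "AE t in L. (\<lambda>n. step n (\<lambda>j. coeff n j x) t) \<longlonglongrightarrow> x t"
    proof (rule step_coeff_tendsto_AE[OF xm])
      fix r assume "r \<in> I"
      then obtain m where m: "r < R m" using R(4) by blast
      have "{0..R m} \<in> bs m" using Rset by (simp add: bs_def)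
      then have "set_integrable L {0..R m} x" unfolding x_def using h_int(1) by (intro set_integral_diff(1)) auto
      then show "set_integrable L {0..r} x"
        by (rule set_integrable_subset) (use m I_down[OF \<open>r \<in> I\<close>] in \<open>auto intro!: borel_Int_I\<close>)
    qed
    moreover have "step n (\<lambda>j. coeff n j x) = g n" for n unfolding g_def by (rule step_cong) (rule x_coeff)
    ultimately show ?thesis by simp
  qed
  \<comment> \<open>\<open>C + 1\<close> lies strictly above all the norms, so the modulars along
    the sequence are at most 1, and Fatou carries this bound over to \<open>x\<close>.\<close>
  have "Mod (\<lambda>t. x t / (C + 1)) \<le> 1"
    unfolding Mod_def
  proof (rule J_Fatou[where k=0])
    show "AE t in L. (\<lambda>n. ennreal (\<phi> \<bar>g n t / (C + 1)\<bar>)) \<longlonglongrightarrow> ennreal (\<phi> \<bar>x t / (C + 1)\<bar>)"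
      using lim by eventually_elim (intro tendsto_ennrealI phi_tendsto tendsto_divide tendsto_const, use C0 in auto)
    show "J (\<lambda>t. ennreal (\<phi> \<bar>g n t / (C + 1)\<bar>)) \<le> 1" for n
      using N_less[OF gX, of n "C + 1"] gN[of n] by (simp add: Mod_def)
  qed measurable
  then have "x \<in> X" using C0 by (intro X_I[OF xm, of "C + 1"]) (auto simp: order_le_less_trans)
  then show ?thesis using x_coeff by blast
qed

theorem radon_nikodym_of_conditions:
  assumes growth_cond delta2_cond "finite_measure M"
  shows "radon_nikodym_property_wrt M X N"
proof (rule nrm.radon_nikodym_from_decomposition[where A=cells and c=coeff and e="\<lambda>n j t. 2 ^ n * indicator (cell n j) t"])
  show "finite (cells n)" for n by (rule finite_cells)
  show "(\<lambda>t. 2 ^ n * indicator (cell n j) t) \<in> X" if "j \<in> cells n" for n j by (rule cell_vector_mem[OF that])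
  show "coeff n j (x + y) = coeff n j x + coeff n j y" if "j \<in> cells n" "x \<in> X" "y \<in> X" for n j x y
    using that by (intro coeff_add)
  show "coeff n j (r *\<^sub>R x) = r * coeff n j x" for n j r x by (rule coeff_scale)
  show "\<exists>K\<ge>0. \<forall>x\<in>X. \<bar>coeff n j x\<bar> \<le> K * N x" if "j \<in> cells n" for n j by (rule coeff_bounded[OF that])
  show "N (\<Sum>j\<in>cells n. coeff n j x *\<^sub>R (\<lambda>t. 2 ^ n * indicator (cell n j) t)) \<le> N x" if "x \<in> X" for n x
    unfolding step_eq_sum[symmetric] by (rule N_average_le[OF that])
  show "(\<lambda>n. N ((\<Sum>j\<in>cells n. coeff n j x *\<^sub>R (\<lambda>t. 2 ^ n * indicator (cell n j) t)) - x)) \<longlonglongrightarrow> 0" if "x \<in> X" for x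
    unfolding step_eq_sum[symmetric] by (rule average_tendsto[OF assms(2) that])
  show "coeff n j (\<Sum>i\<in>cells (Suc n). coeff (Suc n) i x *\<^sub>R (\<lambda>t. 2 ^ Suc n * indicator (cell (Suc n) i) t)) = coeff n j x"
    if "j \<in> cells n" "x \<in> X" for n j x
    unfolding step_eq_sum[symmetric] by (rule coeff_compat[OF that(2,1)])
  show "\<exists>x\<in>X. \<forall>n. \<forall>j\<in>cells n. coeff n j x = a n j"
    if "\<And>n j. j \<in> cells n \<Longrightarrow> coeff n j (\<Sum>i\<in>cells (Suc n). a (Suc n) i *\<^sub>R (\<lambda>t. 2 ^ Suc n * indicator (cell (Suc n) i) t)) = a n j"
      "\<And>n. N (\<Sum>j\<in>cells n. a n j *\<^sub>R (\<lambda>t. 2 ^ n * indicator (cell n j) t)) \<le> C" for a C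
    using that unfolding step_eq_sum[symmetric] by (intro boundedly_complete[OF assms(1)])
  show "finite_measure M" by fact
qed

subsection \<open>Necessity\<close>

text \<open>Since \<phi>(u)/u increases, it is bounded if it does not tend to \<infinity>; and the
  weight is bounded by \<open>weight_bounded_iff\<close>. So both \<phi> and \<open>W\<close> grow
  at most linearly, which bounds the norm of an indicator by a multiple of the measure of its
  set.\<close>

lemma not_growth_bounds:
  assumes "\<not> growth_cond"
  shows "\<exists>l>0. \<exists>b>0. (\<forall>u\<ge>0. \<phi> u \<le> l * u) \<and> (\<forall>x. W (ennreal x) \<le> ennreal (b * x))"
proof -
  have nN: "\<not> N_function_at_infinity \<phi>" and nW: "\<not> ((\<lambda>t. t / weight_primitive w t) \<longlongrightarrow> 0) (at_right 0)"
    using assms by (auto simp: growth_cond_def)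
  obtain z where z: "\<not> eventually (\<lambda>u. z \<le> \<phi> u / u) at_top"
    using nN unfolding N_function_at_infinity_def filterlim_at_top by blast
  define l where "l = max z 1"
  have phi: "\<phi> u \<le> l * u" if u: "0 \<le> u" for u
  proof (cases "u = 0")
    case False
    then have u: "0 < u" using u by simp
    obtain v where v: "v \<ge> u" "\<phi> v / v < z"
      using z unfolding eventually_at_top_linorder by (meson not_le)
    have "\<phi> u / u \<le> \<phi> v / v" by (rule phi_ratio_mono[OF u v(1)])
    then have "\<phi> u / u \<le> l" using v(2) by (simp add: l_def)
    then show ?thesis using u by (simp add: field_simps)
  qed simp
  obtain b where b: "\<And>s. 0 < s \<Longrightarrow> s \<in> I \<Longrightarrow> w s \<le> b" using nW weight_bounded_iff by blast
  have b0: "0 < b" using exists_pos b w_pos by (meson less_le_trans)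
  have "W (ennreal x) \<le> ennreal (b * x)" for x
  proof (cases "0 \<le> x")
    case True
    have A: "{t \<in> I. t \<in> {0..x}} \<in> sets L" by (rule mem_sets_L_borel) simp
    have "W (ennreal x) \<le> (\<integral>\<^sup>+t. ennreal b * indicator {t \<in> I. t \<in> {0..x}} t \<partial>L)"
      unfolding W_def
    proof (rule nn_integral_mono_AE)
      show "AE t in L. ennreal (w t) * indicator {t. ennreal t < ennreal x} t \<le> ennreal b * indicator {t \<in> I. t \<in> {0..x}} t"
        using AE_L_pos AE_space
        by eventually_elim (use b True in \<open>auto simp: indicator_def ennreal_less_iff intro!: ennreal_leI\<close>)
    qed
    also have "\<dots> = ennreal b * emeasure L {t \<in> I. t \<in> {0..x}}" by (rule nn_integral_cmult_indicator[OF A])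
    also have "\<dots> \<le> ennreal b * ennreal x" using True by (intro mult_left_mono emeasure_L_le[OF A]) auto
    finally show ?thesis using b0 True by (simp add: ennreal_mult)
  qed (simp add: ennreal_neg)
  then show ?thesis using phi b0 by (intro exI[of _ l]) (auto simp: l_def)
qed

text \<open>The interval is cut into n pieces of length c/n. The integral of a simple function over
  a piece is a combination of its finitely many values with coefficients at most c/n. Restricted to
  the respective pieces, these integrals have total mass in mean at most T c/n, whereas the
  indicators of the pieces have total mass c. So the errors cannot be small in sum.\<close>

lemma not_growth_imp_not_rnp:
  assumes ng: "\<not> growth_cond"
  shows "\<exists>M :: real measure. finite_measure M \<and> \<not> radon_nikodym_property_wrt M X N"
proof -
  obtain c where c: "0 < c" "c \<in> I" using exists_pos by blast
  define M where "M = lebesgue_on {0..c}"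
  have cI: "{0..c} \<subseteq> I" using I_down[OF c(2)] by auto
  have M_sets: "E \<in> sets M \<longleftrightarrow> E \<in> sets lebesgue \<and> E \<subseteq> {0..c}" for E
    unfolding M_def by (auto simp: sets_restrict_space_iff)
  have in_L: "E \<in> sets L" if "E \<in> sets M" for E using that cI by (auto simp: M_sets sets_L_iff)
  have M_em: "emeasure M E = emeasure L E" if "E \<in> sets M" for E
  proof -
    have "E \<subseteq> {0..c}" using that by (simp add: M_sets)
    then show ?thesis using L_le_lebesgue[OF in_L[OF that]] by (simp add: M_def emeasure_restrict_space)
  qed
  have spM: "space M = {0..c}" by (simp add: M_def)
  have fm: "finite_measure M" by (rule finite_measureI) (use c in \<open>simp add: M_def emeasure_restrict_space\<close>)
  interpret fin: finite_measure M by (rule fm)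
  define G :: "real set \<Rightarrow> real \<Rightarrow> real" where "G E = (\<lambda>t. 1 * indicator E t)" for E
  have L_em: "emeasure L E = ennreal (measure M E)" if "E \<in> sets M" for E
    using M_em[OF that] by (simp add: fin.emeasure_eq_measure)
  have GX: "G E \<in> X" if "E \<in> sets M" for E
    unfolding G_def by (rule indicator_mem[OF in_L[OF that]]) (simp add: L_em[OF that])
  obtain l b where lb: "0 < l" "0 < b" "\<And>u. 0 \<le> u \<Longrightarrow> \<phi> u \<le> l * u" "\<And>x. W (ennreal x) \<le> ennreal (b * x)"
    using not_growth_bounds[OF ng] by blast
  have G_bound: "N (G E) \<le> (l * b) * measure M E" if E: "E \<in> sets M" for E
  proof (rule dense_ge)
    fix e assume e: "(l * b) * measure M E < e"
    have e0: "0 < e" by (rule le_less_trans[OF _ e]) (use lb in simp)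
    have "Mod (\<lambda>t. G E t / e) = Mod (\<lambda>t. (1 / e) * indicator E t)" by (simp add: G_def)
    also have "\<dots> = ennreal (\<phi> (1 / e)) * W (ennreal (measure M E))"
      using Mod_indicator[OF in_L[OF E], of "1 / e"] e0 by (simp add: L_em[OF E])
    also have "\<dots> \<le> ennreal (l * (1 / e)) * ennreal (b * measure M E)"
      using e0 by (intro mult_mono ennreal_leI lb(3,4)) auto
    also have "\<dots> = ennreal (l * b * measure M E / e)"
      using lb e0 by (simp add: ennreal_mult[symmetric] mult_ac)
    also have "\<dots> \<le> ennreal 1" using e e0 by (intro ennreal_leI) (simp add: field_simps)
    finally show "N (G E) \<le> e" using e0 X_measurable[OF GX[OF E]] by (intro N_le) auto
  qed
  have G_add: "G (A \<union> B) = G A + G B" if "A \<inter> B = {}" for A B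
    using that by (auto simp: G_def fun_eq_iff indicator_def)
  have vm: "vector_measure X N M G" "continuous_wrt_measure N M G" "bounded_variation N M G"
    using lb by (intro nrm.vector_measure_of_lipschitz[OF fm GX G_add _ G_bound]; simp)+
  have "\<not> radon_nikodym_property_wrt M X N"
  proof
    assume "radon_nikodym_property_wrt M X N"
    then obtain g where g: "\<And>E. E \<in> sets M \<Longrightarrow> has_bochner_integral_over X N M g E (G E)"
      unfolding radon_nikodym_property_wrt_def using vm by blast
    obtain K where K: "0 \<le> K" "\<And>f B. f \<in> X \<Longrightarrow> B \<in> sets L \<Longrightarrow> B \<subseteq> {0..c} \<Longrightarrow> set_lebesgue_integral L B (\<lambda>t. \<bar>f t\<bar>) \<le> K * N f"
      using L1_local_bound_real[OF c] by blast
    \<comment> \<open>The allowed total error \<open>d\<close> corresponds to at most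
      \<open>c / 2\<close> in mean, while the actual error will exceed
      \<open>3 * c / 4\<close>.\<close>
    define d where "d = c / (2 * (K + 1))"
    have d: "0 < d" "K * d \<le> c / 2"
    proof -
      show "0 < d" using c K(1) by (simp add: d_def)
      have "K * d = c / 2 * (K / (K + 1))" by (simp add: d_def)
      also have "\<dots> \<le> c / 2 * 1" using c K(1) by (intro mult_left_mono) auto
      finally show "K * d \<le> c / 2" by simp
    qed
    have "\<exists>s. simple_into X M s \<and> (\<forall>k F. finite (k::nat set) \<longrightarrow> F ` k \<subseteq> sets M \<longrightarrow> disjoint_family_on F k \<longrightarrow>
        (\<Sum>i\<in>k. N (simple_integral_over M (F i) s - G (F i))) \<le> d)"
      by (rule nrm.bochner_simple_approx[OF fm]) (rule g, assumption, rule d(1))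
    then obtain s where s: "simple_into X M s"
      and s_err_all: "\<forall>k F. finite (k::nat set) \<longrightarrow> F ` k \<subseteq> sets M \<longrightarrow> disjoint_family_on F k \<longrightarrow>
        (\<Sum>i\<in>k. N (simple_integral_over M (F i) s - G (F i))) \<le> d"
      by (elim exE conjE)
    have s_err: "(\<Sum>i\<in>k. N (simple_integral_over M (F i) s - G (F i))) \<le> d"
      if "finite k" "F ` k \<subseteq> sets M" "disjoint_family_on F k" for F and k :: "nat set"
      using s_err_all that by simp
    define Y where "Y = s ` space M"
    have Y: "finite Y" "Y \<subseteq> X" using s by (auto simp: Y_def simple_into_def simple_function_def)
    \<comment> \<open>The total mass in mean of the values of \<open>s\<close>. It is fixed before
      n, so n can exceed \<open>4 * T\<close>.\<close>
    define T where "T = (\<Sum>y\<in>Y. set_lebesgue_integral L {0..c} (\<lambda>t. \<bar>y t\<bar>))"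
    obtain n :: nat where n: "4 * T < real n" "0 < n" 
      using reals_Archimedean2[of "max (4 * T) 1"] by auto
    define F where "F k = {real k * c / real n ..< real (Suc k) * c / real n}" for k
    have F_sub: "F k \<subseteq> {0..c}" if "k < n" for k
    proof
      fix t assume "t \<in> F k"
      then have t: "real k * c / real n \<le> t" "t < real (Suc k) * c / real n" by (auto simp: F_def)
      have "0 \<le> real k * c / real n" using c by simp
      moreover have "real (Suc k) * c / real n \<le> real n * c / real n"
        using that c by (intro divide_right_mono mult_right_mono) auto
      ultimately have "0 \<le> t" "t \<le> c" using t n by auto
      then show "t \<in> {0..c}" by simp
    qed
    have F_sets: "F k \<in> sets M" if "k < n" for k
      using F_sub[OF that] by (auto simp: M_sets F_def)
    have F_len: "real (Suc k) * c / real n - real k * c / real n = c / real n" for k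
      by (simp add: diff_divide_distrib[symmetric] left_diff_distrib[symmetric])
    have F_meas: "measure M (F k) = c / real n" "measure L (F k) = c / real n" if "k < n" for k
    proof -
      have "emeasure L (F k) = ennreal (c / real n)"
        using L_le_lebesgue[OF in_L[OF F_sets[OF that]]] F_len[of k] c n(2)
        by (simp add: F_def divide_right_mono mult_right_mono)
      then show "measure M (F k) = c / real n" "measure L (F k) = c / real n"
        using M_em[OF F_sets[OF that]] c by (auto simp: measure_def)
    qed
    have F_disj: "disjoint_family_on F {..<n}"
    proof -
      have "k = nat \<lfloor>t * real n / c\<rfloor>" if "t \<in> F k" for t k
      proof -
        have "real k \<le> t * real n / c" "t * real n / c < real (Suc k)"
          using that c n(2) by (auto simp: F_def field_simps)
        then show ?thesis by linarith
      qed
      then show ?thesis unfolding disjoint_family_on_def by blast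
    qed
    define \<mu> where "\<mu> k y = measure M (s -` {y} \<inter> F k \<inter> space M)" for k y
    have \<mu>: "0 \<le> \<mu> k y" "\<mu> k y \<le> c / real n" if "k < n" for k y
      using F_sets[OF that] F_meas[OF that] fin.finite_measure_mono[of "s -` {y} \<inter> F k \<inter> space M" "F k"] by (auto simp: \<mu>_def)
    define f where "f k = simple_integral_over M (F k) s - G (F k)" for k
    have fX: "f k \<in> X" if "k < n" for k
      unfolding f_def by (intro nrm.diff nrm.simple_integral_mem[OF s] GX F_sets that)
    have FL: "F k \<in> sets L" if "k < n" for k by (rule in_L[OF F_sets[OF that]])
    have yint: "set_integrable L B (\<lambda>t. \<bar>y t\<bar>)" if "y \<in> Y" "B \<in> sets L" "B \<subseteq> {0..c}" for y B
      using X_set_integrable[OF _ that(2,3) c(2), of y] Y that(1) by (intro set_integrable_abs) auto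
    \<comment> \<open>On the piece \<open>F k\<close> the value of \<open>G (F k)\<close> is 1, and
      the simple integral takes away at most its own mass there; only this piece of the error is
      counted.\<close>
    have low: "c / real n - c / real n * (\<Sum>y\<in>Y. set_lebesgue_integral L (F k) (\<lambda>t. \<bar>y t\<bar>)) \<le> K * N (f k)" if k: "k < n" for k
    proof -
      have one: "set_integrable L (F k) (\<lambda>t. 1 :: real)" "set_lebesgue_integral L (F k) (\<lambda>t. 1 :: real) = c / real n"
        using FL[OF k] F_meas[OF k] L_em[OF F_sets[OF k]] sets.sets_into_space[OF FL[OF k]]
        by (auto simp: set_integrable_def set_lebesgue_integral_def Int_absorb2)
      have int: "set_integrable L (F k) (\<lambda>t. \<Sum>y\<in>Y. \<mu> k y * \<bar>y t\<bar>)"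
        "set_lebesgue_integral L (F k) (\<lambda>t. \<Sum>y\<in>Y. \<mu> k y * \<bar>y t\<bar>) = (\<Sum>y\<in>Y. \<mu> k y * set_lebesgue_integral L (F k) (\<lambda>t. \<bar>y t\<bar>))"
      proof -
        have i: "integrable L (\<lambda>t. indicator (F k) t *\<^sub>R (\<mu> k y * \<bar>y t\<bar>))" if "y \<in> Y" for y
          using integrable_mult_right[OF yint[OF that FL[OF k] F_sub[OF k], unfolded set_integrable_def], of "\<mu> k y"]
          by (simp add: mult.left_commute)
        show "set_integrable L (F k) (\<lambda>t. \<Sum>y\<in>Y. \<mu> k y * \<bar>y t\<bar>)"
          unfolding set_integrable_def scaleR_sum_right by (intro Bochner_Integration.integrable_sum i)
        show "set_lebesgue_integral L (F k) (\<lambda>t. \<Sum>y\<in>Y. \<mu> k y * \<bar>y t\<bar>) = (\<Sum>y\<in>Y. \<mu> k y * set_lebesgue_integral L (F k) (\<lambda>t. \<bar>y t\<bar>))"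
          unfolding set_lebesgue_integral_def scaleR_sum_right
          by (subst Bochner_Integration.integral_sum[OF i]) (auto simp: mult.left_commute)
      qed
      have "c / real n - c / real n * (\<Sum>y\<in>Y. set_lebesgue_integral L (F k) (\<lambda>t. \<bar>y t\<bar>))
          \<le> c / real n - (\<Sum>y\<in>Y. \<mu> k y * set_lebesgue_integral L (F k) (\<lambda>t. \<bar>y t\<bar>))"
      proof -
        have "(\<Sum>y\<in>Y. \<mu> k y * set_lebesgue_integral L (F k) (\<lambda>t. \<bar>y t\<bar>)) \<le> (\<Sum>y\<in>Y. c / real n * set_lebesgue_integral L (F k) (\<lambda>t. \<bar>y t\<bar>))"
          using \<mu>[OF k] by (intro sum_mono mult_right_mono) (auto simp: set_lebesgue_integral_def intro!: integral_nonneg_AE)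
        then show ?thesis by (simp add: sum_distrib_left)
      qed
      also have "\<dots> = set_lebesgue_integral L (F k) (\<lambda>t. 1 - (\<Sum>y\<in>Y. \<mu> k y * \<bar>y t\<bar>))"
        using one int by (subst set_integral_diff(2)) auto
      also have "\<dots> \<le> set_lebesgue_integral L (F k) (\<lambda>t. \<bar>f k t\<bar>)"
      proof (rule set_integral_mono)
        show "set_integrable L (F k) (\<lambda>t. 1 - (\<Sum>y\<in>Y. \<mu> k y * \<bar>y t\<bar>))" by (intro set_integral_diff(1) one int)
        show "set_integrable L (F k) (\<lambda>t. \<bar>f k t\<bar>)"
          by (intro set_integrable_abs X_set_integrable[OF fX[OF k] FL[OF k] F_sub[OF k] c(2)])
        fix t assume t: "t \<in> F k"
        have "simple_integral_over M (F k) s t = (\<Sum>y\<in>Y. \<mu> k y * y t)"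
          unfolding simple_integral_over_def Y_def \<mu>_def by (simp add: sum_fun_apply scaleR_fun_def)
        then have "f k t = (\<Sum>y\<in>Y. \<mu> k y * y t) - 1" using t by (simp add: f_def G_def)
        moreover have "\<bar>\<Sum>y\<in>Y. \<mu> k y * y t\<bar> \<le> (\<Sum>y\<in>Y. \<bar>\<mu> k y * y t\<bar>)" by (rule sum_abs)
        moreover have "(\<Sum>y\<in>Y. \<bar>\<mu> k y * y t\<bar>) = (\<Sum>y\<in>Y. \<mu> k y * \<bar>y t\<bar>)"
          using \<mu>(1)[OF k] by (simp add: abs_mult)
        ultimately show "1 - (\<Sum>y\<in>Y. \<mu> k y * \<bar>y t\<bar>) \<le> \<bar>f k t\<bar>" by linarith
      qed
      also have "\<dots> \<le> K * N (f k)" by (rule K(2)[OF fX[OF k] FL[OF k] F_sub[OF k]])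
      finally show ?thesis .
    qed
    have T_sum: "(\<Sum>k<n. \<Sum>y\<in>Y. set_lebesgue_integral L (F k) (\<lambda>t. \<bar>y t\<bar>)) \<le> T"
    proof -
      have "(\<Sum>k<n. set_lebesgue_integral L (F k) (\<lambda>t. \<bar>y t\<bar>)) \<le> set_lebesgue_integral L {0..c} (\<lambda>t. \<bar>y t\<bar>)" if y: "y \<in> Y" for y
      proof -
        have c_sets: "{0..c} \<in> sets L" by (rule borel_Int_I[OF _ cI]) simp
        have i: "integrable L (\<lambda>t. indicator (F k) t *\<^sub>R \<bar>y t\<bar>)" if "k \<in> {..<n}" for k
          using yint[OF y FL F_sub, of k] that by (simp add: set_integrable_def)
        have "(\<Sum>k<n. set_lebesgue_integral L (F k) (\<lambda>t. \<bar>y t\<bar>)) = (\<integral>t. (\<Sum>k<n. indicator (F k) t *\<^sub>R \<bar>y t\<bar>) \<partial>L)"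
          unfolding set_lebesgue_integral_def by (rule Bochner_Integration.integral_sum[OF i, symmetric])
        also have "\<dots> \<le> set_lebesgue_integral L {0..c} (\<lambda>t. \<bar>y t\<bar>)"
          unfolding set_lebesgue_integral_def
        proof (rule integral_mono)
          show "integrable L (\<lambda>t. \<Sum>k<n. indicator (F k) t *\<^sub>R \<bar>y t\<bar>)" by (rule Bochner_Integration.integrable_sum[OF i])
          show "integrable L (\<lambda>t. indicator {0..c} t *\<^sub>R \<bar>y t\<bar>)" using yint[OF y c_sets] by (simp add: set_integrable_def)
          fix t
          have "(\<Sum>k<n. indicator (F k) t :: real) = indicator (\<Union>k<n. F k) t"
            by (rule indicator_UN_disjoint[OF _ F_disj, symmetric]) simp
          also have "\<dots> \<le> indicator {0..c} t"
          proof -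
            have "(\<Union>k<n. F k) \<subseteq> {0..c}" by (rule UN_least) (use F_sub in simp)
            then show ?thesis unfolding indicator_def by auto
          qed
          finally show "(\<Sum>k<n. indicator (F k) t *\<^sub>R \<bar>y t\<bar>) \<le> indicator {0..c} t *\<^sub>R \<bar>y t\<bar>"
            by (simp add: sum_distrib_right[symmetric] mult_right_mono)
        qed
        finally show ?thesis .
      qed
      then show ?thesis unfolding T_def by (subst sum.swap) (rule sum_mono)
    qed
    have "c - c / real n * T \<le> (\<Sum>k<n. c / real n - c / real n * (\<Sum>y\<in>Y. set_lebesgue_integral L (F k) (\<lambda>t. \<bar>y t\<bar>)))"
    proof -
      have "(\<Sum>k<n. c / real n - c / real n * (\<Sum>y\<in>Y. set_lebesgue_integral L (F k) (\<lambda>t. \<bar>y t\<bar>)))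
        = c - c / real n * (\<Sum>k<n. \<Sum>y\<in>Y. set_lebesgue_integral L (F k) (\<lambda>t. \<bar>y t\<bar>))"
        using n(2) by (simp add: sum_subtractf sum_distrib_left)
      moreover have "c / real n * (\<Sum>k<n. \<Sum>y\<in>Y. set_lebesgue_integral L (F k) (\<lambda>t. \<bar>y t\<bar>)) \<le> c / real n * T"
        using c by (intro mult_left_mono T_sum) auto
      ultimately show ?thesis by linarith
    qed
    also have "\<dots> \<le> (\<Sum>k<n. K * N (f k))" by (intro sum_mono low) simp
    also have "\<dots> = K * (\<Sum>k<n. N (f k))" by (simp add: sum_distrib_left)
    also have "\<dots> \<le> K * d"
      unfolding f_def by (intro mult_left_mono s_err K F_disj) (auto simp: F_sets)
    finally have "c - c / real n * T \<le> K * d" .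
    moreover have "c / real n * T < c / 4"
    proof -
      have "c * (4 * T) < c * real n" using n(1) c by (intro mult_strict_left_mono) auto
      then show ?thesis using n(2) by (simp add: field_simps)
    qed
    ultimately show False using d(2) c by linarith
  qed
  then show ?thesis using fm by blast
qed

text \<open>If the condition at infinity fails, the point u can be taken arbitrarily large, so
  \<phi>(2u) exceeds any \<open>z\<close>; on a bounded interval this is what makes the blocks
  short. If it holds, the interval is the half-line and the condition at 0 fails, where no size is
  demanded.\<close>

lemma not_delta2_large_ratio:
  assumes nd: "\<not> delta2_cond"
  shows "\<exists>u>0. (2::real) ^ n * \<phi> u < \<phi> (2 * u) \<and> (\<gamma> < \<infinity> \<longrightarrow> z \<le> \<phi> (2 * u))"
proof -
  \<comment> \<open>At least \<open>2 ^ n\<close> and larger than 2, as the definitions of the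
    doubling conditions demand.\<close>
  define K :: real where "K = 2 ^ n + 2"
  have K: "2 < K" "(2::real) ^ n \<le> K" by (auto simp: K_def)
  have inf: ?thesis if ninf: "\<not> delta2_infinity \<phi>"
  proof -
    obtain l c where lc: "0 < l" "\<And>u. 0 \<le> u \<Longrightarrow> l * u - c \<le> \<phi> u" using phi_affine_lower by blast
    define u0 where "u0 = max 1 ((\<bar>z\<bar> + \<bar>c\<bar>) / l)"
    have "0 \<le> u0" by (simp add: u0_def)
    then have "\<exists>u\<ge>u0. K * \<phi> u < \<phi> (2 * u)"
      using ninf K(1) unfolding delta2_infinity_def by (meson not_le)
    then obtain u where u: "u \<ge> u0" "K * \<phi> u < \<phi> (2 * u)" by blast
    have u1: "1 \<le> u" using u(1) by (simp add: u0_def)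
    have "(\<bar>z\<bar> + \<bar>c\<bar>) / l \<le> u" using u(1) by (simp add: u0_def)
    then have "\<bar>z\<bar> + \<bar>c\<bar> \<le> l * u" using lc(1) by (simp add: field_simps)
    then have "z \<le> \<phi> u" using lc(2)[of u] u1 by linarith
    also have "\<dots> \<le> \<phi> (2 * u)" using u1 by (intro phi_mono) auto
    finally have z: "z \<le> \<phi> (2 * u)" .
    have "2 ^ n * \<phi> u \<le> K * \<phi> u" using K(2) phi_nonneg[of u] u1 by (intro mult_right_mono) auto
    then show ?thesis using u(2) u1 z by (intro exI[of _ u]) auto
  qed
  show ?thesis
  proof (cases "delta2_infinity \<phi>")
    case False then show ?thesis by (rule inf)
  next
    case True
    then have g: "\<not> \<gamma> < \<infinity>" and nz: "\<not> delta2_zero \<phi>"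
      using nd unfolding delta2_cond_def delta2_def by (auto split: if_splits)
    \<comment> \<open>A point with a positive value is needed, since the negated condition at 0
      concerns such points.\<close>
    obtain u0 where u0: "u0 > 0" "0 < \<phi> u0" using phi_pos_at by blast
    obtain u where u: "0 \<le> u" "K * \<phi> u < \<phi> (2 * u)"
      using nz K(1) u0 unfolding delta2_zero_def by (meson not_le)
    have "u \<noteq> 0" using u(2) by auto
    moreover have "2 ^ n * \<phi> u \<le> K * \<phi> u" using K(2) phi_nonneg[OF u(1)] by (intro mult_right_mono) auto
    ultimately show ?thesis using u g by (intro exI[of _ u]) auto
  qed
qed

lemma W_attains:
  assumes c: "c \<in> I" "0 < c" and y: "0 < y" "y \<le> weight_primitive w c"
  shows "\<exists>t>0. t \<le> c \<and> W (ennreal t) = ennreal y"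
proof -
  have int: "set_integrable lebesgue {0..c} w" using weight c by (simp add: weight_function_def)
  have eq: "weight_primitive w x = integral {0..x} w" if "0 \<le> x" "x \<le> c" for x
  proof -
    have "set_integrable lebesgue {0..x} w" by (rule set_integrable_subset[OF int]) (use that in auto)
    then show ?thesis unfolding weight_primitive_def by (rule set_lebesgue_integral_eq_integral(2))
  qed
  have "w integrable_on {0..c}" using int by (rule set_lebesgue_integral_eq_integral(1))
  then have "continuous_on {0..c} (\<lambda>x. integral {0..x} w)" by (rule indefinite_integral_continuous_1)
  then have "\<exists>x\<ge>0. x \<le> c \<and> integral {0..x} w = y"
    using y c eq[of c] by (intro IVT') auto
  then obtain t where t: "0 \<le> t" "t \<le> c" "integral {0..t} w = y" by blast
  have "t \<noteq> 0" using t(3) y(1) by auto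
  moreover have "W (ennreal t) = ennreal y"
    using W_eq_primitive[OF I_down[OF c(1) t(1,2)]] eq[OF t(1,2)] t(3) by simp
  ultimately show ?thesis using t by (intro exI[of _ t]) auto
qed

lemma primitive_unbounded:
  assumes "\<gamma> = \<infinity>" shows "\<exists>c>0. c \<in> I \<and> y \<le> weight_primitive w c"
proof -
  have "(SUP n. W (of_nat n)) = W (SUP n. of_nat n)"
    by (rule W_SUP[symmetric]) (auto simp: incseq_def)
  also have "\<dots> = \<infinity>" using W_top[OF assms] by (simp add: ennreal_SUP_of_nat_eq_top)
  finally have top: "(SUP n. W (of_nat n)) = \<infinity>" .
  have "ennreal y < (SUP n. W (of_nat n))" unfolding top by simp
  then obtain n where n: "ennreal y < W (of_nat n)" by (auto simp: less_SUP_iff)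
  have I: "real (Suc n) \<in> I" using assms by (simp add: half_open_interval_def)
  have "W (of_nat n) \<le> W (ennreal (real (Suc n)))" by (intro W_mono) (simp add: ennreal_of_nat_eq_real_of_nat ennreal_leI)
  then have "ennreal y < ennreal (weight_primitive w (real (Suc n)))" using n W_eq_primitive[OF I] by (auto intro: less_le_trans)
  then have "y \<le> weight_primitive w (real (Suc n))" by (meson ennreal_leI leD linear)
  then show ?thesis using I by (intro exI[of _ "real (Suc n)"]) auto
qed

text \<open>The measure of the \<open>n\<close>-th block is chosen so that \<open>W(\<bar>A\<^sub>n\<bar>) \<phi>(2 u\<^sub>n) = 1\<close>.\<close>

lemma disjoint_blocks:
  assumes nd: "\<not> delta2_cond"
  shows "\<exists>u A. (\<forall>n. 0 < u n \<and> A n \<in> sets L \<and> emeasure L (A n) < \<infinity> \<and>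
      Mod (\<lambda>t. u n * indicator (A n) t) \<le> ennreal ((1/2) ^ n) \<and> 1/4 \<le> N (\<lambda>t. u n * indicator (A n) t)) \<and>
    (\<forall>m n. m \<noteq> n \<longrightarrow> A m \<inter> A n = {})"
proof -
  obtain c where c: "0 < c" "c \<in> I" using exists_pos by blast
  \<comment> \<open>The lengths add up to \<open>c\<close>, so blocks no longer than these fit into
    a bounded interval.\<close>
  define r where "r n = c / 2 ^ Suc n" for n :: nat
  have r: "0 < r n" "r n \<in> I" for n
  proof -
    show "0 < r n" using c by (simp add: r_def)
    moreover have "c \<le> c * 2 ^ Suc n" using c one_le_power[of "2::real" "Suc n"] by (simp add: mult_le_cancel_left1 del: power_Suc)
    then have "r n \<le> c" using c by (simp add: r_def field_simps del: power_Suc)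
    ultimately show "r n \<in> I" using I_down[OF c(2)] by simp
  qed
  have "\<exists>u l. 0 < u \<and> 0 < l \<and> l \<in> I \<and> (\<gamma> < \<infinity> \<longrightarrow> l \<le> r n) \<and> (2::real) ^ n * \<phi> u < \<phi> (2 * u) \<and> W (ennreal l) = ennreal (1 / \<phi> (2 * u))" for n
  proof -
    \<comment> \<open>On a bounded interval \<phi>(2u) is made so large that the value 1/\<phi>(2u)
      of the primitive is reached within length \<open>r n\<close>.\<close>
    obtain u where u: "0 < u" "(2::real) ^ n * \<phi> u < \<phi> (2 * u)" "\<gamma> < \<infinity> \<longrightarrow> 1 / weight_primitive w (r n) \<le> \<phi> (2 * u)"
      using not_delta2_large_ratio[OF nd] by blast
    have pos: "0 < \<phi> (2 * u)" using u phi_nonneg[of u] by (smt (verit) mult_nonneg_nonneg zero_le_power)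
    have "\<exists>d>0. d \<in> I \<and> (\<gamma> < \<infinity> \<longrightarrow> d \<le> r n) \<and> 1 / \<phi> (2 * u) \<le> weight_primitive w d"
    proof (cases "\<gamma> < \<infinity>")
      case True
      have "1 / \<phi> (2 * u) \<le> weight_primitive w (r n)"
        using True u(3) pos primitive_ge(2)[OF r] by (simp add: field_simps)
      then show ?thesis using r by blast
    next
      case False
      then show ?thesis using primitive_unbounded[of "1 / \<phi> (2 * u)"] by auto
    qed
    then obtain d where d: "0 < d" "d \<in> I" "\<gamma> < \<infinity> \<longrightarrow> d \<le> r n" "1 / \<phi> (2 * u) \<le> weight_primitive w d" by blast
    have "0 < 1 / \<phi> (2 * u)" using pos by simp
    from W_attains[OF d(2,1) this d(4)] obtain l where l: "0 < l" "l \<le> d" "W (ennreal l) = ennreal (1 / \<phi> (2 * u))" by blast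
    show ?thesis
      using u l d I_down[OF d(2), of l] by (intro exI[of _ u] exI[of _ l]) auto
  qed
  then obtain u l where u: "\<And>n. 0 < u n" and l: "\<And>n. 0 < l n" "\<And>n. l n \<in> I" "\<And>n. \<gamma> < \<infinity> \<Longrightarrow> l n \<le> r n"
    and ratio: "\<And>n. (2::real) ^ n * \<phi> (u n) < \<phi> (2 * u n)" and Wl: "\<And>n. W (ennreal (l n)) = ennreal (1 / \<phi> (2 * u n))" by metis
  define s where "s n = (\<Sum>i<n. l i)" for n
  define A where "A n = {s n..<s (Suc n)}" for n
  have s0: "0 \<le> s n" for n unfolding s_def using l(1) by (intro sum_nonneg less_imp_le)
  have s_mono: "m \<le> n \<Longrightarrow> s m \<le> s n" for m n
    unfolding s_def using l(1) by (intro sum_mono2) (auto intro: less_imp_le)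
  have s_I: "s n \<in> I" for n
  proof (cases "\<gamma> < \<infinity>")
    case True
    have "s n \<le> (\<Sum>i<n. r i)" unfolding s_def using l(3)[OF True] by (intro sum_mono)
    also have "(\<Sum>i<n. r i) = c * (1 - 1 / 2 ^ n)"
      by (induction n) (auto simp: r_def field_simps)
    also have "\<dots> \<le> c * 1" using c by (intro mult_left_mono) auto
    finally show ?thesis using I_down[OF c(2) s0] by simp
  next
    case False then show ?thesis using s0 by (auto simp: half_open_interval_def)
  qed
  have A_sub: "A n \<subseteq> I" for n
    using I_down[OF s_I[of "Suc n"]] s0[of n] by (auto simp: A_def intro: order_trans)
  have A_sets: "A n \<in> sets L" for n by (rule borel_Int_I[OF _ A_sub]) (simp add: A_def)
  have A_em: "emeasure L (A n) = ennreal (l n)" for n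
    using L_le_lebesgue[OF A_sets[of n]] l(1)[of n] by (simp add: A_def s_def)
  have disj: "A m \<inter> A n = {}" if "m \<noteq> n" for m n
  proof -
    have *: "A m \<inter> A n = {}" if "m < n" for m n using s_mono[of "Suc m" n] that by (auto simp: A_def)
    show ?thesis using *[of m n] *[of n m] that by (cases m n rule: linorder_cases) auto
  qed
  have pos: "0 < \<phi> (2 * u n)" for n
    using ratio[of n] phi_nonneg[of "u n"] u[of n] by (smt (verit) mult_nonneg_nonneg zero_le_power)
  have Mod_le: "Mod (\<lambda>t. u n * indicator (A n) t) \<le> ennreal ((1/2) ^ n)" for n
  proof -
    have "Mod (\<lambda>t. u n * indicator (A n) t) = ennreal (\<phi> (u n) / \<phi> (2 * u n))"
      using Mod_indicator[OF A_sets, of "u n" n] u[of n] pos[of n] phi_nonneg[of "u n"]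
      by (simp add: A_em Wl ennreal_mult[symmetric])
    also have "\<dots> \<le> ennreal ((1/2) ^ n)"
      using ratio[of n] pos[of n] by (intro ennreal_leI) (simp add: field_simps power_divide)
    finally show ?thesis .
  qed
  \<comment> \<open>A norm below 1/4 would make the modular of four times the block at most 1, that
    is \<phi>(4u) \<le> \<phi>(2u). But convexity gives 2\<phi>(2u) \<le> \<phi>(4u).\<close>
  have N_ge: "1/4 \<le> N (\<lambda>t. u n * indicator (A n) t)" for n
  proof (rule ccontr)
    assume "\<not> ?thesis"
    then have "N (\<lambda>t. u n * indicator (A n) t) < 1/4" by simp
    then have "Mod (\<lambda>t. u n * indicator (A n) t / (1/4)) \<le> 1"
      by (intro N_less indicator_mem A_sets) (simp_all add: A_em)
    also have "(\<lambda>t. u n * indicator (A n) t / (1/4)) = (\<lambda>t. (4 * u n) * indicator (A n) t)" by auto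
    also have "Mod \<dots> = ennreal (\<phi> (4 * u n) / \<phi> (2 * u n))"
      using Mod_indicator[OF A_sets, of "4 * u n" n] u[of n] pos[of n] phi_nonneg[of "4 * u n"]
      by (simp add: A_em Wl ennreal_mult[symmetric])
    finally have "\<phi> (4 * u n) \<le> \<phi> (2 * u n)" using pos[of n] by simp
    moreover have "\<phi> (2 * u n) \<le> 1/2 * \<phi> (4 * u n)" using phi_scale[of "4 * u n" "1/2"] u[of n] by simp
    ultimately show False using pos[of n] by linarith
  qed
  show ?thesis
    using u A_sets A_em Mod_le N_ge disj by (intro exI[of _ u] exI[of _ A]) auto
qed

text \<open>\<open>F\<close> embeds bounded sequences, because the modulars of the blocks are
  summable and each block has norm at least 1/4. For a fixed set the Rademacher coefficients tend to
  0, so for large n the finitely many level sets of a simple function do not see the signs of the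
  n-th Rademacher function, while the values of \<open>G\<close> on the two sets of equal sign
  differ by 1 in the n-th coordinate.\<close>

lemma not_delta2_imp_not_rnp:
  assumes nd: "\<not> delta2_cond"
  shows "\<exists>M :: real measure. finite_measure M \<and> \<not> radon_nikodym_property_wrt M X N"
proof -
  obtain u A where u: "\<And>n. 0 < u n" and A [measurable]: "\<And>n. A n \<in> sets L" and A_fin: "\<And>n. emeasure L (A n) < \<infinity>"
    and Mod_le: "\<And>n. Mod (\<lambda>t. u n * indicator (A n) t) \<le> ennreal ((1/2) ^ n)"
    and N_ge: "\<And>n. 1/4 \<le> N (\<lambda>t. u n * indicator (A n) t)" and disj: "\<And>m n. m \<noteq> n \<Longrightarrow> A m \<inter> A n = {}"
    using disjoint_blocks[OF nd] by metis
  define F where "F a t = (\<Sum>n. a n * (u n * indicator (A n) t))" for a :: "nat \<Rightarrow> real" and t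
  have F_in: "F a t = a n * u n" if t: "t \<in> A n" for a t n
  proof -
    have "(\<lambda>m. a m * (u m * indicator (A m) t)) = (\<lambda>m. if m = n then a n * u n else 0)"
      using t disj by (auto simp: fun_eq_iff indicator_def)
    then show ?thesis unfolding F_def using sums_If_finite_set[of "{n}" "\<lambda>_. a n * u n"] by (simp add: sums_iff)
  qed
  have F_out: "F a t = 0" if "\<And>n. t \<notin> A n" for a t
    unfolding F_def using that by simp
  have Fm [measurable]: "F a \<in> borel_measurable L" for a unfolding F_def[abs_def] by measurable
  have F_add: "F (\<lambda>n. a n + b n) = F a + F b" for a b
  proof (rule ext)
    fix t
    show "F (\<lambda>n. a n + b n) t = (F a + F b) t"
      by (cases "\<exists>n. t \<in> A n") (auto simp: F_in F_out distrib_right)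
  qed
  have F_diff: "F a - F b = F (\<lambda>n. a n - b n)" for a b
  proof (rule ext)
    fix t
    show "(F a - F b) t = F (\<lambda>n. a n - b n) t"
      by (cases "\<exists>n. t \<in> A n") (auto simp: F_in F_out left_diff_distrib)
  qed
  have F1: "F (\<lambda>_. 1) \<in> X"
  proof -
    have "Mod (F (\<lambda>_. 1)) = J (\<lambda>t. \<Sum>n. ennreal (\<phi> \<bar>u n * indicator (A n) t\<bar>))"
      unfolding Mod_def
    proof (rule arg_cong[of _ _ J], rule ext)
      fix t
      show "ennreal (\<phi> \<bar>F (\<lambda>_. 1) t\<bar>) = (\<Sum>n. ennreal (\<phi> \<bar>u n * indicator (A n) t\<bar>))"
      proof (cases "\<exists>n. t \<in> A n")
        case True
        then obtain n where n: "t \<in> A n" by blast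
        have "(\<lambda>m. ennreal (\<phi> \<bar>u m * indicator (A m) t\<bar>)) = (\<lambda>m. if m = n then ennreal (\<phi> \<bar>u n\<bar>) else 0)"
          using n disj by (auto simp: fun_eq_iff indicator_def)
        then show ?thesis using sums_If_finite_set[of "{n}" "\<lambda>_. ennreal (\<phi> \<bar>u n\<bar>)"] by (simp add: F_in[OF n] sums_iff)
      next
        case False then show ?thesis by (simp add: F_out)
      qed
    qed
    also have "\<dots> \<le> (\<Sum>n. J (\<lambda>t. ennreal (\<phi> \<bar>u n * indicator (A n) t\<bar>)))"
      by (rule J_suminf_le) measurable
    also have "\<dots> \<le> (\<Sum>n. ennreal ((1/2) ^ n))" using Mod_le by (intro suminf_le) (auto simp: Mod_def)
    also have "\<dots> = ennreal (\<Sum>n. (1/2) ^ n)" by (rule suminf_ennreal2) (auto intro: summable_geometric)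
    also have "\<dots> < \<infinity>" by simp
    finally show ?thesis using X_I[OF Fm, of 1] by simp
  qed
  have F_bound: "F a \<in> X" "N (F a) \<le> k * N (F (\<lambda>_. 1))" if a: "\<And>n. \<bar>a n\<bar> \<le> k" for a k
  proof -
    have k: "0 \<le> k" using a[of 0] by linarith
    have "\<bar>F a t\<bar> \<le> \<bar>k * F (\<lambda>_. 1) t\<bar>" for t
    proof (cases "\<exists>n. t \<in> A n")
      case True
      then obtain n where n: "t \<in> A n" by blast
      show ?thesis using a[of n] k u[of n] by (simp add: F_in[OF n] abs_mult mult_right_mono)
    qed (simp add: F_out)
    then have ae: "AE t in L. \<bar>F a t\<bar> \<le> \<bar>k * F (\<lambda>_. 1) t\<bar>" by (intro AE_I2)
    note * = X_mono_AE[OF X_scale(1)[OF F1] Fm ae]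
    show "F a \<in> X" by (rule *)
    show "N (F a) \<le> k * N (F (\<lambda>_. 1))" using *(2) X_scale(2)[OF F1, of k] k by simp
  qed
  \<comment> \<open>The unit interval with constant weight supplies the probability space together
    with its dyadic cells and Rademacher functions.\<close>
  interpret U: weighted_interval 1 "\<lambda>_. 1"
  proof
    show "weight_function 1 (\<lambda>_. 1)"
      unfolding weight_function_def by (auto simp: monotone_on_def set_integrable_def half_open_interval_def intro!: integrable_real_indicator)
  qed simp
  have U_I: "U.I = {0..<1}" by (auto simp: half_open_interval_def)
  have U_fin: "emeasure U.L U.I < \<infinity>" by (simp add: U_I emeasure_restrict_space)
  define M where "M = U.L"
  have fm: "finite_measure M" unfolding M_def by (rule finite_measureI) (use U_fin in simp)
  interpret fin: finite_measure M by (rule fm)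
  define rad where "rad = U.rademacher"
  have rad_m [measurable]: "rad n \<in> borel_measurable M" for n unfolding rad_def M_def by (rule U.rademacher_measurable)
  have rad_abs: "\<bar>rad n t\<bar> = 1" for n t by (simp add: rad_def)
  have rad_int: "integrable M (rad n)" for n
    by (rule fin.integrable_const_bound[where B=1]) (auto simp: rad_abs)
  define a where "a E n = set_lebesgue_integral M E (rad n)" for E n
  have a_lim: "(\<lambda>n. a E n) \<longlonglongrightarrow> 0" if "E \<in> sets M" for E
    unfolding a_def rad_def M_def by (rule U.rademacher_tendsto_0[OF U_fin]) (use that in \<open>simp add: M_def\<close>)
  have a_le: "\<bar>a E n\<bar> \<le> measure M E" if E: "E \<in> sets M" for E n
  proof -
    have "\<bar>a E n\<bar> \<le> set_lebesgue_integral M E (\<lambda>t. \<bar>rad n t\<bar>)"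
      unfolding a_def using set_integral_norm_bound[OF set_integrable_of_integrable[OF rad_int E]] by simp
    also have "\<dots> = measure M E" using E by (simp add: rad_abs set_lebesgue_integral_def fin.emeasure_eq_measure)
    finally show ?thesis .
  qed
  define G where "G E = F (a E)" for E
  have GX: "G E \<in> X" if "E \<in> sets M" for E unfolding G_def by (rule F_bound(1)[OF a_le[OF that]])
  have G_bound: "N (G E) \<le> N (F (\<lambda>_. 1)) * measure M E" if "E \<in> sets M" for E
    unfolding G_def using F_bound(2)[OF a_le[OF that]] by (simp add: mult.commute)
  have G_add: "G (B \<union> C) = G B + G C" if "B \<in> sets M" "C \<in> sets M" "B \<inter> C = {}" for B C
  proof -
    have "a (B \<union> C) = (\<lambda>n. a B n + a C n)"
      unfolding a_def using that by (auto simp: fun_eq_iff intro!: set_integral_Un set_integrable_of_integrable rad_int)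
    then show ?thesis unfolding G_def by (simp add: F_add)
  qed
  have vm: "vector_measure X N M G" "continuous_wrt_measure N M G" "bounded_variation N M G"
    using N_nonneg[OF F1] by (intro nrm.vector_measure_of_lipschitz[OF fm GX G_add _ G_bound]; simp)+
  have "\<not> radon_nikodym_property_wrt M X N"
  proof
    assume "radon_nikodym_property_wrt M X N"
    then obtain g where g: "\<And>E. E \<in> sets M \<Longrightarrow> has_bochner_integral_over X N M g E (G E)"
      unfolding radon_nikodym_property_wrt_def using vm by blast
    have "\<exists>s. simple_into X M s \<and> (\<forall>k F. finite (k::bool set) \<longrightarrow> F ` k \<subseteq> sets M \<longrightarrow> disjoint_family_on F k \<longrightarrow>
        (\<Sum>i\<in>k. N (simple_integral_over M (F i) s - G (F i))) \<le> 1/16)"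
      by (rule nrm.bochner_simple_approx[OF fm]) (rule g, assumption, simp)
    then obtain s where s: "simple_into X M s"
      and s_err_all: "\<forall>k F. finite (k::bool set) \<longrightarrow> F ` k \<subseteq> sets M \<longrightarrow> disjoint_family_on F k \<longrightarrow>
        (\<Sum>i\<in>k. N (simple_integral_over M (F i) s - G (F i))) \<le> 1/16"
      by (elim exE conjE)
    have s_err: "(\<Sum>i\<in>k. N (simple_integral_over M (F i) s - G (F i))) \<le> 1/16"
      if "finite k" "F ` k \<subseteq> sets M" "disjoint_family_on F k" for F and k :: "bool set"
      using s_err_all that by simp
    define Y where "Y = s ` space M"
    have Y: "finite Y" "Y \<subseteq> X" using s by (auto simp: Y_def simple_into_def simple_function_def)
    define H where "H y = s -` {y} \<inter> space M" for y
    have H: "H y \<in> sets M" if "y \<in> Y" for y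
      using s that unfolding H_def Y_def simple_into_def simple_function_def by blast
    \<comment> \<open>\<open>s\<close> has finitely many level sets, so one index n works for all of
      them; the two sets \<open>E True\<close> and \<open>E False\<close> are chosen only after
      that.\<close>
    have "(\<lambda>n. \<Sum>y\<in>Y. \<bar>a (H y) n\<bar> * N y) \<longlonglongrightarrow> (\<Sum>y\<in>Y. \<bar>0\<bar> * N y)"
      by (intro tendsto_sum tendsto_mult tendsto_rabs tendsto_const a_lim H)
    then have "(\<lambda>n. \<Sum>y\<in>Y. \<bar>a (H y) n\<bar> * N y) \<longlonglongrightarrow> 0" by simp
    then have "eventually (\<lambda>n. (\<Sum>y\<in>Y. \<bar>a (H y) n\<bar> * N y) < 1/16) sequentially" by (rule order_tendstoD) simp
    then obtain n where n: "(\<Sum>y\<in>Y. \<bar>a (H y) n\<bar> * N y) < 1/16" by (auto simp: eventually_sequentially)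
    define E where "E b = {t \<in> space M. rad n t = (if b then 1 else - 1)}" for b
    have E: "E b \<in> sets M" for b unfolding E_def by measurable
    have rad_pm: "rad n t = 1 \<or> rad n t = - 1" for t using rad_abs[of n t] by auto
    have err: "N (simple_integral_over M (E True) s - G (E True)) + N (simple_integral_over M (E False) s - G (E False)) \<le> 1/16"
    proof -
      have "disjoint_family_on E UNIV" unfolding disjoint_family_on_def E_def by (auto split: if_splits)
      from s_err[OF _ _ this] E show ?thesis by (auto simp: UNIV_bool add.commute)
    qed
    define q where "q b = simple_integral_over M (E b) s" for b
    have qX: "q b \<in> X" for b unfolding q_def by (rule nrm.simple_integral_mem[OF s])
    \<comment> \<open>The difference of the measures of the two sign sets within a level set of
      \<open>s\<close> is the n-th Rademacher coefficient of that level set.\<close>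
    have coef: "measure M (s -` {y} \<inter> E True \<inter> space M) - measure M (s -` {y} \<inter> E False \<inter> space M) = a (H y) n" if y: "y \<in> Y" for y
    proof -
      have HE: "s -` {y} \<inter> E b \<inter> space M = H y \<inter> E b" for b by (auto simp: H_def)
      have "a (H y) n = (\<integral>t. indicator (H y \<inter> E True) t - indicator (H y \<inter> E False) t \<partial>M)"
        unfolding a_def set_lebesgue_integral_def
      proof (rule Bochner_Integration.integral_cong[OF refl])
        fix t assume "t \<in> space M"
        then show "indicator (H y) t *\<^sub>R rad n t = indicator (H y \<inter> E True) t - indicator (H y \<inter> E False) t"
          using rad_pm[of t] by (auto simp: E_def indicator_def)
      qed
      also have "\<dots> = measure M (H y \<inter> E True) - measure M (H y \<inter> E False)"
        using H[OF y] E by (subst Bochner_Integration.integral_diff) (auto simp: fin.emeasure_eq_measure intro!: integrable_real_indicator)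
      finally show ?thesis unfolding HE by simp
    qed
    have q_diff: "N (q True - q False) < 1/16"
    proof -
      have "q True - q False = (\<Sum>y\<in>Y. a (H y) n *\<^sub>R y)"
        unfolding q_def simple_integral_over_def Y_def[symmetric] sum_subtractf[symmetric] scaleR_diff_left[symmetric]
        by (intro sum.cong refl) (simp add: coef)
      then have "N (q True - q False) \<le> (\<Sum>y\<in>Y. N (a (H y) n *\<^sub>R y))"
        using nrm.N_sum[OF Y(1), of "\<lambda>y. a (H y) n *\<^sub>R y"] Y(2) nrm.scale by auto
      also have "\<dots> = (\<Sum>y\<in>Y. \<bar>a (H y) n\<bar> * N y)" using Y(2) by (intro sum.cong refl nrm.N_scale) auto
      finally show ?thesis using n by simp
    qed
    have "a (E True) n - a (E False) n = measure M (space M)"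
    proof -
      have "a (E b) n = (if b then 1 else - 1) * measure M (E b)" for b
      proof -
        have "a (E b) n = (\<integral>t. (if b then 1 else - 1) * indicator (E b) t \<partial>M)"
          unfolding a_def set_lebesgue_integral_def
          by (intro Bochner_Integration.integral_cong refl) (auto simp: E_def indicator_def)
        then show ?thesis using E[of b] by (simp add: fin.emeasure_eq_measure)
      qed
      moreover have "measure M (E True) + measure M (E False) = measure M (E True \<union> E False)"
        using E by (intro fin.finite_measure_Union[symmetric]) (auto simp: E_def)
      moreover have "E True \<union> E False = space M" using rad_pm by (auto simp: E_def)
      ultimately show ?thesis by simp
    qed
    moreover have "measure M (space M) = 1" by (simp add: M_def U_I measure_restrict_space)
    ultimately have one: "a (E True) n - a (E False) n = 1" by simp
    have Gd: "G (E True) - G (E False) = F (\<lambda>m. a (E True) m - a (E False) m)" unfolding G_def by (rule F_diff)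
    \<comment> \<open>The n-th block alone has norm at least 1/4, but the two approximation errors
      and the difference of the simple integrals together contribute less than 1/8.\<close>
    have "1/4 \<le> N (\<lambda>t. u n * indicator (A n) t)" by (rule N_ge)
    also have "\<dots> \<le> N (G (E True) - G (E False))"
    proof (rule X_mono_AE(2)[OF nrm.diff[OF GX[OF E] GX[OF E]] _ AE_I2])
      fix t
      show "\<bar>u n * indicator (A n) t\<bar> \<le> \<bar>(G (E True) - G (E False)) t\<bar>"
        unfolding Gd by (cases "t \<in> A n") (auto simp: F_in one)
    qed measurable
    also have "\<dots> \<le> N ((G (E True) - G (E False)) - (q True - q False)) + N (q True - q False)"
      using nrm.N_le_add_diff[OF nrm.diff[OF GX[OF E] GX[OF E]] nrm.diff[OF qX qX], of True False True False] by simp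
    also have "(G (E True) - G (E False)) - (q True - q False) = (q False - G (E False)) - (q True - G (E True))" by simp
    also have "N \<dots> \<le> N (q False - G (E False)) + N (q True - G (E True))"
      by (intro nrm.N_diff_triangle nrm.diff qX GX E)
    finally show False using err q_diff unfolding q_def[symmetric] by linarith
  qed
  then show ?thesis using fm by blast
qed

text \<open>Both counterexamples live on measure spaces of real numbers, that is in the second
  clause of the definition, while sufficiency holds for points of any type. So the equivalence is
  the same for every \<open>'m\<close>.\<close>

lemma radon_nikodym_property_iff:
  "radon_nikodym_property TYPE('m) X N \<longleftrightarrow> growth_cond \<and> delta2_cond"
proof
  assume "radon_nikodym_property TYPE('m) X N"
  then have "radon_nikodym_property_wrt M X N" if "finite_measure M" for M :: "real measure"
    using that unfolding radon_nikodym_property_def by blast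
  then show "growth_cond \<and> delta2_cond" using not_growth_imp_not_rnp not_delta2_imp_not_rnp by blast
next
  assume "growth_cond \<and> delta2_cond"
  then show "radon_nikodym_property TYPE('m) X N"
    unfolding radon_nikodym_property_def by (intro conjI allI impI radon_nikodym_of_conditions) auto
qed

end

theorem theorem3p6:
  fixes \<gamma> :: ereal and \<phi> w :: "real \<Rightarrow> real"
  assumes "0 < \<gamma>"
    and "orlicz_function \<phi>"
    and "weight_function \<gamma> w"
  shows "radon_nikodym_property TYPE('m)
           (orlicz_lorentz_space \<gamma> \<phi> w) (luxemburg_norm \<gamma> \<phi> w) \<longleftrightarrow>
         (N_function_at_infinity \<phi> \<or>
          ((\<lambda>t. t / weight_primitive w t) \<longlongrightarrow> 0) (at_right 0)) \<and>
         (if \<gamma> < \<infinity> then delta2_infinity \<phi> else delta2 \<phi>)"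
proof -
  interpret orlicz_lorentz \<gamma> w \<phi> by unfold_locales (rule assms)+
  show ?thesis
    using radon_nikodym_property_iff[where ?'m='m] unfolding growth_cond_def delta2_cond_def .
qed

end
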